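(* Let $\Omega\subset\mathbb{R}^N$ be a bounded domain, let $2\le p<N$, and let $f\in L^m(\Omega)$ with $(p^* )'\le m<\frac{N}{p}$. Suppose that $$0<\lambda<\frac{(m-1)N(N-mp)^{p-1}}{(p-1)^{p-1}m^{p}}.$$ Then the Dirichlet problem $$\begin{cases}-\operatorname{div}(|Du|^{p-2}Du)=\dfrac{\lambda}{|x|^p}|u|^{p-2}u+f & \text{in }\Omega,\\ u=0 & \text{on }\partial\Omega,\end{cases}$$ has a (weak) solution $u\in W_0^{1,p}(\Omega)\cap L^s(\Omega)$, where $s=\frac{mN}{N-pm}$.
   Context: $W_0^{1,p}(\Omega)$ is the closure of $C_0^\infty(\Omega)$ in the usual Sobolev space $W^{1,p}(\Omega)$. For $q>1$, $q'$ is the Hölder conjugate, $\frac1q+\frac1{q'}=1$; for $1\le q<N$, $q^*=\frac{qN}{N-q}$ is the Sobolev conjugate; thus $(p^* )'$ is the Hölder conjugate of $p^*=\frac{pN}{N-p}$. Standing assumption: $0<\lambda<\mathcal{H}^p$ with $\mathcal{H}=\frac{N-p}{p}$ (the Hardy constant). A weak solution is $u\in W_0^{1,p}(\Omega)$ such that for every $\varphi\in W_0^{1,p}(\Omega)\cap L^\infty(\Omega)$, $$\int_\Omega |Du|^{p-2}Du\cdot D\varphi=\int_\Omega\frac{\lambda}{|x|^p}|u|^{p-2}u\,\varphi+\int_\Omega f\varphi .$$ *)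

theory Defs
  imports "HOL-Analysis.Analysis"
begin

text \<open>
  Elements of function spaces over an open set \<open>\<Omega>\<close> are represented by total functions on the
  whole Euclidean space; membership in \<open>Lp\<close>, \<open>Linf\<close>, \<open>W1\<close>, \<open>W1_0\<close> depends only on the values on
  \<open>\<Omega>\<close> up to Lebesgue null sets. Test functions are extended by zero outside \<open>\<Omega>\<close>.
\<close>

definition holder_conj :: "real \<Rightarrow> real" where
  "holder_conj q = q / (q - 1)"

lemma holder_conj: "q > 1 \<Longrightarrow> 1 / q + 1 / holder_conj q = 1"
  by (simp add: holder_conj_def field_simps)

definition sobolev_conj :: "real \<Rightarrow> real \<Rightarrow> real" where
  "sobolev_conj N q = q * N / (N - q)"

definition hardy_const :: "real \<Rightarrow> real \<Rightarrow> real" where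
  "hardy_const N p = (N - p) / p"

primrec C_k :: "nat \<Rightarrow> ('a::euclidean_space \<Rightarrow> real) \<Rightarrow> bool" where
  "C_k 0 f \<longleftrightarrow> continuous_on UNIV f"
| "C_k (Suc k) f \<longleftrightarrow> (\<forall>x. f differentiable at x) \<and>
     (\<forall>b\<in>Basis. C_k k (\<lambda>x. frechet_derivative f (at x) b))"

definition test_functions :: "'a::euclidean_space set \<Rightarrow> ('a \<Rightarrow> real) set" where
  "test_functions \<Omega> = {\<phi>. (\<forall>k. C_k k \<phi>) \<and>
     compact (closure {x. \<phi> x \<noteq> 0}) \<and> closure {x. \<phi> x \<noteq> 0} \<subseteq> \<Omega>}"

definition Lp :: "'a::euclidean_space set \<Rightarrow> real \<Rightarrow> ('a \<Rightarrow> 'b::real_normed_vector) set" where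
  "Lp \<Omega> p = {f. f \<in> borel_measurable (lebesgue_on \<Omega>) \<and>
     integrable (lebesgue_on \<Omega>) (\<lambda>x. norm (f x) powr p)}"

definition Linf :: "'a::euclidean_space set \<Rightarrow> ('a \<Rightarrow> real) set" where
  "Linf \<Omega> = {f. f \<in> borel_measurable (lebesgue_on \<Omega>) \<and>
     (\<exists>C. AE x in lebesgue_on \<Omega>. \<bar>f x\<bar> \<le> C)}"

definition locally_integrable_on ::
    "('a::euclidean_space \<Rightarrow> 'b::euclidean_space) \<Rightarrow> 'a set \<Rightarrow> bool" where
  "locally_integrable_on f \<Omega> \<longleftrightarrow> (\<forall>K. compact K \<and> K \<subseteq> \<Omega> \<longrightarrow> integrable (lebesgue_on K) f)"

definition has_weak_gradient ::
    "'a::euclidean_space set \<Rightarrow> ('a \<Rightarrow> real) \<Rightarrow> ('a \<Rightarrow> 'a) \<Rightarrow> bool" where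
  "has_weak_gradient \<Omega> u G \<longleftrightarrow> locally_integrable_on u \<Omega> \<and> locally_integrable_on G \<Omega> \<and>
     (\<forall>\<phi>\<in>test_functions \<Omega>. \<forall>b\<in>Basis.
        (LINT x|lebesgue_on \<Omega>. u x * frechet_derivative \<phi> (at x) b)
          = - (LINT x|lebesgue_on \<Omega>. (G x \<bullet> b) * \<phi> x))"

text \<open>On an open set the weak gradient, if it exists, is unique almost everywhere, so the choice
  below is immaterial.\<close>

definition weak_grad :: "'a::euclidean_space set \<Rightarrow> ('a \<Rightarrow> real) \<Rightarrow> 'a \<Rightarrow> 'a" where
  "weak_grad \<Omega> u = (SOME G. has_weak_gradient \<Omega> u G)"

definition W1 :: "'a::euclidean_space set \<Rightarrow> real \<Rightarrow> ('a \<Rightarrow> real) set" where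
  "W1 \<Omega> p = {u. u \<in> Lp \<Omega> p \<and> (\<exists>G. has_weak_gradient \<Omega> u G) \<and> weak_grad \<Omega> u \<in> Lp \<Omega> p}"

definition W1_norm :: "'a::euclidean_space set \<Rightarrow> real \<Rightarrow> ('a \<Rightarrow> real) \<Rightarrow> real" where
  "W1_norm \<Omega> p u =
     ((LINT x|lebesgue_on \<Omega>. \<bar>u x\<bar> powr p) +
      (LINT x|lebesgue_on \<Omega>. norm (weak_grad \<Omega> u x) powr p)) powr (1 / p)"

definition W1_0 :: "'a::euclidean_space set \<Rightarrow> real \<Rightarrow> ('a \<Rightarrow> real) set" where
  "W1_0 \<Omega> p = {u \<in> W1 \<Omega> p.
     \<forall>\<epsilon>>0. \<exists>\<phi>\<in>test_functions \<Omega>. W1_norm \<Omega> p (\<lambda>x. u x - \<phi> x) < \<epsilon>}"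

text \<open>
  Weak solutions of \<open>- div (|Du|\<^sup>p\<^sup>-\<^sup>2 Du) = \<mu> |x|\<^sup>-\<^sup>p |u|\<^sup>p\<^sup>-\<^sup>2 u + f\<close> in \<open>\<Omega>\<close> with \<open>u = 0\<close> on the boundary.
  The three integrability conditions exclude the default value \<open>0\<close> of the Bochner integral of a
  non-integrable function. Where \<open>Du\<close> or \<open>u\<close> vanishes, \<open>0 powr (p - 2) = 0\<close> (also for \<open>p = 2\<close>) is
  harmless, since it multiplies \<open>0\<close>; the value of the potential at the origin concerns a null set.
\<close>

definition weak_solution ::
    "'a::euclidean_space set \<Rightarrow> real \<Rightarrow> real \<Rightarrow> ('a \<Rightarrow> real) \<Rightarrow> ('a \<Rightarrow> real) \<Rightarrow> bool" where
  "weak_solution \<Omega> p \<mu> f u \<longleftrightarrow> u \<in> W1_0 \<Omega> p \<and>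
     (\<forall>\<phi> \<in> W1_0 \<Omega> p \<inter> Linf \<Omega>.
        integrable (lebesgue_on \<Omega>)
          (\<lambda>x. norm (weak_grad \<Omega> u x) powr (p - 2) * (weak_grad \<Omega> u x \<bullet> weak_grad \<Omega> \<phi> x)) \<and>
        integrable (lebesgue_on \<Omega>)
          (\<lambda>x. \<mu> / norm x powr p * \<bar>u x\<bar> powr (p - 2) * u x * \<phi> x) \<and>
        integrable (lebesgue_on \<Omega>) (\<lambda>x. f x * \<phi> x) \<and>
        (LINT x|lebesgue_on \<Omega>.
            norm (weak_grad \<Omega> u x) powr (p - 2) * (weak_grad \<Omega> u x \<bullet> weak_grad \<Omega> \<phi> x))
          = (LINT x|lebesgue_on \<Omega>. \<mu> / norm x powr p * \<bar>u x\<bar> powr (p - 2) * u x * \<phi> x)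
            + (LINT x|lebesgue_on \<Omega>. f x * \<phi> x))"

end

theory Submission
  imports Defs
begin

text \<open>
  Since \<open>p \<ge> 2\<close>, Clarkson's inequality makes the functional \<open>\<integral>|Du|\<^sup>p / p - \<integral>h u\<close> uniformly convex, so its
  minimizing sequences are Cauchy sequences, and \<open>- div (|Du|\<^sup>p\<^sup>-\<^sup>2 Du) = h\<close> is solvable without weak
  compactness for every \<open>h\<close> that pairs boundedly with \<open>W\<^sub>0\<^sup>1\<^sup>,\<^sup>p\<close>. The solution depends
  monotonically on \<open>h\<close>. Starting from \<open>0\<close>, one solves successively with right-hand sides
  \<open>\<mu> |x|\<^sup>-\<^sup>p min(U\<^sub>j, j)\<^sup>p\<^sup>-\<^sup>1 + |f|\<close>, which gives an increasing sequence. Testing the equation for \<open>U\<^sub>j\<^sub>+\<^sub>1\<close>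
  with powers of \<open>min(U\<^sub>j\<^sub>+\<^sub>1, j)\<close>, the Hardy inequality (this is where the bound on \<open>\<mu>\<close> enters) and the
  Sobolev inequality bound the sequence in \<open>L\<^sup>t\<close> with \<open>t = (p - 1) m N / (N - p m) \<ge> s\<close>. Its limit \<open>W\<close>
  solves the problem for \<open>|f|\<close>. A second monotone iteration, for \<open>f\<close> itself and trapped between \<open>-W\<close>
  and \<open>W\<close>, converges to the required solution. All limits are monotone or dominated.
\<close>

section \<open>Integrals of powers\<close>

text \<open>The potential has the same order as the principal part, so the full problem is not
  evidently convex; freezing the potential at the previous iterate makes every step convex. The
  exponents come from one balance. For a test exponent \<open>t = p * \<gamma> - p + 1\<close> the
  principal part yields \<open>t / \<gamma> powr p\<close> times the energy of
  \<open>T powr \<gamma>\<close>, and the potential at most \<open>\<mu> / hardy\<close> times that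
  energy, so \<open>\<mu> * \<gamma> powr p < hardy * t\<close> is required. The datum f in L^m
  dictates \<open>\<gamma>\<close>: its pairing must involve exactly the Sobolev power of
  \<open>T powr \<gamma>\<close>. With this \<open>\<gamma>\<close> the requirement is the last
  hypothesis on \<open>\<mu>\<close>. The case \<open>\<gamma> = 1\<close> requires only
  \<open>\<mu>\<close> below the Hardy constant and keeps the energies of the truncations, hence the
  limiting potential, under control. At the limit, strong convexity compares the minimizers for two
  right-hand sides: right-hand sides that increase to their limit force the gradients to converge in
  the p-th mean.\<close>

lemma powr_add_le:
  fixes x y p :: real
  assumes "0 \<le> x" "0 \<le> y" "0 \<le> p"
  shows "(x + y) powr p \<le> 2 powr p * (x powr p + y powr p)"
proof -
  have "(x + y) powr p \<le> (2 * max x y) powr p"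
    using assms by (intro powr_mono2) auto
  also have "\<dots> = 2 powr p * max x y powr p"
    using assms by (simp add: powr_mult)
  also have "\<dots> \<le> 2 powr p * (x powr p + y powr p)"
    by (intro mult_left_mono) (auto simp: max_def)
  finally show ?thesis .
qed

lemma norm_add_powr_le:
  fixes a b :: "'b::real_normed_vector"
  assumes "0 \<le> p"
  shows "norm (a + b) powr p \<le> 2 powr p * (norm a powr p + norm b powr p)"
proof -
  have "norm (a + b) powr p \<le> (norm a + norm b) powr p"
    using assms by (intro powr_mono2) (auto simp: norm_triangle_ineq)
  also have "\<dots> \<le> 2 powr p * (norm a powr p + norm b powr p)"
    using assms by (intro powr_add_le) auto
  finally show ?thesis .
qed

text \<open>Continuity of the energy needs a factor arbitrarily close to 1 on one summand, which the
  crude factor \<open>2 powr p\<close> cannot give. \<open>\<eta>\<close> solves (1 + \<eta>)^p = 1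
  + \<delta>: either b is small against a and this factor suffices, or a is dominated by b /
  \<eta>.\<close>

lemma norm_add_powr_le_eps:
  assumes "1 \<le> p" "0 < \<delta>"
  obtains C where "0 \<le> C"
    "\<And>a b::'b::real_normed_vector. norm (a + b) powr p \<le> (1 + \<delta>) * norm a powr p + C * norm b powr p"
proof -
  define \<eta> where "\<eta> = (1 + \<delta>) powr (1 / p) - 1"
  have "(1 + \<delta>) powr 0 < (1 + \<delta>) powr (1 / p)"
    using assms by (intro powr_less_mono) auto
  then have \<eta>: "\<eta> > 0" using assms by (simp add: \<eta>_def)
  have \<eta>p: "(1 + \<eta>) powr p = 1 + \<delta>"
    using assms by (simp add: \<eta>_def powr_powr)
  show thesis
  proof (rule that[of "(1 + 1 / \<eta>) powr p"])
    fix a b :: 'b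
    show "norm (a + b) powr p \<le> (1 + \<delta>) * norm a powr p + (1 + 1 / \<eta>) powr p * norm b powr p"
    proof (cases "norm b \<le> \<eta> * norm a")
      case True
      have "norm (a + b) powr p \<le> ((1 + \<eta>) * norm a) powr p"
        using True norm_triangle_ineq[of a b] assms
        by (intro powr_mono2) (auto simp: algebra_simps)
      also have "\<dots> = (1 + \<delta>) * norm a powr p"
        using \<eta> \<eta>p by (simp add: powr_mult)
      finally show ?thesis by (smt (verit) mult_nonneg_nonneg powr_ge_zero)
    next
      case False
      then have "norm a \<le> norm b / \<eta>" using \<eta> by (simp add: field_simps)
      then have "norm (a + b) powr p \<le> ((1 + 1 / \<eta>) * norm b) powr p"
        using norm_triangle_ineq[of a b] assms
        by (intro powr_mono2) (auto simp: algebra_simps)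
      also have "\<dots> = (1 + 1 / \<eta>) powr p * norm b powr p"
        using \<eta> by (simp add: powr_mult)
      finally show ?thesis using assms by (smt (verit) mult_nonneg_nonneg powr_ge_zero)
    qed
  qed auto
qed

text \<open>Kept with sharp factors (equality at y = z), because Jensen's inequality for finite sums
  and the optimal Hardy constant are both derived from it.\<close>

lemma young_powr:
  fixes p y z :: real
  assumes "1 < p" "0 \<le> y" "0 \<le> z"
  shows "p * (y powr (p - 1) * z) \<le> (p - 1) * y powr p + z powr p"
proof -
  have "z * y powr (p - 1) \<le> z powr p / p + (y powr (p - 1)) powr (p / (p - 1)) / (p / (p - 1))"
    using assms by (intro Youngs_inequality) (auto simp: field_simps)
  also have "(y powr (p - 1)) powr (p / (p - 1)) = y powr p"
    using assms by (simp add: powr_powr)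
  finally show ?thesis using assms by (simp add: field_simps)
qed

lemma young_powr_simple:
  fixes p y z :: real
  assumes "1 < p" "0 \<le> y" "0 \<le> z"
  shows "y powr (p - 1) * z \<le> y powr p + z powr p"
proof -
  have "p * (y powr (p - 1) * z) \<le> (p - 1) * y powr p + z powr p"
    by (rule young_powr[OF assms])
  also have "\<dots> \<le> p * y powr p + p * z powr p"
    using assms mult_right_mono[of 1 p "z powr p"] by (intro add_mono mult_right_mono) auto
  finally show ?thesis using assms by (simp flip: distrib_left)
qed

lemma powr_superadditive:
  fixes x y r :: real
  assumes "0 \<le> x" "0 \<le> y" "1 \<le> r"
  shows "x powr r + y powr r \<le> (x + y) powr r"
proof (cases "x + y = 0")
  case False
  then have s: "x + y > 0" using assms by auto
  have *: "z powr r \<le> (x + y) powr (r - 1) * z" if "0 \<le> z" "z \<le> x + y" for z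
  proof (cases "z = 0")
    case False
    then have "z powr r = z powr (r - 1) * z"
      using that by (simp add: powr_diff)
    also have "\<dots> \<le> (x + y) powr (r - 1) * z"
      using that assms by (intro mult_right_mono powr_mono2) auto
    finally show ?thesis .
  qed (use assms in auto)
  have "x powr r + y powr r \<le> (x + y) powr (r - 1) * (x + y)"
    using *[of x] *[of y] assms by (auto simp: algebra_simps)
  also have "\<dots> = (x + y) powr r" using s by (simp add: powr_diff)
  finally show ?thesis .
next
  case True
  then have "x = 0" "y = 0" using assms by auto
  then show ?thesis by simp
qed

lemma powr_midpoint_convex:
  fixes x y r :: real
  assumes "0 \<le> x" "0 \<le> y" "1 \<le> r"
  shows "((x + y) / 2) powr r \<le> (x powr r + y powr r) / 2"
proof -
  have *: "(z / 2) powr r \<le> z powr r / 2" if "0 \<le> z" for z :: real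
  proof -
    have "(z / 2) powr r = z powr r / 2 powr r" using that by (simp add: powr_divide)
    also have "\<dots> \<le> z powr r / 2 powr 1"
      using assms by (intro divide_left_mono powr_mono) auto
    finally show ?thesis by simp
  qed
  show ?thesis
  proof (cases "x = 0 \<or> y = 0")
    case True
    then show ?thesis using *[of x] *[of y] assms by auto
  next
    case False
    then show ?thesis
      using convex_onD[OF powr_convex[OF assms(3)], of "1/2" x y] assms
      by (simp add: field_simps)
  qed
qed

text \<open>The parallelogram law, placed between superadditivity and midpoint convexity of s^(p/2);
  both demand p \<ge> 2. The second term on the left is the gain that later becomes strong
  convexity.\<close>

lemma clarkson:
  fixes a b :: "'b::real_inner"
  assumes "2 \<le> p"
  shows "norm ((1/2) *\<^sub>R (a + b)) powr p + norm ((1/2) *\<^sub>R (a - b)) powr p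
    \<le> (norm a powr p + norm b powr p) / 2"
proof -
  have sq: "(x\<^sup>2) powr (p / 2) = x powr p" if "0 \<le> x" for x :: real
    using that by (cases "x = 0") (auto simp: powr_powr simp flip: powr_numeral)
  let ?x = "norm ((1/2) *\<^sub>R (a + b))" and ?y = "norm ((1/2) *\<^sub>R (a - b))"
  have "?x powr p + ?y powr p = (?x\<^sup>2) powr (p / 2) + (?y\<^sup>2) powr (p / 2)"
    by (simp add: sq)
  also have "\<dots> \<le> (?x\<^sup>2 + ?y\<^sup>2) powr (p / 2)"
    using assms by (intro powr_superadditive) auto
  also have "?x\<^sup>2 + ?y\<^sup>2 = ((norm a)\<^sup>2 + (norm b)\<^sup>2) / 2"
    by (simp only: power2_norm_eq_inner)
      (simp add: algebra_simps inner_commute)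
  also have "\<dots> powr (p / 2) \<le> (((norm a)\<^sup>2) powr (p / 2) + ((norm b)\<^sup>2) powr (p / 2)) / 2"
    using assms by (intro powr_midpoint_convex) auto
  finally show ?thesis by (simp add: sq)
qed

section \<open>Energies and convergence in the p-th mean\<close>

definition memLp :: "'x measure \<Rightarrow> real \<Rightarrow> ('x \<Rightarrow> 'b::euclidean_space) \<Rightarrow> bool" where
  "memLp M p f \<longleftrightarrow> f \<in> borel_measurable M \<and> integrable M (\<lambda>x. norm (f x) powr p)"

text \<open>The \<open>p\<close>-th power of the norm. Without the \<open>p\<close>-th root it obeys the triangle inequality only up to
  the factor \<open>2 powr p\<close>, which suffices for all limits and avoids Minkowski's inequality.\<close>

definition En :: "'x measure \<Rightarrow> real \<Rightarrow> ('x \<Rightarrow> 'b::euclidean_space) \<Rightarrow> real" where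
  "En M p f = (LINT x|M. norm (f x) powr p)"

lemma En_nonneg [simp]: "0 \<le> En M p f"
  by (simp add: En_def)

lemma memLp_measurable: "memLp M p f \<Longrightarrow> f \<in> borel_measurable M"
  by (simp add: memLp_def)

lemma memLp_integrable: "memLp M p f \<Longrightarrow> integrable M (\<lambda>x. norm (f x) powr p)"
  by (simp add: memLp_def)

lemma memLp_bound:
  fixes f :: "'x \<Rightarrow> 'b::euclidean_space" and g :: "'x \<Rightarrow> 'c::euclidean_space"
  assumes "memLp M p g" "f \<in> borel_measurable M" "0 \<le> p" "AE x in M. norm (f x) \<le> C * norm (g x)"
  shows "memLp M p f"
proof -
  have m: "g \<in> borel_measurable M" using assms by (auto simp: memLp_def)
  have "integrable M (\<lambda>x. norm (f x) powr p)"
  proof (rule Bochner_Integration.integrable_bound)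
    show "integrable M (\<lambda>x. \<bar>C\<bar> powr p * norm (g x) powr p)"
      using assms by (auto simp: memLp_def)
    show "AE x in M. norm (norm (f x) powr p) \<le> norm (\<bar>C\<bar> powr p * norm (g x) powr p)"
      using assms(4)
    proof eventually_elim
      case (elim x)
      have "norm (f x) powr p \<le> (\<bar>C\<bar> * norm (g x)) powr p"
        using elim assms(3)
        by (intro powr_mono2) (auto intro: order_trans[OF _ mult_right_mono[OF abs_ge_self]])
      then show ?case by (simp add: powr_mult)
    qed
  qed (use assms in measurable)
  then show ?thesis using assms by (simp add: memLp_def)
qed

lemma memLp_add:
  assumes "memLp M p f" "memLp M p g" "0 \<le> p"
  shows "memLp M p (\<lambda>x. f x + g x)"
proof -
  have [measurable]: "f \<in> borel_measurable M" "g \<in> borel_measurable M"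
    using assms by (auto simp: memLp_def)
  have "integrable M (\<lambda>x. norm (f x + g x) powr p)"
  proof (rule Bochner_Integration.integrable_bound)
    show "integrable M (\<lambda>x. 2 powr p * (norm (f x) powr p + norm (g x) powr p))"
      using assms by (auto simp: memLp_def)
    show "AE x in M. norm (norm (f x + g x) powr p)
        \<le> norm (2 powr p * (norm (f x) powr p + norm (g x) powr p))"
      using norm_add_powr_le[OF assms(3)] by (intro AE_I2) auto
  qed measurable
  then show ?thesis by (simp add: memLp_def)
qed

lemma memLp_scaleR:
  assumes "memLp M p f" "0 \<le> p"
  shows "memLp M p (\<lambda>x. c *\<^sub>R f x)"
  using assms(1) by (intro memLp_bound[OF assms(1) _ assms(2), of _ "\<bar>c\<bar>"]) (auto simp: memLp_def)

lemma memLp_minus: "memLp M p f \<Longrightarrow> memLp M p (\<lambda>x. - f x)"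
  by (simp add: memLp_def)

lemma memLp_diff:
  assumes "memLp M p f" "memLp M p g" "0 \<le> p"
  shows "memLp M p (\<lambda>x. f x - g x)"
  using memLp_add[OF assms(1) memLp_minus[OF assms(2)] assms(3)] by simp

lemma memLp_cong_AE:
  assumes "f \<in> borel_measurable M" "g \<in> borel_measurable M" "AE x in M. f x = g x"
  shows "memLp M p f \<longleftrightarrow> memLp M p g"
proof -
  have "integrable M (\<lambda>x. norm (f x) powr p) \<longleftrightarrow> integrable M (\<lambda>x. norm (g x) powr p)"
    by (rule integrable_cong_AE) (use assms in auto)
  then show ?thesis using assms by (simp add: memLp_def)
qed

lemma En_cong_AE:
  assumes "f \<in> borel_measurable M" "g \<in> borel_measurable M" "AE x in M. f x = g x"
  shows "En M p f = En M p g"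
  unfolding En_def by (rule integral_cong_AE) (use assms in auto)

lemma En_mono:
  assumes "memLp M p g" "memLp M p f" "0 \<le> p" "AE x in M. norm (f x) \<le> norm (g x)"
  shows "En M p f \<le> En M p g"
  unfolding En_def
proof (rule integral_mono_AE)
  show "AE x in M. norm (f x) powr p \<le> norm (g x) powr p"
    using assms(4) by eventually_elim (use assms(3) in \<open>auto intro: powr_mono2\<close>)
qed (use assms in \<open>auto simp: memLp_def\<close>)

lemma En_minus: "En M p (\<lambda>x. - f x) = En M p f"
  by (simp add: En_def)

lemma En_minus_commute: "En M p (\<lambda>x. f x - g x) = En M p (\<lambda>x. g x - f x)"
  by (simp add: En_def norm_minus_commute)

lemma En_scaleR: "0 \<le> p \<Longrightarrow> En M p (\<lambda>x. c *\<^sub>R f x) = \<bar>c\<bar> powr p * En M p f"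
  by (simp add: En_def powr_mult)

lemma En_add_le:
  assumes "memLp M p f" "memLp M p g" "0 \<le> p"
  shows "En M p (\<lambda>x. f x + g x) \<le> 2 powr p * (En M p f + En M p g)"
proof -
  have "En M p (\<lambda>x. f x + g x) \<le> (LINT x|M. 2 powr p * (norm (f x) powr p + norm (g x) powr p))"
    unfolding En_def using assms memLp_integrable[OF memLp_add[OF assms]]
    by (intro integral_mono norm_add_powr_le) (auto simp: memLp_def)
  also have "\<dots> = 2 powr p * (En M p f + En M p g)"
    using assms by (simp add: En_def memLp_def)
  finally show ?thesis .
qed

lemma En_triangle:
  assumes "memLp M p f" "memLp M p g" "memLp M p h" "0 \<le> p"
  shows "En M p (\<lambda>x. f x - h x) \<le> 2 powr p * (En M p (\<lambda>x. f x - g x) + En M p (\<lambda>x. g x - h x))"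
  using En_add_le[OF memLp_diff[OF assms(1,2,4)] memLp_diff[OF assms(2,3,4)] assms(4)] by simp

text \<open>The estimate with factor 1 + \<delta> is applied in both directions. The second
  direction has \<open>En M p (f n)\<close> on the right, so this must be bounded first, which the
  first direction achieves.\<close>

lemma En_tendsto:
  assumes "\<And>n::nat. memLp M p (f n)" "memLp M p g" "1 \<le> p"
    and lim: "(\<lambda>n. En M p (\<lambda>x. f n x - g x)) \<longlonglongrightarrow> 0"
  shows "(\<lambda>n. En M p (f n)) \<longlonglongrightarrow> En M p g"
proof (rule LIMSEQ_I)
  fix e :: real assume e: "e > 0"
  \<comment> \<open>The cap 1 gives the bound \<open>2 * En M p g + 1\<close> for the energies of
    the sequence. The other entry makes \<open>\<delta>\<close> times the energies a fraction of e;
    the summand 1 covers the case that g has energy zero.\<close>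
  define \<delta> where "\<delta> = min 1 (e / (4 * (En M p g + 1)))"
  have gpos: "En M p g + 1 > 0" by (simp add: add_nonneg_pos)
  then have \<delta>: "0 < \<delta>" "\<delta> \<le> 1" using e by (auto simp: \<delta>_def)
  have \<delta>g: "\<delta> * (En M p g + 1) \<le> e / 4"
  proof -
    have "\<delta> * (En M p g + 1) \<le> e / (4 * (En M p g + 1)) * (En M p g + 1)"
      using gpos by (intro mult_right_mono) (auto simp: \<delta>_def)
    also have "\<dots> = e / 4" using gpos by (simp add: divide_simps)
    finally show ?thesis .
  qed
  obtain C where C: "0 \<le> C"
    "\<And>a b::'b. norm (a + b) powr p \<le> (1 + \<delta>) * norm a powr p + C * norm b powr p"
    using norm_add_powr_le_eps[OF assms(3) \<delta>(1)] by blast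
  have le: "En M p u \<le> (1 + \<delta>) * En M p v + C * En M p (\<lambda>x. u x - v x)"
    if "memLp M p u" "memLp M p v" for u v :: "'a \<Rightarrow> 'b"
  proof -
    have d: "memLp M p (\<lambda>x. u x - v x)" using that assms by (intro memLp_diff) auto
    have "En M p u \<le> (LINT x|M. (1 + \<delta>) * norm (v x) powr p + C * norm (u x - v x) powr p)"
      unfolding En_def using that d C(2)[of "v x" "u x - v x" for x]
      by (intro integral_mono) (auto simp: memLp_def)
    also have "\<dots> = (1 + \<delta>) * En M p v + C * En M p (\<lambda>x. u x - v x)"
      using that d by (simp add: En_def memLp_def)
    finally show ?thesis .
  qed
  have "(\<lambda>n. C * En M p (\<lambda>x. f n x - g x)) \<longlonglongrightarrow> 0"
    using tendsto_mult_left[OF lim, of C] by simp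
  then have "\<forall>\<^sub>F n in sequentially. C * En M p (\<lambda>x. f n x - g x) < min (e / 4) 1"
    using e by (intro order_tendstoD) auto
  then obtain n0 where n0: "\<And>n. n \<ge> n0 \<Longrightarrow> C * En M p (\<lambda>x. f n x - g x) < min (e / 4) 1"
    by (auto simp: eventually_sequentially)
  show "\<exists>no. \<forall>n\<ge>no. norm (En M p (f n) - En M p g) < e"
  proof (intro exI allI impI)
    fix n assume "n \<ge> n0"
    then have s: "C * En M p (\<lambda>x. f n x - g x) < e / 4" "C * En M p (\<lambda>x. f n x - g x) < 1"
      using n0 by fastforce+
    have 1: "En M p (f n) \<le> (1 + \<delta>) * En M p g + C * En M p (\<lambda>x. f n x - g x)"
      using assms le by blast
    have 2: "En M p g \<le> (1 + \<delta>) * En M p (f n) + C * En M p (\<lambda>x. f n x - g x)"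
      using le[of g "f n"] assms En_minus_commute[of M p "f n" g] by simp
    have "\<delta> * En M p g \<le> 1 * En M p g" using \<delta> by (intro mult_right_mono) auto
    then have "En M p (f n) \<le> 2 * En M p g + 1" using 1 s(2) by (simp add: algebra_simps)
    then have "\<delta> * En M p (f n) \<le> \<delta> * (2 * En M p g + 1)" using \<delta> by simp
    also have "\<dots> \<le> 2 * (\<delta> * (En M p g + 1))" using \<delta> by (simp add: algebra_simps)
    also have "\<dots> \<le> e / 2" using \<delta>g by simp
    finally have 3: "\<delta> * En M p (f n) \<le> e / 2" .
    have "\<delta> * En M p g \<le> e / 4" using \<delta>g \<delta> by (simp add: algebra_simps)
    then show "norm (En M p (f n) - En M p g) < e"
      using 1 2 3 s(1) by (auto simp: algebra_simps abs_if)
  qed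
qed

lemma En_tendsto_AE_subseq:
  assumes "\<And>n::nat. memLp M p (f n)" "memLp M p g" "0 < p"
    and lim: "(\<lambda>n. En M p (\<lambda>x. f n x - g x)) \<longlonglongrightarrow> 0"
  obtains r :: "nat \<Rightarrow> nat" where "strict_mono r" "AE x in M. (\<lambda>n. f (r n) x) \<longlonglongrightarrow> g x"
proof -
  have "\<exists>r::nat\<Rightarrow>nat. strict_mono r \<and> (AE x in M. (\<lambda>n. norm (f (r n) x - g x) powr p) \<longlonglongrightarrow> 0)"
  proof (rule tendsto_L1_AE_subseq)
    show "integrable M (\<lambda>x. norm (f n x - g x) powr p)" for n
      using memLp_diff[OF assms(1,2)] assms(3) by (auto simp: memLp_def)
    show "(\<lambda>n. LINT x|M. norm (norm (f n x - g x) powr p)) \<longlonglongrightarrow> 0"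
      using lim by (simp add: En_def)
  qed
  then obtain r :: "nat \<Rightarrow> nat" where r: "strict_mono r"
    "AE x in M. (\<lambda>n. norm (f (r n) x - g x) powr p) \<longlonglongrightarrow> 0" by auto
  have "AE x in M. (\<lambda>n. f (r n) x) \<longlonglongrightarrow> g x"
    using r(2)
  proof eventually_elim
    case (elim x)
    have "(\<lambda>n. (norm (f (r n) x - g x) powr p) powr (1 / p)) \<longlonglongrightarrow> 0 powr (1 / p)"
      using elim assms(3) by (intro tendsto_powr2) auto
    then have "(\<lambda>n. norm (f (r n) x - g x)) \<longlonglongrightarrow> 0"
      using assms(3) by (simp add: powr_powr)
    then show ?case by (simp add: LIM_zero_iff tendsto_norm_zero_iff)
  qed
  then show thesis using r that by blast
qed

text \<open>The form of Fatou's lemma that carries the Hardy, Sobolev and energy bounds to limits: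
  the bounds may vary with n, and integrability of the limit is a conclusion.\<close>

lemma fatou_bounded:
  fixes f :: "nat \<Rightarrow> 'x \<Rightarrow> real"
  assumes int: "\<And>n. integrable M (f n)" and nn: "\<And>n. AE x in M. 0 \<le> f n x"
    and [measurable]: "g \<in> borel_measurable M"
    and lim: "AE x in M. (\<lambda>n. f n x) \<longlonglongrightarrow> g x"
    and bd: "\<And>n. integral\<^sup>L M (f n) \<le> C n" and C: "C \<longlonglongrightarrow> L"
  shows "integrable M g" "integral\<^sup>L M g \<le> L"
proof -
  have [measurable]: "f n \<in> borel_measurable M" for n using int by auto
  have nn': "AE x in M. \<forall>n. 0 \<le> f n x" using nn by (simp add: AE_all_countable)
  have g0: "AE x in M. 0 \<le> g x"
    using nn' lim by eventually_elim (auto intro: LIMSEQ_le_const)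
  have C0: "0 \<le> C n" for n
    using integral_nonneg_AE[OF nn[of n]] bd[of n] by linarith
  have L0: "0 \<le> L" using C C0 by (auto intro: LIMSEQ_le_const)
  have "(\<integral>\<^sup>+x. ennreal (g x) \<partial>M) = (\<integral>\<^sup>+x. liminf (\<lambda>n. ennreal (f n x)) \<partial>M)"
  proof (rule nn_integral_cong_AE)
    show "AE x in M. ennreal (g x) = liminf (\<lambda>n. ennreal (f n x))"
      using lim
    proof eventually_elim
      case (elim x)
      then have "(\<lambda>n. ennreal (f n x)) \<longlonglongrightarrow> ennreal (g x)" by (intro tendsto_intros)
      then show ?case by (simp add: lim_imp_Liminf)
    qed
  qed
  also have "\<dots> \<le> liminf (\<lambda>n. \<integral>\<^sup>+x. ennreal (f n x) \<partial>M)"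
    by (rule nn_integral_liminf) measurable
  also have "\<dots> \<le> liminf (\<lambda>n. ennreal (C n))"
    using bd int nn by (intro Liminf_mono always_eventually allI)
      (auto simp: nn_integral_eq_integral intro: ennreal_leI)
  also have "\<dots> = ennreal L"
    using C by (intro lim_imp_Liminf) (auto intro!: tendsto_intros)
  finally have le: "(\<integral>\<^sup>+x. ennreal (g x) \<partial>M) \<le> ennreal L" .
  show I: "integrable M g"
    using le g0 by (intro integrableI_nonneg) (auto simp: top_unique less_top[symmetric])
  show "integral\<^sup>L M g \<le> L"
    using le I g0 L0 by (simp add: nn_integral_eq_integral)
qed

text \<open>Along a subsequence with increments of energy below \<open>4 powr (- p k)\<close>, the weights \<open>2 powr (p k)\<close>
  still give a convergent sum, so the increments are pointwise eventually below \<open>(1/2)\<^sup>k\<close>.\<close>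

lemma riesz_fischer:
  fixes f :: "nat \<Rightarrow> 'x \<Rightarrow> 'b::euclidean_space"
  assumes mem: "\<And>n. memLp M p (f n)" and p: "1 \<le> p"
    and cau: "\<And>e. e > 0 \<Longrightarrow> \<exists>k. \<forall>m\<ge>k. \<forall>n\<ge>k. En M p (\<lambda>x. f m x - f n x) < e"
  obtains g where "memLp M p g" "(\<lambda>n. En M p (\<lambda>x. f n x - g x)) \<longlonglongrightarrow> 0"
proof -
  have [measurable]: "f n \<in> borel_measurable M" for n using mem by (auto simp: memLp_def)
  define a where "a k = (1/4 :: real) powr (p * real k)" for k
  have apos: "a k > 0" for k by (simp add: a_def)
  obtain N where N: "\<And>k m n. m \<ge> N k \<Longrightarrow> n \<ge> N k \<Longrightarrow> En M p (\<lambda>x. f m x - f n x) < a k"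
    using cau[OF apos] by metis
  define r where "r = rec_nat (N 0) (\<lambda>k rk. max (Suc rk) (N (Suc k)))"
  have rSuc: "r (Suc k) = max (Suc (r k)) (N (Suc k))" for k by (simp add: r_def)
  have rN: "r k \<ge> N k" for k by (cases k) (auto simp: r_def)
  have r: "strict_mono r" by (auto simp: strict_mono_Suc_iff rSuc)
  define d where "d k x = norm (f (r (Suc k)) x - f (r k) x)" for k x
  have [measurable]: "d k \<in> borel_measurable M" for k by (simp add: d_def[abs_def])
  have dint: "integrable M (\<lambda>x. d k x powr p)" for k
    using memLp_integrable[OF memLp_diff[OF mem mem]] p by (simp add: d_def)
  have dEn: "(LINT x|M. d k x powr p) < a k" for k
  proof -
    have "N k \<le> r (Suc k)" using rN[of k] strict_monoD[OF r, of k "Suc k"] by simp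
    then show ?thesis using N[of k "r (Suc k)" "r k"] rN[of k] by (simp add: d_def En_def)
  qed
  define w where "w k = (2::real) powr (p * real k)" for k
  have wa: "w k * a k \<le> (1/2) ^ k" for k
  proof -
    have "w k * a k = (2 * (1/4)) powr (p * real k)"
      unfolding w_def a_def by (simp flip: powr_mult)
    also have "\<dots> \<le> (1/2) powr (1 * real k)"
      using p mult_right_mono[of 1 p "real k"] by (simp, intro powr_mono') auto
    also have "\<dots> = (1/2) ^ k" by (subst powr_realpow[symmetric]) auto
    finally show ?thesis .
  qed
  have wpos: "w k > 0" for k by (simp add: w_def)
  have "(\<integral>\<^sup>+x. (\<Sum>k. ennreal (w k * d k x powr p)) \<partial>M) = (\<Sum>k. \<integral>\<^sup>+x. ennreal (w k * d k x powr p) \<partial>M)"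
    by (rule nn_integral_suminf) measurable
  also have "\<dots> = (\<Sum>k. ennreal (w k * (LINT x|M. d k x powr p)))"
    using dint wpos by (intro suminf_cong) (simp add: nn_integral_eq_integral less_imp_le)
  also have "\<dots> \<le> (\<Sum>k. ennreal ((1/2)^k))"
  proof (intro suminf_le ennreal_leI)
    fix k
    have "w k * (LINT x|M. d k x powr p) \<le> w k * a k"
      using dEn[of k] wpos[of k] by simp
    then show "w k * (LINT x|M. d k x powr p) \<le> (1/2)^k" using wa[of k] by linarith
  qed auto
  also have "\<dots> = ennreal (\<Sum>k. (1/2)^k)"
    by (intro suminf_ennreal2) (auto intro: summable_geometric)
  finally have "(\<integral>\<^sup>+x. (\<Sum>k. ennreal (w k * d k x powr p)) \<partial>M) < \<infinity>"
    by (simp add: order.strict_trans1)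
  then have fin: "AE x in M. (\<Sum>k. ennreal (w k * d k x powr p)) \<noteq> \<infinity>"
    by (intro nn_integral_PInf_AE) auto
  have conv: "AE x in M. convergent (\<lambda>k. f (r k) x)"
    using fin
  proof eventually_elim
    case (elim x)
    have "summable (\<lambda>k. w k * d k x powr p)"
      using elim wpos by (intro summable_suminf_not_top) (auto simp: less_imp_le)
    then have "(\<lambda>k. w k * d k x powr p) \<longlonglongrightarrow> 0" by (rule summable_LIMSEQ_zero)
    then have "\<forall>\<^sub>F k in sequentially. w k * d k x powr p < 1"
      by (intro order_tendstoD) auto
    then have ev: "\<forall>\<^sub>F k in sequentially. norm (f (r (Suc k)) x - f (r k) x) \<le> (1/2)^k"
    proof eventually_elim
      case (elim k)
      have "(2 powr real k * d k x) powr p = w k * d k x powr p"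
        by (simp add: w_def powr_mult powr_powr d_def mult.commute)
      then have "(2 powr real k * d k x) powr p < 1 powr p" using elim by simp
      then have "2 powr real k * d k x < 1"
        using p powr_mono2[of p 1 "2 powr real k * d k x"] by force
      then show ?case by (simp add: powr_realpow d_def field_simps)
    qed
    have "summable (\<lambda>k. norm (f (r (Suc k)) x - f (r k) x))"
      using ev by (intro summable_comparison_test_ev[OF _ summable_geometric[of "1/2::real"]]) auto
    then have "summable (\<lambda>k. f (r (Suc k)) x - f (r k) x)" by (rule summable_norm_cancel)
    then have "convergent (\<lambda>n. \<Sum>k<n. f (r (Suc k)) x - f (r k) x)"
      by (simp add: summable_iff_convergent)
    then have "convergent (\<lambda>n. f (r n) x - f (r 0) x)"
      by (subst (asm) sum_lessThan_telescope)
    then have "convergent (\<lambda>n. (f (r n) x - f (r 0) x) + f (r 0) x)"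
      by (intro convergent_add) (auto intro: convergent_const)
    then show ?case by simp
  qed
  define g where "g x = lim (\<lambda>k. f (r k) x)" for x
  have [measurable]: "g \<in> borel_measurable M" unfolding g_def[abs_def] by measurable
  have glim: "AE x in M. (\<lambda>k. f (r k) x) \<longlonglongrightarrow> g x"
    using conv by eventually_elim (simp add: g_def convergent_LIMSEQ_iff)
  \<comment> \<open>Fatou's lemma in the second index of the Cauchy estimate. The shift in
    \<open>r (j + k)\<close> keeps that index at least k for every j.\<close>
  have key: "memLp M p (\<lambda>x. f n x - g x) \<and> En M p (\<lambda>x. f n x - g x) \<le> e"
    if e: "e > 0" and k: "\<forall>m\<ge>k. \<forall>n\<ge>k. En M p (\<lambda>x. f m x - f n x) < e" and n: "n \<ge> k" for e k n
  proof -
    have 1: "integrable M (\<lambda>x. norm (f n x - f (r (j + k)) x) powr p)" for j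
      using memLp_integrable[OF memLp_diff[OF mem mem]] p by simp
    have 2: "(LINT x|M. norm (f n x - f (r (j + k)) x) powr p) \<le> e" for j
    proof -
      have "r (j + k) \<ge> k" using seq_suble[OF r, of "j + k"] by simp
      then show ?thesis using k n by (auto simp: En_def less_imp_le)
    qed
    have 3: "AE x in M. (\<lambda>j. norm (f n x - f (r (j + k)) x) powr p) \<longlonglongrightarrow> norm (f n x - g x) powr p"
      using glim
    proof eventually_elim
      case (elim x)
      then have "(\<lambda>j. f (r (j + k)) x) \<longlonglongrightarrow> g x" by (rule LIMSEQ_ignore_initial_segment)
      then have *: "(\<lambda>j. norm (f n x - f (r (j + k)) x)) \<longlonglongrightarrow> norm (f n x - g x)"
        by (intro tendsto_intros)
      show ?case using p by (intro tendsto_powr2[OF * tendsto_const]) auto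
    qed
    have 4: "(\<lambda>x. norm (f n x - g x) powr p) \<in> borel_measurable M" by measurable
    have "integrable M (\<lambda>x. norm (f n x - g x) powr p)" "(LINT x|M. norm (f n x - g x) powr p) \<le> e"
      using fatou_bounded[OF 1 _ 4 3 2 tendsto_const] by auto
    then show ?thesis by (auto simp: memLp_def En_def)
  qed
  have "memLp M p g"
  proof -
    obtain k where "\<forall>m\<ge>k. \<forall>n\<ge>k. En M p (\<lambda>x. f m x - f n x) < 1" using cau[of 1] by auto
    then have "memLp M p (\<lambda>x. f k x - g x)" using key[of 1 k k] by auto
    from memLp_diff[OF mem[of k] this] show ?thesis using p by simp
  qed
  moreover have "(\<lambda>n. En M p (\<lambda>x. f n x - g x)) \<longlonglongrightarrow> 0"
  proof (rule LIMSEQ_I)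
    fix e :: real assume "e > 0"
    then obtain k where "\<forall>m\<ge>k. \<forall>n\<ge>k. En M p (\<lambda>x. f m x - f n x) < e/2" using cau[of "e/2"] by auto
    then have "En M p (\<lambda>x. f n x - g x) \<le> e/2" if "n \<ge> k" for n
      using key[of "e/2" k n] \<open>e > 0\<close> that by auto
    then show "\<exists>no. \<forall>n\<ge>no. norm (En M p (\<lambda>x. f n x - g x) - 0) < e"
      using \<open>e > 0\<close> by (intro exI[of _ k]) force
  qed
  ultimately show thesis using that by blast
qed

section \<open>Test functions and compactly supported differentiable functions\<close>

lemma C_k_SucD: "C_k (Suc k) f \<Longrightarrow> C_k k f"
proof (induction k arbitrary: f)
  case 0
  then show ?case
    by (auto simp: continuous_on_eq_continuous_at differentiable_imp_continuous_within)
qed auto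

lemma C_k_const [simp]: "C_k k (\<lambda>x. c)"
  by (induction k arbitrary: c) (auto simp: frechet_derivative_const)

lemma frechet_derivative_mult_real:
  fixes f g :: "'a::euclidean_space \<Rightarrow> real"
  assumes "f differentiable at x" "g differentiable at x"
  shows "frechet_derivative (\<lambda>x. f x * g x) (at x)
    = (\<lambda>h. f x * frechet_derivative g (at x) h + frechet_derivative f (at x) h * g x)"
  by (rule frechet_derivative_at[symmetric])
    (intro has_derivative_mult assms[unfolded frechet_derivative_works])

lemma frechet_derivative_add_real:
  fixes f g :: "'a::euclidean_space \<Rightarrow> real"
  assumes "f differentiable at x" "g differentiable at x"
  shows "frechet_derivative (\<lambda>x. f x + g x) (at x)
    = (\<lambda>h. frechet_derivative f (at x) h + frechet_derivative g (at x) h)"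
  by (rule frechet_derivative_at[symmetric])
    (intro has_derivative_add assms[unfolded frechet_derivative_works])

lemma C_k_add: "C_k k f \<Longrightarrow> C_k k g \<Longrightarrow> C_k k (\<lambda>x. f x + g x)"
proof (induction k arbitrary: f g)
  case 0
  then show ?case by (auto intro: continuous_intros)
next
  case (Suc k)
  then show ?case by (auto simp: frechet_derivative_add_real)
qed

lemma C_k_mult: "C_k k f \<Longrightarrow> C_k k g \<Longrightarrow> C_k k (\<lambda>x. f x * g x)"
proof (induction k arbitrary: f g)
  case 0
  then show ?case by (auto intro: continuous_intros)
next
  case (Suc k)
  have "C_k k f" "C_k k g" using Suc.prems C_k_SucD by blast+
  then show ?case using Suc by (auto simp: frechet_derivative_mult_real intro!: C_k_add)
qed

lemma C_k_prod: "(\<And>i. i \<in> I \<Longrightarrow> C_k k (f i)) \<Longrightarrow> C_k k (\<lambda>x. \<Prod>i\<in>I. f i x)"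
  by (induction I rule: infinite_finite_induct) (auto intro: C_k_mult)

lemma test_functionsI:
  assumes "\<And>k. C_k k \<phi>" "compact K" "K \<subseteq> \<Omega>" "\<And>x. x \<notin> K \<Longrightarrow> \<phi> x = 0"
  shows "\<phi> \<in> test_functions \<Omega>"
proof -
  have sub: "closure {x. \<phi> x \<noteq> 0} \<subseteq> K"
    using assms by (intro closure_minimal) (auto simp: compact_imp_closed)
  then have "compact (closure {x. \<phi> x \<noteq> 0})"
    by (metis assms(2) closed_closure compact_Int_closed inf.absorb_iff2)
  then show ?thesis using sub assms by (auto simp: test_functions_def)
qed

lemma test_functionsE:
  assumes "\<phi> \<in> test_functions \<Omega>"
  obtains K where "compact K" "K \<subseteq> \<Omega>" "\<And>x. x \<notin> K \<Longrightarrow> \<phi> x = 0"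
  using assms closure_subset[of "{x. \<phi> x \<noteq> 0}"]
  by (intro that[of "closure {x. \<phi> x \<noteq> 0}"]) (auto simp: test_functions_def)

lemma test_C_k: "\<phi> \<in> test_functions \<Omega> \<Longrightarrow> C_k k \<phi>"
  by (simp add: test_functions_def)

lemma test_add:
  assumes "\<phi> \<in> test_functions \<Omega>" "\<psi> \<in> test_functions \<Omega>"
  shows "(\<lambda>x. \<phi> x + \<psi> x) \<in> test_functions \<Omega>"
proof -
  obtain K where K: "compact K" "K \<subseteq> \<Omega>" "\<And>x. x \<notin> K \<Longrightarrow> \<phi> x = 0"
    using test_functionsE[OF assms(1)] by blast
  obtain L where L: "compact L" "L \<subseteq> \<Omega>" "\<And>x. x \<notin> L \<Longrightarrow> \<psi> x = 0"
    using test_functionsE[OF assms(2)] by blast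
  show ?thesis
    using K L assms by (intro test_functionsI[of _ "K \<union> L"]) (auto intro: C_k_add simp: test_C_k)
qed

lemma test_mult_C_k:
  assumes "\<phi> \<in> test_functions \<Omega>" "\<And>k. C_k k \<psi>"
  shows "(\<lambda>x. \<psi> x * \<phi> x) \<in> test_functions \<Omega>"
proof -
  obtain K where K: "compact K" "K \<subseteq> \<Omega>" "\<And>x. x \<notin> K \<Longrightarrow> \<phi> x = 0"
    using test_functionsE[OF assms(1)] by blast
  show ?thesis
    using K assms by (intro test_functionsI[of _ "K"]) (auto intro: C_k_mult simp: test_C_k)
qed

lemma test_mult:
  "\<phi> \<in> test_functions \<Omega> \<Longrightarrow> \<psi> \<in> test_functions \<Omega> \<Longrightarrow> (\<lambda>x. \<psi> x * \<phi> x) \<in> test_functions \<Omega>"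
  by (rule test_mult_C_k) (auto simp: test_C_k)

lemma test_cmult: "\<phi> \<in> test_functions \<Omega> \<Longrightarrow> (\<lambda>x. c * \<phi> x) \<in> test_functions \<Omega>"
  by (rule test_mult_C_k) auto

lemma test_zero: "(\<lambda>x. 0) \<in> test_functions \<Omega>"
  by (rule test_functionsI[of _ "{}"]) auto

lemma test_power_Suc: "\<phi> \<in> test_functions \<Omega> \<Longrightarrow> (\<lambda>x. \<phi> x ^ Suc n) \<in> test_functions \<Omega>"
  by (induction n) (auto intro: test_mult)

lemma test_sum:
  "(\<And>i. i \<in> I \<Longrightarrow> f i \<in> test_functions \<Omega>) \<Longrightarrow> (\<lambda>x. \<Sum>i\<in>I. f i x) \<in> test_functions \<Omega>"
  by (induction I rule: infinite_finite_induct) (auto intro: test_add test_zero)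

definition grad :: "('a::euclidean_space \<Rightarrow> real) \<Rightarrow> 'a \<Rightarrow> 'a" where
  "grad \<phi> x = (\<Sum>b\<in>Basis. frechet_derivative \<phi> (at x) b *\<^sub>R b)"

lemma grad_inner_Basis: "b \<in> Basis \<Longrightarrow> grad \<phi> x \<bullet> b = frechet_derivative \<phi> (at x) b"
  by (simp add: grad_def inner_sum_left inner_Basis if_distrib sum.delta cong: if_cong)

lemma differentiable_grad:
  assumes "\<phi> differentiable at x"
  shows "(\<phi> has_derivative (\<lambda>h. grad \<phi> x \<bullet> h)) (at x)"
proof -
  have d: "(\<phi> has_derivative frechet_derivative \<phi> (at x)) (at x)"
    using assms frechet_derivative_works by blast
  then have "linear (frechet_derivative \<phi> (at x))" by (rule has_derivative_linear)
  then have "frechet_derivative \<phi> (at x) h = grad \<phi> x \<bullet> h" for h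
    unfolding grad_def
    by (subst (1) euclidean_representation[of h, symmetric])
      (simp add: linear_sum linear_cmul inner_sum_left inner_sum_right[of h] inner_commute mult.commute)
  then show ?thesis using d by presburger
qed

lemma grad_eqI:
  assumes "(\<phi> has_derivative (\<lambda>h. g \<bullet> h)) (at x)"
  shows "grad \<phi> x = g"
proof -
  have "frechet_derivative \<phi> (at x) = (\<lambda>h. g \<bullet> h)"
    using frechet_derivative_at[OF assms] by simp
  then show ?thesis by (simp add: grad_def euclidean_representation)
qed

lemma test_has_derivative:
  assumes "\<phi> \<in> test_functions \<Omega>"
  shows "(\<phi> has_derivative (\<lambda>h. grad \<phi> x \<bullet> h)) (at x)"
  using test_C_k[OF assms, of 1] by (intro differentiable_grad) auto

lemma test_grad_continuous: "\<phi> \<in> test_functions \<Omega> \<Longrightarrow> continuous_on UNIV (grad \<phi>)"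
  using test_C_k[of \<phi> \<Omega> 1] unfolding grad_def[abs_def] by (auto intro!: continuous_intros)

lemma grad_add:
  assumes "\<phi> \<in> test_functions \<Omega>" "\<psi> \<in> test_functions \<Omega>"
  shows "grad (\<lambda>x. \<phi> x + \<psi> x) = (\<lambda>x. grad \<phi> x + grad \<psi> x)"
  using has_derivative_add[OF test_has_derivative[OF assms(1)] test_has_derivative[OF assms(2)]]
  by (intro ext grad_eqI) (auto simp: inner_add_left)

lemma grad_cmult:
  assumes "\<phi> \<in> test_functions \<Omega>"
  shows "grad (\<lambda>x. c * \<phi> x) = (\<lambda>x. c *\<^sub>R grad \<phi> x)"
  using has_derivative_mult_right[OF test_has_derivative[OF assms(1)]]
  by (intro ext grad_eqI) auto

text \<open>Smoothness is lost under the operations that the Hardy and Sobolev inequalities need,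
  such as \<open>\<bar>\<phi> x\<bar> powr p\<close> or a C^1 cutoff of \<open>\<phi>\<close>; this
  class is stable under them. The gradient is carried explicitly, and K need only contain the
  support.\<close>

definition C1c :: "('a::euclidean_space \<Rightarrow> real) \<Rightarrow> ('a \<Rightarrow> 'a) \<Rightarrow> 'a set \<Rightarrow> bool" where
  "C1c g G K \<longleftrightarrow> compact K \<and> (\<forall>x. (g has_derivative (\<lambda>h. G x \<bullet> h)) (at x)) \<and>
     continuous_on UNIV G \<and> (\<forall>x. x \<notin> K \<longrightarrow> g x = 0)"

lemma test_C1c:
  assumes "\<phi> \<in> test_functions \<Omega>"
  obtains K where "C1c \<phi> (grad \<phi>) K" "K \<subseteq> \<Omega>"
proof -
  obtain K where "compact K" "K \<subseteq> \<Omega>" "\<And>x. x \<notin> K \<Longrightarrow> \<phi> x = 0"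
    using test_functionsE[OF assms] by blast
  then show thesis using test_has_derivative[OF assms] test_grad_continuous[OF assms]
    by (intro that[of K]) (auto simp: C1c_def)
qed

lemma C1c_continuous: "C1c g G K \<Longrightarrow> continuous_on UNIV g"
  unfolding C1c_def continuous_on_eq_continuous_within
  by (meson UNIV_I has_derivative_continuous)

lemma C1c_grad_outside:
  assumes "C1c g G K" "x \<notin> K"
  shows "G x = 0"
proof -
  have "open (- K)" using assms by (simp add: C1c_def compact_imp_closed open_Compl)
  have "((\<lambda>x. 0) has_derivative (\<lambda>h. G x \<bullet> h)) (at x)"
    by (rule has_derivative_transform_within_open[of g _ _ _ "- K"])
      (use assms \<open>open (- K)\<close> in \<open>auto simp: C1c_def\<close>)
  moreover have "((\<lambda>x. 0::real) has_derivative (\<lambda>h. 0)) (at x)" by (rule has_derivative_const)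
  ultimately have "(\<lambda>h. G x \<bullet> h) = (\<lambda>h. 0)" by (rule has_derivative_unique)
  then have "G x \<bullet> G x = 0" by meson
  then show ?thesis by simp
qed

lemma compact_support_bounded:
  fixes F :: "'a::euclidean_space \<Rightarrow> 'b::real_normed_vector"
  assumes "continuous_on UNIV F" "compact K" "\<And>x. x \<notin> K \<Longrightarrow> F x = 0"
  obtains B where "0 \<le> B" "\<And>x. norm (F x) \<le> B"
proof -
  have "compact (F ` K)"
    using assms by (intro compact_continuous_image) (auto intro: continuous_on_subset)
  then obtain B where B: "B > 0" "\<And>y. y \<in> F ` K \<Longrightarrow> norm y \<le> B"
    using compact_imp_bounded bounded_pos by metis
  show thesis
    using B assms(3) by (intro that[of B]) (metis imageI less_imp_le norm_zero)+
qed

lemma compact_support_integrable: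
  fixes F :: "'a::euclidean_space \<Rightarrow> 'b::euclidean_space"
  assumes "F \<in> borel_measurable borel" "compact K" "\<And>x. x \<notin> K \<Longrightarrow> F x = 0" "\<And>x. norm (F x) \<le> B"
  shows "integrable lborel F"
proof (rule Bochner_Integration.integrable_bound)
  show "integrable lborel (\<lambda>x. B * indicator K x :: real)"
    using assms by (intro integrable_mult_right integrable_real_indicator)
      (auto simp: emeasure_compact_finite[simplified] borel_compact)
  show "AE x in lborel. norm (F x) \<le> norm (B * indicator K x :: real)"
    using assms(3,4) by (intro AE_I2) (auto simp: indicator_def intro: order_trans[OF _ abs_ge_self])
qed (use assms in auto)

lemma integral_lborel_translate:
  fixes f :: "'a::euclidean_space \<Rightarrow> 'b::euclidean_space"
  assumes "f \<in> borel_measurable borel"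
  shows "(LINT x|lborel. f (x + h)) = (LINT x|lborel. f x)"
proof -
  have "(LINT x|lborel. f x) = (LINT x|distr lborel borel ((+) h). f x)"
    by (simp add: lborel_distr_plus)
  also have "\<dots> = (LINT x|lborel. f (h + x))"
    using assms by (intro integral_distr) auto
  finally show ?thesis by (simp add: add.commute)
qed

lemma integrable_lborel_translate:
  fixes f :: "'a::euclidean_space \<Rightarrow> 'b::euclidean_space"
  assumes "integrable lborel f"
  shows "integrable lborel (\<lambda>x. f (x + h))"
proof -
  have "integrable (distr lborel borel ((+) h)) f" using assms by (simp add: lborel_distr_plus)
  then have "integrable lborel (\<lambda>x. f (h + x))"
    by (subst (asm) integrable_distr_eq) (use assms in auto)
  then show ?thesis by (simp add: add.commute)
qed

lemma C1c_diff_bound: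
  assumes "C1c g G K" "\<And>x. norm (G x) \<le> B"
  shows "\<bar>g y - g x\<bar> \<le> B * norm (y - x)"
proof -
  have "norm (g y - g x) \<le> B * norm (y - x)"
  proof (rule differentiable_bound[of UNIV g "\<lambda>x h. G x \<bullet> h"])
    fix x
    have B: "0 \<le> B" using assms(2)[of x] norm_ge_zero order_trans by blast
    show "onorm (\<lambda>h. G x \<bullet> h) \<le> B"
      by (intro onorm_bound B) (metis Cauchy_Schwarz_ineq2 assms(2) mult_right_mono norm_ge_zero order_trans real_norm_def)
  qed (use assms in \<open>auto simp: C1c_def\<close>)
  then show ?thesis by simp
qed

text \<open>The steps 1 / (n + 1) form a sequence, so that dominated convergence applies
  directly.\<close>

definition dquot :: "('a::real_vector \<Rightarrow> real) \<Rightarrow> 'a \<Rightarrow> nat \<Rightarrow> 'a \<Rightarrow> real" where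
  "dquot g h n x = (g (x + (1 / real (Suc n)) *\<^sub>R h) - g x) * real (Suc n)"

lemma C1c_diff_quotient:
  assumes "C1c g G K"
  shows "(\<lambda>n. dquot g h n x) \<longlonglongrightarrow> G x \<bullet> h"
proof -
  have "(g has_derivative (\<lambda>h. G x \<bullet> h)) (at x)" using assms by (simp add: C1c_def)
  then have "(g has_derivative (\<lambda>h. G x \<bullet> h)) (at (x + 0 *\<^sub>R h) within UNIV)" by simp
  moreover have "((\<lambda>t::real. x + t *\<^sub>R h) has_derivative (\<lambda>t. t *\<^sub>R h)) (at 0)"
    by (auto intro!: derivative_eq_intros)
  ultimately have "((\<lambda>t. g (x + t *\<^sub>R h)) has_derivative (\<lambda>t. G x \<bullet> (t *\<^sub>R h))) (at 0)"
    using has_derivative_compose by blast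
  then have "((\<lambda>t. g (x + t *\<^sub>R h)) has_real_derivative (G x \<bullet> h)) (at 0)"
    by (simp add: has_field_derivative_def mult_commute_abs)
  then have "((\<lambda>t. (g (x + t *\<^sub>R h) - g x) / t) \<longlongrightarrow> G x \<bullet> h) (at 0)"
    by (simp add: DERIV_def)
  moreover have "filterlim (\<lambda>n. 1 / real (Suc n)) (at 0) sequentially"
    using LIMSEQ_inverse_real_of_nat by (intro filterlim_atI) (auto simp: field_simps)
  ultimately have "(\<lambda>n. (g (x + (1 / real (Suc n)) *\<^sub>R h) - g x) / (1 / real (Suc n))) \<longlonglongrightarrow> G x \<bullet> h"
    by (rule filterlim_compose)
  then show ?thesis by (simp add: dquot_def)
qed

lemma C1c_diff_quotient_dominated:
  fixes h :: "'a::euclidean_space"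
  assumes "C1c g G K"
  obtains B K' where "compact K'" "0 \<le> B"
    "\<And>x n. \<bar>dquot g h n x\<bar> \<le> B * indicator K' x"
proof -
  obtain B where B: "0 \<le> B" "\<And>x. norm (G x) \<le> B"
    using compact_support_bounded[of G K] assms C1c_grad_outside[OF assms] by (auto simp: C1c_def)
  \<comment> \<open>No step is longer than \<open>norm h\<close>, so a single compact neighbourhood
    of K contains the supports of all difference quotients.\<close>
  define K' where "K' = {x + y |x y. x \<in> K \<and> y \<in> cball 0 (norm h)}"
  have K': "compact K'" unfolding K'_def using assms by (intro compact_sums) (auto simp: C1c_def)
  show thesis
  proof (rule that[OF K', of "B * norm h"])
    fix x n
    let ?h = "(1 / real (Suc n)) *\<^sub>R h"
    have nh: "norm ?h \<le> norm h" by (simp add: field_simps mult_left_le[of 1 "norm h"])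
    have "\<bar>g (x + ?h) - g x\<bar> * real (Suc n) \<le> B * norm ?h * real (Suc n)"
      using C1c_diff_bound[OF assms B(2), of "x + ?h" x] by (intro mult_right_mono) auto
    also have "\<dots> = B * norm h" by simp
    finally have 1: "\<bar>(g (x + ?h) - g x) * real (Suc n)\<bar> \<le> B * norm h"
      by (simp add: abs_mult)
    have 2: "x \<in> K'" if "g (x + ?h) - g x \<noteq> 0"
    proof (cases "x \<in> K")
      case True
      then show ?thesis unfolding K'_def by (intro CollectI exI[of _ x] exI[of _ "0::'a"]) auto
    next
      case False
      then have "x + ?h \<in> K" using that assms by (auto simp: C1c_def)
      then show ?thesis unfolding K'_def
        using nh by (intro CollectI exI[of _ "x + ?h"] exI[of _ "- ?h"]) (auto simp del: norm_scaleR)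
    qed
    show "\<bar>dquot g h n x\<bar> \<le> B * norm h * indicator K' x"
      using 1 2 by (cases "x \<in> K'") (auto simp: dquot_def)
  qed (use B in auto)
qed

lemma C1c_measurable [measurable_dest]: "C1c g G K \<Longrightarrow> g \<in> borel_measurable borel"
  by (intro borel_measurable_continuous_onI C1c_continuous)

lemma C1c_grad_measurable: "C1c g G K \<Longrightarrow> G \<in> borel_measurable borel"
  by (intro borel_measurable_continuous_onI) (auto simp: C1c_def)

lemma C1c_integrable:
  assumes "C1c g G K" shows "integrable lborel g"
proof -
  obtain B where B: "0 \<le> B" "\<And>x. norm (g x) \<le> B"
    using compact_support_bounded[OF C1c_continuous[OF assms], of K] assms by (auto simp: C1c_def)
  show ?thesis using assms B
    by (intro compact_support_integrable[of _ K B]) (auto simp: C1c_def intro: C1c_measurable[OF assms])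
qed

lemma integrable_indicator_compact:
  "compact (K::'a::euclidean_space set) \<Longrightarrow> integrable lborel (\<lambda>x. B * indicator K x :: real)"
  by (intro compact_support_integrable[of _ K "\<bar>B\<bar>"])
    (auto simp: borel_compact abs_mult split: split_indicator
      intro!: borel_measurable_times borel_measurable_indicator)

text \<open>Translation invariance makes the integral of every difference quotient vanish, and
  dominated convergence passes this on to the derivative. It serves as the divergence theorem for
  compact support.\<close>

lemma C1c_integral_derivative_zero:
  assumes "C1c g G K"
  shows "(LINT x|lborel. G x \<bullet> h) = 0"
proof -
  note [measurable] = C1c_measurable[OF assms] C1c_grad_measurable[OF assms]
  obtain B K' where K': "compact K'" "0 \<le> B"
    "\<And>x n. \<bar>dquot g h n x\<bar> \<le> B * indicator K' x"
    by (rule C1c_diff_quotient_dominated[OF assms]) (rule that)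
  have [measurable]: "dquot g h n \<in> borel_measurable borel" for n
    unfolding dquot_def[abs_def] by measurable
  have "(\<lambda>n. LINT x|lborel. dquot g h n x)
      \<longlonglongrightarrow> (LINT x|lborel. G x \<bullet> h)"
  proof (rule integral_dominated_convergence[where w = "\<lambda>x. B * indicator K' x"])
    show "integrable lborel (\<lambda>x. B * indicator K' x)"
      by (rule integrable_indicator_compact[OF K'(1)])
    show "AE x in lborel. (\<lambda>n. dquot g h n x) \<longlonglongrightarrow> G x \<bullet> h"
      by (intro AE_I2 C1c_diff_quotient[OF assms])
    show "AE x in lborel. norm (dquot g h n x) \<le> B * indicator K' x" for n
      using K'(3) by (intro AE_I2) (simp only: real_norm_def)
  qed measurable
  moreover have "(LINT x|lborel. dquot g h n x) = 0" for n
    using C1c_integrable[OF assms] unfolding dquot_def[abs_def]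
    by (simp add: integral_lborel_translate integrable_lborel_translate)
  ultimately show ?thesis by (simp add: LIMSEQ_const_iff)
qed

text \<open>Jensen's inequality with equal weights. Young's inequality compares each
  \<open>f i\<close> with the mean m; summation gives p n m^p on the left and (p - 1) n m^p on the
  right, and the difference n m^p is what remains.\<close>

lemma powr_sum_le:
  fixes f :: "nat \<Rightarrow> real"
  assumes "1 < p" "0 < n" "\<And>i. i < n \<Longrightarrow> 0 \<le> f i"
  shows "(\<Sum>i<n. f i) powr p \<le> real n powr (p - 1) * (\<Sum>i<n. f i powr p)"
proof -
  define m where "m = (\<Sum>i<n. f i) / real n"
  have m: "0 \<le> m" "(\<Sum>i<n. f i) = real n * m"
    using assms by (auto simp: m_def intro!: sum_nonneg divide_nonneg_nonneg)
  have mp: "m powr (p - 1) * m = m powr p"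
    using m(1) by (cases "m = 0") (auto simp: powr_diff)
  have "p * (real n * m powr p) = (\<Sum>i<n. p * (m powr (p - 1) * f i))"
    unfolding sum_distrib_left[symmetric] m(2) mp[symmetric] by simp
  also have "\<dots> \<le> (\<Sum>i<n. (p - 1) * m powr p + f i powr p)"
    using assms m by (intro sum_mono young_powr) auto
  also have "\<dots> = (p - 1) * (real n * m powr p) + (\<Sum>i<n. f i powr p)"
    by (simp add: sum.distrib)
  finally have "real n * m powr p \<le> (\<Sum>i<n. f i powr p)"
    by (simp add: left_diff_distrib)
  then have "real n powr (p - 1) * (real n * m powr p) \<le> real n powr (p - 1) * (\<Sum>i<n. f i powr p)"
    by (intro mult_left_mono) auto
  moreover have "real n powr (p - 1) * (real n * m powr p) = (\<Sum>i<n. f i) powr p"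
    using m assms by (simp add: powr_mult powr_diff)
  ultimately show ?thesis by simp
qed

text \<open>Telescoping the shift by \<open>h\<close> into \<open>m\<close> shifts by \<open>h / m\<close> bounds the left side by the difference
  quotients with step \<open>1 / m\<close>, which converge to the directional derivative.\<close>

lemma C1c_translation_estimate:
  fixes h :: "'a::euclidean_space"
  assumes "C1c g G K" "1 < p"
  shows "integrable lborel (\<lambda>x. \<bar>g (x + h) - g x\<bar> powr p)"
    and "integrable lborel (\<lambda>x. norm (G x) powr p)"
    and "(LINT x|lborel. \<bar>g (x + h) - g x\<bar> powr p) \<le> norm h powr p * (LINT x|lborel. norm (G x) powr p)"
proof -
  note [measurable] = C1c_measurable[OF assms(1)] C1c_grad_measurable[OF assms(1)]
  obtain B K' where K': "compact K'" "0 \<le> B"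
    "\<And>x n. \<bar>dquot g h n x\<bar> \<le> B * indicator K' x"
    by (rule C1c_diff_quotient_dominated[OF assms(1)]) (rule that)
  define D where "D n x = \<bar>dquot g h n x\<bar> powr p" for n x
  have Db: "D n x \<le> B powr p * indicator K' x" for n x
  proof -
    have "D n x \<le> (B * indicator K' x) powr p"
      unfolding D_def using K'(3)[of n x] assms(2) by (intro powr_mono2) auto
    then show ?thesis using assms(2) by (auto simp: indicator_def split: if_splits)
  qed
  have D0: "0 \<le> D n x" for n x by (simp add: D_def)
  have [measurable]: "D n \<in> borel_measurable borel" for n unfolding D_def[abs_def] dquot_def[abs_def] by measurable
  have Kint: "integrable lborel (\<lambda>x. B powr p * indicator K' x)"
    by (rule integrable_indicator_compact[OF K'(1)])
  have Dint: "integrable lborel (D n)" for n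
    by (rule Bochner_Integration.integrable_bound[OF Kint]) (use Db D0 in \<open>auto intro!: AE_I2\<close>)
  show "integrable lborel (\<lambda>x. \<bar>g (x + h) - g x\<bar> powr p)"
    using Dint[of 0] by (simp add: D_def[abs_def] dquot_def)
  obtain BG where BG: "0 \<le> BG" "\<And>x. norm (G x) \<le> BG"
    using compact_support_bounded[of G K] assms C1c_grad_outside[OF assms(1)] by (auto simp: C1c_def)
  show Gint: "integrable lborel (\<lambda>x. norm (G x) powr p)"
    using assms C1c_grad_outside[OF assms(1)] BG
    by (intro compact_support_integrable[of _ K "BG powr p"]) (auto simp: C1c_def intro: powr_mono2)
  have lim: "(\<lambda>n. integral\<^sup>L lborel (D n)) \<longlonglongrightarrow> (LINT x|lborel. \<bar>G x \<bullet> h\<bar> powr p)"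
  proof (rule integral_dominated_convergence[where w = "\<lambda>x. B powr p * indicator K' x"])
    show "AE x in lborel. (\<lambda>n. D n x) \<longlonglongrightarrow> \<bar>G x \<bullet> h\<bar> powr p"
      unfolding D_def using assms(2)
      by (intro AE_I2 tendsto_powr2 tendsto_rabs C1c_diff_quotient[OF assms(1)] tendsto_const) auto
    show "AE x in lborel. norm (D n x) \<le> B powr p * indicator K' x" for n
      using Db D0 by (intro AE_I2) simp
  qed (use Kint in measurable)
  have tele: "(LINT x|lborel. \<bar>g (x + h) - g x\<bar> powr p) \<le> integral\<^sup>L lborel (D n)" for n
  proof -
    define m where "m = Suc n"
    define k where "k = (1 / real m) *\<^sub>R h"
    have m: "m > 0" "real m *\<^sub>R k = h" by (auto simp: m_def k_def)
    define d where "d x = \<bar>g (x + k) - g x\<bar> powr p" for x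
    have dD: "D n x = real m powr p * d x" for x
      by (simp add: D_def dquot_def d_def abs_mult powr_mult m_def k_def mult.commute)
    have dint: "integrable lborel d"
      using Dint[of n] m by (simp add: dD[abs_def])
    have pt: "\<bar>g (x + h) - g x\<bar> powr p \<le> real m powr (p - 1) * (\<Sum>i<m. d (x + real i *\<^sub>R k))" for x
    proof -
      have "g (x + h) - g x = (\<Sum>i<m. g (x + real (Suc i) *\<^sub>R k) - g (x + real i *\<^sub>R k))"
        by (subst sum_lessThan_telescope) (simp add: m)
      then have "\<bar>g (x + h) - g x\<bar> \<le> (\<Sum>i<m. \<bar>g (x + real (Suc i) *\<^sub>R k) - g (x + real i *\<^sub>R k)\<bar>)"
        by (simp only: sum_abs)
      then have "\<bar>g (x + h) - g x\<bar> powr p \<le> (\<Sum>i<m. \<bar>g (x + real (Suc i) *\<^sub>R k) - g (x + real i *\<^sub>R k)\<bar>) powr p"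
        using assms(2) by (intro powr_mono2) auto
      also have "\<dots> \<le> real m powr (p - 1) * (\<Sum>i<m. \<bar>g (x + real (Suc i) *\<^sub>R k) - g (x + real i *\<^sub>R k)\<bar> powr p)"
        using assms(2) m by (intro powr_sum_le) auto
      finally show ?thesis by (simp add: d_def algebra_simps)
    qed
    have "(LINT x|lborel. \<bar>g (x + h) - g x\<bar> powr p)
        \<le> (LINT x|lborel. real m powr (p - 1) * (\<Sum>i<m. d (x + real i *\<^sub>R k)))"
      using pt dint Dint[of 0] by (intro integral_mono)
        (auto simp: D_def[abs_def] dquot_def intro!: integrable_lborel_translate)
    also have "\<dots> = real m powr (p - 1) * (\<Sum>i<m. LINT x|lborel. d (x + real i *\<^sub>R k))"
      using dint by (simp add: integrable_lborel_translate Bochner_Integration.integral_sum)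
    \<comment> \<open>The shifted integrals are all equal. The loss
      \<open>real m powr (p - 1)\<close> from the power of a sum, times the m equal terms, is
      exactly the normalization \<open>real m powr p\<close> of \<open>D n\<close>.\<close>
    also have "\<dots> = real m powr (p - 1) * real m * integral\<^sup>L lborel d"
      using dint by (simp add: integral_lborel_translate)
    also have "real m powr (p - 1) * real m = real m powr p" using m by (simp add: powr_diff)
    also have "real m powr p * integral\<^sup>L lborel d = integral\<^sup>L lborel (D n)"
      by (simp add: dD[abs_def])
    finally show ?thesis .
  qed
  have "(LINT x|lborel. \<bar>g (x + h) - g x\<bar> powr p) \<le> (LINT x|lborel. \<bar>G x \<bullet> h\<bar> powr p)"
    using tele by (intro LIMSEQ_le_const[OF lim]) auto
  also have "\<dots> \<le> (LINT x|lborel. norm h powr p * norm (G x) powr p)"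
  proof (rule integral_mono_AE')
    show "AE x in lborel. \<bar>G x \<bullet> h\<bar> powr p \<le> norm h powr p * norm (G x) powr p"
    proof (rule AE_I2)
      fix x
      have "\<bar>G x \<bullet> h\<bar> powr p \<le> (norm h * norm (G x)) powr p"
        using assms(2) Cauchy_Schwarz_ineq2[of "G x" h] by (intro powr_mono2) (auto simp: mult.commute)
      then show "\<bar>G x \<bullet> h\<bar> powr p \<le> norm h powr p * norm (G x) powr p" by (simp add: powr_mult)
    qed
  qed (use Gint in auto)
  finally show "(LINT x|lborel. \<bar>g (x + h) - g x\<bar> powr p) \<le> norm h powr p * (LINT x|lborel. norm (G x) powr p)"
    by simp
qed

section \<open>Weak gradients\<close>

lemma lebesgue_on_vanishing_outside:
  fixes f :: "'a::euclidean_space \<Rightarrow> 'b::euclidean_space"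
  assumes "\<Omega> \<in> sets lebesgue" "f \<in> borel_measurable borel" "\<And>x. x \<notin> \<Omega> \<Longrightarrow> f x = 0"
  shows "integrable (lebesgue_on \<Omega>) f \<longleftrightarrow> integrable lborel f"
    and "integral\<^sup>L (lebesgue_on \<Omega>) f = integral\<^sup>L lborel f"
proof -
  have eq: "(\<lambda>x. if x \<in> \<Omega> then f x else 0) = f" using assms(3) by auto
  show "integrable (lebesgue_on \<Omega>) f \<longleftrightarrow> integrable lborel f"
    using Lebesgue_Measure.integrable_restrict_UNIV[OF assms(1), of f] integrable_completion[of f lborel] assms(2)
    by (simp add: eq)
  show "integral\<^sup>L (lebesgue_on \<Omega>) f = integral\<^sup>L lborel f"
    using Lebesgue_Measure.integral_restrict_UNIV[OF assms(1), of f] integral_completion[of f lborel] assms(2)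
    by (simp add: eq)
qed

lemma borel_measurable_lebesgue_on:
  "f \<in> borel_measurable borel \<Longrightarrow> f \<in> borel_measurable (lebesgue_on \<Omega>)"
  by (auto intro!: measurable_restrict_space1 measurable_completion)

section \<open>Smooth bump functions on boxes\<close>

text \<open>This class of functions is closed under differentiation, and its members are smooth and flat at 0.\<close>

definition expinv :: "real poly \<Rightarrow> real \<Rightarrow> real" where
  "expinv P s = (if s > 0 then poly P (1 / s) * exp (- (1 / s)) else 0)"

lemma expinv_tendsto_0: "(expinv P \<longlongrightarrow> 0) (at 0)"
proof -
  have "((\<lambda>y::real. \<Sum>i\<le>degree P. coeff P i * (y ^ i / exp y)) \<longlongrightarrow> (\<Sum>i\<le>degree P. coeff P i * 0)) at_top"
    by (intro tendsto_intros tendsto_power_div_exp_0)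
  then have top: "((\<lambda>y. poly P y * exp (- y)) \<longlongrightarrow> 0) at_top"
    by (simp add: poly_altdef sum_distrib_right sum_divide_distrib exp_minus field_simps)
  have "((\<lambda>s. poly P (inverse s) * exp (- inverse s)) \<longlongrightarrow> 0) (at_right 0)"
    by (rule filterlim_compose[OF top filterlim_inverse_at_top_right])
  then have r: "(expinv P \<longlongrightarrow> 0) (at_right 0)"
    by (rule Lim_transform_eventually)
      (auto simp: expinv_def eventually_at_right_less inverse_eq_divide intro: eventually_mono[OF eventually_at_right_less])
  have l: "(expinv P \<longlongrightarrow> 0) (at_left 0)"
    by (rule Lim_transform_eventually[OF tendsto_const])
      (auto simp: expinv_def intro!: eventually_mono[OF eventually_at_left_real[of "-1" 0]])
  show ?thesis using l r by (simp add: filterlim_at_split)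
qed

text \<open>With y = 1 / s, differentiation in s sends P(y) exp(-y) to y^2 (P - P')(y) exp(-y); the
  two \<open>pCons 0\<close> are the factor y^2.\<close>

lemma expinv_has_derivative:
  "(expinv P has_real_derivative expinv (pCons 0 (pCons 0 (P - pderiv P))) s) (at s)"
proof -
  consider "s < 0" | "s = 0" | "s > 0" by linarith
  then show ?thesis
  proof cases
    case 1
    have "((\<lambda>_. 0) has_real_derivative 0) (at s)" by simp
    then have "(expinv P has_real_derivative 0) (at s)"
      by (rule has_field_derivative_transform_within_open[where S = "{..<0}"])
        (use 1 in \<open>auto simp: expinv_def\<close>)
    then show ?thesis using 1 by (simp add: expinv_def)
  next
    case 2
    \<comment> \<open>Away from h = 0 the difference quotient is
      \<open>expinv (pCons 0 P) h\<close>, again a member of the class, so it tends to 0.\<close>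
    have "((\<lambda>h. (expinv P (0 + h) - expinv P 0) / h) \<longlongrightarrow> 0) (at 0)"
      by (rule Lim_transform_eventually[OF expinv_tendsto_0[of "pCons 0 P"]])
        (auto simp: expinv_def eventually_at_filter)
    then show ?thesis using 2 by (simp add: DERIV_def expinv_def)
  next
    case 3
    have "((\<lambda>s. poly P (1 / s) * exp (- (1 / s))) has_real_derivative
        expinv (pCons 0 (pCons 0 (P - pderiv P))) s) (at s)"
      using 3 by (auto intro!: derivative_eq_intros simp: expinv_def power2_eq_square field_simps)
    then show ?thesis
      by (rule has_field_derivative_transform_within_open[where S = "{0<..}"])
        (use 3 in \<open>auto simp: expinv_def\<close>)
  qed
qed

lemma C_k_expinv: "C_k k (\<lambda>x::'a::euclidean_space. expinv P (c * (x \<bullet> b) + d))"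
proof -
  have der: "((\<lambda>x. expinv P (c * (x \<bullet> b) + d)) has_derivative
      (\<lambda>h. c * (h \<bullet> b) * expinv (pCons 0 (pCons 0 (P - pderiv P))) (c * (x \<bullet> b) + d))) (at x)"
    for P and x :: 'a
  proof -
    have "((\<lambda>x. c * (x \<bullet> b) + d) has_derivative (\<lambda>h. c * (h \<bullet> b))) (at x)"
      by (auto intro!: derivative_eq_intros)
    from has_derivative_compose[OF this expinv_has_derivative[of P, unfolded has_field_derivative_def]]
    show ?thesis by (simp add: mult.commute)
  qed
  show ?thesis
  proof (induction k arbitrary: P)
    case 0
    show ?case unfolding C_k.simps continuous_on_eq_continuous_within
      using der has_derivative_continuous by blast
  next
    case (Suc k)
    show ?case unfolding C_k.simps
    proof (intro conjI allI ballI)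
      show "(\<lambda>x. expinv P (c * (x \<bullet> b) + d)) differentiable at x" for x
        using der differentiable_def by blast
      show "C_k k (\<lambda>x. frechet_derivative (\<lambda>x. expinv P (c * (x \<bullet> b) + d)) (at x) e)" for e
        unfolding frechet_derivative_at[OF der, symmetric] by (intro C_k_mult C_k_const Suc)
    qed
  qed
qed

text \<open>Each coordinate contributes the flat exponential of its distance to both faces, and t
  rescales the distances. As t grows, every factor at an interior point tends to 1, so the bumps
  tend to the indicator of the open box.\<close>

definition box_bump :: "'a::euclidean_space \<Rightarrow> 'a \<Rightarrow> real \<Rightarrow> 'a \<Rightarrow> real" where
  "box_bump a b t x = (\<Prod>i\<in>Basis. expinv 1 (t * (x \<bullet> i) + (- t * (a \<bullet> i))) * expinv 1 (- t * (x \<bullet> i) + t * (b \<bullet> i)))"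

lemma expinv_one_range: "0 \<le> expinv 1 s" "expinv 1 s \<le> 1"
  by (auto simp: expinv_def)

lemma box_bump_outside:
  assumes "t > 0" "x \<notin> box a b"
  shows "box_bump a b t x = 0"
proof -
  obtain i where i: "i \<in> Basis" "\<not> (a \<bullet> i < x \<bullet> i \<and> x \<bullet> i < b \<bullet> i)"
    using assms by (auto simp: mem_box)
  have "\<not> (0 < t * (x \<bullet> i) + (- t * (a \<bullet> i)) \<and> 0 < - t * (x \<bullet> i) + t * (b \<bullet> i))"
    using i assms(1) by auto
  then have "expinv 1 (t * (x \<bullet> i) + (- t * (a \<bullet> i))) * expinv 1 (- t * (x \<bullet> i) + t * (b \<bullet> i)) = 0"
    unfolding expinv_def by auto
  then show ?thesis unfolding box_bump_def using i(1) by (intro prod_zero) auto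
qed

lemma box_bump_range: "0 \<le> box_bump a b t x" "box_bump a b t x \<le> 1"
  unfolding box_bump_def
  by (intro prod_nonneg mult_nonneg_nonneg expinv_one_range ballI)
    (intro prod_le_1 conjI mult_nonneg_nonneg mult_le_one expinv_one_range)

lemma box_bump_test:
  assumes "t > 0" "cbox a b \<subseteq> \<Omega>"
  shows "box_bump a b t \<in> test_functions \<Omega>"
proof (rule test_functionsI[of _ "cbox a b"])
  show "C_k k (box_bump a b t)" for k
    unfolding box_bump_def[abs_def] by (intro C_k_prod C_k_mult C_k_expinv)
  show "box_bump a b t x = 0" if "x \<notin> cbox a b" for x
    using that box_subset_cbox by (intro box_bump_outside assms) blast
qed (use assms in auto)

lemma box_bump_tendsto:
  "(\<lambda>n. box_bump a b (real (Suc n)) x) \<longlonglongrightarrow> indicator (box a b) x"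
proof (cases "x \<in> box a b")
  case True
  have lim: "(\<lambda>n. expinv 1 (real (Suc n) * s)) \<longlonglongrightarrow> 1" if "s > 0" for s
  proof -
    have "(\<lambda>n. exp (- ((1 / s) * (1 / real (Suc n))))) \<longlonglongrightarrow> exp (- ((1 / s) * 0))"
      by (intro tendsto_exp tendsto_minus tendsto_mult tendsto_const LIMSEQ_Suc[OF lim_1_over_n])
    then show ?thesis using that by (simp add: expinv_def zero_less_mult_iff mult.commute)
  qed
  have "(\<lambda>n. \<Prod>i\<in>Basis. expinv 1 (real (Suc n) * (x \<bullet> i - a \<bullet> i)) * expinv 1 (real (Suc n) * (b \<bullet> i - x \<bullet> i)))
      \<longlonglongrightarrow> (\<Prod>i\<in>(Basis::'a set). 1 * 1)"
    using True by (intro tendsto_prod tendsto_mult lim) (auto simp: mem_box)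
  moreover have "box_bump a b t x = (\<Prod>i\<in>Basis. expinv 1 (t * (x \<bullet> i - a \<bullet> i)) * expinv 1 (t * (b \<bullet> i - x \<bullet> i)))" for t
    unfolding box_bump_def by (intro prod.cong refl) (simp add: algebra_simps)
  ultimately show ?thesis using True by simp
qed (simp add: box_bump_outside)

section \<open>Local integrability and the fundamental lemma of the calculus of variations\<close>

lemma locally_integrable_restrict:
  fixes g :: "'a::euclidean_space \<Rightarrow> 'b::euclidean_space"
  assumes "locally_integrable_on g \<Omega>" "open \<Omega>" "compact K" "K \<subseteq> \<Omega>"
  shows "integrable lebesgue (\<lambda>x. if x \<in> K then g x else 0)"
    and "integrable (lebesgue_on \<Omega>) (\<lambda>x. if x \<in> K then g x else 0)"
proof -
  have K: "K \<in> sets lebesgue" "\<Omega> \<in> sets lebesgue"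
    using assms by (auto simp: compact_imp_closed)
  show 1: "integrable lebesgue (\<lambda>x. if x \<in> K then g x else 0)"
    using assms Lebesgue_Measure.integrable_restrict_UNIV[OF K(1), of g] by (auto simp: locally_integrable_on_def)
  have "(\<lambda>x. if x \<in> \<Omega> then (if x \<in> K then g x else 0) else 0) = (\<lambda>x. if x \<in> K then g x else 0)"
    using assms(4) by (auto simp: fun_eq_iff)
  then show "integrable (lebesgue_on \<Omega>) (\<lambda>x. if x \<in> K then g x else 0)"
    using Lebesgue_Measure.integrable_restrict_UNIV[OF K(2), of "\<lambda>x. if x \<in> K then g x else 0"] 1 by simp
qed

lemma integrable_mult_bounded:
  fixes f g :: "'x \<Rightarrow> real"
  assumes "integrable M f" "g \<in> borel_measurable M" "\<And>x. \<bar>g x\<bar> \<le> B"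
  shows "integrable M (\<lambda>x. f x * g x)"
proof (rule Bochner_Integration.integrable_bound[of M "\<lambda>x. B * f x"])
  show "AE x in M. norm (f x * g x) \<le> norm (B * f x)"
  proof (rule AE_I2)
    fix x
    have "\<bar>f x\<bar> * \<bar>g x\<bar> \<le> \<bar>f x\<bar> * \<bar>B\<bar>"
      using assms(3)[of x] by (intro mult_left_mono) auto
    then show "norm (f x * g x) \<le> norm (B * f x)" by (simp add: abs_mult mult.commute)
  qed
qed (use assms in auto)

lemma locally_integrable_mult:
  fixes g :: "'a::euclidean_space \<Rightarrow> real"
  assumes "locally_integrable_on g \<Omega>" "open \<Omega>" "continuous_on UNIV \<phi>"
    "compact K" "K \<subseteq> \<Omega>" "\<And>x. x \<notin> K \<Longrightarrow> \<phi> x = 0"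
  shows "integrable (lebesgue_on \<Omega>) (\<lambda>x. g x * \<phi> x)"
proof -
  obtain B where B: "\<And>x. norm (\<phi> x) \<le> B"
    using compact_support_bounded[OF assms(3,4,6)] by metis
  have "integrable (lebesgue_on \<Omega>) (\<lambda>x. (if x \<in> K then g x else 0) * \<phi> x)"
    using B assms(3) locally_integrable_restrict(2)[OF assms(1,2,4,5)]
    by (intro integrable_mult_bounded[of _ _ _ B] borel_measurable_lebesgue_on borel_measurable_continuous_onI) auto
  moreover have "(\<lambda>x. (if x \<in> K then g x else 0) * \<phi> x) = (\<lambda>x. g x * \<phi> x)"
    using assms(6) by auto
  ultimately show ?thesis by simp
qed

lemma test_continuous: "\<phi> \<in> test_functions \<Omega> \<Longrightarrow> continuous_on UNIV \<phi>"
  using test_C_k[of \<phi> \<Omega> 0] by simp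

lemma locally_integrable_mult_test:
  fixes g :: "'a::euclidean_space \<Rightarrow> real"
  assumes "locally_integrable_on g \<Omega>" "open \<Omega>" "\<phi> \<in> test_functions \<Omega>"
  shows "integrable (lebesgue_on \<Omega>) (\<lambda>x. g x * \<phi> x)"
proof -
  obtain K where "compact K" "K \<subseteq> \<Omega>" "\<And>x. x \<notin> K \<Longrightarrow> \<phi> x = 0"
    using test_functionsE[OF assms(3)] by metis
  then show ?thesis using locally_integrable_mult[OF assms(1,2) test_continuous[OF assms(3)]] by blast
qed

text \<open>The bumps lie between 0 and 1 and converge to the indicator of the open box, so the
  vanishing test integrals pass to the integral of g over the box; open and closed box have the same
  integral.\<close>

lemma fundamental_lemma_box:
  fixes g :: "'a::euclidean_space \<Rightarrow> real"
  assumes li: "locally_integrable_on g \<Omega>" and op: "open \<Omega>"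
    and zero: "\<And>\<phi>. \<phi> \<in> test_functions \<Omega> \<Longrightarrow> (LINT x|lebesgue_on \<Omega>. g x * \<phi> x) = 0"
    and sub: "cbox a b \<subseteq> \<Omega>"
  shows "integral (cbox a b) g = 0"
proof -
  define f where "f x = (if x \<in> cbox a b then g x else 0)" for x
  have fint: "integrable (lebesgue_on \<Omega>) f" and fint': "integrable lebesgue f"
    unfolding f_def[abs_def] using locally_integrable_restrict[OF li op compact_cbox sub] by auto
  have \<Omega>: "\<Omega> \<in> sets lebesgue" using op by auto
  have eq: "f x * box_bump a b (real (Suc n)) x = g x * box_bump a b (real (Suc n)) x" for n x
    using box_bump_outside[of "real (Suc n)" x a b] box_subset_cbox[of a b] by (auto simp: f_def)
  have "(\<lambda>n. LINT x|lebesgue_on \<Omega>. f x * box_bump a b (real (Suc n)) x) \<longlonglongrightarrow> (LINT x|lebesgue_on \<Omega>. f x * indicator (box a b) x)"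
  proof (rule integral_dominated_convergence[where w = "\<lambda>x. \<bar>f x\<bar>"])
    have m: "box_bump a b t \<in> borel_measurable (lebesgue_on \<Omega>)" if "t > 0" for t
      using test_continuous[OF box_bump_test[OF that sub]]
      by (intro borel_measurable_lebesgue_on borel_measurable_continuous_onI)
    show "(\<lambda>x. f x * indicator (box a b) x) \<in> borel_measurable (lebesgue_on \<Omega>)"
      by (intro borel_measurable_times[OF borel_measurable_integrable[OF fint]] borel_measurable_lebesgue_on borel_measurable_indicator) auto
    show "(\<lambda>x. f x * box_bump a b (real (Suc n)) x) \<in> borel_measurable (lebesgue_on \<Omega>)" for n
      using fint m[of "real (Suc n)"] by (intro borel_measurable_times) auto
    show "integrable (lebesgue_on \<Omega>) (\<lambda>x. \<bar>f x\<bar>)" using fint by auto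
    show "AE x in lebesgue_on \<Omega>. (\<lambda>n. f x * box_bump a b (real (Suc n)) x) \<longlonglongrightarrow> f x * indicator (box a b) x"
      by (intro AE_I2 tendsto_mult tendsto_const box_bump_tendsto)
    show "AE x in lebesgue_on \<Omega>. norm (f x * box_bump a b (real (Suc n)) x) \<le> \<bar>f x\<bar>" for n
      using box_bump_range[of a b "real (Suc n)"]
      by (intro AE_I2) (simp only: real_norm_def abs_mult, intro mult_left_le, auto)
  qed
  moreover have "(LINT x|lebesgue_on \<Omega>. f x * box_bump a b (real (Suc n)) x) = 0" for n
    unfolding eq by (intro zero box_bump_test sub) auto
  ultimately have "(LINT x|lebesgue_on \<Omega>. f x * indicator (box a b) x) = 0"
    by (simp add: LIMSEQ_const_iff)
  also have "(\<lambda>x. f x * indicator (box a b) x) = (\<lambda>x. if x \<in> box a b then g x else 0)"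
    using box_subset_cbox[of a b] by (auto simp: f_def fun_eq_iff indicator_def)
  finally have "(LINT x|lebesgue_on \<Omega>. (if x \<in> box a b then g x else 0)) = 0" .
  also have "(LINT x|lebesgue_on \<Omega>. (if x \<in> box a b then g x else 0))
      = (LINT x|lebesgue. (if x \<in> \<Omega> then if x \<in> box a b then g x else 0 else 0))"
    by (rule Lebesgue_Measure.integral_restrict_UNIV[OF \<Omega>, symmetric])
  also have "(\<lambda>x. if x \<in> \<Omega> then if x \<in> box a b then g x else 0 else 0) = (\<lambda>x. if x \<in> box a b then g x else 0)"
    using sub box_subset_cbox[of a b] by (auto simp: fun_eq_iff)
  also have "(LINT x|lebesgue. (if x \<in> box a b then g x else 0)) = (LINT x|lebesgue_on (box a b). g x)"
    by (rule Lebesgue_Measure.integral_restrict_UNIV) auto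
  also have "\<dots> = integral (box a b) g"
  proof (rule lebesgue_integral_eq_integral)
    have "integrable lebesgue (\<lambda>x. f x * indicator (box a b) x)"
      using fint' by (intro integrable_mult_bounded[of _ _ _ 1] borel_measurable_indicator)
        (auto split: split_indicator)
    then have "integrable lebesgue (\<lambda>x. if x \<in> box a b then g x else 0)"
      by (rule back_subst[of "integrable lebesgue"])
        (use box_subset_cbox[of a b] in \<open>auto simp: f_def fun_eq_iff indicator_def\<close>)
    then show "integrable (lebesgue_on (box a b)) g"
      by (subst (asm) Lebesgue_Measure.integrable_restrict_UNIV) auto
  qed auto
  finally show ?thesis by (simp add: integral_open_interval)
qed

text \<open>Lebesgue differentiation recovers g almost everywhere from its averages over cubes with
  corner x, and all small averages are zero. Countably many closed boxes fill \<Omega>.\<close>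

lemma fundamental_lemma:
  fixes g :: "'a::euclidean_space \<Rightarrow> real"
  assumes li: "locally_integrable_on g \<Omega>" and op: "open \<Omega>"
    and zero: "\<And>\<phi>. \<phi> \<in> test_functions \<Omega> \<Longrightarrow> (LINT x|lebesgue_on \<Omega>. g x * \<phi> x) = 0"
  shows "AE x in lebesgue_on \<Omega>. g x = 0"
proof -
  have neg: "negligible {x \<in> cbox a b. g x \<noteq> 0}" if sub: "cbox a b \<subseteq> \<Omega>" for a b
  proof -
    define f where "f x = (if x \<in> cbox a b then g x else 0)" for x
    have fint: "integrable lebesgue f"
      unfolding f_def[abs_def] by (rule locally_integrable_restrict[OF li op compact_cbox sub])
    then have "f integrable_on UNIV" using integrable_on_lebesgue by blast
    then have io: "f integrable_on cbox u v" for u v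
      by (rule integrable_on_subcbox) auto
    obtain N where N: "negligible N" "\<And>x e. \<lbrakk>x \<notin> N; 0 < e\<rbrakk> \<Longrightarrow> \<exists>d>0. \<forall>h. 0 < h \<and> h < d \<longrightarrow>
        norm (integral (cbox x (x + h *\<^sub>R One)) f /\<^sub>R h ^ DIM('a) - f x) < e"
      using integrable_ccontinuous_explicit[of f] io by blast
    have "g x = 0" if x: "x \<in> box a b" "x \<notin> N" for x
    proof (rule ccontr)
      assume "g x \<noteq> 0"
      then have "\<bar>f x\<bar> > 0" using x box_subset_cbox[of a b] by (auto simp: f_def)
      then obtain d where d: "d > 0" "\<And>h. 0 < h \<Longrightarrow> h < d \<Longrightarrow>
          norm (integral (cbox x (x + h *\<^sub>R One)) f /\<^sub>R h ^ DIM('a) - f x) < \<bar>f x\<bar>"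
        using N(2)[OF x(2), of "\<bar>f x\<bar>"] by blast
      \<comment> \<open>The cubes extend from x in the positive coordinate directions only, so the
        distance to the upper faces decides whether they stay inside the box.\<close>
      define m where "m = Min ((\<lambda>i. b \<bullet> i - x \<bullet> i) ` Basis)"
      have m: "m > 0" "\<And>i. i \<in> Basis \<Longrightarrow> m \<le> b \<bullet> i - x \<bullet> i"
        using x(1) by (auto simp: m_def mem_box)
      define h where "h = min d m / 2"
      have h: "0 < h" "h < d" "h \<le> m" using d(1) m(1) by (auto simp: h_def min_def)
      have sub': "cbox x (x + h *\<^sub>R One) \<subseteq> cbox a b"
      proof -
        have "x \<bullet> i + h \<le> b \<bullet> i" if "i \<in> Basis" for i using m(2)[OF that] h(3) by linarith
        then show ?thesis
          using x(1) by (auto simp: subset_box mem_box inner_add_left less_imp_le)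
      qed
      have "integral (cbox x (x + h *\<^sub>R One)) f = integral (cbox x (x + h *\<^sub>R One)) g"
        using sub' by (intro Henstock_Kurzweil_Integration.integral_cong) (auto simp: f_def)
      also have "\<dots> = 0"
        using sub' sub by (intro fundamental_lemma_box[OF li op zero]) auto
      finally show False using d(2)[OF h(1,2)] by simp
    qed
    then have "{x \<in> cbox a b. g x \<noteq> 0} \<subseteq> N \<union> (cbox a b - box a b)" by blast
    then show ?thesis
      using N(1) negligible_frontier_interval[of a b] negligible_Un negligible_subset by blast
  qed
  obtain \<D> where D: "countable \<D>" "\<D> \<subseteq> Pow \<Omega>" "\<And>X. X \<in> \<D> \<Longrightarrow> \<exists>a b. X = cbox a b" "\<Union> \<D> = \<Omega>"
    using open_countable_Union_open_cbox[OF op] by blast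
  have "negligible (\<Union> ((\<lambda>X. {x \<in> X. g x \<noteq> 0}) ` \<D>))"
  proof (rule negligible_countable_Union)
    fix S assume "S \<in> (\<lambda>X. {x \<in> X. g x \<noteq> 0}) ` \<D>"
    then obtain X where X: "X \<in> \<D>" "S = {x \<in> X. g x \<noteq> 0}" by blast
    then obtain a b where "X = cbox a b" using D(3) by blast
    then show "negligible S" using X D(2) neg[of a b] by auto
  qed (use D(1) in auto)
  moreover have "\<Union> ((\<lambda>X. {x \<in> X. g x \<noteq> 0}) ` \<D>) = {x \<in> \<Omega>. g x \<noteq> 0}" using D(4) by blast
  ultimately have "{x \<in> \<Omega>. g x \<noteq> 0} \<in> null_sets lebesgue" by (simp add: negligible_iff_null_sets)
  then have "AE x in lebesgue. x \<in> \<Omega> \<longrightarrow> g x = 0"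
    by (rule AE_I') auto
  then show ?thesis using op by (subst AE_restrict_space_iff) auto
qed

lemma has_weak_gradient_unique:
  fixes u :: "'a::euclidean_space \<Rightarrow> real"
  assumes "has_weak_gradient \<Omega> u G" "has_weak_gradient \<Omega> u H" "open \<Omega>"
  shows "AE x in lebesgue_on \<Omega>. G x = H x"
proof -
  have "AE x in lebesgue_on \<Omega>. (G x - H x) \<bullet> b = 0" if b: "b \<in> Basis" for b
  proof (rule fundamental_lemma[OF _ assms(3)])
    have li: "locally_integrable_on (\<lambda>x. G x \<bullet> b) \<Omega>" "locally_integrable_on (\<lambda>x. H x \<bullet> b) \<Omega>"
      using assms by (auto simp: has_weak_gradient_def locally_integrable_on_def)
    then show "locally_integrable_on (\<lambda>x. (G x - H x) \<bullet> b) \<Omega>"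
      by (auto simp: locally_integrable_on_def inner_diff_left)
    fix \<phi> :: "'a \<Rightarrow> real" assume \<phi>: "\<phi> \<in> test_functions \<Omega>"
    have "(LINT x|lebesgue_on \<Omega>. (G x \<bullet> b) * \<phi> x) = (LINT x|lebesgue_on \<Omega>. (H x \<bullet> b) * \<phi> x)"
    proof -
      have "(LINT x|lebesgue_on \<Omega>. u x * frechet_derivative \<phi> (at x) b) = - (LINT x|lebesgue_on \<Omega>. (F x \<bullet> b) * \<phi> x)"
        if "has_weak_gradient \<Omega> u F" for F
        using that \<phi> b unfolding has_weak_gradient_def by blast
      from this[OF assms(1)] this[OF assms(2)] show ?thesis by simp
    qed
    then show "(LINT x|lebesgue_on \<Omega>. ((G x - H x) \<bullet> b) * \<phi> x) = 0"
      using locally_integrable_mult_test[OF li(1) assms(3) \<phi>] locally_integrable_mult_test[OF li(2) assms(3) \<phi>]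
      by (simp add: inner_diff_left left_diff_distrib)
  qed
  then have "AE x in lebesgue_on \<Omega>. \<forall>b\<in>Basis. (G x - H x) \<bullet> b = 0"
    by (subst AE_ball_countable) (auto intro: countable_finite)
  then show ?thesis
    by eventually_elim (metis euclidean_eqI inner_zero_left right_minus_eq)
qed

text \<open>The product of the two test functions is in the class \<open>C1c\<close>, so its
  derivative in direction b has integral zero; the product rule splits it.\<close>

lemma test_integration_by_parts:
  fixes \<phi> \<psi> :: "'a::euclidean_space \<Rightarrow> real"
  assumes "\<phi> \<in> test_functions \<Omega>" "\<psi> \<in> test_functions \<Omega>" "open \<Omega>"
  shows "(LINT x|lebesgue_on \<Omega>. \<phi> x * (grad \<psi> x \<bullet> b)) = - (LINT x|lebesgue_on \<Omega>. (grad \<phi> x \<bullet> b) * \<psi> x)"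
proof -
  obtain K where K: "C1c \<phi> (grad \<phi>) K" "K \<subseteq> \<Omega>" using test_C1c[OF assms(1)] by metis
  have prod: "C1c (\<lambda>x. \<phi> x * \<psi> x) (\<lambda>x. \<phi> x *\<^sub>R grad \<psi> x + \<psi> x *\<^sub>R grad \<phi> x) K"
    unfolding C1c_def
  proof (intro conjI allI impI)
    show "((\<lambda>x. \<phi> x * \<psi> x) has_derivative (\<lambda>h. (\<phi> x *\<^sub>R grad \<psi> x + \<psi> x *\<^sub>R grad \<phi> x) \<bullet> h)) (at x)" for x
      using has_derivative_mult[OF test_has_derivative[OF assms(1)] test_has_derivative[OF assms(2)], of x]
      by (simp add: inner_add_left mult.commute)
    show "continuous_on UNIV (\<lambda>x. \<phi> x *\<^sub>R grad \<psi> x + \<psi> x *\<^sub>R grad \<phi> x)"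
      using assms by (intro continuous_intros test_continuous test_grad_continuous)
  qed (use K in \<open>auto simp: C1c_def\<close>)
  have cont: "continuous_on UNIV (\<lambda>x. \<phi> x * (grad \<psi> x \<bullet> b))" "continuous_on UNIV (\<lambda>x. (grad \<phi> x \<bullet> b) * \<psi> x)"
    using assms by (intro continuous_intros test_continuous test_grad_continuous; fast)+
  have z: "\<phi> x * (grad \<psi> x \<bullet> b) = 0" "(grad \<phi> x \<bullet> b) * \<psi> x = 0" if "x \<notin> K" for x
    using C1c_grad_outside[OF K(1) that] K(1) that by (auto simp: C1c_def)
  have cK: "compact K" using K by (auto simp: C1c_def)
  have int: "integrable lborel F" if F: "continuous_on UNIV F" "\<And>x. x \<notin> K \<Longrightarrow> F x = 0" for F :: "'a \<Rightarrow> real"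
  proof -
    obtain B where B: "\<And>x. norm (F x) \<le> B" using compact_support_bounded[OF F(1) cK F(2)] by metis
    show ?thesis
      using F B cK by (intro compact_support_integrable[of _ K B] borel_measurable_continuous_onI) auto
  qed
  have conv: "integral\<^sup>L (lebesgue_on \<Omega>) F = integral\<^sup>L lborel F"
    if F: "continuous_on UNIV F" "\<And>x. x \<notin> K \<Longrightarrow> F x = 0" for F :: "'a \<Rightarrow> real"
    using F K(2) assms(3) by (intro lebesgue_on_vanishing_outside borel_measurable_continuous_onI) auto
  have "0 = (LINT x|lborel. (\<phi> x *\<^sub>R grad \<psi> x + \<psi> x *\<^sub>R grad \<phi> x) \<bullet> b)"
    using C1c_integral_derivative_zero[OF prod] by simp
  also have "\<dots> = (LINT x|lborel. \<phi> x * (grad \<psi> x \<bullet> b) + (grad \<phi> x \<bullet> b) * \<psi> x)"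
    by (simp add: inner_add_left mult.commute)
  also have "\<dots> = (LINT x|lborel. \<phi> x * (grad \<psi> x \<bullet> b)) + (LINT x|lborel. (grad \<phi> x \<bullet> b) * \<psi> x)"
    using int[OF cont(1) z(1)] int[OF cont(2) z(2)] by (rule Bochner_Integration.integral_add)
  finally show ?thesis using conv[OF cont(1) z(1)] conv[OF cont(2) z(2)] by simp
qed

text \<open>Rests on the completeness of Lebesgue measure. It is needed for
  \<open>weak_grad\<close>, a mere choice that is known to agree almost everywhere with a measurable
  gradient.\<close>

lemma borel_measurable_lebesgue_on_AE:
  fixes f g :: "'a::euclidean_space \<Rightarrow> 'b::euclidean_space"
  assumes "f \<in> borel_measurable (lebesgue_on \<Omega>)" "AE x in lebesgue_on \<Omega>. f x = g x" "\<Omega> \<in> sets lebesgue"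
  shows "g \<in> borel_measurable (lebesgue_on \<Omega>)"
proof -
  have "AE x in lebesgue. x \<in> \<Omega> \<longrightarrow> f x = g x"
    using assms(2,3) by (subst (asm) AE_restrict_space_iff) auto
  then have "AE x in lebesgue. (if x \<in> \<Omega> then f x else 0) = (if x \<in> \<Omega> then g x else 0)"
    by eventually_elim auto
  then have "(\<lambda>x. if x \<in> \<Omega> then g x else 0) \<in> borel_measurable lebesgue"
    using borel_measurable_if_I[OF assms(1,3)] by (rule borel_measurable_AE[rotated])
  then show ?thesis by (rule borel_measurable_if_D)
qed

section \<open>The Hardy inequality\<close>

lemma norm_powr_has_derivative:
  fixes x :: "'b::real_inner"
  assumes "1 < p"
  shows "((\<lambda>x. norm x powr p) has_derivative (\<lambda>h. p * (norm x powr (p - 2) * (x \<bullet> h)))) (at x)"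
proof (cases "x = 0")
  \<comment> \<open>At the origin the claimed derivative is 0, and the quotient to be controlled is
    \<open>norm y powr (p - 1)\<close>, which tends to 0 because p > 1.\<close>
  case True
  have "((\<lambda>y::'b. norm y powr (p - 1)) \<longlongrightarrow> norm (0::'b) powr (p - 1)) (at 0)"
    using assms by (intro tendsto_powr2[OF tendsto_norm[OF tendsto_ident_at] tendsto_const]) auto
  then have "((\<lambda>y::'b. norm y powr (p - 1)) \<longlongrightarrow> 0) (at 0)" using assms by simp
  then have "((\<lambda>y::'b. (norm y powr p) / norm y) \<longlongrightarrow> 0) (at 0)"
    by (rule Lim_transform_eventually) (auto simp: eventually_at_filter powr_diff)
  then have "((\<lambda>y::'b. norm (norm y powr p - 0 - 0) / norm (y - 0)) \<longlongrightarrow> 0) (at 0)" by simp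
  then have "((\<lambda>x::'b. norm x powr p) has_derivative (\<lambda>h. 0)) (at 0)"
    using assms by (simp add: has_derivative_at_within divide_inverse mult.commute)
  then show ?thesis using True by simp
next
  case False
  then have pos: "x \<bullet> x > 0" by simp
  have eq: "norm y powr p = (y \<bullet> y) powr (p / 2)" for y :: 'b
    by (cases "y = 0") (auto simp: powr_powr simp flip: power2_norm_eq_inner powr_numeral)
  have eq2: "(x \<bullet> x) powr (p / 2 - 1) = norm x powr (p - 2)"
    using False by (simp add: powr_powr diff_divide_distrib algebra_simps flip: power2_norm_eq_inner powr_numeral)
  have r: "((\<lambda>t. t powr (p / 2)) has_derivative (\<lambda>t. p / 2 * (x \<bullet> x) powr (p / 2 - 1) * t)) (at (x \<bullet> x))"
    using DERIV_fun_powr[OF DERIV_ident pos, of "p / 2"]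
    unfolding has_field_derivative_def by (rule has_derivative_eq_rhs) auto
  have i: "((\<lambda>y. y \<bullet> y) has_derivative (\<lambda>h. x \<bullet> h + h \<bullet> x)) (at x)"
    by (intro has_derivative_inner has_derivative_ident)
  show ?thesis
    using has_derivative_compose[OF i r] unfolding eq eq2
    by (rule has_derivative_eq_rhs) (auto simp: inner_commute algebra_simps eq2 simp flip: eq)
qed

text \<open>For p = 2 the scalar factor is discontinuous at the origin, since
  \<open>0 powr 0 = 0\<close>, but the product is the identity; hence the case distinction.\<close>

lemma continuous_norm_powr_scaleR:
  assumes "2 \<le> p"
  shows "continuous_on UNIV (\<lambda>x::'b::real_normed_vector. norm x powr (p - 2) *\<^sub>R x)"
proof (cases "p = 2")
  case True
  then have "(\<lambda>x::'b. norm x powr (p - 2) *\<^sub>R x) = (\<lambda>x. x)" by (auto simp: fun_eq_iff)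
  then show ?thesis by (simp only: continuous_on_id)
next
  case False
  then show ?thesis using assms
    by (intro continuous_on_scaleR continuous_on_powr' continuous_on_norm continuous_on_id continuous_on_const) auto
qed

lemma C1c_compose:
  assumes "C1c \<phi> G K" "\<And>s. (\<theta> has_real_derivative \<theta>' s) (at s)" "continuous_on UNIV \<theta>'" "\<theta> 0 = 0"
  shows "C1c (\<lambda>x. \<theta> (\<phi> x)) (\<lambda>x. \<theta>' (\<phi> x) *\<^sub>R G x) K"
  unfolding C1c_def
proof (intro conjI allI impI)
  fix x
  have "(\<phi> has_derivative (\<lambda>h. G x \<bullet> h)) (at x)" using assms by (simp add: C1c_def)
  from has_derivative_compose[OF this assms(2)[unfolded has_field_derivative_def]]
  show "((\<lambda>x. \<theta> (\<phi> x)) has_derivative (\<lambda>h. (\<theta>' (\<phi> x) *\<^sub>R G x) \<bullet> h)) (at x)" by simp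
next
  show "continuous_on UNIV (\<lambda>x. \<theta>' (\<phi> x) *\<^sub>R G x)"
    using assms(1) C1c_continuous[OF assms(1)] assms(3)
    by (intro continuous_on_scaleR continuous_on_compose2[OF assms(3)]) (auto simp: C1c_def)
qed (use assms in \<open>auto simp: C1c_def\<close>)

lemma C1c_mult:
  assumes "C1c \<phi> G K" "\<And>x. (W has_derivative (\<lambda>h. D x \<bullet> h)) (at x)" "continuous_on UNIV D"
  shows "C1c (\<lambda>x. \<phi> x * W x) (\<lambda>x. \<phi> x *\<^sub>R D x + W x *\<^sub>R G x) K"
  unfolding C1c_def
proof (intro conjI allI impI)
  fix x
  have "(\<phi> has_derivative (\<lambda>h. G x \<bullet> h)) (at x)" using assms by (simp add: C1c_def)
  from has_derivative_mult[OF this assms(2)]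
  show "((\<lambda>x. \<phi> x * W x) has_derivative (\<lambda>h. (\<phi> x *\<^sub>R D x + W x *\<^sub>R G x) \<bullet> h)) (at x)"
    by (simp add: inner_add_left mult.commute)
next
  have "continuous_on UNIV W"
    unfolding continuous_on_eq_continuous_within using assms(2) has_derivative_continuous by blast
  then show "continuous_on UNIV (\<lambda>x. \<phi> x *\<^sub>R D x + W x *\<^sub>R G x)"
    using assms(1,3) C1c_continuous[OF assms(1)] by (intro continuous_intros) (auto simp: C1c_def)
qed (use assms in \<open>auto simp: C1c_def\<close>)

lemma C1c_grad_integrable:
  assumes "C1c g G K" shows "integrable lborel G"
proof -
  obtain B where "\<And>x. norm (G x) \<le> B"
    using compact_support_bounded[of G K] assms C1c_grad_outside[OF assms] unfolding C1c_def by metis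
  then show ?thesis using assms C1c_grad_outside[OF assms]
    by (intro compact_support_integrable[of _ K B] C1c_grad_measurable[OF assms]) (auto simp: C1c_def)
qed

lemma C1c_powr_integrable:
  assumes "C1c g G K" "0 < p"
  shows "integrable lborel (\<lambda>x. norm (G x) powr p)" "integrable lborel (\<lambda>x. \<bar>g x\<bar> powr p)"
proof -
  note [measurable] = C1c_measurable[OF assms(1)] C1c_grad_measurable[OF assms(1)]
  obtain B where "\<And>x. norm (G x) \<le> B"
    using compact_support_bounded[of G K] assms C1c_grad_outside[OF assms(1)] unfolding C1c_def by metis
  then show "integrable lborel (\<lambda>x. norm (G x) powr p)" using assms C1c_grad_outside[OF assms(1)]
    by (intro compact_support_integrable[of _ K "B powr p"]) (auto simp: C1c_def intro!: powr_mono2)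
  obtain B where "\<And>x. norm (g x) \<le> B"
    using compact_support_bounded[OF C1c_continuous[OF assms(1)], of K] assms unfolding C1c_def by metis
  then show "integrable lborel (\<lambda>x. \<bar>g x\<bar> powr p)" using assms
    by (intro compact_support_integrable[of _ K "B powr p"]) (auto simp: C1c_def intro!: powr_mono2)
qed

text \<open>Young's inequality for c y and c^(1 - p) z, where c^p = \<kappa>. The product of the two
  arguments is unchanged in the mixed term, so the weight can be tuned freely.\<close>

lemma young_powr_weighted:
  fixes p y z \<kappa> :: real
  assumes "1 < p" "0 \<le> y" "0 \<le> z" "0 < \<kappa>"
  shows "p * (y powr (p - 1) * z) \<le> (p - 1) * \<kappa> * y powr p + \<kappa> powr (1 - p) * z powr p"
proof -
  define c where "c = \<kappa> powr (1 / p)"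
  have c: "c > 0" "c powr p = \<kappa>" using assms by (auto simp: c_def powr_powr)
  have "p * ((c * y) powr (p - 1) * (c powr (1 - p) * z)) \<le> (p - 1) * (c * y) powr p + (c powr (1 - p) * z) powr p"
    using assms c by (intro young_powr) auto
  moreover have "(c * y) powr (p - 1) * (c powr (1 - p) * z) = (c powr (p - 1) * c powr (1 - p)) * (y powr (p - 1) * z)"
    using assms c by (simp add: powr_mult)
  moreover have "c powr (p - 1) * c powr (1 - p) = 1" using c by (simp flip: powr_add)
  moreover have "(c powr (1 - p) * z) powr p = \<kappa> powr (1 - p) * z powr p"
    using c assms by (simp add: powr_mult powr_powr mult.commute flip: c(2))
  moreover have "(c * y) powr p = \<kappa> * y powr p" using c assms by (simp add: powr_mult)
  ultimately show ?thesis by (simp add: mult.assoc)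
qed

text \<open>Integrate the divergence of \<open>|\<phi>|\<^sup>p x / (|x|\<^sup>2 + \<epsilon>)\<^sup>p\<^sup>/\<^sup>2\<close>. Young's inequality with the weight \<open>Hc\<close>, applied
  pointwise, already yields the optimal constant.\<close>

lemma hardy_regularized:
  fixes \<phi> :: "'a::euclidean_space \<Rightarrow> real"
  assumes C: "C1c \<phi> G K" and p: "2 \<le> p" "p < real DIM('a)" and \<epsilon>: "\<epsilon> > 0"
  defines "Hc \<equiv> (real DIM('a) - p) / p"
  shows "integrable lborel (\<lambda>x. \<bar>\<phi> x\<bar> powr p * ((norm x)\<^sup>2 + \<epsilon>) powr (- p / 2))"
    and "Hc powr p * (LINT x|lborel. \<bar>\<phi> x\<bar> powr p * ((norm x)\<^sup>2 + \<epsilon>) powr (- p / 2))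
      \<le> (LINT x|lborel. norm (G x) powr p)"
proof -
  note [measurable] = C1c_measurable[OF C] C1c_grad_measurable[OF C]
  define q where "q x = x \<bullet> x + \<epsilon>" for x :: 'a
  have q: "q x > 0" "x \<bullet> x \<le> q x" for x using \<epsilon> by (auto simp: q_def add_nonneg_pos)
  have qn: "(norm x)\<^sup>2 + \<epsilon> = q x" for x by (simp add: q_def power2_norm_eq_inner)
  have qcont: "continuous_on UNIV q" unfolding q_def[abs_def] by (intro continuous_intros)
  have [measurable]: "q \<in> borel_measurable borel" by (intro borel_measurable_continuous_onI qcont)
  define P where "P x = \<bar>\<phi> x\<bar> powr p" for x
  define DP where "DP x = (p * (\<bar>\<phi> x\<bar> powr (p - 2) * \<phi> x)) *\<^sub>R G x" for x
  have P0: "P x \<ge> 0" for x by (simp add: P_def)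
  have PC: "C1c P DP K"
    unfolding P_def[abs_def] DP_def[abs_def]
  proof (rule C1c_compose[OF C])
    show "((\<lambda>s. \<bar>s\<bar> powr p) has_real_derivative p * (\<bar>s\<bar> powr (p - 2) * s)) (at s)" for s :: real
    proof -
      have "1 < p" using p by simp
      from norm_powr_has_derivative[OF this, of s] show ?thesis
        unfolding has_field_derivative_def real_norm_def by (rule has_derivative_eq_rhs) auto
    qed
    show "continuous_on UNIV (\<lambda>s::real. p * (\<bar>s\<bar> powr (p - 2) * s))"
      using continuous_norm_powr_scaleR[of p, where 'b = real] p
      by (intro continuous_on_mult[OF continuous_on_const]) simp
  qed (use p in auto)
  \<comment> \<open>The component in direction b of the field x / (|x|^2 + \<epsilon>)^(p/2), with
    gradient \<open>DW b\<close>. The divergence is assembled by components because each directional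
    derivative of a \<open>C1c\<close> function integrates to zero.\<close>
  define W where "W b x = (x \<bullet> b) * q x powr (- p / 2)" for b x
  define DW where "DW b x = q x powr (- p / 2) *\<^sub>R b - (p * (x \<bullet> b) * q x powr (- p / 2 - 1)) *\<^sub>R x" for b x
  have Wder: "(W b has_derivative (\<lambda>h. DW b x \<bullet> h)) (at x)" for b x
  proof -
    have "(q has_derivative (\<lambda>h. x \<bullet> h + h \<bullet> x + 0)) (at x)"
      unfolding q_def[abs_def] by (intro has_derivative_add has_derivative_inner has_derivative_ident has_derivative_const)
    moreover have "((\<lambda>t. t powr (- p / 2)) has_derivative (\<lambda>t. (- p / 2) * (q x) powr (- p / 2 - 1) * t)) (at (q x))"
      using DERIV_fun_powr[OF DERIV_ident q(1)[of x], of "- p / 2"]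
      unfolding has_field_derivative_def by (rule has_derivative_eq_rhs) auto
    ultimately have "((\<lambda>x. q x powr (- p / 2)) has_derivative
        (\<lambda>h. (- p / 2) * (q x) powr (- p / 2 - 1) * (x \<bullet> h + h \<bullet> x + 0))) (at x)"
      by (rule has_derivative_compose)
    moreover have "((\<lambda>x. x \<bullet> b) has_derivative (\<lambda>h. h \<bullet> b)) (at x)"
      by (intro derivative_eq_intros) auto
    ultimately have "((\<lambda>x. (x \<bullet> b) * q x powr (- p / 2)) has_derivative
        (\<lambda>h. (x \<bullet> b) * ((- p / 2) * (q x) powr (- p / 2 - 1) * (x \<bullet> h + h \<bullet> x + 0)) + (h \<bullet> b) * q x powr (- p / 2))) (at x)"
      by (intro has_derivative_mult)
    then show ?thesis unfolding W_def[abs_def]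
      by (rule has_derivative_eq_rhs)
        (auto simp: DW_def fun_eq_iff inner_diff_left inner_commute algebra_simps)
  qed
  have DWcont: "continuous_on UNIV (DW b)" for b
    unfolding DW_def[abs_def]
    by (intro continuous_intros continuous_on_powr qcont) (use q(1) in \<open>auto simp: less_imp_neq[symmetric]\<close>)
  define Div where "Div x = (\<Sum>b\<in>Basis. (P x *\<^sub>R DW b x + W b x *\<^sub>R DP x) \<bullet> b)" for x
  have FC: "C1c (\<lambda>x. P x * W b x) (\<lambda>x. P x *\<^sub>R DW b x + W b x *\<^sub>R DP x) K" for b
    by (rule C1c_mult[OF PC Wder DWcont])
  have Fint: "integrable lborel (\<lambda>x. (P x *\<^sub>R DW b x + W b x *\<^sub>R DP x) \<bullet> b)" for b
    using C1c_grad_integrable[OF FC[of b]] by (rule integrable_inner_left)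
  have Divint: "integrable lborel Div" unfolding Div_def[abs_def] using Fint by auto
  have Div0: "(LINT x|lborel. Div x) = 0"
    unfolding Div_def using Fint C1c_integral_derivative_zero[OF FC]
    by (subst Bochner_Integration.integral_sum) auto
  have Diveq: "Div x = P x * (real DIM('a) * q x powr (- p / 2) - p * (x \<bullet> x) * q x powr (- p / 2 - 1))
      + q x powr (- p / 2) * (x \<bullet> DP x)" for x
  proof -
    have xx: "(\<Sum>b\<in>Basis. (x \<bullet> b) * (x \<bullet> b)) = x \<bullet> x"
      by (rule euclidean_inner[symmetric])
    have xD: "(\<Sum>b\<in>Basis. (x \<bullet> b) * (DP x \<bullet> b)) = x \<bullet> DP x"
      by (rule euclidean_inner[symmetric])
    have "Div x = (\<Sum>b\<in>Basis. P x * q x powr (- p / 2) - (P x * p * q x powr (- p / 2 - 1)) * ((x \<bullet> b) * (x \<bullet> b))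
        + q x powr (- p / 2) * ((x \<bullet> b) * (DP x \<bullet> b)))"
      unfolding Div_def
      by (intro sum.cong refl) (auto simp: DW_def W_def inner_add_left inner_diff_left algebra_simps)
    also have "\<dots> = real DIM('a) * (P x * q x powr (- p / 2)) - (P x * p * q x powr (- p / 2 - 1)) * (x \<bullet> x)
        + q x powr (- p / 2) * (x \<bullet> DP x)"
      by (simp only: sum.distrib sum_subtractf sum_distrib_left[symmetric] xx xD) simp
    finally show ?thesis by (simp add: algebra_simps)
  qed
  have H: "Hc > 0" using p by (simp add: Hc_def)
  define Y where "Y x = P x * q x powr (- p / 2)" for x
  \<comment> \<open>The divergence of the field alone contributes at least (N - p) Y = p Hc Y,
    because |x|^2 \<le> q. Young's inequality with weight Hc spends (p - 1) Hc Y on the term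
    containing the gradient, so one share Hc Y is left.\<close>
  have lower: "Hc * Y x - Hc powr (1 - p) * norm (G x) powr p \<le> Div x" for x
  proof -
    define y where "y = \<bar>\<phi> x\<bar> * q x powr (- 1 / 2)"
    have y: "y \<ge> 0" "y powr p = Y x"
      using q[of x] by (auto simp: y_def Y_def P_def powr_mult powr_powr)
    have "q x powr (- p / 2 - 1) * (x \<bullet> x) \<le> q x powr (- p / 2 - 1) * q x"
      using q[of x] by (intro mult_left_mono) auto
    also have "\<dots> = q x powr (- p / 2)" using q(1)[of x] by (simp add: powr_diff)
    finally have "p * (q x powr (- p / 2 - 1) * (x \<bullet> x)) \<le> p * q x powr (- p / 2)"
      using p by (intro mult_left_mono) auto
    then have "P x * ((real DIM('a) - p) * q x powr (- p / 2))
        \<le> P x * (real DIM('a) * q x powr (- p / 2) - p * (x \<bullet> x) * q x powr (- p / 2 - 1))"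
      using P0[of x] by (intro mult_left_mono) (auto simp: algebra_simps)
    then have 1: "(real DIM('a) - p) * Y x \<le> P x * (real DIM('a) * q x powr (- p / 2) - p * (x \<bullet> x) * q x powr (- p / 2 - 1))"
      by (simp add: Y_def algebra_simps)
    have nx: "norm x \<le> q x powr (1 / 2)"
    proof -
      have "norm x = (x \<bullet> x) powr (1 / 2)" by (simp add: norm_eq_sqrt_inner powr_half_sqrt)
      also have "\<dots> \<le> q x powr (1 / 2)" using q[of x] by (intro powr_mono2) auto
      finally show ?thesis .
    qed
    have "\<bar>q x powr (- p / 2) * (x \<bullet> DP x)\<bar> \<le> q x powr (- p / 2) * (norm x * norm (DP x))"
      by (simp add: abs_mult Cauchy_Schwarz_ineq2 mult_left_mono)
    also have "norm (DP x) = p * (\<bar>\<phi> x\<bar> powr (p - 1) * norm (G x))"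
      using p by (cases "\<phi> x = 0") (auto simp: DP_def abs_mult powr_diff power2_eq_square)
    also have "q x powr (- p / 2) * (norm x * (p * (\<bar>\<phi> x\<bar> powr (p - 1) * norm (G x))))
        \<le> q x powr (- p / 2) * (q x powr (1 / 2) * (p * (\<bar>\<phi> x\<bar> powr (p - 1) * norm (G x))))"
      using nx p by (intro mult_left_mono mult_right_mono) auto
    also have "\<dots> = p * ((q x powr (- p / 2) * q x powr (1 / 2)) * \<bar>\<phi> x\<bar> powr (p - 1) * norm (G x))"
      by (simp add: algebra_simps)
    also have "q x powr (- p / 2) * q x powr (1 / 2) = (q x powr (- 1 / 2)) powr (p - 1)"
    proof -
      have e: "- p / 2 + 1 / 2 = - 1 / 2 * (p - 1)" by (simp add: field_simps)
      show ?thesis by (simp only: powr_powr powr_add[symmetric] e)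
    qed
    also have "(q x powr (- 1 / 2)) powr (p - 1) * \<bar>\<phi> x\<bar> powr (p - 1) = y powr (p - 1)"
      using q(1)[of x] by (simp add: y_def powr_mult mult.commute)
    also have "p * (y powr (p - 1) * norm (G x)) \<le> (p - 1) * Hc * y powr p + Hc powr (1 - p) * norm (G x) powr p"
      using p y H by (intro young_powr_weighted) auto
    finally have "\<bar>q x powr (- p / 2) * (x \<bullet> DP x)\<bar> \<le> (p - 1) * Hc * Y x + Hc powr (1 - p) * norm (G x) powr p"
      unfolding y(2) .
    then have 2: "- ((p - 1) * Hc * Y x + Hc powr (1 - p) * norm (G x) powr p) \<le> q x powr (- p / 2) * (x \<bullet> DP x)"
      by linarith
    have "(real DIM('a) - p) = p * Hc" using p by (simp add: Hc_def)
    then show ?thesis unfolding Diveq using 1 2 by (simp add: algebra_simps)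
  qed
  have [measurable]: "P \<in> borel_measurable borel" using C1c_measurable[OF PC] .
  obtain B where B: "\<And>x. norm (P x) \<le> B"
    using compact_support_bounded[OF C1c_continuous[OF PC], of K] PC unfolding C1c_def by metis
  have Yint: "integrable lborel Y"
  proof (rule compact_support_integrable[of _ K "B * \<epsilon> powr (- p / 2)"])
    show "norm (Y x) \<le> B * \<epsilon> powr (- p / 2)" for x
    proof -
      have "\<epsilon> \<le> q x" by (simp add: q_def)
      then have "q x powr (- p / 2) \<le> \<epsilon> powr (- p / 2)"
        using \<epsilon> p by (intro powr_mono2') auto
      moreover have "\<bar>P x\<bar> \<le> B" using B[of x] by simp
      ultimately show ?thesis
        unfolding Y_def using P0[of x] by (simp add: abs_mult) (intro mult_mono, auto)
    qed
  qed (use PC in \<open>auto simp: Y_def[abs_def] C1c_def\<close>)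
  show "integrable lborel (\<lambda>x. \<bar>\<phi> x\<bar> powr p * ((norm x)\<^sup>2 + \<epsilon>) powr (- p / 2))"
    using Yint by (simp add: Y_def[abs_def] P_def qn)
  have Gint: "integrable lborel (\<lambda>x. norm (G x) powr p)"
    using C1c_powr_integrable[OF C] p by auto
  have "(LINT x|lborel. Hc * Y x - Hc powr (1 - p) * norm (G x) powr p) \<le> (LINT x|lborel. Div x)"
    using Yint Gint Divint lower by (intro integral_mono) auto
  then have "Hc * (LINT x|lborel. Y x) \<le> Hc powr (1 - p) * (LINT x|lborel. norm (G x) powr p)"
    using Div0 Yint Gint by simp
  then have "Hc powr (p - 1) * (Hc * (LINT x|lborel. Y x)) \<le> Hc powr (p - 1) * (Hc powr (1 - p) * (LINT x|lborel. norm (G x) powr p))"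
    by (intro mult_left_mono) auto
  moreover have "Hc powr (p - 1) * Hc = Hc powr p" using H by (simp add: powr_diff)
  moreover have "Hc powr (p - 1) * Hc powr (1 - p) = 1" using H by (simp flip: powr_add)
  ultimately have "Hc powr p * (LINT x|lborel. Y x) \<le> (LINT x|lborel. norm (G x) powr p)"
    by (metis mult.assoc mult_1)
  then show "Hc powr p * (LINT x|lborel. \<bar>\<phi> x\<bar> powr p * ((norm x)\<^sup>2 + \<epsilon>) powr (- p / 2))
      \<le> (LINT x|lborel. norm (G x) powr p)"
    by (simp add: Y_def P_def qn)
qed

text \<open>The regularized inequality has a constant independent of \<epsilon>, so Fatou's lemma
  along \<epsilon> = 1 / (n + 1) applies. The pointwise limit is taken away from the origin, a null
  set.\<close>

lemma hardy_C1c: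
  fixes \<phi> :: "'a::euclidean_space \<Rightarrow> real"
  assumes C: "C1c \<phi> G K" and p: "2 \<le> p" "p < real DIM('a)"
  defines "Hc \<equiv> (real DIM('a) - p) / p"
  shows "integrable lborel (\<lambda>x. \<bar>\<phi> x\<bar> powr p / norm x powr p)"
    and "Hc powr p * (LINT x|lborel. \<bar>\<phi> x\<bar> powr p / norm x powr p) \<le> (LINT x|lborel. norm (G x) powr p)"
proof -
  note [measurable] = C1c_measurable[OF C]
  have H: "Hc powr p > 0" using p by (simp add: Hc_def)
  let ?f = "\<lambda>n x. \<bar>\<phi> x\<bar> powr p * ((norm x)\<^sup>2 + 1 / real (Suc n)) powr (- p / 2)"
  have int: "integrable lborel (?f n)" for n
    by (rule hardy_regularized[OF C p]) auto
  have bd: "(LINT x|lborel. ?f n x) \<le> (LINT x|lborel. norm (G x) powr p) / Hc powr p" for n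
    using hardy_regularized(2)[OF C p, of "1 / real (Suc n)"] H
    by (simp add: Hc_def pos_le_divide_eq mult.commute)
  have lim: "AE x in lborel. (\<lambda>n. ?f n x) \<longlonglongrightarrow> \<bar>\<phi> x\<bar> powr p / norm x powr p"
  proof -
    have "AE x in lborel. x \<noteq> (0::'a)" by (rule AE_lborel_singleton)
    then show ?thesis
    proof eventually_elim
      case (elim x)
      have "(\<lambda>n. \<bar>\<phi> x\<bar> powr p * ((norm x)\<^sup>2 + 1 / real (Suc n)) powr (- p / 2)) \<longlonglongrightarrow>
          \<bar>\<phi> x\<bar> powr p * ((norm x)\<^sup>2 + 0) powr (- p / 2)"
        using elim by (intro tendsto_mult tendsto_const tendsto_powr tendsto_add LIMSEQ_Suc[OF lim_1_over_n]) auto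
      also have "((norm x)\<^sup>2 + 0) powr (- p / 2) = 1 / norm x powr p"
        using elim by (simp add: powr_powr powr_minus_divide flip: powr_numeral)
      finally show ?case by simp
    qed
  qed
  have m: "(\<lambda>x. \<bar>\<phi> x\<bar> powr p / norm x powr p) \<in> borel_measurable lborel" by measurable
  show "integrable lborel (\<lambda>x. \<bar>\<phi> x\<bar> powr p / norm x powr p)"
    by (rule fatou_bounded(1)[OF int _ m lim bd tendsto_const]) auto
  have "(LINT x|lborel. \<bar>\<phi> x\<bar> powr p / norm x powr p) \<le> (LINT x|lborel. norm (G x) powr p) / Hc powr p"
    by (rule fatou_bounded(2)[OF int _ m lim bd tendsto_const]) auto
  then show "Hc powr p * (LINT x|lborel. \<bar>\<phi> x\<bar> powr p / norm x powr p) \<le> (LINT x|lborel. norm (G x) powr p)"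
    using H by (simp add: pos_le_divide_eq mult.commute)
qed

section \<open>The Sobolev inequality\<close>

text \<open>The derivative \<open>smoothstep'\<close> is the hat function on \<open>[1, 2]\<close> of height 2, which has integral 1.\<close>

definition smoothstep :: "real \<Rightarrow> real" where
  "smoothstep t = 2 * ((max 0 (t - 1))\<^sup>2 - 2 * (max 0 (t - 3/2))\<^sup>2 + (max 0 (t - 2))\<^sup>2)"

definition smoothstep' :: "real \<Rightarrow> real" where
  "smoothstep' t = 4 * (max 0 (t - 1) - 2 * max 0 (t - 3/2) + max 0 (t - 2))"

text \<open>The building block of the C^1 cutoffs: both \<open>smoothstep\<close> and the ramps that
  approximate a positive part are combinations of such squares.\<close>

lemma max0_square_has_derivative:
  "((\<lambda>t::real. (max 0 (t - c))\<^sup>2) has_real_derivative 2 * max 0 (s - c)) (at s)"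
proof -
  have d: "((\<lambda>t::real. (t - c)\<^sup>2) has_real_derivative 2 * (s - c)) (at s)" for s
    by (auto intro!: derivative_eq_intros)
  consider "s < c" | "s = c" | "s > c" by linarith
  then show ?thesis
  proof cases
    case 1
    have "((\<lambda>_. 0) has_real_derivative 0) (at s)" by simp
    then have "((\<lambda>t. (max 0 (t - c))\<^sup>2) has_real_derivative 0) (at s)"
      by (rule has_field_derivative_transform_within_open[where S = "{..<c}"]) (use 1 in auto)
    then show ?thesis using 1 by simp
  next
    case 2
    have "((\<lambda>h. (max 0 (c + h - c))\<^sup>2 / h) \<longlongrightarrow> 0) (at 0)"
    proof (rule Lim_null_comparison)
      show "\<forall>\<^sub>F h in at 0. norm ((max 0 (c + h - c))\<^sup>2 / h) \<le> \<bar>h\<bar>"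
        by (auto simp: eventually_at_filter max_def power2_eq_square)
      show "((\<lambda>h::real. \<bar>h\<bar>) \<longlongrightarrow> 0) (at 0)"
        by (rule tendsto_rabs_zero[OF tendsto_ident_at])
    qed
    then show ?thesis using 2 by (simp add: DERIV_def)
  next
    case 3
    then have "((\<lambda>t. (max 0 (t - c))\<^sup>2) has_real_derivative 2 * (s - c)) (at s)"
      by (intro has_field_derivative_transform_within_open[OF d, where S = "{c<..}"]) auto
    then show ?thesis using 3 by simp
  qed
qed

lemma smoothstep_has_derivative: "(smoothstep has_real_derivative smoothstep' s) (at s)"
proof -
  have "((\<lambda>t. 2 * ((max 0 (t - 1))\<^sup>2 - 2 * (max 0 (t - 3/2))\<^sup>2 + (max 0 (t - 2))\<^sup>2)) has_real_derivative
     2 * (2 * max 0 (s - 1) - 2 * (2 * max 0 (s - 3/2)) + 2 * max 0 (s - 2))) (at s)"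
    by (intro DERIV_cmult DERIV_add DERIV_diff max0_square_has_derivative)
  then show ?thesis by (simp add: smoothstep_def[abs_def] smoothstep'_def algebra_simps)
qed

lemma smoothstep_low: "t \<le> 1 \<Longrightarrow> smoothstep t = 0" "t \<le> 1 \<Longrightarrow> smoothstep' t = 0"
  by (auto simp: smoothstep_def smoothstep'_def)

lemma smoothstep_high: "t \<ge> 2 \<Longrightarrow> smoothstep t = 1" "t \<ge> 2 \<Longrightarrow> smoothstep' t = 0"
  by (auto simp: smoothstep_def smoothstep'_def max_def power2_eq_square algebra_simps)

lemma smoothstep'_bound: "\<bar>smoothstep' t\<bar> \<le> 2"
  by (auto simp: smoothstep'_def max_def abs_if)

lemma smoothstep'_continuous: "continuous_on UNIV smoothstep'"
  unfolding smoothstep'_def[abs_def] by (intro continuous_intros)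

lemma nn_integral_lborel_translate:
  assumes [measurable]: "f \<in> borel_measurable borel"
  shows "(\<integral>\<^sup>+h. f (x + h) \<partial>lborel) = (\<integral>\<^sup>+h. f (h::'a::euclidean_space) \<partial>lborel)"
proof -
  have "(\<integral>\<^sup>+h. f h \<partial>lborel) = (\<integral>\<^sup>+h. f h \<partial>(distr lborel borel ((+) x)))"
    by (simp add: lborel_distr_plus)
  also have "\<dots> = (\<integral>\<^sup>+h. f (x + h) \<partial>lborel)"
    by (rule nn_integral_distr) auto
  finally show ?thesis by simp
qed

text \<open>The ball of radius \<open>r\<close> is chosen with twice the volume of \<open>A\<close>: for every \<open>x \<in> A'\<close> at least half of
  the shifts \<open>h\<close> in the ball lead out of \<open>A\<close>, where \<open>\<psi>\<close> drops from 1 to 0.\<close>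

lemma level_set_estimate:
  fixes \<psi> :: "'a::euclidean_space \<Rightarrow> real"
  assumes C: "C1c \<psi> G K" and p: "1 < p"
    and A: "A \<in> sets borel" "A' \<in> sets borel" "emeasure lborel A = ennreal m" "m > 0"
    and A': "emeasure lborel A' = ennreal m'" "m' \<ge> 0"
    and psi: "\<And>x. x \<notin> A \<Longrightarrow> \<psi> x = 0" "\<And>x. x \<in> A' \<Longrightarrow> \<psi> x = 1"
  shows "m' \<le> 2 * (2 * m / unit_ball_vol (real DIM('a))) powr (p / real DIM('a)) * (LINT x|lborel. norm (G x) powr p)"
proof -
  note [measurable] = C1c_measurable[OF C] A(1,2)
  define \<omega> where "\<omega> = unit_ball_vol (real DIM('a))"
  have \<omega>: "\<omega> > 0" by (simp add: \<omega>_def)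
  define r where "r = (2 * m / \<omega>) powr (1 / real DIM('a))"
  have r: "r > 0" using A(4) \<omega> by (simp add: r_def)
  have "r ^ DIM('a) = r powr real DIM('a)" using r by (simp add: powr_realpow)
  also have "\<dots> = 2 * m / \<omega>" using A(4) \<omega> by (simp add: r_def powr_powr)
  finally have rN: "\<omega> * r ^ DIM('a) = 2 * m" using \<omega> by simp
  have rp: "r powr p = (2 * m / \<omega>) powr (p / real DIM('a))" by (simp add: r_def powr_powr)
  define B where "B = ball (0::'a) r"
  have [measurable]: "B \<in> sets borel" by (simp add: B_def)
  have eB: "emeasure lborel B = ennreal (2 * m)"
    using emeasure_ball[of r "0::'a"] r rN by (simp add: B_def \<omega>_def)
  define D where "D = (LINT x|lborel. norm (G x) powr p)"
  have D0: "D \<ge> 0" by (simp add: D_def)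
  \<comment> \<open>Double counting of the pairs (h, x) with x in A', h in the ball and x + h
    outside A. Integrating over h first gives at least m' m, integrating over x first at most 2 m
    r^p times the energy.\<close>
  define T :: "'a \<Rightarrow> 'a \<Rightarrow> ennreal" where
    "T h x = indicator B h * (indicator A' x * indicator (- A) (x + h))" for h x
  have [measurable]: "- A \<in> sets borel" using A(1) by auto
  have Tm: "case_prod T \<in> borel_measurable (lborel \<Otimes>\<^sub>M lborel)"
    unfolding T_def[abs_def] by measurable
  have up: "(\<integral>\<^sup>+x. T h x \<partial>lborel) \<le> indicator B h * ennreal (r powr p * D)" for h
  proof (cases "h \<in> B")
    case True
    have nh: "norm h \<le> r" using True by (simp add: B_def)
    have "(\<integral>\<^sup>+x. T h x \<partial>lborel) \<le> (\<integral>\<^sup>+x. ennreal (\<bar>\<psi> (x + h) - \<psi> x\<bar> powr p) \<partial>lborel)"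
      by (rule nn_integral_mono) (auto simp: T_def indicator_def psi)
    also have "\<dots> = ennreal (LINT x|lborel. \<bar>\<psi> (x + h) - \<psi> x\<bar> powr p)"
      by (rule nn_integral_eq_integral[OF C1c_translation_estimate(1)[OF C p]]) auto
    also have "\<dots> \<le> ennreal (norm h powr p * D)"
      unfolding D_def by (rule ennreal_leI[OF C1c_translation_estimate(3)[OF C p]])
    also have "\<dots> \<le> ennreal (r powr p * D)"
      using nh p D0 by (intro ennreal_leI mult_right_mono powr_mono2) auto
    finally show ?thesis using True by simp
  qed (simp add: T_def)
  have low: "indicator A' x * ennreal m \<le> (\<integral>\<^sup>+h. T h x \<partial>lborel)" for x
  proof (cases "x \<in> A'")
    case True
    have "ennreal (2 * m) = (\<integral>\<^sup>+h. indicator B h \<partial>lborel)" by (simp add: eB)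
    also have "\<dots> \<le> (\<integral>\<^sup>+h. T h x + indicator A (x + h) \<partial>lborel)"
      using True by (intro nn_integral_mono) (auto simp: T_def indicator_def)
    also have "\<dots> = (\<integral>\<^sup>+h. T h x \<partial>lborel) + (\<integral>\<^sup>+h. indicator A (x + h) \<partial>lborel)"
      by (rule nn_integral_add) (auto simp: T_def)
    also have "(\<integral>\<^sup>+h. indicator A (x + h) \<partial>lborel) = ennreal m"
      by (subst nn_integral_lborel_translate) (auto simp: A(3))
    finally have "ennreal (2 * m) - ennreal m \<le> (\<integral>\<^sup>+h. T h x \<partial>lborel)"
      by (simp add: ennreal_minus_le_iff add.commute)
    also have "ennreal (2 * m) - ennreal m = ennreal m"
      using A(4) by (subst ennreal_minus) auto
    finally show ?thesis using True by simp
  qed simp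
  have "ennreal (m' * m) = (\<integral>\<^sup>+x. indicator A' x * ennreal m \<partial>lborel)"
    using A' A(4) by (simp add: nn_integral_multc ennreal_mult)
  also have "\<dots> \<le> (\<integral>\<^sup>+x. (\<integral>\<^sup>+h. T h x \<partial>lborel) \<partial>lborel)"
    by (intro nn_integral_mono low)
  also have "\<dots> = (\<integral>\<^sup>+h. (\<integral>\<^sup>+x. T h x \<partial>lborel) \<partial>lborel)"
    by (rule lborel_pair.Fubini'[OF Tm])
  also have "\<dots> \<le> (\<integral>\<^sup>+h. indicator B h * ennreal (r powr p * D) \<partial>lborel)"
    by (intro nn_integral_mono up)
  also have "\<dots> = ennreal (2 * m * (r powr p * D))"
    using A(4) D0 by (simp add: nn_integral_multc eB ennreal_mult)
  finally have "m' * m \<le> 2 * m * (r powr p * D)"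
    using A(4) D0 by (subst (asm) ennreal_le_iff) auto
  then have "m * m' \<le> m * (2 * r powr p * D)" by (simp add: algebra_simps)
  then have "m' \<le> 2 * r powr p * D" using A(4) by (simp only: mult_le_cancel_left_pos)
  then show ?thesis by (simp add: rp D_def \<omega>_def)
qed

text \<open>The level set estimate for \<open>smoothstep (\<phi> x / s)\<close>, which is 0 up to
  level s and 1 from level 2 s on. Its gradient lives between the two levels, so only the energy of
  that slab appears; for dyadic s the slabs are disjoint.\<close>

lemma sobolev_step:
  fixes \<phi> :: "'a::euclidean_space \<Rightarrow> real"
  assumes C: "C1c \<phi> G K" and p: "1 < p" and s: "s > 0"
  shows "measure lborel {x. \<phi> x \<ge> 2 * s} * s powr p
    \<le> 2 * 2 powr p * (2 / unit_ball_vol (real DIM('a))) powr (p / real DIM('a)) *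
      measure lborel {x. \<phi> x \<ge> s} powr (p / real DIM('a)) *
      (LINT x|lborel. indicator {x. s \<le> \<phi> x \<and> \<phi> x < 2 * s} x * norm (G x) powr p)"
proof -
  note [measurable] = C1c_measurable[OF C] C1c_grad_measurable[OF C]
  define A where "A = {x. \<phi> x \<ge> s}"
  define A' where "A' = {x. \<phi> x \<ge> 2 * s}"
  define R where "R = {x. s \<le> \<phi> x \<and> \<phi> x < 2 * s}"
  define m where "m = measure lborel A"
  define m' where "m' = measure lborel A'"
  have [measurable]: "A \<in> sets borel" "A' \<in> sets borel" "R \<in> sets borel"
    unfolding A_def A'_def R_def by measurable
  have sub: "A' \<subseteq> A" "A \<subseteq> K"
  proof -
    show "A' \<subseteq> A" using s by (auto simp: A_def A'_def)
    show "A \<subseteq> K"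
    proof
      fix x assume "x \<in> A"
      then have "\<phi> x \<noteq> 0" using s by (auto simp: A_def)
      then show "x \<in> K" using C by (auto simp: C1c_def)
    qed
  qed
  have fin: "emeasure lborel K < \<infinity>" "K \<in> sets borel"
    using C by (auto simp: C1c_def emeasure_compact_finite[simplified] borel_compact)
  have eA: "emeasure lborel A = ennreal m"
    unfolding m_def using sub fin
    by (intro emeasure_eq_ennreal_measure) (metis emeasure_mono infinity_ennreal_def leD sets_lborel)
  have eA': "emeasure lborel A' = ennreal m'"
    unfolding m'_def using sub fin
    by (intro emeasure_eq_ennreal_measure) (metis emeasure_mono infinity_ennreal_def leD sets_lborel subset_trans)
  have nn: "m \<ge> 0" "m' \<ge> 0" by (auto simp: m_def m'_def)
  define w where "w = (LINT x|lborel. indicator R x * norm (G x) powr p)"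
  have w0: "w \<ge> 0" unfolding w_def by (intro integral_nonneg_AE AE_I2) auto
  define \<omega> where "\<omega> = unit_ball_vol (real DIM('a))"
  have \<omega>: "\<omega> > 0" by (simp add: \<omega>_def)
  have "m' * s powr p \<le> 2 * 2 powr p * (2 / \<omega>) powr (p / real DIM('a)) * m powr (p / real DIM('a)) * w"
  proof (cases "m = 0")
    case True
    have "emeasure lborel A' \<le> emeasure lborel A" using sub by (intro emeasure_mono) auto
    then have "m' = 0" using True eA eA' nn by simp
    then show ?thesis using w0 by simp
  next
    case False
    then have m: "m > 0" using nn by simp
    define D where "D x = (smoothstep' (\<phi> x / s) / s) *\<^sub>R G x" for x
    have CC: "C1c (\<lambda>x. smoothstep (\<phi> x / s)) D K"
      unfolding D_def[abs_def]
    proof (rule C1c_compose[OF C, where \<theta> = "\<lambda>t. smoothstep (t / s)"])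
      show "((\<lambda>t. smoothstep (t / s)) has_real_derivative smoothstep' (t / s) / s) (at t)" for t
      proof -
        have "((\<lambda>t. t / s) has_real_derivative 1 / s) (at t)"
          using s by (auto intro!: derivative_eq_intros)
        from DERIV_chain2[OF smoothstep_has_derivative this] show ?thesis by simp
      qed
      show "continuous_on UNIV (\<lambda>t. smoothstep' (t / s) / s)"
        using s by (intro continuous_intros continuous_on_compose2[OF smoothstep'_continuous]) auto
    qed (simp add: smoothstep_low)
    have Rint: "integrable lborel (\<lambda>x. indicator R x * norm (G x) powr p)"
    proof (rule Bochner_Integration.integrable_bound)
      show "integrable lborel (\<lambda>x. norm (G x) powr p)" using C1c_powr_integrable[OF C] p by auto
    qed (auto simp: indicator_def)
    have "m' \<le> 2 * (2 * m / \<omega>) powr (p / real DIM('a)) * (LINT x|lborel. norm (D x) powr p)"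
      unfolding \<omega>_def
    proof (rule level_set_estimate[OF CC p _ _ eA m eA' nn(2)])
      show "smoothstep (\<phi> x / s) = 0" if "x \<notin> A" for x
        using that s by (intro smoothstep_low) (auto simp: A_def)
      show "smoothstep (\<phi> x / s) = 1" if "x \<in> A'" for x
        using that s by (intro smoothstep_high) (auto simp: A'_def field_simps)
    qed auto
    also have "(LINT x|lborel. norm (D x) powr p) \<le> (LINT x|lborel. (2 / s) powr p * (indicator R x * norm (G x) powr p))"
    proof (rule integral_mono)
      show "integrable lborel (\<lambda>x. norm (D x) powr p)" using C1c_powr_integrable[OF CC] p by auto
      show "integrable lborel (\<lambda>x. (2 / s) powr p * (indicator R x * norm (G x) powr p))" using Rint by simp
      fix x
      show "norm (D x) powr p \<le> (2 / s) powr p * (indicator R x * norm (G x) powr p)"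
      proof (cases "x \<in> R")
        case True
        have "norm (D x) powr p \<le> (2 / s * norm (G x)) powr p"
          unfolding D_def using smoothstep'_bound[of "\<phi> x / s"] s p
          by (intro powr_mono2) (auto intro!: mult_right_mono divide_right_mono)
        also have "(2 / s * norm (G x)) powr p = (2 / s) powr p * norm (G x) powr p"
          by (rule powr_mult)
        finally show ?thesis using True by simp
      next
        case False
        then have "smoothstep' (\<phi> x / s) = 0"
          using s smoothstep_low(2)[of "\<phi> x / s"] smoothstep_high(2)[of "\<phi> x / s"]
          by (auto simp: R_def field_simps)
        then show ?thesis using p by (simp add: D_def)
      qed
    qed
    also have "\<dots> = (2 / s) powr p * w" using Rint by (simp add: w_def)
    finally have "m' \<le> 2 * (2 * m / \<omega>) powr (p / real DIM('a)) * ((2 / s) powr p * w)"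
      by (simp add: mult_left_mono)
    then have "m' * s powr p \<le> (2 * (2 * m / \<omega>) powr (p / real DIM('a)) * ((2 / s) powr p * w)) * s powr p"
      by (intro mult_right_mono) auto
    also have "\<dots> = 2 * (2 * m / \<omega>) powr (p / real DIM('a)) * ((2 / s) powr p * s powr p) * w"
      by (simp add: algebra_simps)
    also have "(2 / s) powr p * s powr p = 2 powr p" using s by (simp add: powr_divide)
    also have "(2 * m / \<omega>) powr (p / real DIM('a)) = (2 / \<omega>) powr (p / real DIM('a)) * m powr (p / real DIM('a))"
      using m \<omega> by (simp flip: powr_mult)
    finally show ?thesis by (simp add: algebra_simps)
  qed
  then show ?thesis by (simp add: m_def m'_def A_def A'_def R_def w_def \<omega>_def)
qed

text \<open>Bounding \<open>a k powr \<alpha>\<close> by \<open>S powr \<alpha>\<close> with the total sum \<open>S\<close> makes the recursion sublinear in \<open>S\<close>.\<close>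

lemma sublinear_recursion_bound:
  fixes a w :: "nat \<Rightarrow> real"
  assumes a0: "\<And>k. 0 \<le> a k" and w0: "\<And>k. 0 \<le> w k" and w1: "\<And>n. (\<Sum>k<n. w k) \<le> 1"
    and step: "\<And>k. a (Suc k) \<le> c * a k powr \<alpha> * w k" and \<alpha>: "0 < \<alpha>" "\<alpha> < 1" and c: "0 \<le> c"
  shows "(\<Sum>k<n. a k) \<le> max (2 * a 0) ((2 * c) powr (1 / (1 - \<alpha>)))"
proof -
  \<comment> \<open>One term more than in the claim: after splitting off \<open>a 0\<close>, the n
    shifted terms are exactly those that the recursion bounds.\<close>
  define S where "S = (\<Sum>k<Suc n. a k)"
  have S0: "S \<ge> 0" unfolding S_def by (intro sum_nonneg a0)
  have aS: "a k \<le> S" if "k < n" for k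
    unfolding S_def using that a0 by (intro member_le_sum) auto
  have "S = a 0 + (\<Sum>k<n. a (Suc k))" unfolding S_def by (rule sum.lessThan_Suc_shift)
  also have "(\<Sum>k<n. a (Suc k)) \<le> (\<Sum>k<n. c * S powr \<alpha> * w k)"
  proof (rule sum_mono)
    fix k assume "k \<in> {..<n}"
    then have "a k powr \<alpha> \<le> S powr \<alpha>" using aS a0 \<alpha> by (intro powr_mono2) auto
    then have "c * a k powr \<alpha> * w k \<le> c * S powr \<alpha> * w k"
      using w0 c by (intro mult_right_mono mult_left_mono) auto
    then show "a (Suc k) \<le> c * S powr \<alpha> * w k" using step[of k] by linarith
  qed
  also have "(\<Sum>k<n. c * S powr \<alpha> * w k) = c * S powr \<alpha> * (\<Sum>k<n. w k)" by (simp add: sum_distrib_left)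
  also have "\<dots> \<le> c * S powr \<alpha> * 1" using w1 c by (intro mult_left_mono) auto
  finally have S: "S \<le> a 0 + c * S powr \<alpha>" by simp
  have "S \<le> max (2 * a 0) ((2 * c) powr (1 / (1 - \<alpha>)))"
  \<comment> \<open>Above \<open>2 * a 0\<close> the initial term is less than half of S and can be
    absorbed, which leaves S bounded by a multiple of its power \<open>\<alpha>\<close> < 1.\<close>
  proof (cases "S \<le> 2 * a 0")
    case False
    then have Spos: "S > 0" using a0[of 0] by linarith
    have "S \<le> 2 * c * S powr \<alpha>" using S False by linarith
    then have "S powr (1 - \<alpha>) \<le> 2 * c"
      using Spos by (simp add: powr_diff field_simps)
    then have "(S powr (1 - \<alpha>)) powr (1 / (1 - \<alpha>)) \<le> (2 * c) powr (1 / (1 - \<alpha>))"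
      using \<alpha> by (intro powr_mono2) auto
    then show ?thesis using \<alpha> Spos by (simp add: powr_powr)
  qed simp
  moreover have "(\<Sum>k<n. a k) \<le> S" using a0 by (simp add: S_def)
  ultimately show ?thesis by linarith
qed

text \<open>A discrete layer-cake bound. For t between 2^k and 2^(k + 1) the term of index k alone
  dominates t^q, hence the exponent with \<open>Suc k\<close>; values below 1 are covered by the
  first summand.\<close>

lemma dyadic_decomposition:
  fixes t q :: real
  assumes "t < 2 ^ n" "q > 0"
  shows "(max 0 t) powr q \<le> (if t > 0 then 1 else 0) + (\<Sum>k<n. 2 powr (real (Suc k) * q) * (if t \<ge> 2 ^ k then 1 else 0))"
  using assms(1)
proof (induction n)
  case 0
  then show ?case using assms(2) powr_mono2[of q t 1] by (auto simp: max_def)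
next
  case (Suc n)
  show ?case
  proof (cases "t < 2 ^ n")
    case True
    then show ?thesis using Suc.IH by simp
  next
    case False
    then have "t > 0" by (smt (verit) zero_less_power)
    have "t powr q \<le> (2 ^ Suc n) powr q" using Suc.prems \<open>t > 0\<close> assms by (intro powr_mono2) auto
    also have "\<dots> = 2 powr (real (Suc n) * q)"
      by (subst powr_realpow[symmetric]) (auto simp: powr_powr)
    finally have "t powr q \<le> 2 powr (real (Suc n) * q)" .
    moreover have "0 \<le> (\<Sum>k<n. 2 powr (real (Suc k) * q) * (if t \<ge> 2 ^ k then 1 else 0))"
      by (intro sum_nonneg) auto
    ultimately show ?thesis using False \<open>t > 0\<close> by simp
  qed
qed

text \<open>Truncation at dyadic levels. The weighted measures \<open>a k\<close> of the superlevel
  sets obey a recursion with power p / N < 1 and factors \<open>w k\<close> of total at most 1, so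
  their sum is bounded by data independent of \<open>\<phi>\<close>. Values below 1 cost at most the
  volume v. Only unit energy is treated; homogeneity supplies the rest.\<close>

lemma sobolev_positive_part:
  fixes p v :: real
  assumes p: "1 < p" "p < real DIM('a::euclidean_space)" and v: "0 \<le> v"
  defines "q \<equiv> p * real DIM('a) / (real DIM('a) - p)"
  obtains C where "0 \<le> C" "\<And>(\<phi>::'a \<Rightarrow> real) G K. C1c \<phi> G K \<Longrightarrow> measure lborel K \<le> v \<Longrightarrow>
    (LINT x|lborel. norm (G x) powr p) \<le> 1 \<Longrightarrow> (LINT x|lborel. (max 0 (\<phi> x)) powr q) \<le> C"
proof -
  define N where "N = real DIM('a)"
  have pN: "1 < p" "p < N" using p by (auto simp: N_def)
  have q: "q = p * N / (N - p)" "q > 0" using pN by (auto simp: q_def N_def)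
  \<comment> \<open>The scaling identity that singles out the Sobolev exponent: with it the powers
    of 2 in the recursion for \<open>a\<close> balance for every k.\<close>
  have qe: "q - p - q * p / N = 0"
  proof -
    have "q * (N - p) = p * N" using pN by (simp add: q(1))
    then have "(q - p) * N - q * p = 0" by (simp add: algebra_simps)
    then show ?thesis using pN by (simp add: field_simps)
  qed
  define c where "c = 2 * 2 powr p * (2 / unit_ball_vol N) powr (p / N)"
  have c: "c \<ge> 0" by (simp add: c_def)
  define M where "M = max (2 * v) ((2 * (2 powr q * c)) powr (1 / (1 - p / N)))"
  have M0: "M \<ge> 0" using v by (simp add: M_def)
  show thesis
  proof (rule that[of "v + 2 powr q * M"])
    show "0 \<le> v + 2 powr q * M" using v M0 by simp
    fix \<phi> :: "'a \<Rightarrow> real" and G K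
    assume C: "C1c \<phi> G K" and K: "measure lborel K \<le> v" and E: "(LINT x|lborel. norm (G x) powr p) \<le> 1"
    note [measurable] = C1c_measurable[OF C] C1c_grad_measurable[OF C]
    have Kfin: "emeasure lborel K < \<infinity>" and [measurable]: "K \<in> sets borel"
      using C by (auto simp: C1c_def emeasure_compact_finite[simplified] borel_compact)
    define A where "A k = {x. \<phi> x \<ge> 2 ^ k}" for k :: nat
    have [measurable]: "A k \<in> sets borel" for k unfolding A_def by measurable
    have AK: "A k \<subseteq> K" for k
    proof
      fix x assume "x \<in> A k"
      then have "\<phi> x > 0" unfolding A_def by (smt (verit) mem_Collect_eq zero_less_power)
      then show "x \<in> K" using C by (auto simp: C1c_def)
    qed
    have Aint: "integrable lborel (\<lambda>x. indicator (A k) x :: real)" for k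
      using emeasure_mono[OF AK[of k], of lborel] Kfin
      by (intro integrable_real_indicator) auto
    define a where "a k = 2 powr (real k * q) * measure lborel (A k)" for k :: nat
    define R where "R k = {x. 2 ^ k \<le> \<phi> x \<and> \<phi> x < 2 * 2 ^ k}" for k :: nat
    have [measurable]: "R k \<in> sets borel" for k unfolding R_def by measurable
    define w where "w k = (LINT x|lborel. indicator (R k) x * norm (G x) powr p)" for k
    have Gint: "integrable lborel (\<lambda>x. norm (G x) powr p)" using C1c_powr_integrable[OF C] p by auto
    have Rint: "integrable lborel (\<lambda>x. indicator (R k) x * norm (G x) powr p)" for k
      by (rule Bochner_Integration.integrable_bound[OF Gint]) (auto simp: indicator_def)
    have sum: "(\<Sum>k<n. a k) \<le> M" for n
    proof -
      have "(\<Sum>k<n. a k) \<le> max (2 * a 0) ((2 * (2 powr q * c)) powr (1 / (1 - p / N)))"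
      proof (rule sublinear_recursion_bound[where w = w])
        show "0 \<le> w k" for k unfolding w_def by (intro integral_nonneg_AE AE_I2) auto
        \<comment> \<open>The shells \<open>R k\<close> are disjoint, so their energies add up to no
          more than the total energy.\<close>
        show "(\<Sum>k<n. w k) \<le> 1" for n
        proof -
          have "(\<Sum>k<n. w k) = (LINT x|lborel. (\<Sum>k<n. indicator (R k) x * norm (G x) powr p))"
            unfolding w_def using Rint by (subst Bochner_Integration.integral_sum) auto
          also have "\<dots> \<le> (LINT x|lborel. norm (G x) powr p)"
          proof (rule integral_mono)
            show "integrable lborel (\<lambda>x. \<Sum>k<n. indicator (R k) x * norm (G x) powr p)"
              by (intro Bochner_Integration.integrable_sum Rint)
            show "(\<Sum>k<n. indicator (R k) x * norm (G x) powr p) \<le> norm (G x) powr p" for x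
            proof -
              have "(\<Sum>k<n. indicator (R k) x :: real) \<le> 1"
              proof (cases "\<exists>k. x \<in> R k")
                case True
                then obtain k where k: "x \<in> R k" by blast
                have "x \<notin> R j" if "j \<noteq> k" for j
                proof
                  assume j: "x \<in> R j"
                  have "\<not> (i < l)" if "x \<in> R i" "x \<in> R l" for i l
                  proof
                    assume "i < l"
                    then have "(2::real) ^ Suc i \<le> 2 ^ l" by (intro power_increasing) auto
                    then show False using that unfolding R_def by auto
                  qed
                  from this[OF j k] this[OF k j] show False using that by linarith
                qed
                then have "(\<Sum>j<n. indicator (R j) x :: real) = (\<Sum>j<n. if j = k then 1 else 0)"
                  using k by (intro sum.cong) (auto simp: indicator_def)
                also have "\<dots> \<le> 1" by (simp add: sum.delta)
                finally show ?thesis .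
              qed (auto simp: indicator_def)
              then have "(\<Sum>k<n. indicator (R k) x) * norm (G x) powr p \<le> 1 * norm (G x) powr p"
                by (intro mult_right_mono) auto
              then show ?thesis by (simp add: sum_distrib_right)
            qed
          qed (rule Gint)
          finally show ?thesis using E by linarith
        qed
        show "a (Suc k) \<le> 2 powr q * c * a k powr (p / N) * w k" for k
        proof -
          have st: "measure lborel (A (Suc k)) * (2 ^ k) powr p \<le> c * measure lborel (A k) powr (p / N) * w k"
            using sobolev_step[OF C p(1), of "2 ^ k"] by (simp add: A_def R_def w_def c_def N_def)
          have e1: "(2 ^ k) powr p = 2 powr (real k * p)"
            by (subst powr_realpow[symmetric]) (auto simp: powr_powr)
          have "a (Suc k) = 2 powr (real (Suc k) * q - real k * p) * (measure lborel (A (Suc k)) * (2 ^ k) powr p)"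
            unfolding a_def e1 by (simp add: powr_diff)
          also have "\<dots> \<le> 2 powr (real (Suc k) * q - real k * p) * (c * measure lborel (A k) powr (p / N) * w k)"
            by (intro mult_left_mono st) auto
          also have "real (Suc k) * q - real k * p = q + real k * (q * p / N)"
          proof -
            have "real (Suc k) * q - real k * p = q + real k * (q - p - q * p / N) + real k * (q * p / N)"
              by (simp add: algebra_simps)
            then show ?thesis by (simp add: qe)
          qed
          also have "2 powr (q + real k * (q * p / N)) = 2 powr q * 2 powr (real k * q * (p / N))"
            by (simp add: powr_add mult.assoc)
          also have "2 powr q * 2 powr (real k * q * (p / N)) * (c * measure lborel (A k) powr (p / N) * w k)
              = 2 powr q * c * a k powr (p / N) * w k"
            by (simp add: a_def powr_mult powr_powr)
          finally show ?thesis .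
        qed
      qed (use c pN in \<open>auto simp: a_def\<close>)
      moreover have "a 0 \<le> v"
        using measure_mono_fmeasurable[OF AK[of 0], of lborel] K Kfin
        by (auto simp: a_def fmeasurable_def)
      ultimately show ?thesis unfolding M_def by linarith
    qed
    obtain B where B: "\<And>x. norm (\<phi> x) \<le> B"
      using compact_support_bounded[OF C1c_continuous[OF C], of K] C unfolding C1c_def by metis
    obtain n where n: "B < 2 ^ n" using real_arch_pow[of 2 B] by auto
    have "(LINT x|lborel. (max 0 (\<phi> x)) powr q)
        \<le> (LINT x|lborel. indicator K x + (\<Sum>k<n. 2 powr (real (Suc k) * q) * indicator (A k) x))"
    proof (rule integral_mono)
      have "integrable lborel (\<lambda>x. \<bar>\<phi> x\<bar> powr q)" using C1c_powr_integrable[OF C q(2)] by simp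
      then show "integrable lborel (\<lambda>x. (max 0 (\<phi> x)) powr q)"
        by (rule Bochner_Integration.integrable_bound) (auto intro!: powr_mono2 simp: less_imp_le[OF q(2)])
      show "integrable lborel (\<lambda>x. indicator K x + (\<Sum>k<n. 2 powr (real (Suc k) * q) * indicator (A k) x))"
        using Kfin by (intro Bochner_Integration.integrable_add Bochner_Integration.integrable_sum
            integrable_mult_right Aint) (auto intro!: integrable_real_indicator)
      fix x
      have "\<phi> x < 2 ^ n" using B[of x] n by auto
      from dyadic_decomposition[OF this q(2)]
      have "(max 0 (\<phi> x)) powr q \<le> (if \<phi> x > 0 then 1 else 0) + (\<Sum>k<n. 2 powr (real (Suc k) * q) * (if \<phi> x \<ge> 2 ^ k then 1 else 0))" .
      also have "\<dots> \<le> indicator K x + (\<Sum>k<n. 2 powr (real (Suc k) * q) * indicator (A k) x)"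
        using C by (intro add_mono sum_mono) (auto simp: A_def C1c_def indicator_def)
      finally show "(max 0 (\<phi> x)) powr q \<le> indicator K x + (\<Sum>k<n. 2 powr (real (Suc k) * q) * indicator (A k) x)" .
    qed
    also have "\<dots> = measure lborel K + (\<Sum>k<n. 2 powr (real (Suc k) * q) * measure lborel (A k))"
    proof -
      have cint: "integrable lborel (\<lambda>x. 2 powr (real (Suc k) * q) * indicator (A k) x)" for k
        by (intro integrable_mult_right Aint)
      have "(LINT x|lborel. (\<Sum>k<n. 2 powr (real (Suc k) * q) * indicator (A k) x))
          = (\<Sum>k<n. LINT x|lborel. 2 powr (real (Suc k) * q) * indicator (A k) x)"
        by (rule Bochner_Integration.integral_sum[OF cint])
      then have "(LINT x|lborel. (\<Sum>k<n. 2 powr (real (Suc k) * q) * indicator (A k) x))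
          = (\<Sum>k<n. 2 powr (real (Suc k) * q) * measure lborel (A k))"
        by simp
      moreover have "integrable lborel (\<lambda>x. indicator K x :: real)"
        using Kfin by (auto intro!: integrable_real_indicator)
      ultimately show ?thesis
        using Bochner_Integration.integrable_sum[OF cint, where I = "{..<n}"]
        by (subst Bochner_Integration.integral_add) auto
    qed
    also have "\<dots> = measure lborel K + 2 powr q * (\<Sum>k<n. a k)"
      by (simp add: a_def sum_distrib_left powr_add algebra_simps)
    also have "\<dots> \<le> v + 2 powr q * M" by (intro add_mono K mult_left_mono sum) auto
    finally show "(LINT x|lborel. (max 0 (\<phi> x)) powr q) \<le> v + 2 powr q * M" .
  qed
qed

lemma C1c_minus: "C1c \<phi> G K \<Longrightarrow> C1c (\<lambda>x. - \<phi> x) (\<lambda>x. - G x) K"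
  by (auto simp: C1c_def intro!: has_derivative_minus[THEN has_derivative_eq_rhs] continuous_on_minus)

lemma sobolev_C1c:
  fixes p v :: real
  assumes p: "1 < p" "p < real DIM('a::euclidean_space)" and v: "0 \<le> v"
  defines "q \<equiv> p * real DIM('a) / (real DIM('a) - p)"
  obtains C where "0 \<le> C" "\<And>(\<phi>::'a \<Rightarrow> real) G K. C1c \<phi> G K \<Longrightarrow> measure lborel K \<le> v \<Longrightarrow>
    (LINT x|lborel. norm (G x) powr p) \<le> 1 \<Longrightarrow> (LINT x|lborel. \<bar>\<phi> x\<bar> powr q) \<le> C"
proof -
  have q: "q > 0" using p by (simp add: q_def)
  obtain C where C: "0 \<le> C" "\<And>(\<phi>::'a \<Rightarrow> real) G K. C1c \<phi> G K \<Longrightarrow> measure lborel K \<le> v \<Longrightarrow>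
    (LINT x|lborel. norm (G x) powr p) \<le> 1 \<Longrightarrow> (LINT x|lborel. (max 0 (\<phi> x)) powr q) \<le> C"
    by (rule sobolev_positive_part[OF p v, folded q_def]) (rule that)
  show thesis
  proof (rule that[of "2 * C"])
    fix \<phi> :: "'a \<Rightarrow> real" and G K
    assume \<phi>: "C1c \<phi> G K" and K: "measure lborel K \<le> v" and E: "(LINT x|lborel. norm (G x) powr p) \<le> 1"
    have int: "integrable lborel (\<lambda>x. (max 0 (\<psi> x)) powr q)" if "C1c \<psi> H K" for \<psi> :: "'a \<Rightarrow> real" and H
    proof -
      note [measurable] = C1c_measurable[OF that]
      have "integrable lborel (\<lambda>x. \<bar>\<psi> x\<bar> powr q)" using C1c_powr_integrable[OF that q] by simp
      then show ?thesis
        by (rule Bochner_Integration.integrable_bound) (auto intro!: powr_mono2 simp: less_imp_le[OF q])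
    qed
    have eq: "\<bar>\<phi> x\<bar> powr q = (max 0 (\<phi> x)) powr q + (max 0 (- \<phi> x)) powr q" for x
      using q by (auto simp: max_def abs_if)
    have "(LINT x|lborel. \<bar>\<phi> x\<bar> powr q) = (LINT x|lborel. (max 0 (\<phi> x)) powr q) + (LINT x|lborel. (max 0 (- \<phi> x)) powr q)"
      unfolding eq by (rule Bochner_Integration.integral_add[OF int[OF \<phi>] int[OF C1c_minus[OF \<phi>]]])
    then show "(LINT x|lborel. \<bar>\<phi> x\<bar> powr q) \<le> 2 * C"
      using C(2)[OF \<phi> K E] C(2)[OF C1c_minus[OF \<phi>] K] E by simp
  qed (use C in auto)
qed

section \<open>The Sobolev space with zero boundary values\<close>

lemma En_dominated:
  fixes f :: "nat \<Rightarrow> 'x \<Rightarrow> 'b::euclidean_space" and h :: "'x \<Rightarrow> 'c::euclidean_space"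
  assumes [measurable]: "\<And>n. f n \<in> borel_measurable M" "g \<in> borel_measurable M"
    and lim: "AE x in M. (\<lambda>n. f n x) \<longlonglongrightarrow> g x"
    and bd: "\<And>n. AE x in M. norm (f n x) \<le> norm (h x)"
    and h: "memLp M p h" and p: "0 < p"
  shows "memLp M p g" "(\<lambda>n. En M p (\<lambda>x. f n x - g x)) \<longlonglongrightarrow> 0"
proof -
  have [measurable]: "h \<in> borel_measurable M" using h by (simp add: memLp_def)
  have bd': "AE x in M. \<forall>n. norm (f n x) \<le> norm (h x)" using bd by (simp add: AE_all_countable)
  have gb: "AE x in M. norm (g x) \<le> norm (h x)"
    using lim bd'
  proof eventually_elim
    case (elim x)
    then show ?case by (intro LIMSEQ_le_const2[OF tendsto_norm[OF elim(1)]]) auto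
  qed
  then show "memLp M p g"
    using p by (intro memLp_bound[OF h assms(2), of 1]) simp_all
  have "(\<lambda>n. LINT x|M. norm (f n x - g x) powr p) \<longlonglongrightarrow> (LINT x|M. 0)"
  proof (rule integral_dominated_convergence)
    show "integrable M (\<lambda>x. 2 powr p * norm (h x) powr p)" using h by (simp add: memLp_def)
    show "AE x in M. (\<lambda>n. norm (f n x - g x) powr p) \<longlonglongrightarrow> 0"
      using lim
    proof eventually_elim
      case (elim x)
      then have "(\<lambda>n. norm (f n x - g x)) \<longlonglongrightarrow> 0"
        by (intro tendsto_norm_zero LIM_zero)
      then have "(\<lambda>n. norm (f n x - g x) powr p) \<longlonglongrightarrow> 0 powr p"
        using p by (intro tendsto_powr2 tendsto_const) auto
      then show ?case using p by simp
    qed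
    show "AE x in M. norm (norm (f n x - g x) powr p) \<le> 2 powr p * norm (h x) powr p" for n
      using bd[of n] gb
    proof eventually_elim
      case (elim x)
      have "norm (f n x - g x) \<le> 2 * norm (h x)"
        using elim norm_triangle_ineq4[of "f n x" "g x"] by linarith
      then have "norm (f n x - g x) powr p \<le> (2 * norm (h x)) powr p"
        using p by (intro powr_mono2) auto
      also have "\<dots> = 2 powr p * norm (h x) powr p" by (rule powr_mult)
      finally show ?case by simp
    qed
  qed measurable
  then show "(\<lambda>n. En M p (\<lambda>x. f n x - g x)) \<longlonglongrightarrow> 0" by (simp add: En_def)
qed

locale sobolev_domain =
  fixes \<Omega> :: "'a::euclidean_space set" and p N :: real
  assumes dim: "N = real DIM('a)" and open_domain: "open \<Omega>" and bounded_domain: "bounded \<Omega>"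
    and p_ge_2: "2 \<le> p" and p_less_dim: "p < N"
begin

abbreviation M :: "'a measure" where "M \<equiv> lebesgue_on \<Omega>"
abbreviation hardy :: real where "hardy \<equiv> ((N - p) / p) powr p"
abbreviation pstar :: real where "pstar \<equiv> p * N / (N - p)"

lemma hardy_pos: "hardy > 0"
  using p_ge_2 p_less_dim by simp

lemma pstar_gt: "pstar > p" "pstar > 0"
proof -
  have "p * (N - p) < p * N" using p_ge_2 by simp
  then show "pstar > p" using p_less_dim by (simp add: pos_less_divide_eq)
  then show "pstar > 0" using p_ge_2 by linarith
qed

lemma domain_sets [simp]: "\<Omega> \<in> sets lebesgue"
  using open_domain by auto

lemma domain_lmeasurable: "\<Omega> \<in> lmeasurable"
  using open_domain bounded_domain by (intro lmeasurable_open)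

lemma finite_measure_M: "finite_measure M"
  using domain_lmeasurable by (rule finite_measure_lebesgue_on)

lemma integrable_const_M: "integrable M (\<lambda>x. c::real)"
  using finite_measure_M by (rule finite_measure.integrable_const)

lemma borel_imp_M [measurable_dest]: "f \<in> borel_measurable borel \<Longrightarrow> f \<in> borel_measurable M"
  by (rule borel_measurable_lebesgue_on)

lemma test_C1c_domain:
  assumes "\<phi> \<in> test_functions \<Omega>"
  obtains K where "C1c \<phi> (grad \<phi>) K" "K \<subseteq> \<Omega>" "measure lborel K \<le> measure lebesgue \<Omega>"
proof -
  obtain K where K: "C1c \<phi> (grad \<phi>) K" "K \<subseteq> \<Omega>" using test_C1c[OF assms] by metis
  then have "K \<in> sets borel" by (auto simp: C1c_def borel_compact)
  then have "measure lborel K = measure lebesgue K" by simp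
  also have "\<dots> \<le> measure lebesgue \<Omega>"
    using K domain_lmeasurable \<open>K \<in> sets borel\<close> by (intro measure_mono_fmeasurable) auto
  finally show thesis using that K by blast
qed

lemma test_memLp:
  assumes "\<phi> \<in> test_functions \<Omega>" "0 < r"
  shows "memLp M r \<phi>" "memLp M r (grad \<phi>)"
proof -
  obtain K where K: "C1c \<phi> (grad \<phi>) K" "K \<subseteq> \<Omega>" using test_C1c[OF assms(1)] by metis
  note [measurable] = C1c_measurable[OF K(1)] C1c_grad_measurable[OF K(1)]
  have z: "\<phi> x = 0" "grad \<phi> x = 0" if "x \<notin> \<Omega>" for x
    using C1c_grad_outside[OF K(1)] K that by (auto simp: C1c_def)
  show "memLp M r \<phi>"
    using C1c_powr_integrable(2)[OF K(1) assms(2)] assms(2) z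
    by (auto simp: memLp_def intro!: lebesgue_on_vanishing_outside(1)[THEN iffD2] borel_imp_M)
  show "memLp M r (grad \<phi>)"
    using C1c_powr_integrable(1)[OF K(1) assms(2)] assms(2) z
    by (auto simp: memLp_def intro!: lebesgue_on_vanishing_outside(1)[THEN iffD2] borel_imp_M)
qed

lemma test_En:
  assumes "\<phi> \<in> test_functions \<Omega>"
  shows "En M p (grad \<phi>) = (LINT x|lborel. norm (grad \<phi> x) powr p)"
proof -
  obtain K where K: "C1c \<phi> (grad \<phi>) K" "K \<subseteq> \<Omega>" using test_C1c[OF assms] by metis
  note [measurable] = C1c_grad_measurable[OF K(1)]
  have z: "grad \<phi> x = 0" if "x \<notin> \<Omega>" for x
    using C1c_grad_outside[OF K(1)] K that by auto
  show ?thesis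
    unfolding En_def using p_ge_2 z by (intro lebesgue_on_vanishing_outside(2)) auto
qed

text \<open>\<open>sob u G\<close> expresses \<open>u \<in> W\<^sub>0\<^sup>1\<^sup>,\<^sup>p\<close> and \<open>Du = G\<close>. Carrying the gradient along as a limit of gradients of test
  functions avoids the choice in \<^const>\<open>weak_grad\<close> until the end.\<close>

definition sob :: "('a \<Rightarrow> real) \<Rightarrow> ('a \<Rightarrow> 'a) \<Rightarrow> bool" where
  "sob u G \<longleftrightarrow> memLp M p u \<and> memLp M p G \<and>
     (\<forall>\<epsilon>>0. \<exists>\<phi>\<in>test_functions \<Omega>. En M p (\<lambda>x. u x - \<phi> x) + En M p (\<lambda>x. G x - grad \<phi> x) < \<epsilon>)"

lemma sob_memLp: "sob u G \<Longrightarrow> memLp M p u" "sob u G \<Longrightarrow> memLp M p G"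
  by (auto simp: sob_def)

lemma sob_measurable: "sob u G \<Longrightarrow> u \<in> borel_measurable M" "sob u G \<Longrightarrow> G \<in> borel_measurable M"
  by (auto simp: sob_def memLp_def)

lemma p0: "0 \<le> p" "0 < p" "1 \<le> p" "1 < p"
  using p_ge_2 by auto

lemma sob_test: "\<phi> \<in> test_functions \<Omega> \<Longrightarrow> sob \<phi> (grad \<phi>)"
  using p0 by (auto simp: sob_def En_def intro!: test_memLp bexI[of _ \<phi>])

lemma sob_zero: "sob (\<lambda>x. 0) (\<lambda>x. 0)"
proof -
  have "grad (\<lambda>x::'a. 0) = (\<lambda>x. 0)" by (rule ext) (simp add: grad_def frechet_derivative_const)
  then show ?thesis using sob_test[OF test_zero] by simp
qed

lemma sob_sequence:
  assumes "sob u G"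
  obtains \<phi> :: "nat \<Rightarrow> 'a \<Rightarrow> real" where "\<And>n. \<phi> n \<in> test_functions \<Omega>"
    "(\<lambda>n. En M p (\<lambda>x. \<phi> n x - u x)) \<longlonglongrightarrow> 0" "(\<lambda>n. En M p (\<lambda>x. grad (\<phi> n) x - G x)) \<longlonglongrightarrow> 0"
    "AE x in M. (\<lambda>n. \<phi> n x) \<longlonglongrightarrow> u x"
proof -
  have "\<exists>\<phi>\<in>test_functions \<Omega>. En M p (\<lambda>x. u x - \<phi> x) + En M p (\<lambda>x. G x - grad \<phi> x) < 1 / real (Suc n)" for n
    using assms unfolding sob_def by simp
  then obtain \<phi> :: "nat \<Rightarrow> 'a \<Rightarrow> real" where \<phi>: "\<And>n. \<phi> n \<in> test_functions \<Omega>"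
    "\<And>n. En M p (\<lambda>x. u x - \<phi> n x) + En M p (\<lambda>x. G x - grad (\<phi> n) x) < 1 / real (Suc n)"
    by metis
  have b: "En M p (\<lambda>x. \<phi> n x - u x) \<le> 1 / real (Suc n)" "En M p (\<lambda>x. grad (\<phi> n) x - G x) \<le> 1 / real (Suc n)" for n
    using \<phi>(2)[of n] En_nonneg[of M p "\<lambda>x. u x - \<phi> n x"] En_nonneg[of M p "\<lambda>x. G x - grad (\<phi> n) x"]
      En_minus_commute[of M p "\<phi> n" u] En_minus_commute[of M p "grad (\<phi> n)" G]
    by linarith+
  have lim: "(\<lambda>n. En M p (\<lambda>x. \<phi> n x - u x)) \<longlonglongrightarrow> 0" "(\<lambda>n. En M p (\<lambda>x. grad (\<phi> n) x - G x)) \<longlonglongrightarrow> 0"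
    by (rule tendsto_sandwich[OF always_eventually always_eventually tendsto_const LIMSEQ_Suc[OF lim_1_over_n]];
        use b in simp)+
  obtain r :: "nat \<Rightarrow> nat" where r: "strict_mono r" "AE x in M. (\<lambda>n. \<phi> (r n) x) \<longlonglongrightarrow> u x"
    using En_tendsto_AE_subseq[OF test_memLp(1)[OF \<phi>(1) p0(2)] sob_memLp(1)[OF assms] p0(2) lim(1)] by metis
  show thesis
    by (rule that[of "\<lambda>n. \<phi> (r n)"])
      (use \<phi>(1) r LIMSEQ_subseq_LIMSEQ[OF lim(1) r(1)] LIMSEQ_subseq_LIMSEQ[OF lim(2) r(1)] in \<open>auto simp: comp_def\<close>)
qed

text \<open>A closure is closed: a test function near \<open>u n\<close> is near the limit. This is
  the tool for nearly every membership proof that follows, since only sequences converging in energy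
  have to be produced.\<close>

lemma sob_closed:
  fixes u :: "nat \<Rightarrow> 'a \<Rightarrow> real"
  assumes s: "\<And>n. sob (u n) (G n)" and m: "memLp M p v" "memLp M p H"
    and lim: "(\<lambda>n. En M p (\<lambda>x. u n x - v x)) \<longlonglongrightarrow> 0" "(\<lambda>n. En M p (\<lambda>x. G n x - H x)) \<longlonglongrightarrow> 0"
  shows "sob v H"
  unfolding sob_def
proof (intro conjI m allI impI)
  fix \<epsilon> :: real assume \<epsilon>: "\<epsilon> > 0"
  \<comment> \<open>Three errors below \<open>\<delta>\<close>, enlarged by the factor
    \<open>2 powr p\<close> of the triangle inequality, total less than
    \<open>3 * \<epsilon> / 4\<close>.\<close>
  define \<delta> where "\<delta> = \<epsilon> / (4 * 2 powr p)"
  have \<delta>: "\<delta> > 0" "2 powr p * \<delta> = \<epsilon> / 4" using \<epsilon> by (auto simp: \<delta>_def)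
  have "\<forall>\<^sub>F n in sequentially. En M p (\<lambda>x. u n x - v x) < \<delta> \<and> En M p (\<lambda>x. G n x - H x) < \<delta>"
    using order_tendstoD(2)[OF lim(1) \<delta>(1)] order_tendstoD(2)[OF lim(2) \<delta>(1)] by (rule eventually_conj)
  then obtain n where n: "En M p (\<lambda>x. u n x - v x) < \<delta>" "En M p (\<lambda>x. G n x - H x) < \<delta>"
    by (auto simp: eventually_sequentially)
  obtain \<phi> where \<phi>: "\<phi> \<in> test_functions \<Omega>" "En M p (\<lambda>x. u n x - \<phi> x) + En M p (\<lambda>x. G n x - grad \<phi> x) < \<delta>"
    using s[of n] \<delta>(1) unfolding sob_def by blast
  have "En M p (\<lambda>x. v x - \<phi> x) \<le> 2 powr p * (En M p (\<lambda>x. v x - u n x) + En M p (\<lambda>x. u n x - \<phi> x))"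
    by (intro En_triangle m sob_memLp[OF s] test_memLp \<phi> p0)
  moreover have "En M p (\<lambda>x. H x - grad \<phi> x) \<le> 2 powr p * (En M p (\<lambda>x. H x - G n x) + En M p (\<lambda>x. G n x - grad \<phi> x))"
    by (intro En_triangle m sob_memLp[OF s] test_memLp \<phi> p0)
  ultimately have "En M p (\<lambda>x. v x - \<phi> x) + En M p (\<lambda>x. H x - grad \<phi> x)
      \<le> 2 powr p * (En M p (\<lambda>x. u n x - v x) + En M p (\<lambda>x. G n x - H x)
          + (En M p (\<lambda>x. u n x - \<phi> x) + En M p (\<lambda>x. G n x - grad \<phi> x)))"
    using En_minus_commute[of M p v "u n"] En_minus_commute[of M p H "G n"]
    by (simp add: distrib_left)
  also have "\<dots> \<le> 2 powr p * (\<delta> + \<delta> + \<delta>)"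
    using n \<phi>(2) by (intro mult_left_mono) auto
  also have "\<dots> < \<epsilon>" using \<delta>(2) \<epsilon> by (simp add: distrib_left)
  finally show "\<exists>\<phi>\<in>test_functions \<Omega>. En M p (\<lambda>x. v x - \<phi> x) + En M p (\<lambda>x. H x - grad \<phi> x) < \<epsilon>"
    using \<phi>(1) by blast
qed

lemma sob_add:
  assumes u: "sob u G" and v: "sob v H"
  shows "sob (\<lambda>x. u x + v x) (\<lambda>x. G x + H x)"
proof -
  obtain \<phi> :: "nat \<Rightarrow> 'a \<Rightarrow> real" where \<phi>: "\<And>n. \<phi> n \<in> test_functions \<Omega>"
    "(\<lambda>n. En M p (\<lambda>x. \<phi> n x - u x)) \<longlonglongrightarrow> 0" "(\<lambda>n. En M p (\<lambda>x. grad (\<phi> n) x - G x)) \<longlonglongrightarrow> 0"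
    by (rule sob_sequence[OF u]) (rule that)
  obtain \<psi> :: "nat \<Rightarrow> 'a \<Rightarrow> real" where \<psi>: "\<And>n. \<psi> n \<in> test_functions \<Omega>"
    "(\<lambda>n. En M p (\<lambda>x. \<psi> n x - v x)) \<longlonglongrightarrow> 0" "(\<lambda>n. En M p (\<lambda>x. grad (\<psi> n) x - H x)) \<longlonglongrightarrow> 0"
    by (rule sob_sequence[OF v]) (rule that)
  have comb: "(\<lambda>n. En M p (\<lambda>x. (a n x + b n x) - (c x + d x))) \<longlonglongrightarrow> 0"
    if a: "\<And>n::nat. memLp M p (a n)" "\<And>n. memLp M p (b n)" "memLp M p c" "memLp M p d"
      and l: "(\<lambda>n. En M p (\<lambda>x. a n x - c x)) \<longlonglongrightarrow> 0" "(\<lambda>n. En M p (\<lambda>x. b n x - d x)) \<longlonglongrightarrow> 0"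
    for a b :: "nat \<Rightarrow> 'a \<Rightarrow> 'b::euclidean_space" and c d
  proof (rule tendsto_sandwich[OF always_eventually always_eventually tendsto_const])
    show "(\<lambda>n. 2 powr p * (En M p (\<lambda>x. a n x - c x) + En M p (\<lambda>x. b n x - d x))) \<longlonglongrightarrow> 0"
      using tendsto_mult_left[OF tendsto_add[OF l], of "2 powr p"] by simp
    show "\<forall>n. En M p (\<lambda>x. (a n x + b n x) - (c x + d x)) \<le> 2 powr p * (En M p (\<lambda>x. a n x - c x) + En M p (\<lambda>x. b n x - d x))"
    proof
      fix n
      have "En M p (\<lambda>x. (a n x - c x) + (b n x - d x)) \<le> 2 powr p * (En M p (\<lambda>x. a n x - c x) + En M p (\<lambda>x. b n x - d x))"
        by (intro En_add_le memLp_diff a p0)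
      then show "En M p (\<lambda>x. (a n x + b n x) - (c x + d x)) \<le> 2 powr p * (En M p (\<lambda>x. a n x - c x) + En M p (\<lambda>x. b n x - d x))"
        by (simp add: algebra_simps)
    qed
  qed simp
  show ?thesis
  proof (rule sob_closed)
    show "sob (\<lambda>x. \<phi> n x + \<psi> n x) (\<lambda>x. grad (\<phi> n) x + grad (\<psi> n) x)" for n
      using sob_test[OF test_add[OF \<phi>(1) \<psi>(1)], of n n] by (simp add: grad_add[OF \<phi>(1) \<psi>(1)])
    show "memLp M p (\<lambda>x. u x + v x)" "memLp M p (\<lambda>x. G x + H x)"
      by (intro memLp_add sob_memLp[OF u] sob_memLp[OF v] p0)+
    show "(\<lambda>n. En M p (\<lambda>x. \<phi> n x + \<psi> n x - (u x + v x))) \<longlonglongrightarrow> 0"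
      by (intro comb test_memLp \<phi> \<psi> sob_memLp[OF u] sob_memLp[OF v] p0)
    show "(\<lambda>n. En M p (\<lambda>x. grad (\<phi> n) x + grad (\<psi> n) x - (G x + H x))) \<longlonglongrightarrow> 0"
      by (intro comb test_memLp \<phi> \<psi> sob_memLp[OF u] sob_memLp[OF v] p0)
  qed
qed

lemma sob_cmult:
  assumes u: "sob u G"
  shows "sob (\<lambda>x. c * u x) (\<lambda>x. c *\<^sub>R G x)"
proof -
  obtain \<phi> :: "nat \<Rightarrow> 'a \<Rightarrow> real" where \<phi>: "\<And>n. \<phi> n \<in> test_functions \<Omega>"
    "(\<lambda>n. En M p (\<lambda>x. \<phi> n x - u x)) \<longlonglongrightarrow> 0" "(\<lambda>n. En M p (\<lambda>x. grad (\<phi> n) x - G x)) \<longlonglongrightarrow> 0"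
    by (rule sob_sequence[OF u]) (rule that)
  show ?thesis
  proof (rule sob_closed)
    show "sob (\<lambda>x. c * \<phi> n x) (\<lambda>x. c *\<^sub>R grad (\<phi> n) x)" for n
      using sob_test[OF test_cmult[OF \<phi>(1)], of c n] by (simp add: grad_cmult[OF \<phi>(1)])
    show "memLp M p (\<lambda>x. c * u x)" "memLp M p (\<lambda>x. c *\<^sub>R G x)"
      using memLp_scaleR[OF sob_memLp(1)[OF u] p0(1), of c] memLp_scaleR[OF sob_memLp(2)[OF u] p0(1), of c]
      by auto
    have "(\<lambda>n. \<bar>c\<bar> powr p * En M p (\<lambda>x. \<phi> n x - u x)) \<longlonglongrightarrow> \<bar>c\<bar> powr p * 0"
      by (intro tendsto_mult tendsto_const \<phi>)
    then show "(\<lambda>n. En M p (\<lambda>x. c * \<phi> n x - c * u x)) \<longlonglongrightarrow> 0"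
      using En_scaleR[OF p0(1), of M c "\<lambda>x. \<phi> _ x - u x"] by (simp add: right_diff_distrib)
    have "(\<lambda>n. \<bar>c\<bar> powr p * En M p (\<lambda>x. grad (\<phi> n) x - G x)) \<longlonglongrightarrow> \<bar>c\<bar> powr p * 0"
      by (intro tendsto_mult tendsto_const \<phi>)
    then show "(\<lambda>n. En M p (\<lambda>x. c *\<^sub>R grad (\<phi> n) x - c *\<^sub>R G x)) \<longlonglongrightarrow> 0"
      using En_scaleR[OF p0(1), of M c "\<lambda>x. grad (\<phi> _) x - G x"] by (simp add: scaleR_right_diff_distrib)
  qed
qed

lemma sob_minus: "sob u G \<Longrightarrow> sob (\<lambda>x. - u x) (\<lambda>x. - G x)"
  using sob_cmult[of u G "-1"] by simp

lemma sob_diff: "sob u G \<Longrightarrow> sob v H \<Longrightarrow> sob (\<lambda>x. u x - v x) (\<lambda>x. G x - H x)"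
  using sob_add[of u G "\<lambda>x. - v x" "\<lambda>x. - H x"] sob_minus by simp

lemma sob_cong_AE:
  assumes "sob u G" "AE x in M. u x = v x" "AE x in M. G x = H x"
  shows "sob v H"
proof -
  have m: "v \<in> borel_measurable M" "H \<in> borel_measurable M"
    using borel_measurable_lebesgue_on_AE[OF sob_measurable(1)[OF assms(1)] assms(2)]
      borel_measurable_lebesgue_on_AE[OF sob_measurable(2)[OF assms(1)] assms(3)] by auto
  have v: "memLp M p v" "memLp M p H"
    using memLp_cong_AE[OF sob_measurable(1)[OF assms(1)] m(1) assms(2)]
      memLp_cong_AE[OF sob_measurable(2)[OF assms(1)] m(2) assms(3)] sob_memLp[OF assms(1)] by auto
  have z: "En M p f = 0" if "f \<in> borel_measurable M" "AE x in M. f x = 0" for f :: "'a \<Rightarrow> 'b::euclidean_space"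
    using En_cong_AE[OF that(1) _ that(2)] by (simp add: En_def)
  show ?thesis
  proof (rule sob_closed[OF assms(1) v])
    have "En M p (\<lambda>x. u x - v x) = 0"
      by (rule z) (use sob_measurable[OF assms(1)] m assms(2) in auto)
    then show "(\<lambda>n. En M p (\<lambda>x. u x - v x)) \<longlonglongrightarrow> 0" by simp
    have "En M p (\<lambda>x. G x - H x) = 0"
      by (rule z) (use sob_measurable[OF assms(1)] m assms(3) in auto)
    then show "(\<lambda>n. En M p (\<lambda>x. G x - H x)) \<longlonglongrightarrow> 0" by simp
  qed
qed

text \<open>For approximating test functions this is the C^1 inequality. Fatou's lemma treats the
  left side and continuity of the energy the right side, so the constant survives unchanged.\<close>

lemma hardy_sob:
  assumes "sob u G"
  shows "integrable M (\<lambda>x. \<bar>u x\<bar> powr p / norm x powr p)"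
    and "hardy * (LINT x|M. \<bar>u x\<bar> powr p / norm x powr p) \<le> En M p G"
proof -
  obtain \<phi> :: "nat \<Rightarrow> 'a \<Rightarrow> real" where \<phi>: "\<And>n. \<phi> n \<in> test_functions \<Omega>"
    "(\<lambda>n. En M p (\<lambda>x. \<phi> n x - u x)) \<longlonglongrightarrow> 0" "(\<lambda>n. En M p (\<lambda>x. grad (\<phi> n) x - G x)) \<longlonglongrightarrow> 0"
    "AE x in M. (\<lambda>n. \<phi> n x) \<longlonglongrightarrow> u x"
    by (rule sob_sequence[OF assms]) (rule that)
  note [measurable] = sob_measurable[OF assms]
  have n[measurable]: "(\<lambda>x::'a. norm x) \<in> borel_measurable M" by (rule borel_imp_M) simp
  have 1: "integrable M (\<lambda>x. \<bar>\<phi> n x\<bar> powr p / norm x powr p)"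
    and 2: "(LINT x|M. \<bar>\<phi> n x\<bar> powr p / norm x powr p) \<le> En M p (grad (\<phi> n)) / hardy" for n
  proof -
    obtain K where K: "C1c (\<phi> n) (grad (\<phi> n)) K" "K \<subseteq> \<Omega>" using test_C1c[OF \<phi>(1)] by metis
    note [measurable] = C1c_measurable[OF K(1)]
    have z: "\<phi> n x = 0" if "x \<notin> \<Omega>" for x using K that by (auto simp: C1c_def)
    note L = lebesgue_on_vanishing_outside[of \<Omega> "\<lambda>x. \<bar>\<phi> n x\<bar> powr p / norm x powr p"]
    show "integrable M (\<lambda>x. \<bar>\<phi> n x\<bar> powr p / norm x powr p)"
      using L(1) hardy_C1c(1)[OF K(1) p_ge_2 p_less_dim[unfolded dim], folded dim] z p0 by auto
    have "(LINT x|M. \<bar>\<phi> n x\<bar> powr p / norm x powr p) = (LINT x|lborel. \<bar>\<phi> n x\<bar> powr p / norm x powr p)"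
      by (rule L(2)) (use z p0 in auto)
    then show "(LINT x|M. \<bar>\<phi> n x\<bar> powr p / norm x powr p) \<le> En M p (grad (\<phi> n)) / hardy"
      using hardy_C1c(2)[OF K(1) p_ge_2 p_less_dim[unfolded dim], folded dim] hardy_pos
      by (simp add: test_En[OF \<phi>(1)] pos_le_divide_eq mult.commute)
  qed
  have 3: "AE x in M. (\<lambda>n. \<bar>\<phi> n x\<bar> powr p / norm x powr p) \<longlonglongrightarrow> \<bar>u x\<bar> powr p / norm x powr p"
    using \<phi>(4)
  proof eventually_elim
    case (elim x)
    have "(\<lambda>n. \<bar>\<phi> n x\<bar> powr p) \<longlonglongrightarrow> \<bar>u x\<bar> powr p"
      using p0 by (intro tendsto_powr2 tendsto_rabs elim tendsto_const) auto
    then show ?case unfolding divide_inverse by (intro tendsto_mult tendsto_const)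
  qed
  have 4: "(\<lambda>x. \<bar>u x\<bar> powr p / norm x powr p) \<in> borel_measurable M" by measurable
  have 5: "(\<lambda>n. En M p (grad (\<phi> n)) / hardy) \<longlonglongrightarrow> En M p G / hardy"
    using hardy_pos by (intro tendsto_divide tendsto_const En_tendsto test_memLp \<phi> sob_memLp[OF assms] p0) auto
  show "integrable M (\<lambda>x. \<bar>u x\<bar> powr p / norm x powr p)"
    by (rule fatou_bounded(1)[OF 1 _ 4 3 2 5]) auto
  have "(LINT x|M. \<bar>u x\<bar> powr p / norm x powr p) \<le> En M p G / hardy"
    by (rule fatou_bounded(2)[OF 1 _ 4 3 2 5]) auto
  then show "hardy * (LINT x|M. \<bar>u x\<bar> powr p / norm x powr p) \<le> En M p G"
    using hardy_pos by (simp add: pos_le_divide_eq mult.commute)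
qed

lemma AE_nonzero: "AE x in M. x \<noteq> 0"
proof -
  have "AE x in lebesgue. x \<noteq> (0::'a)"
    using AE_completion[OF AE_lborel_singleton[of "0::'a"]] by simp
  then have "AE x in lebesgue. x \<in> \<Omega> \<longrightarrow> x \<noteq> (0::'a)" by eventually_elim simp
  then show ?thesis by (subst AE_restrict_space_iff) auto
qed

text \<open>A consequence of Hardy's inequality: on a domain inside the ball of radius R the weight
  is at least R^(-p).\<close>

lemma poincare:
  obtains C where "0 < C" "\<And>u G. sob u G \<Longrightarrow> En M p u \<le> C * En M p G"
proof -
  obtain R where R: "R > 0" "\<And>x. x \<in> \<Omega> \<Longrightarrow> norm x \<le> R"
    using bounded_domain bounded_pos by metis
  show thesis
  proof (rule that[of "R powr p / hardy"])
    show "0 < R powr p / hardy" using R(1) hardy_pos by simp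
    fix u G assume s: "sob u G"
    have "En M p u \<le> (LINT x|M. R powr p * (\<bar>u x\<bar> powr p / norm x powr p))"
      unfolding En_def
    proof (rule integral_mono_AE)
      show "integrable M (\<lambda>x. norm (u x) powr p)" using sob_memLp[OF s] by (simp add: memLp_def)
      show "integrable M (\<lambda>x. R powr p * (\<bar>u x\<bar> powr p / norm x powr p))"
        by (intro integrable_mult_right hardy_sob[OF s])
      show "AE x in M. norm (u x) powr p \<le> R powr p * (\<bar>u x\<bar> powr p / norm x powr p)"
        using AE_nonzero AE_space
      proof eventually_elim
        case (elim x)
        have "norm x powr p \<le> R powr p" using elim R p0 by (intro powr_mono2) auto
        then have "\<bar>u x\<bar> powr p * norm x powr p \<le> \<bar>u x\<bar> powr p * R powr p" by (intro mult_left_mono) auto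
        then show ?case using elim by (simp add: field_simps)
      qed
    qed
    also have "\<dots> = R powr p * (LINT x|M. \<bar>u x\<bar> powr p / norm x powr p)"
      by (rule integral_mult_right_zero)
    also have "\<dots> \<le> R powr p * (En M p G / hardy)"
      using hardy_sob(2)[OF s] hardy_pos by (intro mult_left_mono) (auto simp: pos_le_divide_eq mult.commute)
    finally show "En M p u \<le> R powr p / hardy * En M p G" by simp
  qed
qed

lemma sob_zero_energy:
  assumes "sob u G" "En M p G = 0"
  shows "AE x in M. u x = 0"
proof -
  obtain C where "En M p u \<le> C * En M p G"
    using poincare assms(1) by metis
  then have "En M p u = 0" using assms(2) En_nonneg[of M p u] by simp
  then have "(LINT x|M. norm (u x) powr p) = 0" by (simp add: En_def)
  then have "AE x in M. norm (u x) powr p = 0"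
    using sob_memLp[OF assms(1)] by (subst (asm) integral_nonneg_eq_0_iff_AE) (auto simp: memLp_def)
  then show ?thesis by eventually_elim auto
qed

lemma sobolev_sob:
  obtains C where "0 \<le> C"
    "\<And>u G. sob u G \<Longrightarrow> En M p G \<le> 1 \<Longrightarrow> integrable M (\<lambda>x. \<bar>u x\<bar> powr pstar)"
    "\<And>u G. sob u G \<Longrightarrow> En M p G \<le> 1 \<Longrightarrow> (LINT x|M. \<bar>u x\<bar> powr pstar) \<le> C"
proof -
  define q where "q = pstar"
  have q: "q > 0" using pstar_gt by (simp add: q_def)
  obtain C where C: "0 \<le> C" "\<And>(\<phi>::'a \<Rightarrow> real) G K. C1c \<phi> G K \<Longrightarrow> measure lborel K \<le> measure lebesgue \<Omega> \<Longrightarrow>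
    (LINT x|lborel. norm (G x) powr p) \<le> 1 \<Longrightarrow> (LINT x|lborel. \<bar>\<phi> x\<bar> powr q) \<le> C"
    by (rule sobolev_C1c[OF p0(4) p_less_dim[unfolded dim] measure_nonneg[of lebesgue \<Omega>], folded dim, folded q_def]) (rule that)
  \<comment> \<open>Approximations of a function of energy at most 1 may have slightly larger
    energy. The margin \<open>2 powr p\<close> covers them, and halving the test function restores
    unit energy.\<close>
  have test: "(LINT x|M. \<bar>\<phi> x\<bar> powr q) \<le> 2 powr q * C"
    if \<phi>: "\<phi> \<in> test_functions \<Omega>" and E: "En M p (grad \<phi>) \<le> 2 powr p" for \<phi>
  proof -
    define \<psi> where "\<psi> x = (1/2) * \<phi> x" for x
    have \<psi>: "\<psi> \<in> test_functions \<Omega>" unfolding \<psi>_def[abs_def] by (rule test_cmult[OF \<phi>])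
    obtain K where K: "C1c \<psi> (grad \<psi>) K" "K \<subseteq> \<Omega>" "measure lborel K \<le> measure lebesgue \<Omega>"
      using test_C1c_domain[OF \<psi>] by metis
    note [measurable] = C1c_measurable[OF K(1)]
    have "En M p (grad \<psi>) = (1/2) powr p * En M p (grad \<phi>)"
      unfolding \<psi>_def[abs_def] grad_cmult[OF \<phi>] using En_scaleR[OF p0(1), of M "1/2"] by simp
    also have "\<dots> \<le> (1/2) powr p * 2 powr p" using E by (intro mult_left_mono) auto
    also have "\<dots> = 1" by (simp add: powr_divide)
    finally have "(LINT x|lborel. \<bar>\<psi> x\<bar> powr q) \<le> C"
      using C(2)[OF K(1,3)] by (simp add: test_En[OF \<psi>])
    moreover have "(LINT x|M. \<bar>\<psi> x\<bar> powr q) = (LINT x|lborel. \<bar>\<psi> x\<bar> powr q)"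
      using K q by (intro lebesgue_on_vanishing_outside(2)) (auto simp: C1c_def)
    moreover have "\<bar>\<phi> x\<bar> powr q = 2 powr q * \<bar>\<psi> x\<bar> powr q" for x
      by (simp add: \<psi>_def abs_mult powr_divide powr_mult)
    ultimately show ?thesis by (simp add: mult_left_mono)
  qed
  have main: "integrable M (\<lambda>x. \<bar>u x\<bar> powr q)" "(LINT x|M. \<bar>u x\<bar> powr q) \<le> 2 powr q * C"
    if s: "sob u G" and E: "En M p G \<le> 1" for u G
  proof -
    obtain \<phi> :: "nat \<Rightarrow> 'a \<Rightarrow> real" where \<phi>: "\<And>n. \<phi> n \<in> test_functions \<Omega>"
      "(\<lambda>n. En M p (\<lambda>x. \<phi> n x - u x)) \<longlonglongrightarrow> 0" "(\<lambda>n. En M p (\<lambda>x. grad (\<phi> n) x - G x)) \<longlonglongrightarrow> 0"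
      "AE x in M. (\<lambda>n. \<phi> n x) \<longlonglongrightarrow> u x"
      by (rule sob_sequence[OF s]) (rule that)
    have "(\<lambda>n. En M p (grad (\<phi> n))) \<longlonglongrightarrow> En M p G"
      by (intro En_tendsto test_memLp \<phi> sob_memLp[OF s] p0)
    moreover have "En M p G < 2 powr p"
    proof -
      have "(2::real) powr 0 < 2 powr p" using p0 by (intro powr_less_mono) auto
      then show ?thesis using E by simp
    qed
    ultimately have "\<forall>\<^sub>F n in sequentially. En M p (grad (\<phi> n)) < 2 powr p" by (rule order_tendstoD)
    then obtain k where k: "\<And>n. n \<ge> k \<Longrightarrow> En M p (grad (\<phi> n)) < 2 powr p"
      by (auto simp: eventually_sequentially)
    note [measurable] = sob_measurable[OF s]
    have 1: "integrable M (\<lambda>x. \<bar>\<phi> (n + k) x\<bar> powr q)" for n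
      using test_memLp(1)[OF \<phi>(1) q] by (simp add: memLp_def)
    have 2: "(LINT x|M. \<bar>\<phi> (n + k) x\<bar> powr q) \<le> 2 powr q * C" for n
      using k[of "n + k"] by (intro test \<phi>) auto
    have 3: "AE x in M. (\<lambda>n. \<bar>\<phi> (n + k) x\<bar> powr q) \<longlonglongrightarrow> \<bar>u x\<bar> powr q"
      using \<phi>(4)
    proof eventually_elim
      case (elim x)
      show ?case using q
        by (intro tendsto_powr2[OF tendsto_rabs[OF LIMSEQ_ignore_initial_segment[OF elim]] tendsto_const]) auto
    qed
    have 4: "(\<lambda>x. \<bar>u x\<bar> powr q) \<in> borel_measurable M" by measurable
    show "integrable M (\<lambda>x. \<bar>u x\<bar> powr q)"
      by (rule fatou_bounded(1)[OF 1 _ 4 3 2 tendsto_const]) auto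
    show "(LINT x|M. \<bar>u x\<bar> powr q) \<le> 2 powr q * C"
      by (rule fatou_bounded(2)[OF 1 _ 4 3 2 tendsto_const]) auto
  qed
  show thesis
    by (rule that[of "2 powr q * C"]) (use main C(1) in \<open>auto simp: q_def\<close>)
qed

end

section \<open>Agreement of \<open>sob\<close> with the Sobolev space defined by weak
  gradients\<close>

lemma locally_integrable_onI:
  fixes f :: "'a::euclidean_space \<Rightarrow> 'b::euclidean_space"
  assumes "integrable (lebesgue_on \<Omega>) f" "\<Omega> \<in> sets lebesgue"
  shows "locally_integrable_on f \<Omega>"
  unfolding locally_integrable_on_def
proof (intro allI impI)
  fix K assume K: "compact K \<and> K \<subseteq> \<Omega>"
  then have Ks: "K \<in> sets lebesgue" by (auto simp: compact_imp_closed)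
  have "integrable lebesgue (\<lambda>x. if x \<in> \<Omega> then f x else 0)"
    using assms by (simp add: Lebesgue_Measure.integrable_restrict_UNIV)
  then have "integrable lebesgue (\<lambda>x. indicator K x *\<^sub>R (if x \<in> \<Omega> then f x else 0))"
    using Ks by (intro integrable_mult_indicator)
  moreover have "(\<lambda>x. indicator K x *\<^sub>R (if x \<in> \<Omega> then f x else 0)) = (\<lambda>x. if x \<in> K then f x else 0)"
    using K by (auto simp: fun_eq_iff indicator_def)
  ultimately show "integrable (lebesgue_on K) f"
    using Ks by (simp add: Lebesgue_Measure.integrable_restrict_UNIV)
qed

lemma has_weak_gradient_diff:
  fixes u v :: "'a::euclidean_space \<Rightarrow> real"
  assumes u: "has_weak_gradient \<Omega> u G" and v: "has_weak_gradient \<Omega> v H" and op: "open \<Omega>"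
  shows "has_weak_gradient \<Omega> (\<lambda>x. u x - v x) (\<lambda>x. G x - H x)"
  unfolding has_weak_gradient_def
proof (intro conjI ballI)
  show "locally_integrable_on (\<lambda>x. u x - v x) \<Omega>" "locally_integrable_on (\<lambda>x. G x - H x) \<Omega>"
    using u v by (auto simp: has_weak_gradient_def locally_integrable_on_def)
  fix \<phi> and b :: 'a assume \<phi>: "\<phi> \<in> test_functions \<Omega>" and b: "b \<in> Basis"
  obtain K where K: "C1c \<phi> (grad \<phi>) K" "K \<subseteq> \<Omega>" using test_C1c[OF \<phi>] by metis
  have c: "continuous_on UNIV (\<lambda>x. grad \<phi> x \<bullet> b)"
    by (intro continuous_intros test_grad_continuous[OF \<phi>])
  have cK: "compact K" using K by (simp add: C1c_def)
  have z: "grad \<phi> x \<bullet> b = 0" if "x \<notin> K" for x using C1c_grad_outside[OF K(1) that] by simp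
  have li: "locally_integrable_on u \<Omega>" "locally_integrable_on v \<Omega>"
    "locally_integrable_on (\<lambda>x. G x \<bullet> b) \<Omega>" "locally_integrable_on (\<lambda>x. H x \<bullet> b) \<Omega>"
    using u v by (auto simp: has_weak_gradient_def locally_integrable_on_def)
  note i = locally_integrable_mult[OF li(1) op c cK K(2) z] locally_integrable_mult[OF li(2) op c cK K(2) z]
    locally_integrable_mult_test[OF li(3) op \<phi>] locally_integrable_mult_test[OF li(4) op \<phi>]
  have eq: "(LINT x|lebesgue_on \<Omega>. u x * (grad \<phi> x \<bullet> b)) = - (LINT x|lebesgue_on \<Omega>. (G x \<bullet> b) * \<phi> x)"
    "(LINT x|lebesgue_on \<Omega>. v x * (grad \<phi> x \<bullet> b)) = - (LINT x|lebesgue_on \<Omega>. (H x \<bullet> b) * \<phi> x)"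
    using u v \<phi> b by (auto simp: has_weak_gradient_def grad_inner_Basis)
  show "(LINT x|lebesgue_on \<Omega>. (u x - v x) * frechet_derivative \<phi> (at x) b) =
      - (LINT x|lebesgue_on \<Omega>. ((G x - H x) \<bullet> b) * \<phi> x)"
    unfolding grad_inner_Basis[OF b, symmetric]
    using i eq by (simp add: left_diff_distrib inner_diff_left)
qed

context sobolev_domain
begin

text \<open>Splitting at the level \<open>\<delta>\<close>. Integrated over a domain of finite
  measure, it turns small p-energy into small L^1 norm.\<close>

lemma norm_le_powr: "0 < \<delta> \<Longrightarrow> norm v \<le> \<delta> + \<delta> powr (1 - p) * norm v powr p"
proof (cases "norm v \<le> \<delta>")
  case False
  assume "0 < \<delta>"
  have "norm v = norm v powr (1 - p) * norm v powr p"
    using False \<open>0 < \<delta>\<close> by (simp flip: powr_add)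
  also have "\<dots> \<le> \<delta> powr (1 - p) * norm v powr p"
    using False \<open>0 < \<delta>\<close> p0 by (intro mult_right_mono powr_mono2') auto
  finally show ?thesis using \<open>0 < \<delta>\<close> by simp
qed (simp add: add_increasing2)

lemma memLp_imp_integrable:
  assumes "memLp M p f"
  shows "integrable M f"
proof (rule Bochner_Integration.integrable_bound)
  show "integrable M (\<lambda>x. 1 + norm (f x) powr p)"
    using assms integrable_const_M[of 1] by (auto simp: memLp_def)
  show "AE x in M. norm (f x) \<le> norm (1 + norm (f x) powr p)"
    using norm_le_powr[of 1] by (intro AE_I2) (simp add: add_nonneg_nonneg)
qed (use assms in \<open>simp add: memLp_def\<close>)

lemma L1_tendsto:
  fixes f :: "nat \<Rightarrow> 'a \<Rightarrow> 'b::euclidean_space"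
  assumes "\<And>n. memLp M p (f n)" "memLp M p g" "(\<lambda>n. En M p (\<lambda>x. f n x - g x)) \<longlonglongrightarrow> 0"
  shows "(\<lambda>n. LINT x|M. norm (f n x - g x)) \<longlonglongrightarrow> 0"
proof (rule LIMSEQ_I)
  fix e :: real assume e: "e > 0"
  define \<delta> where "\<delta> = e / (2 * (measure M (space M) + 1))"
  have mpos: "measure M (space M) + 1 > 0" by (simp add: add_nonneg_pos)
  have \<delta>: "\<delta> > 0" using e mpos by (simp add: \<delta>_def)
  have \<delta>m: "\<delta> * measure M (space M) \<le> e / 2"
  proof -
    have "\<delta> * measure M (space M) \<le> \<delta> * (measure M (space M) + 1)" using \<delta> by simp
    also have "\<dots> = e / 2" using mpos by (simp add: \<delta>_def divide_simps)
    finally show ?thesis .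
  qed
  have "(\<lambda>n. \<delta> powr (1 - p) * En M p (\<lambda>x. f n x - g x)) \<longlonglongrightarrow> 0"
    using tendsto_mult_left[OF assms(3), of "\<delta> powr (1 - p)"] by simp
  then have "\<forall>\<^sub>F n in sequentially. \<delta> powr (1 - p) * En M p (\<lambda>x. f n x - g x) < e / 2"
    using e by (intro order_tendstoD) auto
  then obtain k where k: "\<And>n. n \<ge> k \<Longrightarrow> \<delta> powr (1 - p) * En M p (\<lambda>x. f n x - g x) < e / 2"
    by (auto simp: eventually_sequentially)
  show "\<exists>no. \<forall>n\<ge>no. norm ((LINT x|M. norm (f n x - g x)) - 0) < e"
  proof (intro exI allI impI)
    fix n assume n: "n \<ge> k"
    have d: "memLp M p (\<lambda>x. f n x - g x)" using assms p0 by (intro memLp_diff) auto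
    have i: "integrable M (\<lambda>x. \<delta> powr (1 - p) * norm (f n x - g x) powr p)"
      using memLp_integrable[OF d] by simp
    have "(LINT x|M. norm (f n x - g x)) \<le> (LINT x|M. \<delta> + \<delta> powr (1 - p) * norm (f n x - g x) powr p)"
      using integrable_const_M[of \<delta>] i norm_le_powr[OF \<delta>] memLp_imp_integrable[OF d]
      by (intro integral_mono) auto
    also have "\<dots> = (LINT x|M. \<delta>) + (LINT x|M. \<delta> powr (1 - p) * norm (f n x - g x) powr p)"
      by (rule Bochner_Integration.integral_add[OF integrable_const_M i])
    also have "\<dots> = \<delta> * measure M (space M) + \<delta> powr (1 - p) * En M p (\<lambda>x. f n x - g x)"
      by (simp add: En_def mult.commute)
    also have "\<dots> < e" using k[OF n] \<delta>m by linarith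
    finally show "norm ((LINT x|M. norm (f n x - g x)) - 0) < e" by simp
  qed
qed

lemma integral_mult_tendsto:
  fixes f :: "nat \<Rightarrow> 'a \<Rightarrow> real"
  assumes f: "\<And>n. memLp M p (f n)" and g: "memLp M p g" and lim: "(\<lambda>n. En M p (\<lambda>x. f n x - g x)) \<longlonglongrightarrow> 0"
    and [measurable]: "\<psi> \<in> borel_measurable M" and B: "\<And>x. \<bar>\<psi> x\<bar> \<le> B"
  shows "(\<lambda>n. LINT x|M. f n x * \<psi> x) \<longlonglongrightarrow> (LINT x|M. g x * \<psi> x)"
proof -
  have B0: "0 \<le> B" using B[of undefined] by linarith
  note i = integrable_mult_bounded[OF memLp_imp_integrable _ B]
  have "(\<lambda>n. (LINT x|M. f n x * \<psi> x) - (LINT x|M. g x * \<psi> x)) \<longlonglongrightarrow> 0"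
  proof (rule Lim_null_comparison)
    show "(\<lambda>n. B * (LINT x|M. norm (f n x - g x))) \<longlonglongrightarrow> 0"
      using tendsto_mult_left[OF L1_tendsto[OF f g lim], of B] by simp
    show "\<forall>\<^sub>F n in sequentially. norm ((LINT x|M. f n x * \<psi> x) - (LINT x|M. g x * \<psi> x)) \<le> B * (LINT x|M. norm (f n x - g x))"
    proof (intro always_eventually allI)
      fix n
      have d: "memLp M p (\<lambda>x. f n x - g x)" using f g p0 by (intro memLp_diff) auto
      have "(LINT x|M. f n x * \<psi> x) - (LINT x|M. g x * \<psi> x) = (LINT x|M. (f n x - g x) * \<psi> x)"
        using i[OF f] i[OF g] by (simp add: left_diff_distrib)
      also have "norm \<dots> \<le> (LINT x|M. norm ((f n x - g x) * \<psi> x))" by (rule integral_norm_bound)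
      also have "\<dots> \<le> (LINT x|M. B * norm (f n x - g x))"
      proof (rule integral_mono)
        show "integrable M (\<lambda>x. norm ((f n x - g x) * \<psi> x))" using i[OF d] by (rule integrable_norm) auto
        show "integrable M (\<lambda>x. B * norm (f n x - g x))" using memLp_imp_integrable[OF d] by auto
        show "norm ((f n x - g x) * \<psi> x) \<le> B * norm (f n x - g x)" for x
          using mult_left_mono[OF B[of x], of "\<bar>f n x - g x\<bar>"] by (simp add: abs_mult mult.commute)
      qed
      finally show "norm ((LINT x|M. f n x * \<psi> x) - (LINT x|M. g x * \<psi> x)) \<le> B * (LINT x|M. norm (f n x - g x))"
        by simp
    qed
  qed
  then show ?thesis by (simp add: LIM_zero_iff)
qed

text \<open>The approximating test functions satisfy the integration by parts formula; both sides
  converge because values and gradients converge in L^1 and the multipliers from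
  \<open>\<phi>\<close> are bounded.\<close>

lemma sob_has_weak_gradient:
  assumes s: "sob u G"
  shows "has_weak_gradient \<Omega> u G"
  unfolding has_weak_gradient_def
proof (intro conjI ballI)
  show "locally_integrable_on u \<Omega>" "locally_integrable_on G \<Omega>"
    using memLp_imp_integrable sob_memLp[OF s] by (auto intro!: locally_integrable_onI)
  fix \<phi> and b :: 'a assume \<phi>: "\<phi> \<in> test_functions \<Omega>" and b: "b \<in> Basis"
  obtain u' :: "nat \<Rightarrow> 'a \<Rightarrow> real" where u': "\<And>n. u' n \<in> test_functions \<Omega>"
    "(\<lambda>n. En M p (\<lambda>x. u' n x - u x)) \<longlonglongrightarrow> 0" "(\<lambda>n. En M p (\<lambda>x. grad (u' n) x - G x)) \<longlonglongrightarrow> 0"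
    by (rule sob_sequence[OF s]) (rule that)
  obtain K where K: "C1c \<phi> (grad \<phi>) K" "K \<subseteq> \<Omega>" using test_C1c[OF \<phi>] by metis
  note [measurable] = C1c_measurable[OF K(1)] C1c_grad_measurable[OF K(1)]
  obtain B1 where B1: "\<And>x. norm (\<phi> x) \<le> B1"
    using compact_support_bounded[OF C1c_continuous[OF K(1)], of K] K unfolding C1c_def by metis
  obtain B2 where B2: "\<And>x. norm (grad \<phi> x) \<le> B2"
    using compact_support_bounded[of "grad \<phi>" K] K C1c_grad_outside[OF K(1)] unfolding C1c_def by metis
  have B2': "\<bar>grad \<phi> x \<bullet> b\<bar> \<le> B2" for x
    using B2[of x] Basis_le_norm[OF b, of "grad \<phi> x"] by linarith
  have "(\<lambda>n. LINT x|M. u' n x * (grad \<phi> x \<bullet> b)) \<longlonglongrightarrow> (LINT x|M. u x * (grad \<phi> x \<bullet> b))"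
    by (rule integral_mult_tendsto[OF test_memLp(1)[OF u'(1) p0(2)] sob_memLp(1)[OF s] u'(2) _ B2'])
      (auto intro!: borel_imp_M)
  moreover have "(\<lambda>n. LINT x|M. (grad (u' n) x \<bullet> b) * \<phi> x) \<longlonglongrightarrow> (LINT x|M. (G x \<bullet> b) * \<phi> x)"
  proof (rule integral_mult_tendsto[where B = B1])
    have le: "norm (v \<bullet> b) \<le> 1 * norm v" for v :: 'a using Basis_le_norm[OF b, of v] by simp
    have inn: "memLp M p (\<lambda>x. F x \<bullet> b)" if "memLp M p F" for F :: "'a \<Rightarrow> 'a"
      by (rule memLp_bound[OF that _ p0(1), of _ 1]) (use that le in \<open>auto simp: memLp_def\<close>)
    show "memLp M p (\<lambda>x. grad (u' n) x \<bullet> b)" for n by (intro inn test_memLp u' p0)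
    show "memLp M p (\<lambda>x. G x \<bullet> b)" by (intro inn sob_memLp[OF s])
    show "(\<lambda>n. En M p (\<lambda>x. grad (u' n) x \<bullet> b - G x \<bullet> b)) \<longlonglongrightarrow> 0"
    proof (rule tendsto_sandwich[OF always_eventually always_eventually tendsto_const u'(3)])
      show "\<forall>n. En M p (\<lambda>x. grad (u' n) x \<bullet> b - G x \<bullet> b) \<le> En M p (\<lambda>x. grad (u' n) x - G x)"
      proof
        fix n
        have d: "memLp M p (\<lambda>x. grad (u' n) x - G x)"
          by (intro memLp_diff test_memLp u' p0 sob_memLp[OF s])
        show "En M p (\<lambda>x. grad (u' n) x \<bullet> b - G x \<bullet> b) \<le> En M p (\<lambda>x. grad (u' n) x - G x)"
          unfolding inner_diff_left[symmetric] using le by (intro En_mono d inn p0) auto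
      qed
    qed simp
    show "\<bar>\<phi> x\<bar> \<le> B1" for x using B1[of x] by simp
  qed (auto intro!: borel_imp_M)
  ultimately have lim: "(\<lambda>n. LINT x|M. u' n x * (grad \<phi> x \<bullet> b)) \<longlonglongrightarrow> (LINT x|M. u x * (grad \<phi> x \<bullet> b))"
    "(\<lambda>n. LINT x|M. (grad (u' n) x \<bullet> b) * \<phi> x) \<longlonglongrightarrow> (LINT x|M. (G x \<bullet> b) * \<phi> x)"
    by blast+
  have "(LINT x|M. u x * (grad \<phi> x \<bullet> b)) = - (LINT x|M. (G x \<bullet> b) * \<phi> x)"
    by (rule LIMSEQ_unique[OF lim(1)[unfolded test_integration_by_parts[OF u'(1) \<phi> open_domain]] tendsto_minus[OF lim(2)]])
  then show "(LINT x|M. u x * frechet_derivative \<phi> (at x) b) = - (LINT x|M. (G x \<bullet> b) * \<phi> x)"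
    unfolding grad_inner_Basis[OF b] by simp
qed

lemma weak_grad_AE:
  assumes "has_weak_gradient \<Omega> u G"
  shows "has_weak_gradient \<Omega> u (weak_grad \<Omega> u)" "AE x in M. G x = weak_grad \<Omega> u x"
proof -
  show 1: "has_weak_gradient \<Omega> u (weak_grad \<Omega> u)"
    unfolding weak_grad_def by (rule someI[of "has_weak_gradient \<Omega> u", OF assms])
  show "AE x in M. G x = weak_grad \<Omega> u x"
    by (rule has_weak_gradient_unique[OF assms 1 open_domain])
qed

lemma Lp_iff_memLp: "f \<in> Lp \<Omega> r \<longleftrightarrow> memLp M r f"
  by (simp add: Lp_def memLp_def)

lemma weak_grad_measurable:
  assumes "has_weak_gradient \<Omega> u G" "G \<in> borel_measurable M"
  shows "weak_grad \<Omega> u \<in> borel_measurable M"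
  by (rule borel_measurable_lebesgue_on_AE[OF assms(2) weak_grad_AE(2)[OF assms(1)]]) simp

lemma W1_norm_eq:
  assumes "has_weak_gradient \<Omega> u G" "G \<in> borel_measurable M"
  shows "W1_norm \<Omega> p u = (En M p u + En M p G) powr (1 / p)"
  unfolding W1_norm_def
  using En_cong_AE[OF assms(2) weak_grad_measurable[OF assms] weak_grad_AE(2)[OF assms(1)], of p]
  by (simp add: En_def)

lemma root_less_iff: "0 \<le> s \<Longrightarrow> 0 < e \<Longrightarrow> s powr (1 / p) < e \<longleftrightarrow> s < e powr p"
proof -
  assume s: "0 \<le> s" and e: "0 < e"
  have "s powr (1 / p) < e \<longleftrightarrow> s powr (1 / p) < (e powr p) powr (1 / p)"
    using e p0 by (simp add: powr_powr)
  also have "\<dots> \<longleftrightarrow> s < e powr p"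
    using s p0 powr_less_mono2[of "1 / p" s "e powr p"] powr_mono2[of "1 / p" "e powr p" s]
    by (metis divide_pos_pos less_imp_le not_less powr_ge_zero zero_less_one)
  finally show ?thesis .
qed

lemma sob_imp_W1_0:
  assumes s: "sob u G"
  shows "u \<in> W1_0 \<Omega> p" "AE x in M. G x = weak_grad \<Omega> u x"
proof -
  note hw = sob_has_weak_gradient[OF s]
  show ae: "AE x in M. G x = weak_grad \<Omega> u x" by (rule weak_grad_AE(2)[OF hw])
  have "memLp M p (weak_grad \<Omega> u)"
    using memLp_cong_AE[OF sob_measurable(2)[OF s] weak_grad_measurable[OF hw sob_measurable(2)[OF s]] ae]
      sob_memLp(2)[OF s] by blast
  then have W1: "u \<in> W1 \<Omega> p"
    using sob_memLp(1)[OF s] hw by (auto simp: W1_def Lp_iff_memLp)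
  have "\<exists>\<phi>\<in>test_functions \<Omega>. W1_norm \<Omega> p (\<lambda>x. u x - \<phi> x) < \<epsilon>" if \<epsilon>: "\<epsilon> > 0" for \<epsilon>
  proof -
    obtain \<phi> where \<phi>: "\<phi> \<in> test_functions \<Omega>"
      "En M p (\<lambda>x. u x - \<phi> x) + En M p (\<lambda>x. G x - grad \<phi> x) < \<epsilon> powr p"
      using s \<epsilon> unfolding sob_def by (metis powr_gt_zero less_irrefl)
    note sd = sob_diff[OF s sob_test[OF \<phi>(1)]]
    have "W1_norm \<Omega> p (\<lambda>x. u x - \<phi> x) < \<epsilon>"
      unfolding W1_norm_eq[OF sob_has_weak_gradient[OF sd] sob_measurable(2)[OF sd]]
      using \<phi>(2) \<epsilon> by (subst root_less_iff) auto
    then show ?thesis using \<phi>(1) by blast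
  qed
  then show "u \<in> W1_0 \<Omega> p" using W1 by (simp add: W1_0_def)
qed

text \<open>The converse inclusion, with the chosen gradient. It allows an arbitrary test function
  from the definition of weak solutions to be inserted into the Euler-Lagrange equation.\<close>

lemma W1_0_imp_sob:
  assumes "u \<in> W1_0 \<Omega> p"
  shows "sob u (weak_grad \<Omega> u)"
  unfolding sob_def
proof (intro conjI allI impI)
  have W1: "u \<in> W1 \<Omega> p" and d: "\<And>\<epsilon>. \<epsilon> > 0 \<Longrightarrow> \<exists>\<phi>\<in>test_functions \<Omega>. W1_norm \<Omega> p (\<lambda>x. u x - \<phi> x) < \<epsilon>"
    using assms by (auto simp: W1_0_def)
  show m: "memLp M p u" "memLp M p (weak_grad \<Omega> u)"
    using W1 by (auto simp: W1_def Lp_iff_memLp)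
  obtain G where "has_weak_gradient \<Omega> u G" using W1 by (auto simp: W1_def)
  then have hw: "has_weak_gradient \<Omega> u (weak_grad \<Omega> u)" by (rule weak_grad_AE)
  fix \<epsilon> :: real assume \<epsilon>: "\<epsilon> > 0"
  obtain \<phi> where \<phi>: "\<phi> \<in> test_functions \<Omega>" "W1_norm \<Omega> p (\<lambda>x. u x - \<phi> x) < \<epsilon> powr (1 / p)"
    using d[of "\<epsilon> powr (1 / p)"] \<epsilon> by auto
  have hd: "has_weak_gradient \<Omega> (\<lambda>x. u x - \<phi> x) (\<lambda>x. weak_grad \<Omega> u x - grad \<phi> x)"
    by (rule has_weak_gradient_diff[OF hw sob_has_weak_gradient[OF sob_test[OF \<phi>(1)]] open_domain])
  have "(\<lambda>x. weak_grad \<Omega> u x - grad \<phi> x) \<in> borel_measurable M"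
    using memLp_measurable[OF m(2)] sob_measurable(2)[OF sob_test[OF \<phi>(1)]] by simp
  from W1_norm_eq[OF hd this] \<phi>(2)
  have "(En M p (\<lambda>x. u x - \<phi> x) + En M p (\<lambda>x. weak_grad \<Omega> u x - grad \<phi> x)) powr (1 / p) < \<epsilon> powr (1 / p)"
    by simp
  then have "En M p (\<lambda>x. u x - \<phi> x) + En M p (\<lambda>x. weak_grad \<Omega> u x - grad \<phi> x) < (\<epsilon> powr (1 / p)) powr p"
    using \<epsilon> by (subst (asm) root_less_iff) auto
  then have "En M p (\<lambda>x. u x - \<phi> x) + En M p (\<lambda>x. weak_grad \<Omega> u x - grad \<phi> x) < \<epsilon>"
    using \<epsilon> p0 by (simp add: powr_powr)
  then show "\<exists>\<phi>\<in>test_functions \<Omega>. En M p (\<lambda>x. u x - \<phi> x) + En M p (\<lambda>x. weak_grad \<Omega> u x - grad \<phi> x) < \<epsilon>"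
    using \<phi>(1) by blast
qed

end

section \<open>Chain rules\<close>

lemma primitive_sum_powers:
  fixes c :: "nat \<Rightarrow> real"
  shows "((\<lambda>s. \<Sum>i\<le>n. c i / real (Suc i) * s ^ Suc i) has_real_derivative (\<Sum>i\<le>n. c i * s ^ i)) (at s)"
proof -
  have "((\<lambda>s. c i / real (Suc i) * s ^ Suc i) has_real_derivative c i * s ^ i) (at s)" for i
  proof -
    have "((\<lambda>s. c i / real (Suc i) * s ^ Suc i) has_real_derivative c i / real (Suc i) * (real (Suc i) * s ^ i)) (at s)"
      using DERIV_pow[of "Suc i" s UNIV] by (intro DERIV_cmult) simp
    moreover have "c i / real (Suc i) * (real (Suc i) * s ^ i) = c i * s ^ i"
      by (simp add: divide_simps del: of_nat_Suc)
    ultimately show ?thesis by simp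
  qed
  then show ?thesis by (intro DERIV_sum)
qed

lemma real_deriv_bounded_diff:
  fixes f :: "real \<Rightarrow> real"
  assumes "\<And>s. (f has_real_derivative f' s) (at s)" "\<And>s. s \<in> {-B..B} \<Longrightarrow> \<bar>f' s\<bar> \<le> L" "x \<in> {-B..B}" "f 0 = 0"
  shows "\<bar>f x\<bar> \<le> L * \<bar>x\<bar>"
proof -
  have "0 \<in> {-B..B}" using assms(3) by auto
  have "norm (f x - f 0) \<le> L * norm (x - 0)"
    by (rule field_differentiable_bound[of "{-B..B}" f f'])
      (use assms \<open>0 \<in> {-B..B}\<close> in \<open>auto intro: has_field_derivative_at_within\<close>)
  then show ?thesis using assms(4) by simp
qed

lemma real_deriv_lipschitz:
  fixes f :: "real \<Rightarrow> real"
  assumes "\<And>s. (f has_real_derivative f' s) (at s)" "\<And>s. \<bar>f' s\<bar> \<le> L"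
  shows "\<bar>f x - f y\<bar> \<le> L * \<bar>x - y\<bar>"
proof -
  have "norm (f x - f y) \<le> L * norm (x - y)"
    by (rule field_differentiable_bound[of UNIV f f']) (use assms in auto)
  then show ?thesis by simp
qed

lemma En_tendsto_zero_scaled:
  fixes d :: "nat \<Rightarrow> 'x \<Rightarrow> 'b::euclidean_space" and h :: "'x \<Rightarrow> 'c::euclidean_space"
  assumes m: "\<And>n. d n \<in> borel_measurable M" and h: "memLp M p h" and p: "0 < p"
    and b: "\<And>n. AE x in M. norm (d n x) \<le> e n * norm (h x)" and e: "\<And>n. 0 \<le> e n" "e \<longlonglongrightarrow> 0"
  shows "(\<lambda>n. En M p (d n)) \<longlonglongrightarrow> 0"
proof (rule tendsto_sandwich[OF always_eventually always_eventually tendsto_const])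
  have "(\<lambda>n. e n powr p * En M p h) \<longlonglongrightarrow> 0 powr p * En M p h"
    using p e by (intro tendsto_mult tendsto_powr2 tendsto_const) auto
  then show "(\<lambda>n. e n powr p * En M p h) \<longlonglongrightarrow> 0" using p by simp
  show "\<forall>n. En M p (d n) \<le> e n powr p * En M p h"
  proof
    fix n
    have s: "memLp M p (\<lambda>x. e n *\<^sub>R h x)" by (rule memLp_scaleR[OF h less_imp_le[OF p]])
    have n: "AE x in M. norm (d n x) \<le> 1 * norm (e n *\<^sub>R h x)"
      using b[of n] e(1)[of n] by simp
    have "En M p (d n) \<le> En M p (\<lambda>x. e n *\<^sub>R h x)"
      by (rule En_mono[OF s memLp_bound[OF s m less_imp_le[OF p] n] less_imp_le[OF p]]) (use n in simp)
    also have "\<dots> = e n powr p * En M p h"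
      using e(1)[of n] p by (simp add: En_scaleR)
    finally show "En M p (d n) \<le> e n powr p * En M p h" .
  qed
qed simp

context sobolev_domain
begin

lemma memLp_const: "memLp M p (\<lambda>x. c::real)"
  using integrable_const_M by (auto simp: memLp_def)

text \<open>Replacing \<open>\<Phi>'\<close> by approximating polynomials keeps the composition a test function.\<close>

lemma sob_chain_test:
  assumes \<phi>: "\<phi> \<in> test_functions \<Omega>"
    and \<Phi>: "\<And>s. (\<Phi> has_real_derivative \<Phi>' s) (at s)" "continuous_on UNIV \<Phi>'" "\<Phi> 0 = 0"
  shows "sob (\<lambda>x. \<Phi> (\<phi> x)) (\<lambda>x. \<Phi>' (\<phi> x) *\<^sub>R grad \<phi> x)"
proof -
  obtain K where K: "C1c \<phi> (grad \<phi>) K" "K \<subseteq> \<Omega>" using test_C1c[OF \<phi>] by metis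
  note C = C1c_compose[OF K(1) \<Phi>]
  obtain B where B: "\<And>x. norm (\<phi> x) \<le> B"
    using compact_support_bounded[OF C1c_continuous[OF K(1)], of K] K unfolding C1c_def by metis
  have \<phi>B: "\<phi> x \<in> {-B..B}" for x using B[of x] by auto
  define e where "e n = 1 / real (Suc n)" for n
  have e: "e n > 0" for n by (simp add: e_def)
  \<comment> \<open>The derivative is approximated rather than \<open>\<Phi>\<close> itself: that
    controls the gradients, and integration from 0 then controls the values.\<close>
  have "\<exists>g. real_polynomial_function g \<and> (\<forall>s\<in>{-B..B}. \<bar>\<Phi>' s - g s\<bar> < e n)" for n
    using Stone_Weierstrass_real_polynomial_function[of "{-B..B}" \<Phi>' "e n"] e \<Phi>(2)
    by (metis compact_Icc continuous_on_subset top_greatest)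
  then obtain g where g: "\<And>n. real_polynomial_function (g n)" "\<And>n s. s \<in> {-B..B} \<Longrightarrow> \<bar>\<Phi>' s - g n s\<bar> < e n"
    by metis
  have "\<exists>a d. g n = (\<lambda>s. \<Sum>i\<le>d. a i * s ^ i)" for n
    using g(1)[of n] real_polynomial_function_iff_sum by blast
  then obtain a d where ad: "\<And>n. g n = (\<lambda>s. \<Sum>i\<le>d n. a n i * s ^ i)" by metis
  \<comment> \<open>The primitive without constant term: composed with \<open>\<phi>\<close> it
    contains only positive powers, so the compact support is preserved.\<close>
  define P where "P n s = (\<Sum>i\<le>d n. a n i / real (Suc i) * s ^ Suc i)" for n s
  have Pd: "(P n has_real_derivative g n s) (at s)" for n s
    unfolding P_def[abs_def] ad by (rule primitive_sum_powers)
  have P0: "P n 0 = 0" for n by (simp add: P_def)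
  have Ptest: "(\<lambda>x. P n (\<phi> x)) \<in> test_functions \<Omega>" for n
    unfolding P_def by (intro test_sum test_cmult test_power_Suc \<phi>)
  have Pgrad: "grad (\<lambda>x. P n (\<phi> x)) = (\<lambda>x. g n (\<phi> x) *\<^sub>R grad \<phi> x)" for n
  proof
    fix x
    show "grad (\<lambda>x. P n (\<phi> x)) x = g n (\<phi> x) *\<^sub>R grad \<phi> x"
      using has_derivative_compose[OF test_has_derivative[OF \<phi>, of x] Pd[of n "\<phi> x", unfolded has_field_derivative_def]]
      by (intro grad_eqI) simp
  qed
  have e0: "e \<longlonglongrightarrow> 0" unfolding e_def[abs_def] by (rule LIMSEQ_Suc[OF lim_1_over_n])
  have mC: "memLp M p (\<lambda>x. \<Phi> (\<phi> x))" "memLp M p (\<lambda>x. \<Phi>' (\<phi> x) *\<^sub>R grad \<phi> x)"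
  proof -
    have z: "\<Phi> (\<phi> x) = 0" "\<Phi>' (\<phi> x) *\<^sub>R grad \<phi> x = 0" if "x \<notin> \<Omega>" for x
      using C1c_grad_outside[OF C] C K(2) that by (auto simp: C1c_def)
    note [measurable] = C1c_measurable[OF C] C1c_grad_measurable[OF C]
    show "memLp M p (\<lambda>x. \<Phi> (\<phi> x))"
      using C1c_powr_integrable(2)[OF C p0(2)] p0 z
      by (auto simp: memLp_def intro!: lebesgue_on_vanishing_outside(1)[THEN iffD2] borel_imp_M)
    have "integrable M (\<lambda>x. norm (\<Phi>' (\<phi> x) *\<^sub>R grad \<phi> x) powr p)"
      using z(2) p0 C1c_powr_integrable(1)[OF C p0(2)]
      by (intro lebesgue_on_vanishing_outside(1)[THEN iffD2]) auto
    then show "memLp M p (\<lambda>x. \<Phi>' (\<phi> x) *\<^sub>R grad \<phi> x)"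
      unfolding memLp_def using C1c_grad_measurable[OF C] by (auto intro: borel_imp_M)
  qed
  have diffb: "\<bar>P n s - \<Phi> s\<bar> \<le> e n * B" if s: "s \<in> {-B..B}" for n s
  proof -
    have "\<bar>P n s - \<Phi> s\<bar> \<le> e n * \<bar>s\<bar>"
    proof (rule real_deriv_bounded_diff[where f = "\<lambda>s. P n s - \<Phi> s" and f' = "\<lambda>s. g n s - \<Phi>' s"])
      show "((\<lambda>s. P n s - \<Phi> s) has_real_derivative g n s - \<Phi>' s) (at s)" for s
        by (intro DERIV_diff Pd \<Phi>)
      show "\<bar>g n s - \<Phi>' s\<bar> \<le> e n" if "s \<in> {-B..B}" for s
        using g(2)[OF that, of n] by (simp add: abs_minus_commute)
    qed (use s P0 \<Phi>(3) in auto)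
    also have "\<dots> \<le> e n * B" using s e[of n] by (intro mult_left_mono) auto
    finally show ?thesis .
  qed
  show ?thesis
  proof (rule sob_closed)
    show "sob (\<lambda>x. P n (\<phi> x)) (\<lambda>x. g n (\<phi> x) *\<^sub>R grad \<phi> x)" for n
      using sob_test[OF Ptest[of n]] by (simp add: Pgrad)
    show "(\<lambda>n. En M p (\<lambda>x. P n (\<phi> x) - \<Phi> (\<phi> x))) \<longlonglongrightarrow> 0"
    proof (rule En_tendsto_zero_scaled[where h = "\<lambda>x. B" and e = e])
      show "(\<lambda>x. P n (\<phi> x) - \<Phi> (\<phi> x)) \<in> borel_measurable M" for n
        using sob_measurable(1)[OF sob_test[OF Ptest]] memLp_measurable[OF mC(1)]
        by (rule borel_measurable_diff)
      show "AE x in M. norm (P n (\<phi> x) - \<Phi> (\<phi> x)) \<le> e n * norm B" for n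
        using diffb[OF \<phi>B, of n] mult_left_mono[OF abs_ge_self[of B] less_imp_le[OF e[of n]]]
        by (intro AE_I2) (simp only: real_norm_def, meson order_trans)
    qed (use p0 memLp_const e0 e in \<open>auto simp: less_imp_le\<close>)
    show "(\<lambda>n. En M p (\<lambda>x. g n (\<phi> x) *\<^sub>R grad \<phi> x - \<Phi>' (\<phi> x) *\<^sub>R grad \<phi> x)) \<longlonglongrightarrow> 0"
    proof (rule En_tendsto_zero_scaled[where h = "grad \<phi>" and e = e])
      show "(\<lambda>x. g n (\<phi> x) *\<^sub>R grad \<phi> x - \<Phi>' (\<phi> x) *\<^sub>R grad \<phi> x) \<in> borel_measurable M" for n
        using sob_measurable(2)[OF sob_test[OF Ptest[of n]], unfolded Pgrad] memLp_measurable[OF mC(2)]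
        by (rule borel_measurable_diff)
      show "AE x in M. norm (g n (\<phi> x) *\<^sub>R grad \<phi> x - \<Phi>' (\<phi> x) *\<^sub>R grad \<phi> x) \<le> e n * norm (grad \<phi> x)" for n
      proof (rule AE_I2)
        fix x
        have "\<bar>g n (\<phi> x) - \<Phi>' (\<phi> x)\<bar> \<le> e n"
          using g(2)[OF \<phi>B[of x], of n] by (simp add: abs_minus_commute)
        then show "norm (g n (\<phi> x) *\<^sub>R grad \<phi> x - \<Phi>' (\<phi> x) *\<^sub>R grad \<phi> x) \<le> e n * norm (grad \<phi> x)"
          unfolding scaleR_left_diff_distrib[symmetric] norm_scaleR by (intro mult_right_mono) auto
      qed
    qed (use p0 test_memLp[OF \<phi>] e0 e in \<open>auto simp: less_imp_le\<close>)
  qed (rule mC)+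
qed

text \<open>The gradient error splits into two: the bounded factor \<open>\<Phi>'\<close> times the
  error of the gradients, and the change of that factor times the fixed G, which is dominated by L
  |G| and tends to 0 pointwise.\<close>

lemma sob_chain_C1:
  assumes s: "sob u G"
    and \<Phi>: "\<And>s. (\<Phi> has_real_derivative \<Phi>' s) (at s)" "continuous_on UNIV \<Phi>'" "\<Phi> 0 = 0"
    and L: "\<And>s. \<bar>\<Phi>' s\<bar> \<le> L"
  shows "sob (\<lambda>x. \<Phi> (u x)) (\<lambda>x. \<Phi>' (u x) *\<^sub>R G x)"
proof -
  have L0: "0 \<le> L" using L[of 0] by linarith
  obtain \<phi> :: "nat \<Rightarrow> 'a \<Rightarrow> real" where \<phi>: "\<And>n. \<phi> n \<in> test_functions \<Omega>"
    "(\<lambda>n. En M p (\<lambda>x. \<phi> n x - u x)) \<longlonglongrightarrow> 0" "(\<lambda>n. En M p (\<lambda>x. grad (\<phi> n) x - G x)) \<longlonglongrightarrow> 0"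
    "AE x in M. (\<lambda>n. \<phi> n x) \<longlonglongrightarrow> u x"
    by (rule sob_sequence[OF s]) (rule that)
  have \<Phi>c: "continuous_on UNIV \<Phi>"
    using \<Phi>(1) by (auto intro!: DERIV_continuous_on[of UNIV \<Phi> \<Phi>'] simp: has_field_derivative_at_within)
  have [measurable]: "\<Phi> \<in> borel_measurable borel" "\<Phi>' \<in> borel_measurable borel"
    using \<Phi>c \<Phi>(2) by (auto intro: borel_measurable_continuous_onI)
  note [measurable] = sob_measurable[OF s] sob_measurable[OF sob_test[OF \<phi>(1)]]
  have lip: "\<bar>\<Phi> a - \<Phi> b\<bar> \<le> L * \<bar>a - b\<bar>" for a b
    by (rule real_deriv_lipschitz[OF \<Phi>(1) L])
  have m1: "memLp M p (\<lambda>x. \<Phi> (u x))"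
    by (rule memLp_bound[OF sob_memLp(1)[OF s] _ p0(1), of _ L]) (use lip[of _ 0] \<Phi>(3) in auto)
  have m2: "memLp M p (\<lambda>x. \<Phi>' (u x) *\<^sub>R G x)"
    by (rule memLp_bound[OF sob_memLp(2)[OF s] _ p0(1), of _ L]) (use L in \<open>auto intro!: AE_I2 mult_right_mono\<close>)
  show ?thesis
  proof (rule sob_closed[OF sob_chain_test[OF \<phi>(1) \<Phi>] m1 m2])
    show "(\<lambda>n. En M p (\<lambda>x. \<Phi> (\<phi> n x) - \<Phi> (u x))) \<longlonglongrightarrow> 0"
    proof (rule tendsto_sandwich[OF always_eventually always_eventually tendsto_const])
      show "(\<lambda>n. L powr p * En M p (\<lambda>x. \<phi> n x - u x)) \<longlonglongrightarrow> 0"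
        using tendsto_mult_left[OF \<phi>(2), of "L powr p"] by simp
      show "\<forall>n. En M p (\<lambda>x. \<Phi> (\<phi> n x) - \<Phi> (u x)) \<le> L powr p * En M p (\<lambda>x. \<phi> n x - u x)"
      proof
        fix n
        have d: "memLp M p (\<lambda>x. L *\<^sub>R (\<phi> n x - u x))"
          by (intro memLp_scaleR memLp_diff test_memLp \<phi> p0 sob_memLp[OF s])
        have le: "AE x in M. norm (\<Phi> (\<phi> n x) - \<Phi> (u x)) \<le> 1 * norm (L *\<^sub>R (\<phi> n x - u x))"
          using lip L0 by (auto simp: abs_mult)
        have "En M p (\<lambda>x. \<Phi> (\<phi> n x) - \<Phi> (u x)) \<le> En M p (\<lambda>x. L *\<^sub>R (\<phi> n x - u x))"
          by (rule En_mono[OF d memLp_bound[OF d _ p0(1) le] p0(1)]) (use le in auto)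
        also have "\<dots> = L powr p * En M p (\<lambda>x. \<phi> n x - u x)"
          using En_scaleR[OF p0(1), of M L "\<lambda>x. \<phi> n x - u x"] L0 by simp
        finally show "En M p (\<lambda>x. \<Phi> (\<phi> n x) - \<Phi> (u x)) \<le> L powr p * En M p (\<lambda>x. \<phi> n x - u x)" .
      qed
    qed simp
    have lim2: "(\<lambda>n. En M p (\<lambda>x. \<Phi>' (\<phi> n x) *\<^sub>R G x - \<Phi>' (u x) *\<^sub>R G x)) \<longlonglongrightarrow> 0"
    proof (rule En_dominated(2)[where h = "\<lambda>x. L *\<^sub>R G x"])
      show "AE x in M. (\<lambda>n. \<Phi>' (\<phi> n x) *\<^sub>R G x) \<longlonglongrightarrow> \<Phi>' (u x) *\<^sub>R G x"
        using \<phi>(4)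
      proof eventually_elim
        case (elim x)
        have "isCont \<Phi>' (u x)" using \<Phi>(2) by (simp add: continuous_on_eq_continuous_at)
        then show ?case by (intro tendsto_scaleR isCont_tendsto_compose[OF _ elim] tendsto_const)
      qed
      show "AE x in M. norm (\<Phi>' (\<phi> n x) *\<^sub>R G x) \<le> norm (L *\<^sub>R G x)" for n
        using L L0 by (auto intro!: mult_right_mono)
      show "memLp M p (\<lambda>x. L *\<^sub>R G x)" by (intro memLp_scaleR sob_memLp[OF s] p0)
    qed (use p0 in auto)
    show "(\<lambda>n. En M p (\<lambda>x. \<Phi>' (\<phi> n x) *\<^sub>R grad (\<phi> n) x - \<Phi>' (u x) *\<^sub>R G x)) \<longlonglongrightarrow> 0"
    proof (rule tendsto_sandwich[OF always_eventually always_eventually tendsto_const])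
      let ?b = "\<lambda>n. 2 powr p * (L powr p * En M p (\<lambda>x. grad (\<phi> n) x - G x)
          + En M p (\<lambda>x. \<Phi>' (\<phi> n x) *\<^sub>R G x - \<Phi>' (u x) *\<^sub>R G x))"
      have "?b \<longlonglongrightarrow> 2 powr p * (L powr p * 0 + 0)"
        by (intro tendsto_mult tendsto_add tendsto_const \<phi>(3) lim2)
      then show "?b \<longlonglongrightarrow> 0" by simp
      show "\<forall>n. En M p (\<lambda>x. \<Phi>' (\<phi> n x) *\<^sub>R grad (\<phi> n) x - \<Phi>' (u x) *\<^sub>R G x) \<le> ?b n"
      proof
        fix n
        have d: "memLp M p (\<lambda>x. L *\<^sub>R (grad (\<phi> n) x - G x))"
          by (intro memLp_scaleR memLp_diff test_memLp \<phi> p0 sob_memLp[OF s])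
        have le: "AE x in M. norm (\<Phi>' (\<phi> n x) *\<^sub>R (grad (\<phi> n) x - G x)) \<le> 1 * norm (L *\<^sub>R (grad (\<phi> n) x - G x))"
          using L L0 by (auto intro!: mult_right_mono)
        have m3: "memLp M p (\<lambda>x. \<Phi>' (\<phi> n x) *\<^sub>R (grad (\<phi> n) x - G x))"
          by (rule memLp_bound[OF d _ p0(1) le]) auto
        have "En M p (\<lambda>x. \<Phi>' (\<phi> n x) *\<^sub>R (grad (\<phi> n) x - G x)) \<le> En M p (\<lambda>x. L *\<^sub>R (grad (\<phi> n) x - G x))"
          by (rule En_mono[OF d m3 p0(1)]) (use le in auto)
        also have "\<dots> = L powr p * En M p (\<lambda>x. grad (\<phi> n) x - G x)"
          using En_scaleR[OF p0(1), of M L] L0 by simp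
        finally have b1: "En M p (\<lambda>x. \<Phi>' (\<phi> n x) *\<^sub>R (grad (\<phi> n) x - G x)) \<le> L powr p * En M p (\<lambda>x. grad (\<phi> n) x - G x)" .
        have m4: "memLp M p (\<lambda>x. \<Phi>' (\<phi> n x) *\<^sub>R G x)"
          by (rule memLp_bound[OF sob_memLp(2)[OF s] _ p0(1), of _ L]) (use L in \<open>auto intro!: AE_I2 mult_right_mono\<close>)
        have "En M p (\<lambda>x. \<Phi>' (\<phi> n x) *\<^sub>R (grad (\<phi> n) x - G x) + (\<Phi>' (\<phi> n x) *\<^sub>R G x - \<Phi>' (u x) *\<^sub>R G x))
            \<le> 2 powr p * (En M p (\<lambda>x. \<Phi>' (\<phi> n x) *\<^sub>R (grad (\<phi> n) x - G x)) + En M p (\<lambda>x. \<Phi>' (\<phi> n x) *\<^sub>R G x - \<Phi>' (u x) *\<^sub>R G x))"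
          by (intro En_add_le m3 memLp_diff m4 m2 p0)
        also have "(\<lambda>x. \<Phi>' (\<phi> n x) *\<^sub>R (grad (\<phi> n) x - G x) + (\<Phi>' (\<phi> n x) *\<^sub>R G x - \<Phi>' (u x) *\<^sub>R G x))
            = (\<lambda>x. \<Phi>' (\<phi> n x) *\<^sub>R grad (\<phi> n) x - \<Phi>' (u x) *\<^sub>R G x)"
          by (simp add: scaleR_right_diff_distrib)
        finally have "En M p (\<lambda>x. \<Phi>' (\<phi> n x) *\<^sub>R grad (\<phi> n) x - \<Phi>' (u x) *\<^sub>R G x)
            \<le> 2 powr p * (En M p (\<lambda>x. \<Phi>' (\<phi> n x) *\<^sub>R (grad (\<phi> n) x - G x)) + En M p (\<lambda>x. \<Phi>' (\<phi> n x) *\<^sub>R G x - \<Phi>' (u x) *\<^sub>R G x))" .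
        also have "\<dots> \<le> ?b n" using b1 by (intro mult_left_mono) auto
        finally show "En M p (\<lambda>x. \<Phi>' (\<phi> n x) *\<^sub>R grad (\<phi> n) x - \<Phi>' (u x) *\<^sub>R G x) \<le> ?b n" .
      qed
    qed simp
  qed
qed

text \<open>Extends the chain rule to functions whose derivative may jump. The approximations
  prescribe the value of \<open>\<psi>\<close> at a jump, and a common Lipschitz constant provides
  the dominating functions.\<close>

lemma sob_chain_limit:
  fixes \<Phi> :: "nat \<Rightarrow> real \<Rightarrow> real"
  assumes s: "sob u G"
    and \<Phi>: "\<And>n s. (\<Phi> n has_real_derivative \<Phi>' n s) (at s)" "\<And>n. continuous_on UNIV (\<Phi>' n)" "\<And>n. \<Phi> n 0 = 0"
    and L: "\<And>n s. \<bar>\<Phi>' n s\<bar> \<le> L"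
    and lim: "\<And>s. (\<lambda>n. \<Phi> n s) \<longlonglongrightarrow> \<Psi> s" "\<And>s. (\<lambda>n. \<Phi>' n s) \<longlonglongrightarrow> \<psi> s"
  shows "sob (\<lambda>x. \<Psi> (u x)) (\<lambda>x. \<psi> (u x) *\<^sub>R G x)"
proof -
  have L0: "0 \<le> L" using L[of 0 0] by linarith
  note sn = sob_chain_C1[OF s \<Phi> L]
  have \<Phi>c: "continuous_on UNIV (\<Phi> n)" for n
    using \<Phi>(1) by (auto intro!: DERIV_continuous_on[of UNIV "\<Phi> n" "\<Phi>' n"] simp: has_field_derivative_at_within)
  have [measurable]: "\<Phi> n \<in> borel_measurable borel" "\<Phi>' n \<in> borel_measurable borel" for n
    using \<Phi>c \<Phi>(2) by (auto intro: borel_measurable_continuous_onI)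
  have [measurable]: "\<Psi> \<in> borel_measurable borel" "\<psi> \<in> borel_measurable borel"
    by (rule borel_measurable_LIMSEQ_metric[where f = \<Phi>], measurable, rule lim)
       (rule borel_measurable_LIMSEQ_metric[where f = \<Phi>'], measurable, rule lim)
  note [measurable] = sob_measurable[OF s]
  have b: "\<bar>\<Phi> n t\<bar> \<le> L * \<bar>t\<bar>" for n t
    using real_deriv_lipschitz[OF \<Phi>(1) L, of n t 0] \<Phi>(3) by simp
  note E1 = En_dominated[where f = "\<lambda>n x. \<Phi> n (u x)" and g = "\<lambda>x. \<Psi> (u x)" and h = "\<lambda>x. L *\<^sub>R u x" and M = M and p = p]
  note E2 = En_dominated[where f = "\<lambda>n x. \<Phi>' n (u x) *\<^sub>R G x" and g = "\<lambda>x. \<psi> (u x) *\<^sub>R G x" and h = "\<lambda>x. L *\<^sub>R G x" and M = M and p = p]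
  have h: "memLp M p (\<lambda>x. L *\<^sub>R u x)" "memLp M p (\<lambda>x. L *\<^sub>R G x)"
    by (intro memLp_scaleR sob_memLp[OF s] p0)+
  have b1: "AE x in M. norm (\<Phi> n (u x)) \<le> norm (L *\<^sub>R u x)" for n
    using b L0 by (auto simp: abs_mult)
  have b2: "AE x in M. norm (\<Phi>' n (u x) *\<^sub>R G x) \<le> norm (L *\<^sub>R G x)" for n
    using L L0 by (auto intro!: mult_right_mono)
  have l1: "AE x in M. (\<lambda>n. \<Phi> n (u x)) \<longlonglongrightarrow> \<Psi> (u x)" using lim by auto
  have l2: "AE x in M. (\<lambda>n. \<Phi>' n (u x) *\<^sub>R G x) \<longlonglongrightarrow> \<psi> (u x) *\<^sub>R G x"
    using lim by (auto intro!: tendsto_intros)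
  show ?thesis
    by (rule sob_closed[OF sn E1(1)[OF _ _ l1 b1 h(1) p0(2)] E2(1)[OF _ _ l2 b2 h(2) p0(2)]
          E1(2)[OF _ _ l1 b1 h(1) p0(2)] E2(2)[OF _ _ l2 b2 h(2) p0(2)]]) measurable
qed

lemma sob_excess:
  assumes s: "sob u G" and k: "0 \<le> k"
  shows "sob (\<lambda>x. max 0 (u x - k)) (\<lambda>x. if u x > k then G x else 0)"
proof -
  \<comment> \<open>The derivative of \<open>\<Phi> n\<close> is a ramp from 0 at k to 1 at k + 1 /
    (n + 1). Since it starts to the right of k, the limiting derivative is 0 at level k itself, in
    agreement with the strict inequality in the claimed gradient.\<close>
  define \<Phi> where "\<Phi> n t = real (Suc n) / 2 * ((max 0 (t - k))\<^sup>2 - (max 0 (t - (k + 1 / real (Suc n))))\<^sup>2)" for n t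
  define \<Phi>' where "\<Phi>' n t = real (Suc n) / 2 * (2 * max 0 (t - k) - 2 * max 0 (t - (k + 1 / real (Suc n))))" for n t
  have e: "(\<lambda>n. 1 / real (Suc n)) \<longlonglongrightarrow> 0" by (rule LIMSEQ_Suc[OF lim_1_over_n])
  have "sob (\<lambda>x. max 0 (u x - k)) (\<lambda>x. (if u x > k then 1 else 0) *\<^sub>R G x)"
  proof (rule sob_chain_limit[OF s, where \<Phi> = \<Phi> and \<Phi>' = \<Phi>' and L = 1])
    show "(\<Phi> n has_real_derivative \<Phi>' n t) (at t)" for n t
      unfolding \<Phi>_def[abs_def] \<Phi>'_def
      by (intro DERIV_cmult DERIV_diff max0_square_has_derivative)
    show "continuous_on UNIV (\<Phi>' n)" for n
      unfolding \<Phi>'_def[abs_def] by (intro continuous_intros)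
    show "\<Phi> n 0 = 0" for n
    proof -
      have "0 \<le> k + 1 / real (Suc n)" using k by (intro add_nonneg_nonneg) auto
      then have "max 0 (0 - (k + 1 / real (Suc n))) = 0" by (intro max_absorb1) linarith
      moreover have "max 0 (0 - k) = 0" using k by simp
      ultimately show ?thesis unfolding \<Phi>_def by simp
    qed
    have cases: "t \<le> k \<Longrightarrow> \<Phi> n t = 0 \<and> \<Phi>' n t = 0"
      "k \<le> t \<Longrightarrow> t \<le> k + 1 / real (Suc n) \<Longrightarrow> \<Phi> n t = real (Suc n) / 2 * (t - k)\<^sup>2 \<and> \<Phi>' n t = real (Suc n) * (t - k)"
      "k + 1 / real (Suc n) \<le> t \<Longrightarrow> \<Phi> n t = t - k - 1 / (2 * real (Suc n)) \<and> \<Phi>' n t = 1" for n t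
    proof -
      show "t \<le> k \<Longrightarrow> \<Phi> n t = 0 \<and> \<Phi>' n t = 0"
        by (simp add: \<Phi>_def \<Phi>'_def max_absorb1 add_increasing2 diff_le_0_iff_le order_trans[of t k])
      show "k \<le> t \<Longrightarrow> t \<le> k + 1 / real (Suc n) \<Longrightarrow> \<Phi> n t = real (Suc n) / 2 * (t - k)\<^sup>2 \<and> \<Phi>' n t = real (Suc n) * (t - k)"
        by (simp add: \<Phi>_def \<Phi>'_def max_absorb1 max_absorb2 del: of_nat_Suc)
      assume t: "k + 1 / real (Suc n) \<le> t"
      define d where "d = real (Suc n)"
      have d: "d > 0" by (simp add: d_def)
      have "k \<le> t" using t d by (smt (verit) d_def divide_pos_pos)
      then have m: "max 0 (t - k) = t - k" "max 0 (t - (k + 1 / d)) = t - k - 1 / d"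
        using t by (auto simp: d_def)
      have "\<Phi> n t = d / 2 * ((t - k)\<^sup>2 - (t - k - 1 / d)\<^sup>2)" "\<Phi>' n t = d / 2 * (2 * (t - k) - 2 * (t - k - 1 / d))"
        unfolding \<Phi>_def \<Phi>'_def d_def[symmetric] m by simp_all
      moreover have "d / 2 * ((t - k)\<^sup>2 - (t - k - 1 / d)\<^sup>2) = t - k - 1 / (2 * d)"
      proof -
        have "(t - k)\<^sup>2 - (t - k - 1 / d)\<^sup>2 = 2 * (t - k) * (1 / d) - (1 / d)\<^sup>2"
          by (simp add: power2_eq_square algebra_simps)
        then show ?thesis using d by (simp add: power2_eq_square field_simps)
      qed
      moreover have "d / 2 * (2 * (t - k) - 2 * (t - k - 1 / d)) = 1"
        using d by (simp add: field_simps)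
      ultimately show "\<Phi> n t = t - k - 1 / (2 * real (Suc n)) \<and> \<Phi>' n t = 1" by (simp add: d_def)
    qed
    have d0: "real (Suc n) > 0" for n by simp
    show "\<bar>\<Phi>' n t\<bar> \<le> 1" for n t
    proof -
      consider "t \<le> k" | "k \<le> t" "t \<le> k + 1 / real (Suc n)" | "k + 1 / real (Suc n) \<le> t" by linarith
      then show ?thesis
      proof cases
        case 2
        have "real (Suc n) * (t - k) \<le> real (Suc n) * (1 / real (Suc n))"
          using 2 by (intro mult_left_mono) auto
        then show ?thesis using cases(2)[OF 2] 2(1) by (simp add: abs_mult del: of_nat_Suc)
      qed (use cases(1,3) in auto)
    qed
    show "(\<lambda>n. \<Phi> n t) \<longlonglongrightarrow> max 0 (t - k)" for t
    proof (rule LIM_zero_cancel, rule Lim_null_comparison[OF always_eventually e], rule allI)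
      fix n
      consider "t \<le> k" | "k \<le> t" "t \<le> k + 1 / real (Suc n)" | "k + 1 / real (Suc n) \<le> t" by linarith
      then show "norm (\<Phi> n t - max 0 (t - k)) \<le> 1 / real (Suc n)"
      proof cases
        case 1
        then show ?thesis using cases(1)[of t n] by simp
      next
        case 2
        have "real (Suc n) * (t - k) \<le> real (Suc n) * (1 / real (Suc n))"
          using 2 by (intro mult_left_mono) auto
        then have "real (Suc n) * (t - k) * (t - k) \<le> 1 * (t - k)"
          using 2 by (intro mult_right_mono) auto
        then have X: "real (Suc n) * (t - k) * (t - k) / 2 \<le> t - k" using 2 by simp
        have "real (Suc n) / 2 * (t - k)\<^sup>2 = real (Suc n) * (t - k) * (t - k) / 2"
          by (simp add: power2_eq_square)
        moreover have "0 \<le> real (Suc n) / 2 * (t - k)\<^sup>2"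
          by (intro mult_nonneg_nonneg) auto
        ultimately have "0 \<le> real (Suc n) / 2 * (t - k)\<^sup>2" "real (Suc n) / 2 * (t - k)\<^sup>2 \<le> t - k"
          using X by simp_all
        then have "0 \<le> \<Phi> n t" "\<Phi> n t \<le> t - k" unfolding cases(2)[OF 2, THEN conjunct1] .
        moreover have "max 0 (t - k) = t - k" "t - k \<le> 1 / real (Suc n)" using 2 by linarith+
        ultimately show ?thesis by auto
      next
        case 3
        then have "k \<le> t" using d0[of n] by (smt (verit) divide_pos_pos)
        moreover have "1 / (2 * real (Suc n)) \<le> 1 / real (Suc n)" by (simp add: field_simps)
        ultimately show ?thesis using cases(3)[OF 3] by (simp del: of_nat_Suc)
      qed
    qed
    show "(\<lambda>n. \<Phi>' n t) \<longlonglongrightarrow> (if t > k then 1 else 0)" for t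
    proof (cases "t > k")
      case True
      then have "\<forall>\<^sub>F n in sequentially. 1 / real (Suc n) < t - k"
        by (intro order_tendstoD[OF e]) simp
      then have "\<forall>\<^sub>F n in sequentially. \<Phi>' n t = 1"
        by eventually_elim (use cases(3) in auto)
      then have "(\<lambda>n. \<Phi>' n t) \<longlonglongrightarrow> 1" by (rule tendsto_eventually)
      then show ?thesis using True by simp
    qed (use cases(1) in auto)
  qed
  then show ?thesis by (rule sob_cong_AE) auto
qed

lemma sob_min_const:
  assumes s: "sob u G" and k: "0 \<le> k"
  shows "sob (\<lambda>x. min (u x) k) (\<lambda>x. if u x > k then 0 else G x)"
  using sob_diff[OF s sob_excess[OF s k]] by (rule sob_cong_AE) (auto simp: min_def max_def)

text \<open>A power with t > 1 has unbounded derivative. Clamping the derivative to the range [0, k]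
  of u and taking the primitive gives a C^1 function with bounded derivative that coincides with the
  power on that range.\<close>

lemma sob_powr:
  assumes s: "sob u G" and k: "0 < k" and b: "AE x in M. 0 \<le> u x \<and> u x \<le> k" and t: "1 \<le> t"
  shows "sob (\<lambda>x. u x powr t) (\<lambda>x. (t * u x powr (t - 1)) *\<^sub>R G x)"
\<comment> \<open>For t = 1 the derivative factor is \<open>u x powr 0\<close>, which is 0 where u
  vanishes and so not continuous in u; it is the gradient factor of the positive part.\<close>
proof (cases "t = 1")
  case True
  from sob_excess[OF s order_refl] show ?thesis
    by (rule sob_cong_AE) (use b in \<open>auto simp: True elim!: eventually_mono\<close>)
next
  case False
  then have t1: "t > 1" using t by simp
  define h where "h s = t * (max 0 (min s k)) powr (t - 1)" for s
  have hc: "continuous_on UNIV h"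
    unfolding h_def[abs_def] using t1
    by (intro continuous_on_mult continuous_on_const continuous_on_powr' continuous_on_max continuous_on_min continuous_on_id) auto
  then have hi: "isCont h s" for s by (simp add: continuous_on_eq_continuous_at)
  obtain F where F: "\<And>s. (F has_real_derivative h s) (at s)"
    using einterval_antiderivative[of "-\<infinity>" "\<infinity>" h] hi
    by (auto simp: has_real_derivative_iff_has_vector_derivative)
  define \<Phi> where "\<Phi> s = F s - F 0" for s
  have \<Phi>d: "(\<Phi> has_real_derivative h s) (at s)" for s
    unfolding \<Phi>_def[abs_def] using DERIV_diff[OF F DERIV_const[of "F 0"]] by simp
  have h0: "0 \<le> h s" for s using t1 by (simp add: h_def)
  have hb: "\<bar>h s\<bar> \<le> t * k powr (t - 1)" for s
    using h0[of s] t1 k by (auto simp: h_def intro!: mult_left_mono powr_mono2)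
  have eq: "\<Phi> s = s powr t" if s: "0 \<le> s" "s \<le> k" for s
  proof (cases "s = 0")
    case True
    then show ?thesis using t1 by (simp add: \<Phi>_def)
  next
    case False
    then have sp: "0 < s" using s by simp
    have "\<Phi> s - s powr t = \<Phi> 0 - 0 powr t"
    proof (rule DERIV_isconst2[of 0 s "\<lambda>s. \<Phi> s - s powr t"])
      show "continuous_on {0..s} (\<lambda>s. \<Phi> s - s powr t)"
        using t1 \<Phi>d by (intro continuous_on_diff continuous_on_powr' continuous_on_id continuous_on_const
            DERIV_continuous_on[of _ \<Phi> h]) (auto intro: has_field_derivative_at_within)
      fix y assume y: "0 < y" "y < s"
      have "((\<lambda>y. y powr t) has_real_derivative t * y powr (t - 1)) (at y)"
        using y has_real_derivative_powr[of y t] by simp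
      moreover have "h y = t * y powr (t - 1)" using y s by (simp add: h_def)
      ultimately show "((\<lambda>s. \<Phi> s - s powr t) has_real_derivative 0) (at y)"
        using DERIV_diff[OF \<Phi>d[of y]] by fastforce
    qed (use sp in auto)
    then show ?thesis using t1 by (simp add: \<Phi>_def)
  qed
  have "sob (\<lambda>x. \<Phi> (u x)) (\<lambda>x. h (u x) *\<^sub>R G x)"
    by (rule sob_chain_C1[OF s \<Phi>d hc _ hb]) (simp add: \<Phi>_def)
  then show ?thesis
  proof (rule sob_cong_AE)
    show "AE x in M. \<Phi> (u x) = u x powr t" using b by eventually_elim (simp add: eq)
    show "AE x in M. h (u x) *\<^sub>R G x = (t * u x powr (t - 1)) *\<^sub>R G x"
      using b by eventually_elim (simp add: h_def)
  qed
qed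

end

section \<open>Minimizers of convex functionals\<close>

lemma norm_powr_line_derivative:
  fixes a b :: "'b::real_inner"
  assumes "1 < p"
  shows "((\<lambda>s. norm (a + s *\<^sub>R b) powr p) has_real_derivative
    p * (norm (a + t *\<^sub>R b) powr (p - 2) * ((a + t *\<^sub>R b) \<bullet> b))) (at t)"
proof -
  have "((\<lambda>s::real. a + s *\<^sub>R b) has_derivative (\<lambda>s. s *\<^sub>R b)) (at t)"
    by (auto intro!: derivative_eq_intros)
  from has_derivative_compose[OF this norm_powr_has_derivative[OF assms]]
  show ?thesis unfolding has_field_derivative_def
    by (rule has_derivative_eq_rhs) (auto simp: fun_eq_iff)
qed

lemma norm_powr_gradient_bound:
  fixes a b :: "'b::real_inner"
  shows "\<bar>norm a powr (p - 2) * (a \<bullet> b)\<bar> \<le> norm a powr (p - 1) * norm b"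
proof (cases "a = 0")
  case False
  have "\<bar>norm a powr (p - 2) * (a \<bullet> b)\<bar> \<le> norm a powr (p - 2) * (norm a * norm b)"
    using Cauchy_Schwarz_ineq2[of a b] by (simp add: abs_mult mult_left_mono)
  also have "\<dots> = norm a powr (p - 1) * norm b"
    using False by (simp add: powr_diff power2_eq_square)
  finally show ?thesis .
qed simp

text \<open>The bound is uniform in the step s and integrable in the application, so it dominates
  the difference quotients of the energy.\<close>

lemma norm_powr_quotient_bound:
  fixes a b :: "'b::real_inner"
  assumes "1 < p" "0 < s" "s \<le> 1"
  shows "\<bar>norm (a + s *\<^sub>R b) powr p - norm a powr p\<bar> / s \<le> p * 2 powr p * (norm a powr p + norm b powr p)"
proof -
  define L where "L = p * ((norm a + norm b) powr (p - 1) * norm b)"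
  have "norm (norm (a + s *\<^sub>R b) powr p - norm (a + 0 *\<^sub>R b) powr p) \<le> L * norm (s - 0)"
  proof (rule field_differentiable_bound[of "{0..1}" "\<lambda>s. norm (a + s *\<^sub>R b) powr p"])
    fix t :: real assume t: "t \<in> {0..1}"
    show "((\<lambda>s. norm (a + s *\<^sub>R b) powr p) has_field_derivative
        p * (norm (a + t *\<^sub>R b) powr (p - 2) * ((a + t *\<^sub>R b) \<bullet> b))) (at t within {0..1})"
      by (rule has_field_derivative_at_within[OF norm_powr_line_derivative[OF assms(1)]])
    have tb: "norm (a + t *\<^sub>R b) \<le> norm a + norm b"
    proof -
      have "norm (a + t *\<^sub>R b) \<le> norm a + \<bar>t\<bar> * norm b" using norm_triangle_ineq[of a "t *\<^sub>R b"] by simp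
      also have "\<dots> \<le> norm a + 1 * norm b" using t by (intro add_left_mono mult_right_mono) auto
      finally show ?thesis by simp
    qed
    have "norm (a + t *\<^sub>R b) powr (p - 1) * norm b \<le> (norm a + norm b) powr (p - 1) * norm b"
      using tb assms by (intro mult_right_mono powr_mono2) auto
    then have "\<bar>norm (a + t *\<^sub>R b) powr (p - 2) * ((a + t *\<^sub>R b) \<bullet> b)\<bar> \<le> (norm a + norm b) powr (p - 1) * norm b"
      using norm_powr_gradient_bound[of "a + t *\<^sub>R b" p b] by linarith
    then show "norm (p * (norm (a + t *\<^sub>R b) powr (p - 2) * ((a + t *\<^sub>R b) \<bullet> b))) \<le> L"
      using assms(1) by (simp add: L_def abs_mult mult_left_mono)
  qed (use assms in auto)
  then have "\<bar>norm (a + s *\<^sub>R b) powr p - norm a powr p\<bar> / s \<le> L"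
    using assms by (simp add: pos_divide_le_eq)
  also have "L \<le> p * (norm a + norm b) powr p"
  proof -
    have "(norm a + norm b) powr (p - 1) * norm b \<le> (norm a + norm b) powr (p - 1) * (norm a + norm b)"
      by (intro mult_left_mono) auto
    also have "\<dots> = (norm a + norm b) powr p"
      by (cases "norm a + norm b = 0") (auto simp: powr_diff)
    finally show ?thesis using assms(1) by (simp add: L_def)
  qed
  also have "\<dots> \<le> p * (2 powr p * (norm a powr p + norm b powr p))"
    using assms(1) by (intro mult_left_mono powr_add_le) auto
  finally show ?thesis by (simp add: mult.assoc)
qed

lemma average_diff_le: "x \<le> m + c \<Longrightarrow> y \<le> m + c \<Longrightarrow> (x + y) / 2 - m \<le> (c::real)"
  by (simp add: field_simps)

lemma midpoint_arith:
  fixes E1 :: real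
  assumes "E1 + E2 \<le> (g + h) / 2" "0 < p"
  shows "E1 / p - (a + b) / 2 + E2 / p \<le> ((g / p - a) + (h / p - b)) / 2"
proof -
  have "(E1 + E2) / p \<le> ((g + h) / 2) / p" using assms by (intro divide_right_mono) auto
  then show ?thesis by (simp add: add_divide_distrib diff_divide_distrib)
qed

section \<open>Right-hand sides acting as bounded functionals\<close>

context sobolev_domain
begin

text \<open>Elements of the dual space of W_0^{1,p} that are given by a function. Absolute integrals
  are bounded, so the property passes to every smaller function in absolute value, and the pointwise
  order remains available for comparison arguments.\<close>

definition dual :: "('a \<Rightarrow> real) \<Rightarrow> bool" where
  "dual h \<longleftrightarrow> h \<in> borel_measurable M \<and> (\<exists>C\<ge>0. \<forall>u G. sob u G \<longrightarrow> En M p G \<le> 1 \<longrightarrow>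
     integrable M (\<lambda>x. h x * u x) \<and> (LINT x|M. \<bar>h x * u x\<bar>) \<le> C)"

lemma dualE:
  assumes "dual h"
  obtains C where "C \<ge> 0" "\<And>u G. sob u G \<Longrightarrow> En M p G \<le> 1 \<Longrightarrow> integrable M (\<lambda>x. h x * u x)"
    "\<And>u G. sob u G \<Longrightarrow> En M p G \<le> 1 \<Longrightarrow> (LINT x|M. \<bar>h x * u x\<bar>) \<le> C"
proof -
  from assms[unfolded dual_def, THEN conjunct2]
  obtain C where C: "C \<ge> 0 \<and> (\<forall>u G. sob u G \<longrightarrow> En M p G \<le> 1 \<longrightarrow>
     integrable M (\<lambda>x. h x * u x) \<and> (LINT x|M. \<bar>h x * u x\<bar>) \<le> C)" ..
  show thesis
    by (rule that[OF C[THEN conjunct1]]) (use C in blast)+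
qed

lemma dual_measurable: "dual h \<Longrightarrow> h \<in> borel_measurable M"
  by (simp add: dual_def)

lemma dual_bound:
  assumes "dual h"
  obtains C where "0 \<le> C"
    "\<And>u G. sob u G \<Longrightarrow> integrable M (\<lambda>x. h x * u x)"
    "\<And>u G a. sob u G \<Longrightarrow> 0 < a \<Longrightarrow> En M p G \<le> a powr p \<Longrightarrow> (LINT x|M. \<bar>h x * u x\<bar>) \<le> C * a"
proof -
  obtain C where C: "C \<ge> 0" "\<And>u G. sob u G \<Longrightarrow> En M p G \<le> 1 \<Longrightarrow> integrable M (\<lambda>x. h x * u x)"
    "\<And>u G. sob u G \<Longrightarrow> En M p G \<le> 1 \<Longrightarrow> (LINT x|M. \<bar>h x * u x\<bar>) \<le> C"
    by (rule dualE[OF assms]) (rule that)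
  have main: "integrable M (\<lambda>x. h x * u x) \<and> (LINT x|M. \<bar>h x * u x\<bar>) \<le> C * a"
    if s: "sob u G" and a: "0 < a" and E: "En M p G \<le> a powr p" for u G a
  proof -
    note sc = sob_cmult[OF s, of "1 / a"]
    have "En M p (\<lambda>x. (1 / a) *\<^sub>R G x) = (1 / a) powr p * En M p G"
      using a p0 by (simp add: En_scaleR)
    also have "\<dots> \<le> (1 / a) powr p * a powr p" using E by (intro mult_left_mono) auto
    also have "\<dots> = 1" using a by (simp add: powr_divide)
    finally have E1: "En M p (\<lambda>x. (1 / a) *\<^sub>R G x) \<le> 1" .
    have eq: "h x * (1 / a * u x) = (1 / a) * (h x * u x)" for x by simp
    have i: "integrable M (\<lambda>x. (1 / a) * (h x * u x))"
      using C(2)[OF sc E1] by (simp only: eq)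
    have "integrable M (\<lambda>x. a * ((1 / a) * (h x * u x)))" using i by (rule integrable_mult_right)
    then have i': "integrable M (\<lambda>x. h x * u x)" using a by simp
    have "(LINT x|M. \<bar>(1 / a) * (h x * u x)\<bar>) \<le> C"
      using C(3)[OF sc E1] by (simp only: eq)
    moreover have "\<bar>(1 / a) * (h x * u x)\<bar> = (1 / a) * \<bar>h x * u x\<bar>" for x using a by (simp add: abs_mult)
    ultimately have "(1 / a) * (LINT x|M. \<bar>h x * u x\<bar>) \<le> C" by (simp only: integral_mult_right_zero)
    then show ?thesis using i' a by (simp add: field_simps)
  qed
  show thesis
  proof (rule that[OF C(1)])
    fix u G assume s: "sob u G"
    have "En M p G \<le> (En M p G + 1) powr 1" using En_nonneg[of M p G] by simp
    also have "\<dots> \<le> (En M p G + 1) powr p" using p0 by (intro powr_mono) auto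
    finally show "integrable M (\<lambda>x. h x * u x)"
      using main[OF s, of "En M p G + 1"] by (simp add: add_nonneg_pos)
  qed (use main in blast)
qed

lemma dual_integrable: "dual h \<Longrightarrow> sob u G \<Longrightarrow> integrable M (\<lambda>x. h x * u x)"
  by (rule dual_bound) 

lemma dual_mono:
  assumes h: "dual h" and k: "k \<in> borel_measurable M" "AE x in M. \<bar>k x\<bar> \<le> \<bar>h x\<bar>"
  shows "dual k"
proof -
  obtain C where C: "C \<ge> 0" "\<And>u G. sob u G \<Longrightarrow> En M p G \<le> 1 \<Longrightarrow> integrable M (\<lambda>x. h x * u x)"
    "\<And>u G. sob u G \<Longrightarrow> En M p G \<le> 1 \<Longrightarrow> (LINT x|M. \<bar>h x * u x\<bar>) \<le> C"
    by (rule dualE[OF h]) (rule that)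
  have "integrable M (\<lambda>x. k x * u x) \<and> (LINT x|M. \<bar>k x * u x\<bar>) \<le> C" if s: "sob u G" and E: "En M p G \<le> 1" for u G
  proof -
    note [measurable] = sob_measurable[OF s] k(1)
    have le: "AE x in M. \<bar>k x * u x\<bar> \<le> \<bar>h x * u x\<bar>"
      using k(2) by eventually_elim (simp add: abs_mult mult_right_mono)
    have i: "integrable M (\<lambda>x. k x * u x)"
      by (rule Bochner_Integration.integrable_bound[OF C(2)[OF s E]]) (use le in auto)
    have "(LINT x|M. \<bar>k x * u x\<bar>) \<le> (LINT x|M. \<bar>h x * u x\<bar>)"
      by (rule integral_mono_AE) (use i C(2)[OF s E] le in auto)
    then show ?thesis using i C(3)[OF s E] by linarith
  qed
  then show ?thesis using k(1) C(1) unfolding dual_def by blast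
qed

lemma dual_add:
  assumes "dual h" "dual k"
  shows "dual (\<lambda>x. h x + k x)"
proof -
  obtain C where C: "C \<ge> 0" "\<And>u G. sob u G \<Longrightarrow> En M p G \<le> 1 \<Longrightarrow> integrable M (\<lambda>x. h x * u x)"
    "\<And>u G. sob u G \<Longrightarrow> En M p G \<le> 1 \<Longrightarrow> (LINT x|M. \<bar>h x * u x\<bar>) \<le> C"
    by (rule dualE[OF assms(1)]) (rule that)
  obtain D where D: "D \<ge> 0" "\<And>u G. sob u G \<Longrightarrow> En M p G \<le> 1 \<Longrightarrow> integrable M (\<lambda>x. k x * u x)"
    "\<And>u G. sob u G \<Longrightarrow> En M p G \<le> 1 \<Longrightarrow> (LINT x|M. \<bar>k x * u x\<bar>) \<le> D"
    by (rule dualE[OF assms(2)]) (rule that)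
  have "integrable M (\<lambda>x. (h x + k x) * u x) \<and> (LINT x|M. \<bar>(h x + k x) * u x\<bar>) \<le> C + D"
    if s: "sob u G" and E: "En M p G \<le> 1" for u G
  proof -
    note i = C(2)[OF s E] D(2)[OF s E]
    have i': "integrable M (\<lambda>x. (h x + k x) * u x)" using i by (simp add: distrib_right)
    have "(LINT x|M. \<bar>(h x + k x) * u x\<bar>) \<le> (LINT x|M. \<bar>h x * u x\<bar> + \<bar>k x * u x\<bar>)"
    proof (rule integral_mono)
      show "\<bar>(h x + k x) * u x\<bar> \<le> \<bar>h x * u x\<bar> + \<bar>k x * u x\<bar>" for x
        unfolding distrib_right by (rule abs_triangle_ineq)
    qed (intro Bochner_Integration.integrable_add integrable_abs i i')+
    also have "\<dots> = (LINT x|M. \<bar>h x * u x\<bar>) + (LINT x|M. \<bar>k x * u x\<bar>)" using i by simp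
    finally show ?thesis using i' C(3)[OF s E] D(3)[OF s E] by linarith
  qed
  then show ?thesis
    using assms C(1) D(1) unfolding dual_def by (intro conjI exI[of _ "C + D"]) auto
qed

lemma dual_minus: "dual h \<Longrightarrow> dual (\<lambda>x. - h x)"
  by (rule dual_mono) (auto simp: dual_def)

lemma dual_diff: "dual h \<Longrightarrow> dual k \<Longrightarrow> dual (\<lambda>x. h x - k x)"
  using dual_add[OF _ dual_minus] by force

lemma dual_zero: "dual (\<lambda>x. 0)"
  by (auto simp: dual_def)

lemma dual_tendsto:
  assumes h: "dual h" and s: "\<And>n::nat. sob (u n) (G n)" "sob v H"
    and lim: "(\<lambda>n. En M p (\<lambda>x. G n x - H x)) \<longlonglongrightarrow> 0"
  shows "(\<lambda>n. LINT x|M. h x * u n x) \<longlonglongrightarrow> (LINT x|M. h x * v x)"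
proof -
  obtain C where C: "0 \<le> C" "\<And>u G. sob u G \<Longrightarrow> integrable M (\<lambda>x. h x * u x)"
    "\<And>u G a. sob u G \<Longrightarrow> 0 < a \<Longrightarrow> En M p G \<le> a powr p \<Longrightarrow> (LINT x|M. \<bar>h x * u x\<bar>) \<le> C * a"
    by (rule dual_bound[OF h]) (rule that)
  \<comment> \<open>The radius of an energy ball containing the n-th difference. The summand 1 / (n
    + 1) keeps it positive when the difference has no energy.\<close>
  define a where "a n = (En M p (\<lambda>x. G n x - H x) + 1 / real (Suc n)) powr (1 / p)" for n
  have pos: "En M p (\<lambda>x. G n x - H x) + 1 / real (Suc n) > 0" for n by (intro add_nonneg_pos) auto
  have apos: "a n > 0" for n using pos[of n] by (simp add: a_def)
  have "a \<longlonglongrightarrow> (0 + 0) powr (1 / p)"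
    unfolding a_def[abs_def] using p0
    by (intro tendsto_powr2 tendsto_add lim LIMSEQ_Suc[OF lim_1_over_n] tendsto_const always_eventually) (auto intro!: add_nonneg_nonneg)
  then have "(\<lambda>n. C * a n) \<longlonglongrightarrow> C * 0" using p0 by (intro tendsto_mult tendsto_const) simp
  then have "(\<lambda>n. C * a n) \<longlonglongrightarrow> 0" by simp
  then have "(\<lambda>n. (LINT x|M. h x * u n x) - (LINT x|M. h x * v x)) \<longlonglongrightarrow> 0"
  proof (rule Lim_null_comparison[rotated], intro always_eventually allI)
    fix n
    note d = sob_diff[OF s(1)[of n] s(2)]
    have "(LINT x|M. h x * u n x) - (LINT x|M. h x * v x) = (LINT x|M. h x * (u n x - v x))"
      using C(2)[OF s(1)] C(2)[OF s(2)] by (simp add: right_diff_distrib)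
    also have "norm \<dots> \<le> (LINT x|M. \<bar>h x * (u n x - v x)\<bar>)"
      using integral_norm_bound[of M "\<lambda>x. h x * (u n x - v x)"] by simp
    also have "\<dots> \<le> C * a n"
      using pos[of n] p0 by (intro C(3)[OF d apos]) (simp add: a_def powr_powr)
    finally show "norm ((LINT x|M. h x * u n x) - (LINT x|M. h x * v x)) \<le> C * a n" .
  qed
  then show ?thesis by (simp add: LIM_zero_iff)
qed

section \<open>The functional, its minimizers and their comparison\<close>

definition J :: "('a \<Rightarrow> real) \<Rightarrow> ('a \<Rightarrow> real) \<Rightarrow> ('a \<Rightarrow> 'a) \<Rightarrow> real" where
  "J h u G = En M p G / p - (LINT x|M. h x * u x)"

definition is_min :: "('a \<Rightarrow> real) \<Rightarrow> ('a \<Rightarrow> real) \<Rightarrow> ('a \<Rightarrow> 'a) \<Rightarrow> bool" where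
  "is_min h u G \<longleftrightarrow> sob u G \<and> (\<forall>v H. sob v H \<longrightarrow> J h u G \<le> J h v H)"

lemma is_min_sob: "is_min h u G \<Longrightarrow> sob u G"
  by (simp add: is_min_def)

lemma is_min_le: "is_min h u G \<Longrightarrow> sob v H \<Longrightarrow> J h u G \<le> J h v H"
  by (simp add: is_min_def)

lemma En_clarkson:
  assumes "memLp M p G" "memLp M p H"
  shows "En M p (\<lambda>x. (1/2) *\<^sub>R (G x + H x)) + En M p (\<lambda>x. (1/2) *\<^sub>R (G x - H x)) \<le> (En M p G + En M p H) / 2"
proof -
  have i: "integrable M (\<lambda>x. norm ((1/2) *\<^sub>R (G x + H x)) powr p)" "integrable M (\<lambda>x. norm ((1/2) *\<^sub>R (G x - H x)) powr p)"
    using memLp_integrable[OF memLp_scaleR[OF memLp_add[OF assms p0(1)] p0(1)]]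
      memLp_integrable[OF memLp_scaleR[OF memLp_diff[OF assms p0(1)] p0(1)]] by blast+
  have "En M p (\<lambda>x. (1/2) *\<^sub>R (G x + H x)) + En M p (\<lambda>x. (1/2) *\<^sub>R (G x - H x))
      = (LINT x|M. norm ((1/2) *\<^sub>R (G x + H x)) powr p + norm ((1/2) *\<^sub>R (G x - H x)) powr p)"
    unfolding En_def by (rule Bochner_Integration.integral_add[OF i, symmetric])
  also have "\<dots> \<le> (LINT x|M. (norm (G x) powr p + norm (H x) powr p) / 2)"
    by (intro integral_mono Bochner_Integration.integrable_add i clarkson p_ge_2)
      (use assms in \<open>auto simp: memLp_def\<close>)
  also have "\<dots> = (En M p G + En M p H) / 2"
    using assms by (simp add: En_def memLp_def)
  finally show ?thesis .
qed

abbreviation conv_const :: real where "conv_const \<equiv> (1/2) powr p / p"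

lemma conv_const_pos: "conv_const > 0"
  using p0 by simp

lemma J_midpoint:
  assumes h: "dual h" and s: "sob u G" "sob v H"
  shows "J h (\<lambda>x. (1/2) * (u x + v x)) (\<lambda>x. (1/2) *\<^sub>R (G x + H x)) + conv_const * En M p (\<lambda>x. G x - H x)
    \<le> (J h u G + J h v H) / 2"
proof -
  have "En M p (\<lambda>x. (1/2) *\<^sub>R (G x - H x)) = (1/2) powr p * En M p (\<lambda>x. G x - H x)"
    using En_scaleR[OF p0(1), of M "1/2" "\<lambda>x. G x - H x"] by simp
  moreover have "(LINT x|M. h x * ((1/2) * (u x + v x))) = ((LINT x|M. h x * u x) + (LINT x|M. h x * v x)) / 2"
  proof -
    have "(LINT x|M. h x * ((1/2) * (u x + v x))) = (LINT x|M. (1/2) * (h x * u x + h x * v x))"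
      by (intro Bochner_Integration.integral_cong refl) (simp add: field_simps)
    also have "\<dots> = (1/2) * (LINT x|M. h x * u x + h x * v x)" by (rule integral_mult_right_zero)
    also have "(LINT x|M. h x * u x + h x * v x) = (LINT x|M. h x * u x) + (LINT x|M. h x * v x)"
      by (rule Bochner_Integration.integral_add[OF dual_integrable[OF h s(1)] dual_integrable[OF h s(2)]])
    finally show ?thesis by simp
  qed
  moreover note midpoint_arith[OF En_clarkson[OF sob_memLp(2)[OF s(1)] sob_memLp(2)[OF s(2)]] p0(2),
      of "LINT x|M. h x * u x" "LINT x|M. h x * v x"]
  ultimately show ?thesis unfolding J_def by (simp only: times_divide_eq_left)
qed

lemma sob_midpoint: "sob u G \<Longrightarrow> sob v H \<Longrightarrow> sob (\<lambda>x. (1/2) * (u x + v x)) (\<lambda>x. (1/2) *\<^sub>R (G x + H x))"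
  by (intro sob_cmult sob_add)

text \<open>The midpoint of the minimizer and a competitor cannot beat the minimizer, so the gain in
  Clarkson's inequality is paid by the competitor. This quantitative form of uniqueness yields both
  comparison and stability.\<close>

lemma J_strongly_convex:
  assumes h: "dual h" and m: "is_min h u G" and s: "sob v H"
  shows "J h u G + 2 * conv_const * En M p (\<lambda>x. G x - H x) \<le> J h v H"
proof -
  have "J h u G \<le> J h (\<lambda>x. (1/2) * (u x + v x)) (\<lambda>x. (1/2) *\<^sub>R (G x + H x))"
    by (rule is_min_le[OF m sob_midpoint[OF is_min_sob[OF m] s]])
  then show ?thesis using J_midpoint[OF h is_min_sob[OF m] s] by (simp add: field_simps)
qed

lemma J_bounded_below:
  assumes h: "dual h"
  obtains B where "\<And>u G. sob u G \<Longrightarrow> B \<le> J h u G"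
proof -
  obtain C where C: "0 \<le> C" "\<And>u G. sob u G \<Longrightarrow> integrable M (\<lambda>x. h x * u x)"
    "\<And>u G a. sob u G \<Longrightarrow> 0 < a \<Longrightarrow> En M p G \<le> a powr p \<Longrightarrow> (LINT x|M. \<bar>h x * u x\<bar>) \<le> C * a"
    by (rule dual_bound[OF h]) (rule that)
  define q where "q = p / (p - 1)"
  have q: "q > 1" "1 / p + 1 / q = 1" using p0 by (auto simp: q_def field_simps)
  show thesis
  proof (rule that[of "- 1 / p - C powr q / q"])
    fix u G assume s: "sob u G"
    \<comment> \<open>The summand 1 makes a positive and costs only the constant 1 / p; Young's
      inequality absorbs \<open>C * a\<close> into a^p / p with exactly the coefficient of the
      energy in \<open>J\<close>.\<close>
    define a where "a = (En M p G + 1) powr (1 / p)"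
    have E1: "En M p G + 1 > 0" by (simp add: add_nonneg_pos)
    have a: "a > 0" "a powr p = En M p G + 1" using E1 p0 by (auto simp: a_def powr_powr)
    have "(LINT x|M. h x * u x) \<le> (LINT x|M. \<bar>h x * u x\<bar>)"
      using C(2)[OF s] by (intro integral_mono) auto
    also have "\<dots> \<le> C * a" by (rule C(3)[OF s a(1)]) (simp add: a(2))
    also have "\<dots> \<le> a powr p / p + C powr q / q"
      using Youngs_inequality[OF p0(4) q(1) q(2), of a C] a(1) C(1) by (simp add: mult.commute)
    finally show "- 1 / p - C powr q / q \<le> J h u G"
      unfolding J_def a(2) by (simp add: add_divide_distrib)
  qed
qed

lemma minimizer_exists:
  assumes h: "dual h"
  obtains u G where "is_min h u G"
proof -
  define S where "S = {J h u G |u G. sob u G}"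
  obtain B where B: "\<And>u G. sob u G \<Longrightarrow> B \<le> J h u G" using J_bounded_below[OF h] by metis
  have bdd: "bdd_below S" unfolding S_def by (rule bdd_belowI[of _ B]) (use B in auto)
  have ne: "S \<noteq> {}" unfolding S_def using sob_zero by blast
  define m where "m = Inf S"
  have m_le: "m \<le> J h u G" if "sob u G" for u G
    unfolding m_def by (rule cInf_lower[OF _ bdd]) (use that in \<open>auto simp: S_def\<close>)
  have "\<exists>u G. sob u G \<and> J h u G < m + 1 / real (Suc n)" for n
  proof -
    have "Inf S < m + 1 / real (Suc n)" by (simp add: m_def)
    from cInf_lessD[OF ne this] show ?thesis unfolding S_def by blast
  qed
  then obtain u G where uG: "\<And>n. sob (u n) (G n)" "\<And>n. J h (u n) (G n) < m + 1 / real (Suc n)"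
    by metis
  \<comment> \<open>Both values exceed the infimum by at most 1 / (k + 1) and the midpoint does not
    fall below it, so the Clarkson gain is no larger than 1 / (k + 1).\<close>
  have dist: "conv_const * En M p (\<lambda>x. G i x - G j x) \<le> 1 / real (Suc k)" if "i \<ge> k" "j \<ge> k" for i j k
  proof -
    have mono: "1 / real (Suc l) \<le> 1 / real (Suc k)" if "l \<ge> k" for l using that by (simp add: field_simps)
    have "m \<le> J h (\<lambda>x. (1/2) * (u i x + u j x)) (\<lambda>x. (1/2) *\<^sub>R (G i x + G j x))"
      by (rule m_le[OF sob_midpoint[OF uG(1) uG(1)]])
    then have "conv_const * En M p (\<lambda>x. G i x - G j x) \<le> (J h (u i) (G i) + J h (u j) (G j)) / 2 - m"
      using J_midpoint[OF h uG(1) uG(1), of i j] by linarith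
    also have "\<dots> \<le> 1 / real (Suc k)"
    proof -
      define c where "c = 1 / real (Suc k)"
      have "J h (u l) (G l) \<le> m + c" if "l \<ge> k" for l
        using less_imp_le[OF uG(2)[of l]] add_left_mono[OF mono[OF that], of m]
        unfolding c_def by (rule order_trans)
      from average_diff_le[OF this[OF that(1)] this[OF that(2)]] show ?thesis unfolding c_def .
    qed
    finally show ?thesis .
  qed
  have cauG: "\<exists>k. \<forall>i\<ge>k. \<forall>j\<ge>k. En M p (\<lambda>x. G i x - G j x) < e" if "e > 0" for e
  proof -
    have "conv_const * e > 0" by (rule mult_pos_pos[OF conv_const_pos that])
    then obtain k where k: "1 / real (Suc k) < conv_const * e" by (rule nat_approx_posE)
    have "En M p (\<lambda>x. G i x - G j x) < e" if "i \<ge> k" "j \<ge> k" for i j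
      using order_le_less_trans[OF dist[OF that] k] conv_const_pos
      by (simp only: mult_less_cancel_left_pos)
    then show ?thesis by blast
  qed
  obtain Cp where Cp: "0 < Cp" "\<And>u G. sob u G \<Longrightarrow> En M p u \<le> Cp * En M p G"
    by (rule poincare) (rule that)
  have cauu: "\<exists>k. \<forall>i\<ge>k. \<forall>j\<ge>k. En M p (\<lambda>x. u i x - u j x) < e" if "e > 0" for e
  proof -
    from cauG[OF divide_pos_pos[OF that Cp(1)]]
    obtain k where k: "\<forall>i\<ge>k. \<forall>j\<ge>k. En M p (\<lambda>x. G i x - G j x) < e / Cp" ..
    have "En M p (\<lambda>x. u i x - u j x) < e" if "i \<ge> k" "j \<ge> k" for i j
    proof -
      have "Cp * En M p (\<lambda>x. G i x - G j x) < Cp * (e / Cp)"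
        using k that Cp(1) by (intro mult_strict_left_mono) auto
      then show ?thesis using Cp(2)[OF sob_diff[OF uG(1) uG(1)], of i j] Cp(1) by simp
    qed
    then show ?thesis by blast
  qed
  obtain H where H: "memLp M p H" "(\<lambda>n. En M p (\<lambda>x. G n x - H x)) \<longlonglongrightarrow> 0"
    by (rule riesz_fischer[OF sob_memLp(2)[OF uG(1)] p0(3) cauG]) (assumption, rule that)
  obtain v where v: "memLp M p v" "(\<lambda>n. En M p (\<lambda>x. u n x - v x)) \<longlonglongrightarrow> 0"
    by (rule riesz_fischer[OF sob_memLp(1)[OF uG(1)] p0(3) cauu]) (assumption, rule that)
  have sv: "sob v H" by (rule sob_closed[OF uG(1) v(1) H(1) v(2) H(2)])
  have "(\<lambda>n. J h (u n) (G n)) \<longlonglongrightarrow> J h v H"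
    unfolding J_def using p0
    by (intro tendsto_diff tendsto_divide tendsto_const En_tendsto[OF sob_memLp(2)[OF uG(1)] H(1) p0(3) H(2)]
        dual_tendsto[OF h uG(1) sv H(2)]) auto
  moreover have "(\<lambda>n. m + 1 / real (Suc n)) \<longlonglongrightarrow> m + 0"
    by (intro tendsto_add tendsto_const LIMSEQ_Suc[OF lim_1_over_n])
  ultimately have "J h v H \<le> m + 0"
    by (rule LIMSEQ_le) (use uG(2) in \<open>auto intro!: exI[of _ 0] less_imp_le\<close>)
  then have "is_min h v H"
    unfolding is_min_def using sv m_le by (auto intro: order_trans)
  then show thesis by (rule that)
qed

text \<open>The competitors are \<open>min u v\<close> for \<open>h\<close> and \<open>max u v\<close> for \<open>k\<close>; exchanging them preserves the sum of the
  energies.\<close>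

lemma comparison:
  assumes h: "dual h" and k: "dual k" and hk: "AE x in M. h x \<le> k x"
    and u: "is_min h u G" and v: "is_min k v H"
  shows "AE x in M. u x \<le> v x"
proof -
  note su = is_min_sob[OF u] and sv = is_min_sob[OF v]
  define w where "w x = max 0 (u x - v x)" for x
  define W where "W x = (if u x - v x > 0 then G x - H x else 0)" for x
  have sw: "sob w W"
    using sob_excess[OF sob_diff[OF su sv] order_refl] by (simp add: w_def[abs_def] W_def[abs_def])
  note s1 = sob_diff[OF su sw] and s2 = sob_add[OF sv sw]
  have m: "memLp M p G" "memLp M p H" "memLp M p (\<lambda>x. G x - W x)" "memLp M p (\<lambda>x. H x + W x)"
    using sob_memLp(2)[OF su] sob_memLp(2)[OF sv] sob_memLp(2)[OF s1] sob_memLp(2)[OF s2] by auto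
  have "En M p (\<lambda>x. G x - W x) + En M p (\<lambda>x. H x + W x)
      = (LINT x|M. norm (G x - W x) powr p + norm (H x + W x) powr p)"
    unfolding En_def by (rule Bochner_Integration.integral_add[symmetric]) (use m in \<open>auto simp: memLp_def\<close>)
  also have "\<dots> = (LINT x|M. norm (G x) powr p + norm (H x) powr p)"
    by (rule Bochner_Integration.integral_cong) (auto simp: W_def)
  also have "\<dots> = En M p G + En M p H"
    unfolding En_def by (rule Bochner_Integration.integral_add) (use m in \<open>auto simp: memLp_def\<close>)
  finally have En: "En M p (\<lambda>x. G x - W x) + En M p (\<lambda>x. H x + W x) = En M p G + En M p H" .
  have i: "integrable M (\<lambda>x. h x * u x)" "integrable M (\<lambda>x. h x * w x)" "integrable M (\<lambda>x. k x * v x)" "integrable M (\<lambda>x. k x * w x)"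
    using dual_integrable[OF h su] dual_integrable[OF h sw] dual_integrable[OF k sv] dual_integrable[OF k sw] by auto
  \<comment> \<open>Strong convexity for u quantifies the loss from replacing u by
    \<open>u - w\<close>. Since the two replacements together change the functionals by the integral
    of (h - k) w, which is at most 0, the energy of w must vanish.\<close>
  have "J h u G + 2 * conv_const * En M p (\<lambda>x. G x - (G x - W x)) \<le> J h (\<lambda>x. u x - w x) (\<lambda>x. G x - W x)"
    by (rule J_strongly_convex[OF h u s1])
  moreover have "J k v H \<le> J k (\<lambda>x. v x + w x) (\<lambda>x. H x + W x)" by (rule is_min_le[OF v s2])
  moreover have "J h (\<lambda>x. u x - w x) (\<lambda>x. G x - W x) + J k (\<lambda>x. v x + w x) (\<lambda>x. H x + W x)
      = J h u G + J k v H + ((LINT x|M. h x * w x) - (LINT x|M. k x * w x))"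
  proof -
    have "(LINT x|M. h x * (u x - w x)) = (LINT x|M. h x * u x) - (LINT x|M. h x * w x)"
      "(LINT x|M. k x * (v x + w x)) = (LINT x|M. k x * v x) + (LINT x|M. k x * w x)"
      using i by (simp_all add: right_diff_distrib distrib_left)
    moreover have "En M p (\<lambda>x. G x - W x) / p + En M p (\<lambda>x. H x + W x) / p = En M p G / p + En M p H / p"
      using En by (simp flip: add_divide_distrib)
    ultimately show ?thesis unfolding J_def by linarith
  qed
  moreover have "(LINT x|M. h x * w x) \<le> (LINT x|M. k x * w x)"
    using i hk by (intro integral_mono_AE) (auto simp: w_def intro!: mult_right_mono elim!: eventually_mono)
  ultimately have "2 * conv_const * En M p W \<le> 0" by simp
  then have "conv_const * En M p W \<le> conv_const * 0" by linarith
  then have "En M p W \<le> 0" using conv_const_pos by (simp only: mult_le_cancel_left_pos)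
  then have "En M p W = 0" using En_nonneg[of M p W] by linarith
  from sob_zero_energy[OF sw this] show ?thesis
    by eventually_elim (auto simp: w_def max_def split: if_splits)
qed

lemma is_min_minus:
  assumes "is_min h u G"
  shows "is_min (\<lambda>x. - h x) (\<lambda>x. - u x) (\<lambda>x. - G x)"
  unfolding is_min_def
proof (intro conjI allI impI)
  show "sob (\<lambda>x. - u x) (\<lambda>x. - G x)" by (rule sob_minus[OF is_min_sob[OF assms]])
  fix v H assume "sob v H"
  from is_min_le[OF assms sob_minus[OF this]]
  show "J (\<lambda>x. - h x) (\<lambda>x. - u x) (\<lambda>x. - G x) \<le> J (\<lambda>x. - h x) v H"
    by (simp add: J_def En_minus)
qed

lemma gradient_pairing_integrable:
  assumes s: "sob u G" "sob v K"
  shows "integrable M (\<lambda>x. norm (G x) powr (p - 2) * (G x \<bullet> K x))"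
proof (rule Bochner_Integration.integrable_bound)
  note [measurable] = sob_measurable[OF s(1)] sob_measurable[OF s(2)]
  show "integrable M (\<lambda>x. norm (G x) powr p + norm (K x) powr p)"
    using sob_memLp(2)[OF s(1)] sob_memLp(2)[OF s(2)] by (auto simp: memLp_def)
  show "(\<lambda>x. norm (G x) powr (p - 2) * (G x \<bullet> K x)) \<in> borel_measurable M" by measurable
  show "AE x in M. norm (norm (G x) powr (p - 2) * (G x \<bullet> K x)) \<le> norm (norm (G x) powr p + norm (K x) powr p)"
  proof (rule AE_I2)
    fix x
    have "\<bar>norm (G x) powr (p - 2) * (G x \<bullet> K x)\<bar> \<le> norm (G x) powr (p - 1) * norm (K x)"
      by (rule norm_powr_gradient_bound)
    also have "\<dots> \<le> norm (G x) powr p + norm (K x) powr p"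
      by (rule young_powr_simple[OF p0(4)]) auto
    finally show "norm (norm (G x) powr (p - 2) * (G x \<bullet> K x)) \<le> norm (norm (G x) powr p + norm (K x) powr p)"
      by simp
  qed
qed

text \<open>Differentiating along u + e v for e > 0 gives one inequality; the opposite one follows
  by inserting - v.\<close>

lemma euler_lagrange_ge:
  assumes h: "dual h" and m: "is_min h u G" and s: "sob v K"
  shows "(LINT x|M. h x * v x) \<le> (LINT x|M. norm (G x) powr (p - 2) * (G x \<bullet> K x))"
proof -
  note su = is_min_sob[OF m]
  note [measurable] = sob_measurable[OF su] sob_measurable[OF s]
  define e where "e n = 1 / real (Suc n)" for n
  have e: "0 < e n" "e n \<le> 1" for n by (auto simp: e_def field_simps)
  define D where "D n x = (norm (G x + e n *\<^sub>R K x) powr p - norm (G x) powr p) / e n" for n x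
  have st: "sob (\<lambda>x. u x + e n * v x) (\<lambda>x. G x + e n *\<^sub>R K x)" for n
    by (intro sob_add sob_cmult su s)
  have Dm: "D n \<in> borel_measurable M" for n unfolding D_def[abs_def] by measurable
  have lim: "(\<lambda>n. LINT x|M. D n x) \<longlonglongrightarrow> (LINT x|M. p * (norm (G x) powr (p - 2) * (G x \<bullet> K x)))"
  proof (rule integral_dominated_convergence[where w = "\<lambda>x. p * 2 powr p * (norm (G x) powr p + norm (K x) powr p)"])
    show "integrable M (\<lambda>x. p * 2 powr p * (norm (G x) powr p + norm (K x) powr p))"
      using sob_memLp(2)[OF su] sob_memLp(2)[OF s] by (auto simp: memLp_def)
    show "AE x in M. norm (D n x) \<le> p * 2 powr p * (norm (G x) powr p + norm (K x) powr p)" for n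
      using norm_powr_quotient_bound[OF p0(4) e(1)[of n] e(2)[of n]] e(1)[of n]
      by (intro AE_I2) (simp add: D_def)
    show "AE x in M. (\<lambda>n. D n x) \<longlonglongrightarrow> p * (norm (G x) powr (p - 2) * (G x \<bullet> K x))"
    proof (rule AE_I2)
      fix x
      have "((\<lambda>t. (norm (G x + t *\<^sub>R K x) powr p - norm (G x) powr p) / t) \<longlongrightarrow> p * (norm (G x) powr (p - 2) * (G x \<bullet> K x))) (at 0)"
        using norm_powr_line_derivative[OF p0(4), of "G x" "K x" 0] by (simp add: DERIV_def)
      moreover have "filterlim e (at 0) sequentially"
        unfolding e_def[abs_def] using LIMSEQ_Suc[OF lim_1_over_n] by (intro filterlim_atI) auto
      ultimately show "(\<lambda>n. D n x) \<longlonglongrightarrow> p * (norm (G x) powr (p - 2) * (G x \<bullet> K x))"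
        unfolding D_def by (rule filterlim_compose)
    qed
  qed (use Dm in measurable)
  have ge: "p * (LINT x|M. h x * v x) \<le> (LINT x|M. D n x)" for n
  proof -
    have i: "integrable M (\<lambda>x. norm (G x + e n *\<^sub>R K x) powr p)" "integrable M (\<lambda>x. norm (G x) powr p)"
      using sob_memLp(2)[OF st] sob_memLp(2)[OF su] by (auto simp: memLp_def)
    have "(LINT x|M. D n x) = (En M p (\<lambda>x. G x + e n *\<^sub>R K x) - En M p G) / e n"
      using i by (simp add: D_def En_def)
    moreover have "J h u G \<le> J h (\<lambda>x. u x + e n * v x) (\<lambda>x. G x + e n *\<^sub>R K x)" by (rule is_min_le[OF m st])
    moreover have "(LINT x|M. h x * (u x + e n * v x)) = (LINT x|M. h x * u x) + e n * (LINT x|M. h x * v x)"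
    proof -
      have "(LINT x|M. h x * (u x + e n * v x)) = (LINT x|M. h x * u x + e n * (h x * v x))" by (simp add: algebra_simps)
      also have "\<dots> = (LINT x|M. h x * u x) + (LINT x|M. e n * (h x * v x))"
        by (rule Bochner_Integration.integral_add[OF dual_integrable[OF h su] integrable_mult_right[OF dual_integrable[OF h s]]])
      finally show ?thesis by simp
    qed
    ultimately have "e n * (LINT x|M. h x * v x) \<le> (En M p (\<lambda>x. G x + e n *\<^sub>R K x) - En M p G) / p"
      unfolding J_def by (simp add: diff_divide_distrib)
    then have "p * (e n * (LINT x|M. h x * v x)) \<le> En M p (\<lambda>x. G x + e n *\<^sub>R K x) - En M p G"
      using p0 by (simp add: pos_le_divide_eq mult.commute)
    then show ?thesis
      using e(1)[of n] \<open>(LINT x|M. D n x) = _\<close> by (simp add: pos_le_divide_eq algebra_simps)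
  qed
  have "p * (LINT x|M. h x * v x) \<le> (LINT x|M. p * (norm (G x) powr (p - 2) * (G x \<bullet> K x)))"
    by (rule LIMSEQ_le_const[OF lim]) (use ge in auto)
  then have "p * (LINT x|M. h x * v x) \<le> p * (LINT x|M. norm (G x) powr (p - 2) * (G x \<bullet> K x))"
    by (simp only: integral_mult_right_zero)
  then show ?thesis using p0 by simp
qed

lemma euler_lagrange:
  assumes h: "dual h" and m: "is_min h u G" and s: "sob v K"
  shows "(LINT x|M. norm (G x) powr (p - 2) * (G x \<bullet> K x)) = (LINT x|M. h x * v x)"
proof (rule antisym)
  show "(LINT x|M. h x * v x) \<le> (LINT x|M. norm (G x) powr (p - 2) * (G x \<bullet> K x))"
    by (rule euler_lagrange_ge[OF assms])
  show "(LINT x|M. norm (G x) powr (p - 2) * (G x \<bullet> K x)) \<le> (LINT x|M. h x * v x)"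
    using euler_lagrange_ge[OF h m sob_minus[OF s]] by simp
qed

text \<open>Adding the strong convexity inequalities for the two functionals cancels the energies
  and bounds the distance of the gradients by the integral of (h - k_n)(w - u_n). Comparison traps
  \<open>u n\<close> between \<open>u0\<close> and w, so (h - h0)(w - u0) dominates the integrand,
  which tends to 0. Thus the pointwise limit of the minimizers minimizes for the limiting right-hand
  side.\<close>

lemma minimizer_stability:
  assumes h: "dual h" and h0: "dual h0" and k: "\<And>n. k n \<in> borel_measurable M"
    and between: "\<And>n. AE x in M. h0 x \<le> k n x" "\<And>n. AE x in M. k n x \<le> h x"
    and conv: "AE x in M. (\<lambda>n. k n x) \<longlonglongrightarrow> h x"
    and u0: "is_min h0 u0 G0" and u: "\<And>n. is_min (k n) (u n) (G n)" and W: "is_min h w W"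
    and ulim: "AE x in M. (\<lambda>n. u n x) \<longlonglongrightarrow> v x"
  shows "AE x in M. v x = w x"
proof -
  note sw = is_min_sob[OF W] and su = is_min_sob[OF u] and s0 = is_min_sob[OF u0]
  note [measurable] = dual_measurable[OF h] dual_measurable[OF h0] k
    sob_measurable[OF sw] sob_measurable[OF su] sob_measurable[OF s0]
  have dk: "dual (k n)" for n
  proof -
    have d: "dual (\<lambda>x. \<bar>h x\<bar> + \<bar>h0 x\<bar>)"
      by (intro dual_add dual_mono[OF h] dual_mono[OF h0]) auto
    show ?thesis
      by (rule dual_mono[OF d k]) (use between[of n] in eventually_elim, auto)
  qed
  have ub: "AE x in M. u n x \<le> w x" for n by (rule comparison[OF dk h between(2) u W])
  have lb: "AE x in M. u0 x \<le> u n x" for n by (rule comparison[OF h0 dk between(1) u0 u])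
  have i: "integrable M (\<lambda>x. h x * w x)" "integrable M (\<lambda>x. h x * u n x)" "integrable M (\<lambda>x. k n x * w x)" "integrable M (\<lambda>x. k n x * u n x)" for n
    using dual_integrable[OF h sw] dual_integrable[OF h su] dual_integrable[OF dk sw] dual_integrable[OF dk su] by auto
  have est: "4 * conv_const * En M p (\<lambda>x. G n x - W x) \<le> (LINT x|M. (h x - k n x) * (w x - u n x))" for n
  proof -
    have 1: "J h w W + 2 * conv_const * En M p (\<lambda>x. W x - G n x) \<le> J h (u n) (G n)"
      by (rule J_strongly_convex[OF h W su])
    have 2: "J (k n) (u n) (G n) + 2 * conv_const * En M p (\<lambda>x. G n x - W x) \<le> J (k n) w W"
      by (rule J_strongly_convex[OF dk u sw])
    have 3: "(LINT x|M. (h x - k n x) * (w x - u n x)) = (LINT x|M. h x * w x) - (LINT x|M. h x * u n x)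
        - ((LINT x|M. k n x * w x) - (LINT x|M. k n x * u n x))"
    proof -
      have "(LINT x|M. (h x - k n x) * (w x - u n x)) = (LINT x|M. (h x * w x - h x * u n x) - (k n x * w x - k n x * u n x))"
        by (simp add: algebra_simps)
      also have "\<dots> = (LINT x|M. h x * w x - h x * u n x) - (LINT x|M. k n x * w x - k n x * u n x)"
        by (intro Bochner_Integration.integral_diff Bochner_Integration.integrable_diff i)
      finally show ?thesis using i by simp
    qed
    show ?thesis using 1 2 3 En_minus_commute[of M p "G n" W] unfolding J_def by (simp add: algebra_simps)
  qed
  have "(\<lambda>n. LINT x|M. (h x - k n x) * (w x - u n x)) \<longlonglongrightarrow> (LINT x|M. 0)"
  proof (rule integral_dominated_convergence[where w = "\<lambda>x. \<bar>(h x - h0 x) * (w x - u0 x)\<bar>"])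
    show "integrable M (\<lambda>x. \<bar>(h x - h0 x) * (w x - u0 x)\<bar>)"
      using dual_integrable[OF dual_diff[OF h h0] sob_diff[OF sw s0]] by (rule integrable_abs)
    show "AE x in M. (\<lambda>n. (h x - k n x) * (w x - u n x)) \<longlonglongrightarrow> 0"
      using conv ulim
    proof eventually_elim
      case (elim x)
      then have "(\<lambda>n. (h x - k n x) * (w x - u n x)) \<longlonglongrightarrow> (h x - h x) * (w x - v x)"
        by (intro tendsto_intros)
      then show ?case by simp
    qed
    show "AE x in M. norm ((h x - k n x) * (w x - u n x)) \<le> \<bar>(h x - h0 x) * (w x - u0 x)\<bar>" for n
      using between[of n] ub[of n] lb[of n]
      by eventually_elim (auto simp: abs_mult intro!: mult_mono)
  qed measurable
  then have lim0: "(\<lambda>n. LINT x|M. (h x - k n x) * (w x - u n x)) \<longlonglongrightarrow> 0" by simp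
  have "(\<lambda>n. En M p (\<lambda>x. G n x - W x)) \<longlonglongrightarrow> 0"
  proof (rule tendsto_sandwich[OF always_eventually always_eventually tendsto_const])
    show "(\<lambda>n. (LINT x|M. (h x - k n x) * (w x - u n x)) / (4 * conv_const)) \<longlonglongrightarrow> 0"
      by (rule tendsto_divide_zero[OF lim0])
    show "\<forall>n. En M p (\<lambda>x. G n x - W x) \<le> (LINT x|M. (h x - k n x) * (w x - u n x)) / (4 * conv_const)"
    proof
      fix n
      have "4 * conv_const > 0" using conv_const_pos by linarith
      then show "En M p (\<lambda>x. G n x - W x) \<le> (LINT x|M. (h x - k n x) * (w x - u n x)) / (4 * conv_const)"
        using est[of n] by (subst pos_le_divide_eq) (auto simp: mult.commute)
    qed
  qed simp
  obtain Cp where Cp: "0 < Cp" "\<And>u G. sob u G \<Longrightarrow> En M p u \<le> Cp * En M p G"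
    by (rule poincare) (rule that)
  have "(\<lambda>n. En M p (\<lambda>x. u n x - w x)) \<longlonglongrightarrow> 0"
  proof (rule tendsto_sandwich[OF always_eventually always_eventually tendsto_const])
    show "(\<lambda>n. Cp * En M p (\<lambda>x. G n x - W x)) \<longlonglongrightarrow> 0"
      using tendsto_mult_left[OF \<open>(\<lambda>n. En M p (\<lambda>x. G n x - W x)) \<longlonglongrightarrow> 0\<close>, of Cp] by simp
    show "\<forall>n. En M p (\<lambda>x. u n x - w x) \<le> Cp * En M p (\<lambda>x. G n x - W x)"
      using Cp(2)[OF sob_diff[OF su sw]] by blast
  qed simp
  then obtain r :: "nat \<Rightarrow> nat" where r: "strict_mono r" "AE x in M. (\<lambda>n. u (r n) x) \<longlonglongrightarrow> w x"
    by (rule En_tendsto_AE_subseq[OF sob_memLp(1)[OF su] sob_memLp(1)[OF sw] p0(2)]) (rule that)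
  show ?thesis
    using r(2) ulim
  proof eventually_elim
    case (elim x)
    show ?case
      by (rule LIMSEQ_unique[OF LIMSEQ_subseq_LIMSEQ[OF elim(2) r(1), unfolded comp_def] elim(1)])
  qed
qed

end

section \<open>Estimate of powers of solutions\<close>

text \<open>By monotone convergence the supremum has finite integral, hence is finite almost
  everywhere. This is what makes the limit of the increasing iterates finite.\<close>

lemma AE_bounded_of_mono_bounded_integral:
  fixes f :: "nat \<Rightarrow> 'x \<Rightarrow> real"
  assumes int: "\<And>n. integrable M (f n)" and nn: "\<And>n. AE x in M. 0 \<le> f n x"
    and mono: "\<And>n. AE x in M. f n x \<le> f (Suc n) x"
    and bd: "\<And>n. integral\<^sup>L M (f n) \<le> C"
  shows "AE x in M. \<exists>b. \<forall>n. f n x \<le> b"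
proof -
  have [measurable]: "f n \<in> borel_measurable M" for n using int by auto
  have "(\<integral>\<^sup>+x. (SUP n. ennreal (f n x)) \<partial>M) = (SUP n. \<integral>\<^sup>+x. ennreal (f n x) \<partial>M)"
  proof (rule nn_integral_monotone_convergence_SUP_AE)
    show "AE x in M. ennreal (f n x) \<le> ennreal (f (Suc n) x)" for n
      using mono[of n] by eventually_elim (rule ennreal_leI)
  qed measurable
  also have "\<dots> \<le> ennreal C"
    using int nn bd by (intro SUP_least) (simp add: nn_integral_eq_integral ennreal_leI)
  finally have "(\<integral>\<^sup>+x. (SUP n. ennreal (f n x)) \<partial>M) \<noteq> \<infinity>"
    by (auto simp: top_unique)
  then have fin: "AE x in M. (SUP n. ennreal (f n x)) \<noteq> \<infinity>"
    by (intro nn_integral_PInf_AE) auto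
  have nn': "AE x in M. \<forall>n. 0 \<le> f n x" using nn by (simp add: AE_all_countable)
  show ?thesis
    using fin nn'
  proof eventually_elim
    case (elim x)
    have "f n x \<le> enn2real (SUP n. ennreal (f n x))" for n
    proof -
      have "ennreal (f n x) \<le> (SUP n. ennreal (f n x))" by (rule SUP_upper) simp
      then have "enn2real (ennreal (f n x)) \<le> enn2real (SUP n. ennreal (f n x))"
        using elim(1) by (intro enn2real_mono) (auto simp: less_top[symmetric])
      then show ?thesis using elim(2) by simp
    qed
    then show ?case by blast
  qed
qed

lemma young_product:
  fixes a b r :: real
  assumes "1 < r" "0 \<le> a" "0 \<le> b"
  shows "a * b \<le> a powr r + b powr (r / (r - 1))"
proof -
  have "a * b \<le> a powr r / r + b powr (r / (r - 1)) / (r / (r - 1))"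
    using assms by (intro Youngs_inequality) (auto simp: field_simps)
  also have "\<dots> \<le> a powr r / 1 + b powr (r / (r - 1)) / 1"
    using assms by (intro add_mono divide_left_mono) (auto simp: field_simps)
  finally show ?thesis by simp
qed

definition signed_powr :: "real \<Rightarrow> real \<Rightarrow> real" where
  "signed_powr p s = \<bar>s\<bar> powr (p - 2) * s"

lemma abs_signed_powr: "\<bar>signed_powr p s\<bar> = \<bar>s\<bar> powr (p - 1)"
  by (cases "s = 0") (auto simp: signed_powr_def abs_mult powr_diff power2_eq_square)

lemma signed_powr_nonneg: "0 \<le> s \<Longrightarrow> signed_powr p s = s powr (p - 1)"
  using abs_signed_powr[of p s] by (simp add: signed_powr_def)

lemma signed_powr_minus: "signed_powr p (- s) = - signed_powr p s"
  by (simp add: signed_powr_def)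

lemma signed_powr_mono:
  assumes "1 \<le> p" "s \<le> t"
  shows "signed_powr p s \<le> signed_powr p t"
proof -
  have pos: "signed_powr p a \<le> signed_powr p b" if "0 \<le> a" "a \<le> b" for a b
    using that assms(1) by (simp add: signed_powr_nonneg powr_mono2)
  consider "0 \<le> s" | "s < 0" "0 \<le> t" | "t < 0" by linarith
  then show ?thesis
  proof cases
    case 2
    have "signed_powr p s \<le> 0" using 2 by (simp add: signed_powr_def mult_nonneg_nonpos)
    also have "0 \<le> signed_powr p t" using 2 by (simp add: signed_powr_def)
    finally show ?thesis .
  next
    case 3
    then show ?thesis using pos[of "- t" "- s"] assms by (simp add: signed_powr_minus)
  qed (use pos assms in auto)
qed

lemma signed_powr_continuous: "2 \<le> p \<Longrightarrow> continuous_on UNIV (signed_powr p)"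
  using continuous_norm_powr_scaleR[of p, where 'b = real] by (simp add: signed_powr_def[abs_def])

lemma signed_powr_measurable [measurable]: "signed_powr p \<in> borel_measurable borel"
  unfolding signed_powr_def[abs_def] by measurable

text \<open>\<open>\<gamma>\<close> is determined by the third identity, the target exponent divided
  by the Sobolev exponent. Then \<open>\<gamma>\<close> \<ge> 1 is equivalent to the lower bound on
  r, the second identity makes a datum in L^r pair with the Sobolev power, and the bound on
  \<open>\<mu>\<close> equals \<open>((N - p) / p) powr p * t / \<gamma> powr p\<close>, so the last
  claim is a rewriting.\<close>

lemma regularity_exponents:
  fixes N p r :: real
  assumes p: "2 \<le> p" "p < N" and r: "1 < r" "p * N / (p * N - N + p) \<le> r" "r < N / p"
  defines "\<gamma> \<equiv> (p - 1) * r * (N - p) / (p * (N - p * r))"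
  defines "t \<equiv> p * \<gamma> - p + 1"
  shows "1 \<le> \<gamma>" "t / \<gamma> * (r / (r - 1)) = p * N / (N - p)"
    "\<gamma> * (p * N / (N - p)) = (p - 1) * r * N / (N - p * r)"
    "\<mu> < (r - 1) * N * (N - r * p) powr (p - 1) / ((p - 1) powr (p - 1) * r powr p) \<Longrightarrow>
      \<mu> * \<gamma> powr p < ((N - p) / p) powr p * t"
proof -
  define d where "d = N - p * r"
  have d: "d > 0" using r p by (simp add: d_def field_simps)
  have g: "\<gamma> = (p - 1) * r * (N - p) / (p * d)" by (simp add: \<gamma>_def d_def)
  have gpos: "\<gamma> > 0" using p r d by (simp add: g)
  have t: "t = (p - 1) * N * (r - 1) / d"
  proof -
    have "t * d = (p - 1) * r * (N - p) - (p - 1) * d" using p d by (simp add: t_def g field_simps)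
    also have "\<dots> = (p - 1) * N * (r - 1)" by (simp add: d_def algebra_simps)
    finally show ?thesis using d by (simp add: field_simps)
  qed
  have pN: "p * N - N + p > 0"
  proof -
    have "0 < (p - 1) * N + p" using p by (intro add_pos_pos mult_pos_pos) auto
    then show ?thesis by (simp add: algebra_simps)
  qed
  have "p * N \<le> r * (p * N - N + p)" using r(2) pN by (simp add: pos_divide_le_eq)
  then have "p * d \<le> (p - 1) * r * (N - p)" by (simp add: d_def algebra_simps)
  then show "1 \<le> \<gamma>" using p d by (simp add: g)
  show "t / \<gamma> * (r / (r - 1)) = p * N / (N - p)"
  proof -
    have nz: "d \<noteq> 0" "p \<noteq> 0" "p - 1 \<noteq> 0" "r \<noteq> 0" "r - 1 \<noteq> 0" "N - p \<noteq> 0"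
      using p r d by auto
    show ?thesis unfolding t g using nz by (simp add: divide_simps)
  qed
  show "\<gamma> * (p * N / (N - p)) = (p - 1) * r * N / (N - p * r)"
    unfolding g d_def[symmetric] using p d by (simp add: divide_simps)
  assume \<mu>: "\<mu> < (r - 1) * N * (N - r * p) powr (p - 1) / ((p - 1) powr (p - 1) * r powr p)"
  have "(r - 1) * N * (N - r * p) powr (p - 1) / ((p - 1) powr (p - 1) * r powr p) * \<gamma> powr p
      = ((N - p) / p) powr p * t"
  proof -
    have e1: "(N - r * p) powr (p - 1) = d powr p / d"
      using d by (simp add: d_def powr_diff mult.commute)
    have e2: "(p - 1) powr (p - 1) = (p - 1) powr p / (p - 1)"
      using p by (simp add: powr_diff)
    have "\<gamma> = ((N - p) / p) * ((p - 1) * r / d)" by (simp add: g)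
    then have "\<gamma> powr p = ((N - p) / p) powr p * ((p - 1) * r / d) powr p" by (simp only: powr_mult)
    also have "((p - 1) * r / d) powr p = (p - 1) powr p * r powr p / d powr p"
      using p r d by (simp add: powr_mult powr_divide)
    finally have e3: "\<gamma> powr p = ((N - p) / p) powr p * ((p - 1) powr p * r powr p / d powr p)" .
    have nz: "d powr p \<noteq> 0" "r powr p \<noteq> 0" "(p - 1) powr p \<noteq> 0" "d \<noteq> 0" "p - 1 \<noteq> 0"
      using p r d by auto
    show ?thesis unfolding e1 e2 e3 t using nz by (simp add: divide_simps)
  qed
  then show "\<mu> * \<gamma> powr p < ((N - p) / p) powr p * t"
    using mult_strict_right_mono[OF \<mu>, of "\<gamma> powr p"] gpos by simp
qed

section \<open>Pairings controlled by the Hardy and Sobolev inequalities\<close>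

context sobolev_domain
begin

lemma norm_measurable_M [measurable]: "(\<lambda>x::'a. norm x) \<in> borel_measurable M"
  by (rule borel_imp_M) simp

text \<open>Young's inequality applied under the common weight separates v from u; Hardy's
  inequality bounds the part with u, and the part with v is finite by assumption.\<close>

lemma dual_hardy_weight:
  assumes [measurable]: "v \<in> borel_measurable M" and v: "integrable M (\<lambda>x. \<bar>v x\<bar> powr p / norm x powr p)"
  shows "dual (\<lambda>x. \<bar>v x\<bar> powr (p - 1) / norm x powr p)"
  unfolding dual_def
proof (intro conjI exI allI impI)
  show "(\<lambda>x. \<bar>v x\<bar> powr (p - 1) / norm x powr p) \<in> borel_measurable M" by measurable
  show "0 \<le> (LINT x|M. \<bar>v x\<bar> powr p / norm x powr p) + 1 / hardy"
    using hardy_pos by (intro add_nonneg_nonneg integral_nonneg_AE AE_I2) auto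
  fix u G assume s: "sob u G" and E: "En M p G \<le> 1"
  note [measurable] = sob_measurable[OF s]
  have le: "\<bar>\<bar>v x\<bar> powr (p - 1) / norm x powr p * u x\<bar> \<le> \<bar>v x\<bar> powr p / norm x powr p + \<bar>u x\<bar> powr p / norm x powr p" for x
  proof -
    have "\<bar>v x\<bar> powr (p - 1) * \<bar>u x\<bar> \<le> \<bar>v x\<bar> powr p + \<bar>u x\<bar> powr p"
      by (rule young_powr_simple[OF p0(4)]) auto
    then have "\<bar>v x\<bar> powr (p - 1) * \<bar>u x\<bar> / norm x powr p \<le> (\<bar>v x\<bar> powr p + \<bar>u x\<bar> powr p) / norm x powr p"
      by (intro divide_right_mono) auto
    then show ?thesis by (simp add: abs_mult add_divide_distrib)
  qed
  have i: "integrable M (\<lambda>x. \<bar>v x\<bar> powr p / norm x powr p + \<bar>u x\<bar> powr p / norm x powr p)"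
    by (intro Bochner_Integration.integrable_add v hardy_sob[OF s])
  show int: "integrable M (\<lambda>x. \<bar>v x\<bar> powr (p - 1) / norm x powr p * u x)"
    by (rule Bochner_Integration.integrable_bound[OF i]) (use le in \<open>auto intro!: AE_I2 order_trans[OF le abs_ge_self]\<close>)
  have "(LINT x|M. \<bar>\<bar>v x\<bar> powr (p - 1) / norm x powr p * u x\<bar>)
      \<le> (LINT x|M. \<bar>v x\<bar> powr p / norm x powr p + \<bar>u x\<bar> powr p / norm x powr p)"
    by (rule integral_mono[OF integrable_abs[OF int] i le])
  also have "\<dots> = (LINT x|M. \<bar>v x\<bar> powr p / norm x powr p) + (LINT x|M. \<bar>u x\<bar> powr p / norm x powr p)"
    by (rule Bochner_Integration.integral_add[OF v hardy_sob(1)[OF s]])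
  also have "(LINT x|M. \<bar>u x\<bar> powr p / norm x powr p) \<le> 1 / hardy"
    using hardy_sob(2)[OF s] E hardy_pos by (simp add: pos_le_divide_eq mult.commute)
  finally show "(LINT x|M. \<bar>\<bar>v x\<bar> powr (p - 1) / norm x powr p * u x\<bar>)
      \<le> (LINT x|M. \<bar>v x\<bar> powr p / norm x powr p) + 1 / hardy" by simp
qed

definition potential :: "real \<Rightarrow> real \<Rightarrow> 'a \<Rightarrow> real" where
  "potential \<mu> s x = \<mu> / norm x powr p * signed_powr p s"

lemma potential_mono: "0 \<le> \<mu> \<Longrightarrow> s \<le> t \<Longrightarrow> potential \<mu> s x \<le> potential \<mu> t x"
  unfolding potential_def using p0 by (intro mult_left_mono signed_powr_mono) auto

lemma potential_measurable [measurable]: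
  "v \<in> borel_measurable M \<Longrightarrow> (\<lambda>x. potential \<mu> (v x) x) \<in> borel_measurable M"
  unfolding potential_def[abs_def] by measurable

lemma potential_tendsto:
  assumes "u \<longlonglongrightarrow> s" shows "(\<lambda>n. potential \<mu> (u n) x) \<longlonglongrightarrow> potential \<mu> s x"
proof -
  have "isCont (signed_powr p) s"
    using signed_powr_continuous[OF p_ge_2] by (simp add: continuous_on_eq_continuous_at)
  then show ?thesis unfolding potential_def
    by (intro tendsto_mult tendsto_const isCont_tendsto_compose[OF _ assms])
qed

lemma dual_cmult:
  assumes "dual h" shows "dual (\<lambda>x. c * h x)"
proof -
  obtain C where C: "C \<ge> 0" "\<And>u G. sob u G \<Longrightarrow> En M p G \<le> 1 \<Longrightarrow> integrable M (\<lambda>x. h x * u x)"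
    "\<And>u G. sob u G \<Longrightarrow> En M p G \<le> 1 \<Longrightarrow> (LINT x|M. \<bar>h x * u x\<bar>) \<le> C"
    by (rule dualE[OF assms]) (rule that)
  show ?thesis
    unfolding dual_def
  proof (intro conjI exI allI impI)
    show "(\<lambda>x. c * h x) \<in> borel_measurable M" using dual_measurable[OF assms] by measurable
    show "0 \<le> \<bar>c\<bar> * C" using C(1) by simp
    fix u G assume s: "sob u G" and E: "En M p G \<le> 1"
    show "integrable M (\<lambda>x. c * h x * u x)"
      using integrable_mult_right[OF C(2)[OF s E], of c] by (simp add: mult.assoc)
    have "\<bar>c * h x * u x\<bar> = \<bar>c\<bar> * \<bar>h x * u x\<bar>" for x by (simp add: abs_mult)
    then have "(LINT x|M. \<bar>c * h x * u x\<bar>) = \<bar>c\<bar> * (LINT x|M. \<bar>h x * u x\<bar>)"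
      by (simp only: integral_mult_right_zero)
    also have "\<dots> \<le> \<bar>c\<bar> * C" by (intro mult_left_mono C(3)[OF s E]) auto
    finally show "(LINT x|M. \<bar>c * h x * u x\<bar>) \<le> \<bar>c\<bar> * C" .
  qed
qed

lemma dual_potential:
  assumes [measurable]: "v \<in> borel_measurable M" and v: "integrable M (\<lambda>x. \<bar>v x\<bar> powr p / norm x powr p)"
  shows "dual (\<lambda>x. potential \<mu> (v x) x)"
  by (rule dual_mono[OF dual_cmult[OF dual_hardy_weight[OF assms], of \<mu>]])
    (auto simp: potential_def abs_mult abs_signed_powr)

text \<open>A bound on the unit ball suffices, so Young's inequality takes the place of Hoelder's.
  With \<open>\<theta> = 1\<close> it shows that a datum in L^r is a functional; with
  \<open>\<theta> = t / \<gamma>\<close> it controls the datum in the power estimate.\<close>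

lemma Lp_pairing:
  assumes g: "memLp M r g" and r: "1 < r" and \<theta>: "\<theta> * (r / (r - 1)) = pstar"
  obtains C where "0 \<le> C" "\<And>V H. sob V H \<Longrightarrow> En M p H \<le> 1 \<Longrightarrow> integrable M (\<lambda>x. \<bar>g x\<bar> * \<bar>V x\<bar> powr \<theta>)"
    "\<And>V H. sob V H \<Longrightarrow> En M p H \<le> 1 \<Longrightarrow> (LINT x|M. \<bar>g x\<bar> * \<bar>V x\<bar> powr \<theta>) \<le> C"
proof -
  obtain S where S: "0 \<le> S"
    "\<And>u G. sob u G \<Longrightarrow> En M p G \<le> 1 \<Longrightarrow> integrable M (\<lambda>x. \<bar>u x\<bar> powr pstar)"
    "\<And>u G. sob u G \<Longrightarrow> En M p G \<le> 1 \<Longrightarrow> (LINT x|M. \<bar>u x\<bar> powr pstar) \<le> S"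
    by (rule sobolev_sob) (rule that)
  have gi: "integrable M (\<lambda>x. \<bar>g x\<bar> powr r)" and [measurable]: "g \<in> borel_measurable M"
    using g by (auto simp: memLp_def)
  have main: "integrable M (\<lambda>x. \<bar>g x\<bar> * \<bar>V x\<bar> powr \<theta>) \<and> (LINT x|M. \<bar>g x\<bar> * \<bar>V x\<bar> powr \<theta>) \<le> En M r g + S"
    if s: "sob V H" and E: "En M p H \<le> 1" for V H
  proof -
    note [measurable] = sob_measurable[OF s]
    have le: "\<bar>g x\<bar> * \<bar>V x\<bar> powr \<theta> \<le> \<bar>g x\<bar> powr r + \<bar>V x\<bar> powr pstar" for x
      using young_product[OF r, of "\<bar>g x\<bar>" "\<bar>V x\<bar> powr \<theta>"]
      unfolding powr_powr \<theta> by simp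
    have i: "integrable M (\<lambda>x. \<bar>g x\<bar> powr r + \<bar>V x\<bar> powr pstar)"
      by (intro Bochner_Integration.integrable_add gi S(2)[OF s E])
    have int: "integrable M (\<lambda>x. \<bar>g x\<bar> * \<bar>V x\<bar> powr \<theta>)"
      by (rule Bochner_Integration.integrable_bound[OF i]) (use le in \<open>auto intro!: AE_I2 order_trans[OF le abs_ge_self]\<close>)
    have "(LINT x|M. \<bar>g x\<bar> * \<bar>V x\<bar> powr \<theta>) \<le> (LINT x|M. \<bar>g x\<bar> powr r + \<bar>V x\<bar> powr pstar)"
      by (rule integral_mono[OF int i le])
    also have "\<dots> = En M r g + (LINT x|M. \<bar>V x\<bar> powr pstar)"
      unfolding En_def real_norm_def by (rule Bochner_Integration.integral_add[OF gi S(2)[OF s E]])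
    finally show ?thesis using int S(3)[OF s E] by simp
  qed
  show thesis by (rule that[of "En M r g + S"]) (use main S(1) in auto)
qed

lemma memLp_lower_exponent:
  assumes "memLp M m g" "0 < r" "r \<le> m"
  shows "memLp M r g"
proof -
  have [measurable]: "g \<in> borel_measurable M" using assms by (simp add: memLp_def)
  have "integrable M (\<lambda>x. norm (g x) powr r)"
  proof (rule Bochner_Integration.integrable_bound)
    show "integrable M (\<lambda>x. 1 + norm (g x) powr m)"
      using assms(1) integrable_const_M[of 1] by (auto simp: memLp_def)
    show "AE x in M. norm (norm (g x) powr r) \<le> norm (1 + norm (g x) powr m)"
    proof (rule AE_I2)
      fix x
      have "norm (g x) powr r \<le> 1 + norm (g x) powr m"
      proof (cases "norm (g x) \<le> 1")
        case True
        then have "norm (g x) powr r \<le> 1 powr r" using assms by (intro powr_mono2) auto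
        then show ?thesis by (simp add: add_increasing2)
      next
        case False
        then have "norm (g x) powr r \<le> norm (g x) powr m" using assms by (intro powr_mono) auto
        then show ?thesis by simp
      qed
      then show "norm (norm (g x) powr r) \<le> norm (1 + norm (g x) powr m)" by simp
    qed
  qed measurable
  then show ?thesis by (simp add: memLp_def)
qed

lemma pstar_conj: "pstar > 1" "1 < pstar / (pstar - 1)" "pstar / (pstar - 1) / (pstar / (pstar - 1) - 1) = pstar"
proof -
  show 1: "pstar > 1" using pstar_gt p0 by linarith
  define q where "q = pstar"
  have q: "q > 1" using 1 by (simp add: q_def)
  have "q / (q - 1) - 1 = 1 / (q - 1)" "1 < q / (q - 1)" using q by (auto simp: field_simps)
  then have "1 < q / (q - 1)" "q / (q - 1) / (q / (q - 1) - 1) = q" using q by auto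
  then show "1 < pstar / (pstar - 1)" "pstar / (pstar - 1) / (pstar / (pstar - 1) - 1) = pstar"
    by (simp_all add: q_def)
qed

lemma dual_Lp:
  assumes "memLp M m g" "pstar / (pstar - 1) \<le> m"
  shows "dual g"
proof -
  define r where "r = pstar / (pstar - 1)"
  have r: "1 < r" "1 * (r / (r - 1)) = pstar" using pstar_conj by (auto simp: r_def)
  have g: "memLp M r g" using memLp_lower_exponent[OF assms(1), of r] r assms(2) by (simp add: r_def)
  obtain C where C: "0 \<le> C" "\<And>V H. sob V H \<Longrightarrow> En M p H \<le> 1 \<Longrightarrow> integrable M (\<lambda>x. \<bar>g x\<bar> * \<bar>V x\<bar> powr 1)"
    "\<And>V H. sob V H \<Longrightarrow> En M p H \<le> 1 \<Longrightarrow> (LINT x|M. \<bar>g x\<bar> * \<bar>V x\<bar> powr 1) \<le> C"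
    by (rule Lp_pairing[OF g r]) (rule that)
  have [measurable]: "g \<in> borel_measurable M" using g by (simp add: memLp_def)
  show ?thesis
    unfolding dual_def
  proof (intro conjI exI allI impI)
    fix u G assume s: "sob u G" and E: "En M p G \<le> 1"
    note [measurable] = sob_measurable[OF s]
    have "integrable M (\<lambda>x. \<bar>g x * u x\<bar>)" using C(2)[OF s E] by (simp add: abs_mult)
    then show "integrable M (\<lambda>x. g x * u x)" by (subst (asm) integrable_abs_iff) auto
    show "(LINT x|M. \<bar>g x * u x\<bar>) \<le> C" using C(3)[OF s E] by (simp add: abs_mult)
  qed (use C(1) in auto)
qed

text \<open>Testing the equation for \<open>U\<close> with \<open>T powr t\<close>, where \<open>T = min U k\<close>, turns the principal part into
  \<open>t / \<gamma> powr p\<close> times the energy of \<open>T powr \<gamma>\<close>. The right-hand side is truncated at the same level \<open>k\<close>,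
  so that the potential term is bounded by the Hardy inequality for \<open>T powr \<gamma>\<close>.\<close>

lemma power_estimate:
  assumes \<gamma>: "1 \<le> \<gamma>" and t: "t = p * \<gamma> - p + 1" and \<mu>: "0 \<le> \<mu>" "\<mu> * \<gamma> powr p < hardy * t"
    and g: "memLp M r g" "1 < r" "t / \<gamma> * (r / (r - 1)) = pstar" "dual g"
  obtains B where "0 < B" "\<And>U G v k. \<lbrakk>AE x in M. 0 \<le> U x; 0 < k; v \<in> borel_measurable M;
      AE x in M. 0 \<le> v x \<and> v x \<le> min (U x) k; dual (\<lambda>x. potential \<mu> (v x) x + \<bar>g x\<bar>);
      is_min (\<lambda>x. potential \<mu> (v x) x + \<bar>g x\<bar>) U G\<rbrakk>
    \<Longrightarrow> \<exists>H. sob (\<lambda>x. min (U x) k powr \<gamma>) H \<and> En M p H \<le> B"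
proof -
  \<comment> \<open>In terms of \<open>V = T powr \<gamma>\<close> the test function
    \<open>T powr t\<close> is \<open>V powr \<theta>\<close>. Since \<open>\<theta>\<close> < p,
    the datum is of lower order than the energy of V.\<close>
  define \<theta> where "\<theta> = t / \<gamma>"
  obtain C where C: "0 \<le> C" "\<And>V H. sob V H \<Longrightarrow> En M p H \<le> 1 \<Longrightarrow> integrable M (\<lambda>x. \<bar>g x\<bar> * \<bar>V x\<bar> powr \<theta>)"
    "\<And>V H. sob V H \<Longrightarrow> En M p H \<le> 1 \<Longrightarrow> (LINT x|M. \<bar>g x\<bar> * \<bar>V x\<bar> powr \<theta>) \<le> C"
    by (rule Lp_pairing[OF g(1,2) g(3)[folded \<theta>_def]]) (rule that)
  have pg: "p * \<gamma> - p \<ge> 0" using \<gamma> p0 by simp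
  then have t1: "1 \<le> t" using t by linarith
  have \<theta>: "0 < \<theta>" "\<theta> < p"
  proof -
    show "0 < \<theta>" using t1 \<gamma> by (simp add: \<theta>_def)
    have "t < p * \<gamma>" using t p0 by linarith
    then show "\<theta> < p" using \<gamma> by (simp add: \<theta>_def pos_divide_less_eq)
  qed
  \<comment> \<open>What is left of the principal part after the Hardy inequality has absorbed the
    potential; the hypothesis on \<open>\<mu>\<close> says precisely that it is positive.
    \<open>A\<close> then solves \<delta> a^p = C a^\<theta>.\<close>
  define \<delta> where "\<delta> = t / \<gamma> powr p - \<mu> / hardy"
  have gp: "\<gamma> powr p > 0" using \<gamma> by simp
  have \<delta>: "\<delta> > 0" using \<mu>(2) gp hardy_pos by (simp add: \<delta>_def field_simps)
  define A where "A = (C / \<delta>) powr (1 / (p - \<theta>))"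
  have A0: "A \<ge> 0" by (simp add: A_def)
  show thesis
  proof (rule that[of "max 1 (A powr p)"])
    show "0 < max 1 (A powr p)" by simp
    fix U G v k
    assume U0: "AE x in M. 0 \<le> U x" and k: "0 < k" and [measurable]: "v \<in> borel_measurable M"
      and v: "AE x in M. 0 \<le> v x \<and> v x \<le> min (U x) k"
      and dh: "dual (\<lambda>x. potential \<mu> (v x) x + \<bar>g x\<bar>)"
      and mn: "is_min (\<lambda>x. potential \<mu> (v x) x + \<bar>g x\<bar>) U G"
    note sU = is_min_sob[OF mn]
    define T where "T x = min (U x) k" for x
    define K where "K x = (if U x > k then 0 else G x)" for x
    define V where "V x = T x powr \<gamma>" for x
    define H where "H x = (\<gamma> * T x powr (\<gamma> - 1)) *\<^sub>R K x" for x
    have sT: "sob T K"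
      unfolding T_def[abs_def] K_def[abs_def] using k by (intro sob_min_const sU) auto
    have T0: "AE x in M. 0 \<le> T x \<and> T x \<le> k"
      using U0 by eventually_elim (use k in \<open>auto simp: T_def\<close>)
    have sV: "sob V H"
      unfolding V_def[abs_def] H_def[abs_def] by (rule sob_powr[OF sT k T0 \<gamma>])
    have sTt: "sob (\<lambda>x. T x powr t) (\<lambda>x. (t * T x powr (t - 1)) *\<^sub>R K x)"
      by (rule sob_powr[OF sT k T0 t1])
    note [measurable] = sob_measurable[OF sU] sob_measurable[OF sT] sob_measurable[OF sV] sob_measurable[OF sTt]
    define E where "E = En M p H"
    have E0: "0 \<le> E" by (simp add: E_def)
    \<comment> \<open>This choice of t makes |H|^p a constant multiple of the integrand that the
      test function produces in the principal part.\<close>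
    have tg: "t - 1 = (\<gamma> - 1) * p" using t by (simp add: algebra_simps)
    have Hn: "norm (H x) powr p = \<gamma> powr p * (T x powr (t - 1) * norm (K x) powr p)" for x
    proof -
      have "norm (H x) = \<gamma> * T x powr (\<gamma> - 1) * norm (K x)" using \<gamma> by (simp add: H_def)
      then show ?thesis by (simp add: powr_mult powr_powr tg)
    qed
    have L: "(LINT x|M. norm (G x) powr (p - 2) * (G x \<bullet> ((t * T x powr (t - 1)) *\<^sub>R K x))) = t / \<gamma> powr p * E"
    proof -
      have "norm (G x) powr (p - 2) * (G x \<bullet> ((t * T x powr (t - 1)) *\<^sub>R K x)) = t / \<gamma> powr p * norm (H x) powr p" for x
      proof -
        have "norm (G x) powr (p - 2) * (G x \<bullet> K x) = norm (K x) powr p"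
        proof (cases "U x > k \<or> G x = 0")
          case False
          then have "norm (G x) powr (p - 2) * (G x \<bullet> K x) = norm (G x) powr (p - 2) * norm (G x) powr 2"
            by (simp add: K_def power2_norm_eq_inner)
          also have "\<dots> = norm (G x) powr p" unfolding powr_add[symmetric] by simp
          finally show ?thesis using False by (simp add: K_def)
        qed (use p0 in \<open>auto simp: K_def\<close>)
        then have "norm (G x) powr (p - 2) * (G x \<bullet> ((t * T x powr (t - 1)) *\<^sub>R K x)) = t * T x powr (t - 1) * norm (K x) powr p"
          by (simp add: algebra_simps)
        then show ?thesis unfolding Hn using gp by simp
      qed
      then show ?thesis by (simp only: E_def En_def integral_mult_right_zero)
    qed
    have R: "(LINT x|M. norm (G x) powr (p - 2) * (G x \<bullet> ((t * T x powr (t - 1)) *\<^sub>R K x)))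
        = (LINT x|M. (potential \<mu> (v x) x + \<bar>g x\<bar>) * T x powr t)"
      by (rule euler_lagrange[OF dh mn sTt])
    \<comment> \<open>The p-th root of the energy, kept at least 1 so that V / a is a legitimate
      rescaling to unit energy; for energies up to 1 nothing has to be shown.\<close>
    define a where "a = max 1 E powr (1 / p)"
    have a: "a \<ge> 1" "a powr p = max 1 E"
    proof -
      have "1 powr (1 / p) \<le> max 1 E powr (1 / p)" using p0 by (intro powr_mono2) auto
      then show "a \<ge> 1" by (simp add: a_def)
      show "a powr p = max 1 E" using p0 by (simp add: a_def powr_powr)
    qed
    have gV: "integrable M (\<lambda>x. \<bar>g x\<bar> * V x powr \<theta>)" "(LINT x|M. \<bar>g x\<bar> * V x powr \<theta>) \<le> C * a powr \<theta>"
    proof -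
      note sa = sob_cmult[OF sV, of "1 / a"]
      have "En M p (\<lambda>x. (1 / a) *\<^sub>R H x) = (1 / a) powr p * E"
        using a p0 by (simp add: En_scaleR E_def)
      also have "\<dots> \<le> (1 / a) powr p * a powr p" using a by (intro mult_left_mono) auto
      also have "\<dots> = 1" using a by (simp add: powr_divide)
      finally have E1: "En M p (\<lambda>x. (1 / a) *\<^sub>R H x) \<le> 1" .
      have eq: "\<bar>g x\<bar> * \<bar>1 / a * V x\<bar> powr \<theta> = (1 / a) powr \<theta> * (\<bar>g x\<bar> * V x powr \<theta>)" for x
      proof -
        have "\<bar>1 / a * V x\<bar> = 1 / a * V x" using a by (simp add: V_def abs_mult)
        then have "\<bar>1 / a * V x\<bar> powr \<theta> = (1 / a) powr \<theta> * V x powr \<theta>" by (simp only: powr_mult)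
        then show ?thesis by simp
      qed
      have inv: "a powr \<theta> * (1 / a) powr \<theta> = 1" using a by (simp add: powr_divide)
      have "integrable M (\<lambda>x. (1 / a) powr \<theta> * (\<bar>g x\<bar> * V x powr \<theta>))"
        using C(2)[OF sa E1] by (simp only: eq)
      from integrable_mult_right[OF this, of "a powr \<theta>"]
      show "integrable M (\<lambda>x. \<bar>g x\<bar> * V x powr \<theta>)"
        by (simp only: mult.assoc[symmetric] inv mult_1)
      have "(1 / a) powr \<theta> * (LINT x|M. \<bar>g x\<bar> * V x powr \<theta>) \<le> C"
        using C(3)[OF sa E1] by (simp only: eq integral_mult_right_zero)
      then have "a powr \<theta> * ((1 / a) powr \<theta> * (LINT x|M. \<bar>g x\<bar> * V x powr \<theta>)) \<le> a powr \<theta> * C"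
        by (intro mult_left_mono) auto
      then show "(LINT x|M. \<bar>g x\<bar> * V x powr \<theta>) \<le> C * a powr \<theta>"
        by (simp only: mult.assoc[symmetric] inv mult_1 mult.commute[of C])
    qed
    have le: "AE x in M. (potential \<mu> (v x) x + \<bar>g x\<bar>) * T x powr t \<le> \<mu> * (\<bar>V x\<bar> powr p / norm x powr p) + \<bar>g x\<bar> * V x powr \<theta>"
      using v T0
    proof eventually_elim
      case (elim x)
      have "v x powr (p - 1) * T x powr t \<le> T x powr (p - 1) * T x powr t"
        using elim p0 by (intro mult_right_mono powr_mono2) (auto simp: T_def)
      also have "\<dots> = \<bar>V x\<bar> powr p"
      proof -
        have "p - 1 + t = \<gamma> * p" using t by (simp add: algebra_simps)
        then show ?thesis by (simp add: V_def powr_powr flip: powr_add)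
      qed
      finally have 1: "v x powr (p - 1) * T x powr t \<le> \<bar>V x\<bar> powr p" .
      have 2: "T x powr t = V x powr \<theta>" using \<gamma> by (simp add: V_def powr_powr \<theta>_def)
      have "potential \<mu> (v x) x * T x powr t = \<mu> / norm x powr p * (v x powr (p - 1) * T x powr t)"
        using elim by (simp add: potential_def signed_powr_nonneg)
      also have "\<dots> \<le> \<mu> / norm x powr p * \<bar>V x\<bar> powr p"
        using 1 \<mu>(1) by (intro mult_left_mono) auto
      finally have "potential \<mu> (v x) x * T x powr t \<le> \<mu> * (\<bar>V x\<bar> powr p / norm x powr p)" by simp
      then show ?case unfolding distrib_right 2 by simp
    qed
    have hV: "integrable M (\<lambda>x. \<mu> * (\<bar>V x\<bar> powr p / norm x powr p))"
      by (intro integrable_mult_right hardy_sob(1)[OF sV])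
    have "t / \<gamma> powr p * E \<le> (LINT x|M. \<mu> * (\<bar>V x\<bar> powr p / norm x powr p) + \<bar>g x\<bar> * V x powr \<theta>)"
      unfolding L[symmetric] R
      by (rule integral_mono_AE[OF dual_integrable[OF dh sTt] Bochner_Integration.integrable_add[OF hV gV(1)] le])
    also have "\<dots> = \<mu> * (LINT x|M. \<bar>V x\<bar> powr p / norm x powr p) + (LINT x|M. \<bar>g x\<bar> * V x powr \<theta>)"
      unfolding Bochner_Integration.integral_add[OF hV gV(1)] by (simp only: integral_mult_right_zero)
    also have "\<dots> \<le> \<mu> * (E / hardy) + C * a powr \<theta>"
      using hardy_sob(2)[OF sV] hardy_pos \<mu>(1)
      by (intro add_mono gV(2) mult_left_mono) (auto simp: E_def pos_le_divide_eq mult.commute)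
    finally have main: "\<delta> * E \<le> C * a powr \<theta>" by (simp add: \<delta>_def left_diff_distrib)
    have "E \<le> max 1 (A powr p)"
    proof (cases "E \<le> 1")
      case False
      then have aE: "a powr p = E" using a by simp
      have "\<delta> * a powr p \<le> C * a powr \<theta>" using main aE by simp
      then have "a powr p / a powr \<theta> \<le> C / \<delta>" using \<delta> a by (simp add: field_simps)
      then have "a powr (p - \<theta>) \<le> C / \<delta>" by (simp add: powr_diff)
      then have "(a powr (p - \<theta>)) powr (1 / (p - \<theta>)) \<le> A"
        unfolding A_def using \<theta> by (intro powr_mono2) auto
      then have "a \<le> A" using \<theta> a by (simp add: powr_powr)
      then have "a powr p \<le> A powr p" using a p0 by (intro powr_mono2) auto
      then show ?thesis using aE by simp
    qed simp
    then show "\<exists>H. sob (\<lambda>x. min (U x) k powr \<gamma>) H \<and> En M p H \<le> max 1 (A powr p)"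
      using sV by (auto simp: V_def[abs_def] T_def E_def)
  qed
qed

end

section \<open>Monotone iteration\<close>

lemma incseq_bounded_LIMSEQ_lim:
  fixes X :: "nat \<Rightarrow> real"
  assumes "\<And>n. X n \<le> X (Suc n)" "\<And>n. X n \<le> B"
  shows "X \<longlonglongrightarrow> lim X" "\<And>n. X n \<le> lim X"
proof -
  have inc: "incseq X" using assms(1) by (simp add: incseq_SucI)
  from incseq_convergent[OF inc, of B] assms(2) obtain L where L: "X \<longlonglongrightarrow> L" "\<forall>i. X i \<le> L" by blast
  have "lim X = L" using L(1) by (rule limI)
  then show "X \<longlonglongrightarrow> lim X" "\<And>n. X n \<le> lim X" using L by auto
qed

context sobolev_domain
begin

text \<open>\<open>F\<close> carries the index because the truncation level may grow along with the
  iterate. Monotonicity in index and value together lets comparison propagate the first inequality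
  \<open>start\<close> to all steps.\<close>

lemma monotone_iteration:
  fixes F :: "nat \<Rightarrow> real \<Rightarrow> 'a \<Rightarrow> real"
  assumes s0: "sob u0 G0" and mono: "\<And>n s t x. s \<le> t \<Longrightarrow> F n s x \<le> F (Suc n) t x"
    and d: "\<And>n u G. sob u G \<Longrightarrow> dual (\<lambda>x. F n (u x) x)"
    and start: "\<And>v H. is_min (\<lambda>x. F 0 (u0 x) x) v H \<Longrightarrow> AE x in M. u0 x \<le> v x"
  obtains u G where "u (0::nat) = u0" "\<And>n. sob (u n) (G n)"
    "\<And>n. is_min (\<lambda>x. F n (u n x) x) (u (Suc n)) (G (Suc n))" "\<And>n. AE x in M. u n x \<le> u (Suc n) x"
proof -
  define S where "S h = (SOME z. is_min h (fst z) (snd z))" for h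
  have S: "is_min h (fst (S h)) (snd (S h))" if h: "dual h" for h
  proof -
    obtain v H where "is_min h v H" by (rule minimizer_exists[OF h])
    then have "is_min h (fst (v, H)) (snd (v, H))" by simp
    then show ?thesis unfolding S_def by (rule someI)
  qed
  define z where "z = rec_nat (u0, G0) (\<lambda>n z. S (\<lambda>x. F n (fst z x) x))"
  define u where "u n = fst (z n)" for n
  define G where "G n = snd (z n)" for n
  have zS: "z (Suc n) = S (\<lambda>x. F n (u n x) x)" for n by (simp add: z_def u_def)
  have u0: "u 0 = u0" "G 0 = G0" by (auto simp: u_def G_def z_def)
  have step: "is_min (\<lambda>x. F n (u n x) x) (u (Suc n)) (G (Suc n))" if "sob (u n) (G n)" for n
    using S[OF d[OF that]] by (simp add: u_def[of "Suc n"] G_def[of "Suc n"] zS)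
  have s: "sob (u n) (G n)" for n
    by (induction n) (use u0 s0 is_min_sob[OF step] in auto)
  have inc: "AE x in M. u n x \<le> u (Suc n) x" for n
  proof (induction n)
    case 0
    then show ?case using start step[OF s, of 0] by (simp add: u0)
  next
    case (Suc n)
    have "AE x in M. F n (u n x) x \<le> F (Suc n) (u (Suc n) x) x"
      using Suc by eventually_elim (rule mono)
    then show ?case
      by (rule comparison[OF d[OF s] d[OF s] _ step[OF s] step[OF s]])
  qed
  show thesis by (rule that[OF u0(1) s step[OF s] inc])
qed

text \<open>Closes the fixed point: the limit occurs in its own right-hand side, where it is
  replaced by the minimizer that equals it almost everywhere.\<close>

lemma is_min_cong_AE:
  assumes "is_min h u G" "h \<in> borel_measurable M" "k \<in> borel_measurable M" "AE x in M. h x = k x"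
  shows "is_min k u G"
proof -
  have "J k v H = J h v H" if s: "sob v H" for v H
  proof -
    note [measurable] = sob_measurable[OF s] assms(2,3)
    have "(LINT x|M. k x * v x) = (LINT x|M. h x * v x)"
    proof (rule integral_cong_AE)
      show "AE x in M. k x * v x = h x * v x" using assms(4) by eventually_elim simp
    qed measurable
    then show ?thesis by (simp add: J_def)
  qed
  then show ?thesis using assms(1) unfolding is_min_def by auto
qed

lemma zero_is_min: "is_min (\<lambda>x. 0) (\<lambda>x. 0) (\<lambda>x. 0)"
  unfolding is_min_def J_def using sob_zero p0 by (auto simp: En_def)

lemma sobolev_scaled:
  assumes B: "0 < B"
  obtains C where "\<And>u G. sob u G \<Longrightarrow> En M p G \<le> B \<Longrightarrow> integrable M (\<lambda>x. \<bar>u x\<bar> powr pstar)"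
    "\<And>u G. sob u G \<Longrightarrow> En M p G \<le> B \<Longrightarrow> (LINT x|M. \<bar>u x\<bar> powr pstar) \<le> C"
proof -
  obtain S where S: "0 \<le> S"
    "\<And>u G. sob u G \<Longrightarrow> En M p G \<le> 1 \<Longrightarrow> integrable M (\<lambda>x. \<bar>u x\<bar> powr pstar)"
    "\<And>u G. sob u G \<Longrightarrow> En M p G \<le> 1 \<Longrightarrow> (LINT x|M. \<bar>u x\<bar> powr pstar) \<le> S"
    by (rule sobolev_sob) (rule that)
  define c where "c = B powr (- 1 / p)"
  have c: "c > 0" "c powr p = 1 / B"
  proof -
    show "c > 0" using B by (simp add: c_def)
    have "c powr p = B powr (- 1)" unfolding c_def powr_powr using p0 by simp
    then show "c powr p = 1 / B" using B by (simp add: powr_minus_divide)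
  qed
  define D where "D = (1 / c) powr pstar"
  have D: "0 \<le> D" "D * c powr pstar = 1"
    using c(1) by (auto simp: D_def powr_divide)
  have main: "integrable M (\<lambda>x. \<bar>u x\<bar> powr pstar) \<and> (LINT x|M. \<bar>u x\<bar> powr pstar) \<le> D * S"
    if s: "sob u G" and E: "En M p G \<le> B" for u G
  proof -
    note sc = sob_cmult[OF s, of c]
    have "En M p (\<lambda>x. c *\<^sub>R G x) = c powr p * En M p G" using c p0 by (simp add: En_scaleR)
    also have "\<dots> \<le> 1" using c E B by (simp add: pos_divide_le_eq)
    finally have E1: "En M p (\<lambda>x. c *\<^sub>R G x) \<le> 1" .
    have eq: "\<bar>c * u x\<bar> powr pstar = c powr pstar * \<bar>u x\<bar> powr pstar" for x
      using c by (simp add: abs_mult powr_mult)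
    have i: "integrable M (\<lambda>x. c powr pstar * \<bar>u x\<bar> powr pstar)"
      using S(2)[OF sc E1] by (simp only: eq)
    have b: "c powr pstar * (LINT x|M. \<bar>u x\<bar> powr pstar) \<le> S"
      using S(3)[OF sc E1] by (simp only: eq integral_mult_right_zero)
    show ?thesis
      using integrable_mult_right[OF i, of D] mult_left_mono[OF b D(1)]
      by (simp only: mult.assoc[symmetric] D(2) mult_1)
  qed
  show thesis by (rule that[of "D * S"]) (use main in blast)+
qed

lemma pstar_conj_eq: "pstar / (pstar - 1) = p * N / (p * N - N + p)"
proof -
  have d: "N - p > 0" using p_less_dim by simp
  have "pstar - 1 = (p * N - N + p) / (N - p)" using d by (simp add: field_simps)
  then show ?thesis using d by simp
qed

lemma dual_abs: "dual h \<Longrightarrow> dual (\<lambda>x. \<bar>h x\<bar>)"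
  by (rule dual_mono) (auto simp: dual_def)

lemma dual_potential_sob: "sob u G \<Longrightarrow> dual (\<lambda>x. potential \<mu> (u x) x)"
  by (intro dual_potential sob_measurable hardy_sob)

text \<open>The nonnegative datum keeps all iterates nonnegative, so powers are admissible test
  functions. The estimates are uniform along the iteration and pass to the limit, whose right-hand
  side is then again a bounded functional.\<close>

lemma supersolution_exists:
  assumes f: "memLp M m f" "pstar / (pstar - 1) \<le> m" "m < N / p"
    and \<mu>: "0 < \<mu>" "\<mu> < hardy"
      "\<mu> < (m - 1) * N * (N - m * p) powr (p - 1) / ((p - 1) powr (p - 1) * m powr p)"
  obtains W H where "sob W H" "AE x in M. 0 \<le> W x"
    "integrable M (\<lambda>x. \<bar>W x\<bar> powr ((p - 1) * m * N / (N - p * m)))"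
    "is_min (\<lambda>x. potential \<mu> (W x) x + \<bar>f x\<bar>) W H"
proof -
  define s where "s = (p - 1) * m * N / (N - p * m)"
  define q where "q = pstar"
  have q: "q > 0" using pstar_gt by (simp add: q_def)
  have m1: "1 < m" using f(2) pstar_conj(2) by linarith
  define \<gamma> where "\<gamma> = (p - 1) * m * (N - p) / (p * (N - p * m))"
  define t where "t = p * \<gamma> - p + 1"
  note ex = regularity_exponents[OF p_ge_2 p_less_dim m1 f(2)[unfolded pstar_conj_eq] f(3), folded \<gamma>_def, folded t_def]
  have \<gamma>: "1 \<le> \<gamma>" by (rule ex(1))
  have \<gamma>s: "\<gamma> * q = s" using ex(3) by (simp add: q_def s_def)
  have s0: "s > 0" using \<gamma> q by (simp flip: \<gamma>s)
  have df: "dual f" by (rule dual_Lp[OF f(1,2)])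
  have [measurable]: "f \<in> borel_measurable M" using f(1) by (simp add: memLp_def)
  \<comment> \<open>Truncation at level n keeps each step within reach of the power estimate, and
    the level is lifted together with the iterate, so monotonicity in the index is
    preserved.\<close>
  define F where "F n v x = potential \<mu> (min v (real n)) x + \<bar>f x\<bar>" for n :: nat and v and x :: 'a
  have Fmono: "F n v x \<le> F (Suc n) w x" if "v \<le> w" for n v w x
    unfolding F_def using \<mu>(1) that by (intro add_right_mono potential_mono) auto
  have Fdual: "dual (\<lambda>x. F n (u x) x)" if "sob u G" for n u G
    unfolding F_def by (intro dual_add dual_abs[OF df] dual_potential_sob[OF sob_min_const[OF that]]) simp
  have start: "AE x in M. 0 \<le> v x" if "is_min (\<lambda>x. F 0 0 x) v H" for v H
    by (rule comparison[OF dual_zero Fdual[OF sob_zero] _ zero_is_min that])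
      (simp add: F_def potential_def signed_powr_def)
  obtain u G where u: "u (0::nat) = (\<lambda>x. 0)" "\<And>n. sob (u n) (G n)"
    "\<And>n. is_min (\<lambda>x. F n (u n x) x) (u (Suc n)) (G (Suc n))" "\<And>n. AE x in M. u n x \<le> u (Suc n) x"
    by (rule monotone_iteration[where F = F and ?u0.0 = "\<lambda>x. 0", OF sob_zero Fmono Fdual start])
      (assumption | rule that)+
  note [measurable] = sob_measurable(1)[OF u(2)]
  have inc: "AE x in M. \<forall>n. u n x \<le> u (Suc n) x" using u(4) by (simp add: AE_all_countable)
  have pos: "AE x in M. \<forall>n. 0 \<le> u n x"
    using inc
  proof eventually_elim
    case (elim x)
    show ?case
    proof
      fix n show "0 \<le> u n x" by (induction n) (use elim u(1) order_trans in auto)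
    qed
  qed
  \<comment> \<open>\<open>u (Suc (Suc n))\<close> minimizes for a potential truncated at level
    \<open>Suc n\<close>; it is cut at the same level. The shift by one also makes every level
    positive.\<close>
  define T where "T n x = min (u (Suc (Suc n)) x) (real (Suc n))" for n x
  have [measurable]: "T n \<in> borel_measurable M" for n unfolding T_def[abs_def] by measurable
  have T0: "AE x in M. \<forall>n. 0 \<le> T n x" using pos by eventually_elim (simp add: T_def)
  have Tmono: "AE x in M. \<forall>n. T n x \<le> T (Suc n) x"
    using inc by eventually_elim (auto simp: T_def min_def intro: order_trans)
  have estimate: "\<exists>B>0. \<forall>n. \<exists>H. sob (\<lambda>x. T n x powr c) H \<and> En M p H \<le> B"
    if c: "1 \<le> c" "\<mu> * c powr p < hardy * (p * c - p + 1)"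
      and g: "memLp M r f" "1 < r" "(p * c - p + 1) / c * (r / (r - 1)) = pstar" for c r
  proof -
    obtain B where B: "0 < B" "\<And>U G v k. \<lbrakk>AE x in M. 0 \<le> U x; 0 < k; v \<in> borel_measurable M;
        AE x in M. 0 \<le> v x \<and> v x \<le> min (U x) k; dual (\<lambda>x. potential \<mu> (v x) x + \<bar>f x\<bar>);
        is_min (\<lambda>x. potential \<mu> (v x) x + \<bar>f x\<bar>) U G\<rbrakk>
      \<Longrightarrow> \<exists>H. sob (\<lambda>x. min (U x) k powr c) H \<and> En M p H \<le> B"
      by (rule power_estimate[OF c(1) refl less_imp_le[OF \<mu>(1)] c(2) g df]) (rule that)
    have "\<exists>H. sob (\<lambda>x. T n x powr c) H \<and> En M p H \<le> B" for n
      unfolding T_def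
    proof (rule B(2))
      show "AE x in M. 0 \<le> u (Suc (Suc n)) x" using pos by eventually_elim simp
      show "AE x in M. 0 \<le> min (u (Suc n) x) (real (Suc n)) \<and>
          min (u (Suc n) x) (real (Suc n)) \<le> min (u (Suc (Suc n)) x) (real (Suc n))"
        using pos inc by eventually_elim (simp add: min.mono min.coboundedI1)
      show "dual (\<lambda>x. potential \<mu> (min (u (Suc n) x) (real (Suc n))) x + \<bar>f x\<bar>)"
        using Fdual[OF u(2), of "Suc n" "Suc n"] by (simp add: F_def)
      show "is_min (\<lambda>x. potential \<mu> (min (u (Suc n) x) (real (Suc n))) x + \<bar>f x\<bar>) (u (Suc (Suc n))) (G (Suc (Suc n)))"
        using u(3)[of "Suc n"] by (simp add: F_def)
    qed auto
    then show ?thesis by (intro exI[of _ B] conjI B(1) allI)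
  qed
  \<comment> \<open>With \<open>\<gamma> = 1\<close> the test exponent is 1 as well, and the
    condition reduces to \<open>\<mu>\<close> below the Hardy constant; the datum is used with the
    lowest admissible exponent. This bound gives finiteness of the limit and integrability against
    the Hardy weight.\<close>
  have "\<exists>B>0. \<forall>n. \<exists>H. sob (\<lambda>x. T n x powr 1) H \<and> En M p H \<le> B"
  proof (rule estimate)
    show "memLp M (pstar / (pstar - 1)) f"
      using memLp_lower_exponent[OF f(1) _ f(2)] pstar_conj(2) by simp
    show "1 < pstar / (pstar - 1)" by (rule pstar_conj(2))
    show "(p * 1 - p + 1) / 1 * (pstar / (pstar - 1) / (pstar / (pstar - 1) - 1)) = pstar"
      using pstar_conj(3) by simp
  qed (use \<mu> in auto)
  then obtain B1 H1 where B1: "B1 > 0" "\<And>n. sob (\<lambda>x. T n x powr 1) (H1 n)" "\<And>n. En M p (H1 n) \<le> B1"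
    by metis
  have "\<exists>B>0. \<forall>n. \<exists>H. sob (\<lambda>x. T n x powr \<gamma>) H \<and> En M p H \<le> B"
    by (rule estimate[OF \<gamma> ex(4)[OF \<mu>(3), unfolded t_def] f(1) m1 ex(2)[unfolded t_def]])
  then obtain B2 H2 where B2: "B2 > 0" "\<And>n. sob (\<lambda>x. T n x powr \<gamma>) (H2 n)" "\<And>n. En M p (H2 n) \<le> B2"
    by metis
  obtain C1 where C1: "\<And>u G. sob u G \<Longrightarrow> En M p G \<le> B1 \<Longrightarrow> integrable M (\<lambda>x. \<bar>u x\<bar> powr q)"
    "\<And>u G. sob u G \<Longrightarrow> En M p G \<le> B1 \<Longrightarrow> (LINT x|M. \<bar>u x\<bar> powr q) \<le> C1"
    by (rule sobolev_scaled[OF B1(1), folded q_def]) (rule that)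
  obtain C2 where C2: "\<And>u G. sob u G \<Longrightarrow> En M p G \<le> B2 \<Longrightarrow> integrable M (\<lambda>x. \<bar>u x\<bar> powr q)"
    "\<And>u G. sob u G \<Longrightarrow> En M p G \<le> B2 \<Longrightarrow> (LINT x|M. \<bar>u x\<bar> powr q) \<le> C2"
    by (rule sobolev_scaled[OF B2(1), folded q_def]) (rule that)
  have bounded: "AE x in M. \<exists>b. \<forall>n. \<bar>T n x powr 1\<bar> powr q \<le> b"
  proof (rule AE_bounded_of_mono_bounded_integral)
    show "AE x in M. \<bar>T n x powr 1\<bar> powr q \<le> \<bar>T (Suc n) x powr 1\<bar> powr q" for n
      using T0 Tmono by eventually_elim (use q in \<open>auto intro!: powr_mono2\<close>)
  qed (use C1[OF B1(2,3)] in auto)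
  define w where "w x = lim (\<lambda>n. u n x)" for x
  have [measurable]: "w \<in> borel_measurable M" unfolding w_def[abs_def] by measurable
  have ulim: "AE x in M. (\<lambda>n. u n x) \<longlonglongrightarrow> w x \<and> (\<forall>n. u n x \<le> w x)"
    using bounded T0 inc
  proof eventually_elim
    case (elim x)
    then obtain b where b: "\<And>n. \<bar>T n x powr 1\<bar> powr q \<le> b" by blast
    have Tb: "T n x \<le> b powr (1 / q)" for n
    proof -
      have "(T n x powr q) powr (1 / q) \<le> b powr (1 / q)"
        using b[of n] elim(2) q by (intro powr_mono2) auto
      then show ?thesis using elim(2) q by (simp add: powr_powr)
    qed
    have mono: "u i x \<le> u j x" if "i \<le> j" for i j
      using that by (rule lift_Suc_mono_le[of "\<lambda>n. u n x", rotated]) (use elim(3) in auto)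
    \<comment> \<open>For indices beyond k the truncation level exceeds the bound already known for
      \<open>T\<close>, so the truncation is inactive and the bound holds for the iterate
      itself.\<close>
    obtain k where k: "b powr (1 / q) < real k" using reals_Archimedean2 by blast
    have "u n x \<le> b powr (1 / q)" for n
    proof -
      have "T (n + k) x \<le> b powr (1 / q)" by (rule Tb)
      then have "u (Suc (Suc (n + k))) x \<le> b powr (1 / q)" using k by (auto simp: T_def min_def split: if_splits)
      then show ?thesis using mono[of n "Suc (Suc (n + k))"] by simp
    qed
    then show ?case
      unfolding w_def using incseq_bounded_LIMSEQ_lim[of "\<lambda>n. u n x" "b powr (1 / q)"] elim(3) by auto
  qed
  have w0: "AE x in M. 0 \<le> w x"
    using ulim pos by eventually_elim (meson order_trans)
  have minlim: "AE x in M. (\<lambda>n. min (u n x) (real n)) \<longlonglongrightarrow> w x"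
    using ulim
  proof eventually_elim
    case (elim x)
    obtain k where k: "w x < real k" using reals_Archimedean2 by blast
    have "u n x = min (u n x) (real n)" if "n \<ge> k" for n
    proof -
      have "u n x \<le> real n" using elim k that by (smt (verit) of_nat_mono)
      then show ?thesis by simp
    qed
    then have "\<forall>\<^sub>F n in sequentially. u n x = min (u n x) (real n)"
      by (auto simp: eventually_sequentially)
    with elim[THEN conjunct1] show ?case by (rule Lim_transform_eventually)
  qed
  have Tlim: "AE x in M. (\<lambda>n. T n x) \<longlonglongrightarrow> w x"
    using ulim
  proof eventually_elim
    case (elim x)
    obtain k where k: "w x < real k" using reals_Archimedean2 by blast
    have "u (Suc (Suc n)) x = T n x" if "n \<ge> k" for n
    proof -
      have "u (Suc (Suc n)) x \<le> w x" using elim by simp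
      also have "\<dots> \<le> real (Suc n)" using k that by simp
      finally show ?thesis by (simp add: T_def)
    qed
    then have "\<forall>\<^sub>F n in sequentially. u (Suc (Suc n)) x = T n x"
      by (auto simp: eventually_sequentially)
    with LIMSEQ_Suc[OF LIMSEQ_Suc[OF elim[THEN conjunct1]]] show ?case
      by (rule Lim_transform_eventually)
  qed
  have wh: "integrable M (\<lambda>x. \<bar>w x\<bar> powr p / norm x powr p)"
  proof (rule fatou_bounded(1)[where f = "\<lambda>n x. \<bar>T n x powr 1\<bar> powr p / norm x powr p" and C = "\<lambda>_. B1 / hardy" and L = "B1 / hardy"])
    show "integrable M (\<lambda>x. \<bar>T n x powr 1\<bar> powr p / norm x powr p)" for n by (rule hardy_sob(1)[OF B1(2)])
    show "(LINT x|M. \<bar>T n x powr 1\<bar> powr p / norm x powr p) \<le> B1 / hardy" for n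
      using hardy_sob(2)[OF B1(2)[of n]] B1(3)[of n] hardy_pos by (simp add: pos_le_divide_eq mult.commute)
    show "AE x in M. (\<lambda>n. \<bar>T n x powr 1\<bar> powr p / norm x powr p) \<longlonglongrightarrow> \<bar>w x\<bar> powr p / norm x powr p"
      using Tlim T0
    proof eventually_elim
      case (elim x)
      have "(\<lambda>n. \<bar>T n x\<bar> powr p) \<longlonglongrightarrow> \<bar>w x\<bar> powr p"
        using p0 by (intro tendsto_powr2[OF tendsto_rabs[OF elim(1)] tendsto_const]) auto
      moreover have "\<bar>T n x powr 1\<bar> = \<bar>T n x\<bar>" for n using elim(2) by simp
      ultimately show ?case unfolding divide_inverse by (intro tendsto_mult tendsto_const) simp
    qed
  qed auto
  have ws: "integrable M (\<lambda>x. \<bar>w x\<bar> powr s)"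
  proof (rule fatou_bounded(1)[where f = "\<lambda>n x. \<bar>T n x powr \<gamma>\<bar> powr q" and C = "\<lambda>_. C2" and L = C2])
    show "AE x in M. (\<lambda>n. \<bar>T n x powr \<gamma>\<bar> powr q) \<longlonglongrightarrow> \<bar>w x\<bar> powr s"
      using Tlim T0
    proof eventually_elim
      case (elim x)
      have "(\<lambda>n. \<bar>T n x\<bar> powr s) \<longlonglongrightarrow> \<bar>w x\<bar> powr s"
        using s0 by (intro tendsto_powr2[OF tendsto_rabs[OF elim(1)] tendsto_const]) auto
      moreover have "\<bar>T n x powr \<gamma>\<bar> powr q = \<bar>T n x\<bar> powr s" for n
        using elim(2) by (simp add: powr_powr \<gamma>s)
      ultimately show ?case by simp
    qed
  qed (use C2[OF B2(2,3)] in auto)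
  have dh: "dual (\<lambda>x. potential \<mu> (w x) x + \<bar>f x\<bar>)"
    by (intro dual_add dual_abs[OF df] dual_potential wh) measurable
  obtain W H where W: "is_min (\<lambda>x. potential \<mu> (w x) x + \<bar>f x\<bar>) W H"
    by (rule minimizer_exists[OF dh])
  \<comment> \<open>Stability with shifted minimizers: \<open>u (Suc n)\<close> belongs to the
    right-hand side built from \<open>u n\<close>. The first right-hand side is the lower bracket,
    the limiting one the upper.\<close>
  have eq: "AE x in M. w x = W x"
  proof (rule minimizer_stability[OF dh Fdual[OF u(2)] _ _ _ _ u(3) u(3) W])
    show "(\<lambda>x. F n (u n x) x) \<in> borel_measurable M" for n by (rule dual_measurable[OF Fdual[OF u(2)]])
    show "AE x in M. F 0 (u 0 x) x \<le> F n (u n x) x" for n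
      using inc
    proof eventually_elim
      case (elim x)
      show ?case by (rule lift_Suc_mono_le[of "\<lambda>n. F n (u n x) x"]) (use elim Fmono in auto)
    qed
    show "AE x in M. F n (u n x) x \<le> potential \<mu> (w x) x + \<bar>f x\<bar>" for n
      using ulim
    proof eventually_elim
      case (elim x)
      then have "min (u n x) (real n) \<le> w x" by (meson min.coboundedI1)
      then show ?case unfolding F_def using \<mu>(1) by (intro add_right_mono potential_mono) auto
    qed
    show "AE x in M. (\<lambda>n. F n (u n x) x) \<longlonglongrightarrow> potential \<mu> (w x) x + \<bar>f x\<bar>"
      using minlim
    proof eventually_elim
      case (elim x)
      show ?case unfolding F_def by (intro tendsto_add tendsto_const potential_tendsto[OF elim])
    qed
    show "AE x in M. (\<lambda>n. u (Suc n) x) \<longlonglongrightarrow> w x"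
      using ulim by eventually_elim (auto intro: LIMSEQ_Suc)
  qed
  note sW = is_min_sob[OF W]
  note [measurable] = sob_measurable(1)[OF sW]
  show thesis
  proof (rule that[OF sW])
    show "AE x in M. 0 \<le> W x" using w0 eq by eventually_elim simp
    have "integrable M (\<lambda>x. \<bar>w x\<bar> powr s) \<longleftrightarrow> integrable M (\<lambda>x. \<bar>W x\<bar> powr s)"
      by (rule integrable_cong_AE) (use eq in \<open>auto elim!: eventually_mono\<close>)
    then show "integrable M (\<lambda>x. \<bar>W x\<bar> powr ((p - 1) * m * N / (N - p * m)))"
      using ws by (simp add: s_def)
    show "is_min (\<lambda>x. potential \<mu> (W x) x + \<bar>f x\<bar>) W H"
      by (rule is_min_cong_AE[OF W]) (use eq in \<open>auto elim!: eventually_mono\<close>)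
  qed
qed

text \<open>Since the potential is odd, - W solves the problem with datum - |f| and lies below the
  solution sought. Starting from - W and staying below W, the iteration inherits integrability from
  W, so no further estimate is required.\<close>

lemma solution_exists:
  assumes f: "memLp M m f" "pstar / (pstar - 1) \<le> m" "m < N / p"
    and \<mu>: "0 < \<mu>" "\<mu> < hardy"
      "\<mu> < (m - 1) * N * (N - m * p) powr (p - 1) / ((p - 1) powr (p - 1) * m powr p)"
  obtains u G where "sob u G" "integrable M (\<lambda>x. \<bar>u x\<bar> powr ((p - 1) * m * N / (N - p * m)))"
    "is_min (\<lambda>x. potential \<mu> (u x) x + f x) u G"
proof -
  define s where "s = (p - 1) * m * N / (N - p * m)"
  obtain W H where W: "sob W H" "AE x in M. 0 \<le> W x" "integrable M (\<lambda>x. \<bar>W x\<bar> powr s)"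
    "is_min (\<lambda>x. potential \<mu> (W x) x + \<bar>f x\<bar>) W H"
    by (rule supersolution_exists[OF f \<mu>, folded s_def]) (rule that)
  have m1: "1 < m" using f(2) pstar_conj(2) by linarith
  have s0: "s \<ge> 0"
  proof -
    have "N - p * m > 0" using f(3) p0 by (simp add: field_simps)
    then show ?thesis using p0 m1 p_less_dim by (simp add: s_def)
  qed
  have df: "dual f" by (rule dual_Lp[OF f(1,2)])
  have [measurable]: "f \<in> borel_measurable M" using f(1) by (simp add: memLp_def)
  note [measurable] = sob_measurable(1)[OF W(1)]
  have dW: "dual (\<lambda>x. potential \<mu> (W x) x + \<bar>f x\<bar>)"
    by (intro dual_add dual_abs[OF df] dual_potential_sob[OF W(1)])
  \<comment> \<open>No truncation here: the barrier W already makes the limit finite, so the index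
    is only carried along to fit the iteration scheme.\<close>
  define F where "F n v x = potential \<mu> v x + f x" for n :: nat and v and x :: 'a
  have Fmono: "F n v x \<le> F n' w x" if "v \<le> w" for n n' v w x
    unfolding F_def using \<mu>(1) that by (intro add_right_mono potential_mono) auto
  have Fdual: "dual (\<lambda>x. F n (u x) x)" if "sob u G" for n u G
    unfolding F_def by (intro dual_add df dual_potential_sob[OF that])
  have odd: "potential \<mu> (- v) x = - potential \<mu> v x" for v x
    by (simp add: potential_def signed_powr_minus)
  have start: "AE x in M. - W x \<le> v x" if "is_min (\<lambda>x. F 0 (- W x) x) v K" for v K
    by (rule comparison[OF dual_minus[OF dW] Fdual[OF sob_minus[OF W(1)]] _ is_min_minus[OF W(4)] that])
      (simp add: F_def odd)
  obtain u G where u: "u (0::nat) = (\<lambda>x. - W x)" "\<And>n. sob (u n) (G n)"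
    "\<And>n. is_min (\<lambda>x. F n (u n x) x) (u (Suc n)) (G (Suc n))" "\<And>n. AE x in M. u n x \<le> u (Suc n) x"
    by (rule monotone_iteration[where F = F and ?u0.0 = "\<lambda>x. - W x", OF sob_minus[OF W(1)] Fmono Fdual start])
      (assumption | rule that)+
  note [measurable] = sob_measurable(1)[OF u(2)]
  have inc: "AE x in M. \<forall>n. u n x \<le> u (Suc n) x" using u(4) by (simp add: AE_all_countable)
  \<comment> \<open>The bound reproduces itself: below W the potential is at most that of W, and f
    \<le> |f|, so comparison with the equation for W gives the next step.\<close>
  have "AE x in M. u n x \<le> W x" for n
  proof (induction n)
    case 0
    show ?case using W(2) by eventually_elim (simp add: u(1))
  next
    case (Suc n)
    have "AE x in M. F n (u n x) x \<le> potential \<mu> (W x) x + \<bar>f x\<bar>"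
      using Suc
    proof eventually_elim
      case (elim x)
      then have "potential \<mu> (u n x) x \<le> potential \<mu> (W x) x" using \<mu>(1) by (intro potential_mono) auto
      then show ?case by (simp add: F_def)
    qed
    then show ?case by (rule comparison[OF Fdual[OF u(2)] dW _ u(3) W(4)])
  qed
  then have ub: "AE x in M. \<forall>n. u n x \<le> W x" by (simp add: AE_all_countable)
  define w where "w x = lim (\<lambda>n. u n x)" for x
  have [measurable]: "w \<in> borel_measurable M" unfolding w_def[abs_def] by measurable
  have ulim: "AE x in M. (\<lambda>n. u n x) \<longlonglongrightarrow> w x \<and> (\<forall>n. u n x \<le> w x)"
    using inc ub
  proof eventually_elim
    case (elim x)
    show ?case
      unfolding w_def using incseq_bounded_LIMSEQ_lim[of "\<lambda>n. u n x" "W x"] elim by auto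
  qed
  have wW: "AE x in M. \<bar>w x\<bar> \<le> W x"
    using ulim ub
  proof eventually_elim
    case (elim x)
    have "w x \<le> W x" using elim by (intro LIMSEQ_le_const2[of "\<lambda>n. u n x"]) auto
    moreover have "u 0 x \<le> w x" using elim by blast
    ultimately show ?case by (simp add: u(1) abs_le_iff)
  qed
  have wh: "integrable M (\<lambda>x. \<bar>w x\<bar> powr p / norm x powr p)"
  proof (rule Bochner_Integration.integrable_bound[OF hardy_sob(1)[OF W(1)]])
    show "AE x in M. norm (\<bar>w x\<bar> powr p / norm x powr p) \<le> norm (\<bar>W x\<bar> powr p / norm x powr p)"
      using wW by eventually_elim (use p0 in \<open>auto intro!: divide_right_mono powr_mono2\<close>)
  qed measurable
  have ws: "integrable M (\<lambda>x. \<bar>w x\<bar> powr s)"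
  proof (rule Bochner_Integration.integrable_bound[OF W(3)])
    show "AE x in M. norm (\<bar>w x\<bar> powr s) \<le> norm (\<bar>W x\<bar> powr s)"
      using wW by eventually_elim (use s0 in \<open>auto intro!: powr_mono2\<close>)
  qed measurable
  have dh: "dual (\<lambda>x. potential \<mu> (w x) x + f x)"
    by (intro dual_add df dual_potential wh) measurable
  obtain v K where v: "is_min (\<lambda>x. potential \<mu> (w x) x + f x) v K"
    by (rule minimizer_exists[OF dh])
  have eq: "AE x in M. w x = v x"
  proof (rule minimizer_stability[OF dh Fdual[OF u(2)] _ _ _ _ u(3) u(3) v])
    show "(\<lambda>x. F n (u n x) x) \<in> borel_measurable M" for n by (rule dual_measurable[OF Fdual[OF u(2)]])
    show "AE x in M. F 0 (u 0 x) x \<le> F n (u n x) x" for n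
      using inc
    proof eventually_elim
      case (elim x)
      show ?case by (rule lift_Suc_mono_le[of "\<lambda>n. F n (u n x) x"]) (use elim Fmono in auto)
    qed
    show "AE x in M. F n (u n x) x \<le> potential \<mu> (w x) x + f x" for n
      using ulim by eventually_elim (use \<mu>(1) in \<open>auto simp: F_def intro!: potential_mono\<close>)
    show "AE x in M. (\<lambda>n. F n (u n x) x) \<longlonglongrightarrow> potential \<mu> (w x) x + f x"
      using ulim
    proof eventually_elim
      case (elim x)
      show ?case unfolding F_def by (intro tendsto_add tendsto_const potential_tendsto elim[THEN conjunct1])
    qed
    show "AE x in M. (\<lambda>n. u (Suc n) x) \<longlonglongrightarrow> w x"
      using ulim by eventually_elim (auto intro: LIMSEQ_Suc)
  qed
  note sv = is_min_sob[OF v]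
  note [measurable] = sob_measurable(1)[OF sv]
  show thesis
  proof (rule that[OF sv])
    have "integrable M (\<lambda>x. \<bar>w x\<bar> powr s) \<longleftrightarrow> integrable M (\<lambda>x. \<bar>v x\<bar> powr s)"
      by (rule integrable_cong_AE) (use eq in \<open>auto elim!: eventually_mono\<close>)
    then show "integrable M (\<lambda>x. \<bar>v x\<bar> powr ((p - 1) * m * N / (N - p * m)))"
      using ws by (simp add: s_def)
    show "is_min (\<lambda>x. potential \<mu> (v x) x + f x) v K"
      by (rule is_min_cong_AE[OF v]) (use eq in \<open>auto elim!: eventually_mono\<close>)
  qed
qed

text \<open>The Euler-Lagrange equation, with the gradient carried by \<open>sob\<close> exchanged
  almost everywhere for the chosen one. The three integrability conditions are finiteness of
  pairings with functionals and gradients.\<close>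

lemma minimizer_weak_solution:
  assumes f: "dual f" and u: "is_min (\<lambda>x. potential \<mu> (u x) x + f x) u G"
  shows "weak_solution \<Omega> p \<mu> f u"
  unfolding weak_solution_def
proof (intro conjI ballI)
  note su = is_min_sob[OF u]
  show "u \<in> W1_0 \<Omega> p" by (rule sob_imp_W1_0(1)[OF su])
  fix \<phi> assume "\<phi> \<in> W1_0 \<Omega> p \<inter> Linf \<Omega>"
  then have s\<phi>: "sob \<phi> (weak_grad \<Omega> \<phi>)" by (auto intro: W1_0_imp_sob)
  have su': "sob u (weak_grad \<Omega> u)"
    by (rule sob_cong_AE[OF su _ sob_imp_W1_0(2)[OF su]]) simp
  note [measurable] = sob_measurable[OF su] sob_measurable[OF s\<phi>] sob_measurable[OF su']
  have dp: "dual (\<lambda>x. potential \<mu> (u x) x)" by (rule dual_potential_sob[OF su])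
  have pot: "\<mu> / norm x powr p * \<bar>u x\<bar> powr (p - 2) * u x * \<phi> x = potential \<mu> (u x) x * \<phi> x" for x
    by (simp add: potential_def signed_powr_def mult.assoc)
  show "integrable M (\<lambda>x. norm (weak_grad \<Omega> u x) powr (p - 2) * (weak_grad \<Omega> u x \<bullet> weak_grad \<Omega> \<phi> x))"
    by (rule gradient_pairing_integrable[OF su' s\<phi>])
  show "integrable M (\<lambda>x. \<mu> / norm x powr p * \<bar>u x\<bar> powr (p - 2) * u x * \<phi> x)"
    unfolding pot by (rule dual_integrable[OF dp s\<phi>])
  show "integrable M (\<lambda>x. f x * \<phi> x)" by (rule dual_integrable[OF f s\<phi>])
  have "(LINT x|M. norm (weak_grad \<Omega> u x) powr (p - 2) * (weak_grad \<Omega> u x \<bullet> weak_grad \<Omega> \<phi> x))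
      = (LINT x|M. norm (G x) powr (p - 2) * (G x \<bullet> weak_grad \<Omega> \<phi> x))"
  proof (rule integral_cong_AE)
    show "AE x in M. norm (weak_grad \<Omega> u x) powr (p - 2) * (weak_grad \<Omega> u x \<bullet> weak_grad \<Omega> \<phi> x)
        = norm (G x) powr (p - 2) * (G x \<bullet> weak_grad \<Omega> \<phi> x)"
      using sob_imp_W1_0(2)[OF su] by eventually_elim simp
  qed measurable
  also have "\<dots> = (LINT x|M. (potential \<mu> (u x) x + f x) * \<phi> x)"
    by (rule euler_lagrange[OF dual_add[OF dp f] u s\<phi>])
  also have "\<dots> = (LINT x|M. potential \<mu> (u x) x * \<phi> x) + (LINT x|M. f x * \<phi> x)"
    unfolding distrib_right
    by (rule Bochner_Integration.integral_add[OF dual_integrable[OF dp s\<phi>] dual_integrable[OF f s\<phi>]])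
  finally show "(LINT x|M. norm (weak_grad \<Omega> u x) powr (p - 2) * (weak_grad \<Omega> u x \<bullet> weak_grad \<Omega> \<phi> x))
      = (LINT x|M. \<mu> / norm x powr p * \<bar>u x\<bar> powr (p - 2) * u x * \<phi> x) + (LINT x|M. f x * \<phi> x)"
    unfolding pot .
qed

end

theorem theorem1:
  fixes \<Omega> :: "'a::euclidean_space set" and f :: "'a \<Rightarrow> real" and p m \<mu> N :: real
  defines "N \<equiv> real DIM('a)"
  assumes "open \<Omega>" and "connected \<Omega>" and "\<Omega> \<noteq> {}" and "bounded \<Omega>"
    and "2 \<le> p" and "p < N"
    and "holder_conj (sobolev_conj N p) \<le> m" and "m < N / p"
    and "f \<in> Lp \<Omega> m"
    and "0 < \<mu>" and "\<mu> < hardy_const N p powr p"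
    and "\<mu> < (m - 1) * N * (N - m * p) powr (p - 1) / ((p - 1) powr (p - 1) * m powr p)"
  shows "\<exists>u. u \<in> W1_0 \<Omega> p \<inter> Lp \<Omega> (m * N / (N - p * m)) \<and> weak_solution \<Omega> p \<mu> f u"
proof -
  interpret sobolev_domain \<Omega> p N
    by unfold_locales (use assms in auto)
  have f: "memLp M m f" using assms by (simp add: Lp_iff_memLp)
  have m: "pstar / (pstar - 1) \<le> m"
    using \<open>holder_conj (sobolev_conj N p) \<le> m\<close> by (simp add: holder_conj_def sobolev_conj_def)
  have \<mu>: "\<mu> < hardy" using \<open>\<mu> < hardy_const N p powr p\<close> by (simp add: hardy_const_def)
  obtain u G where u: "sob u G" "integrable M (\<lambda>x. \<bar>u x\<bar> powr ((p - 1) * m * N / (N - p * m)))"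
    "is_min (\<lambda>x. potential \<mu> (u x) x + f x) u G"
    by (rule solution_exists[OF f m \<open>m < N / p\<close> \<open>0 < \<mu>\<close> \<mu>
          \<open>\<mu> < (m - 1) * N * (N - m * p) powr (p - 1) / ((p - 1) powr (p - 1) * m powr p)\<close>]) (rule that)
  have m1: "1 < m" using m pstar_conj(2) by linarith
  have d: "N - p * m > 0" using \<open>m < N / p\<close> p0 by (simp add: field_simps)
  have "memLp M ((p - 1) * m * N / (N - p * m)) u"
    using u(2) sob_measurable(1)[OF u(1)] by (simp add: memLp_def)
  moreover have "0 < m * N / (N - p * m)" using m1 d p0 p_less_dim by simp
  \<comment> \<open>The solution is integrable to a power p - 1 times the required one. As p \<ge> 2
    this power is no smaller, and on a bounded domain the lower power follows.\<close>
  moreover have "m * N / (N - p * m) \<le> (p - 1) * m * N / (N - p * m)"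
  proof -
    have "1 * (m * N) \<le> (p - 1) * (m * N)" using m1 p_ge_2 p_less_dim by (intro mult_right_mono) auto
    then show ?thesis using d by (intro divide_right_mono) auto
  qed
  ultimately have "memLp M (m * N / (N - p * m)) u" by (rule memLp_lower_exponent)
  then show ?thesis
    using sob_imp_W1_0(1)[OF u(1)] minimizer_weak_solution[OF dual_Lp[OF f m] u(3)]
    by (auto simp: Lp_iff_memLp)
qed

end
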